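(* There is a universal constant $C>0$ such that the following holds. Let $Y_1,\dots,Y_n$ be independent Gaussian random vectors in $\mathbb{R}^d$ with $Y_i\sim N(0,\Sigma_i)$, and let $S=\sum_{i=1}^nY_iY_i^*$. Then for any $\varepsilon\in(0,1]$, $$\mathbf{E}\|S-\mathbf{E}S\|\le(1+\varepsilon)\,2\bigg\|\sum_{i=1}^n\mathrm{Tr}[\Sigma_i]\Sigma_i\bigg\|^{\frac12}+\frac{C}{\varepsilon^3}\bigg(\bigg\|\sum_{i=1}^n\Sigma_i^2\bigg\|^{\frac12}+\max_{i\le n}\mathrm{Tr}\,\Sigma_i\bigg)\log^3(d+n).$$
   Context: $\|\cdot\|$ is the operator norm and $\mathrm{Tr}$ the unnormalized trace; $\Sigma_1,\dots,\Sigma_n$ are arbitrary $d\times d$ covariance matrices. *)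

theory Defs
  imports "HOL-Probability.Probability" "Jordan_Normal_Form.Matrix"
begin

no_notation inner (infix "\<bullet>" 70)
no_notation vec_nth (infixl "$" 90)

text \<open>
  The dimension \<open>d\<close> and the number of vectors \<open>n\<close> must be bound inside the scope of the universal
  constant, so they are natural numbers and not types: vectors and matrices are those of
  \<open>Jordan_Normal_Form\<close>, with carriers \<open>carrier_vec d\<close> and \<open>carrier_mat d d\<close>.
\<close>

definition trace_mat :: "real mat \<Rightarrow> real" where
  "trace_mat A = (\<Sum>j<dim_row A. A $$ (j, j))"

definition euclid_norm :: "real vec \<Rightarrow> real" where
  "euclid_norm x = sqrt (x \<bullet> x)"

definition op_norm :: "real mat \<Rightarrow> real" where
  "op_norm A = (SUP x \<in> {x \<in> carrier_vec (dim_col A). euclid_norm x \<le> 1}. euclid_norm (A *\<^sub>v x))"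

definition sum_mats :: "nat \<Rightarrow> (nat \<Rightarrow> real mat) \<Rightarrow> nat set \<Rightarrow> real mat" where
  "sum_mats d A I = mat d d (\<lambda>(j, k). \<Sum>i\<in>I. A i $$ (j, k))"

definition outer_prod :: "nat \<Rightarrow> real vec \<Rightarrow> real mat" where
  "outer_prod d y = mat d d (\<lambda>(j, k). y $ j * y $ k)"

definition expect_mat :: "'w measure \<Rightarrow> nat \<Rightarrow> ('w \<Rightarrow> real mat) \<Rightarrow> real mat" where
  "expect_mat M d A = mat d d (\<lambda>(j, k). \<integral>\<omega>. A \<omega> $$ (j, k) \<partial>M)"

definition covariance_matrix :: "nat \<Rightarrow> real mat \<Rightarrow> bool" where
  "covariance_matrix d \<Sigma> \<longleftrightarrow>
     \<Sigma> \<in> carrier_mat d d \<and> transpose_mat \<Sigma> = \<Sigma> \<and> (\<forall>u\<in>carrier_vec d. 0 \<le> u \<bullet> (\<Sigma> *\<^sub>v u))"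

text \<open>
  The Borel \<open>\<sigma>\<close>-algebra of \<open>\<real>\<^sup>d\<close>, transported from the product \<open>\<sigma>\<close>-algebra along the coordinate
  bijection. Only the measurable sets matter; the measure itself is a dummy.
\<close>

definition borel_vec :: "nat \<Rightarrow> real vec measure" where
  "borel_vec d =
     vimage_algebra (carrier_vec d) (\<lambda>v. \<lambda>j\<in>{..<d}. v $ j) (\<Pi>\<^sub>M j\<in>{..<d}. borel)"

text \<open>
  The second parameter of \<open>normal_density\<close> is the standard deviation, and for standard deviation \<open>0\<close>
  it is not a probability density; \<open>N(0,0)\<close> is the point mass at \<open>0\<close>.
\<close>

definition normal_law :: "real \<Rightarrow> real measure" where
  "normal_law v = (if v = 0 then return borel 0 else density lborel (normal_density 0 (sqrt v)))"

text \<open>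
  \<open>Y \<sim> N(0, \<Sigma>)\<close>, where \<open>\<Sigma>\<close> may be singular: every linear functional \<open>u \<bullet> Y\<close> has the
  (possibly degenerate) normal law with mean \<open>0\<close> and variance \<open>u \<bullet> \<Sigma> u\<close>.
\<close>

definition gaussian_vector :: "'w measure \<Rightarrow> nat \<Rightarrow> real mat \<Rightarrow> ('w \<Rightarrow> real vec) \<Rightarrow> bool" where
  "gaussian_vector M d \<Sigma> Y \<longleftrightarrow>
     Y \<in> measurable M (borel_vec d) \<and>
     (\<forall>u\<in>carrier_vec d. distr M borel (\<lambda>\<omega>. u \<bullet> Y \<omega>) = normal_law (u \<bullet> (\<Sigma> *\<^sub>v u)))"

definition sample_cov :: "nat \<Rightarrow> nat \<Rightarrow> (nat \<Rightarrow> 'w \<Rightarrow> real vec) \<Rightarrow> 'w \<Rightarrow> real mat" where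
  "sample_cov d n Y \<omega> = sum_mats d (\<lambda>i. outer_prod d (Y i \<omega>)) {1..n}"

text \<open>
  \<open>C\<close> is an admissible constant in the deviation bound, for all dimensions, sample sizes, covariances
  and all probability spaces whose underlying type is \<open>'w\<close>.
\<close>

definition deviation_bound :: "'w itself \<Rightarrow> real \<Rightarrow> bool" where
  "deviation_bound (_ :: 'w itself) C \<longleftrightarrow>
     (\<forall>(d::nat) (n::nat) (\<Sigma> :: nat \<Rightarrow> real mat) (M :: 'w measure) (Y :: nat \<Rightarrow> 'w \<Rightarrow> real vec) (\<epsilon>::real).
        1 \<le> d \<longrightarrow> 1 \<le> n \<longrightarrow>
        (\<forall>i\<in>{1..n}. covariance_matrix d (\<Sigma> i)) \<longrightarrow>
        prob_space M \<longrightarrow>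
        prob_space.indep_vars M (\<lambda>_. borel_vec d) Y {1..n} \<longrightarrow>
        (\<forall>i\<in>{1..n}. gaussian_vector M d (\<Sigma> i) (Y i)) \<longrightarrow>
        0 < \<epsilon> \<longrightarrow> \<epsilon> \<le> 1 \<longrightarrow>
        (\<integral>\<omega>. op_norm (sample_cov d n Y \<omega> - expect_mat M d (sample_cov d n Y)) \<partial>M)
          \<le> (1 + \<epsilon>) * 2 * sqrt (op_norm (sum_mats d (\<lambda>i. trace_mat (\<Sigma> i) \<cdot>\<^sub>m \<Sigma> i) {1..n}))
            + C / \<epsilon> ^ 3
              * (sqrt (op_norm (sum_mats d (\<lambda>i. \<Sigma> i * \<Sigma> i) {1..n}))
                 + (MAX i\<in>{1..n}. trace_mat (\<Sigma> i)))
              * ln (real d + real n) ^ 3)"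

end

theory Submission
  imports Defs
begin

text \<open>
  Let \<open>X = \<Sum>\<^sub>i (Y\<^sub>i Y\<^sub>i\<^sup>T - \<Sigma>\<^sub>i)\<close> and \<open>M\<^sub>n = E X\<^sup>n\<close>. Gaussian integration by parts, together with
  interpolation to an independent copy for the covariances, shows that \<open>tr (M\<^sub>n W)\<close> equals
  \<open>\<Sum> tr (\<Sigma>\<^sub>i M\<^sub>j) tr (\<Sigma>\<^sub>i M\<^sub>k W)\<close>, summed over \<open>i\<close> and \<open>j + k = n - 2\<close>, up to errors that are
  expectations of multilinear forms in powers of \<open>X\<close>. Such a form is easy to bound when one
  argument has rank one and the others are contractions; Abel summation over spectral truncations
  then bounds it by sums of products of sorted eigenvalues, and AM-GM turns these into products of
  Schatten norms. Testing with \<open>W = sgn M\<^sub>n |M\<^sub>n| powr (2p/n - 1)\<close> yields, for the normalised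
  Schatten \<open>2p/n\<close>-norms \<open>b\<^sub>n\<close> of \<open>M\<^sub>n\<close>, the Catalan recursion \<open>b\<^sub>n \<le> \<sigma>\<^sup>2 \<Sum> b\<^sub>j b\<^sub>k + error\<close>. Put
  \<open>\<mu>\<^sup>2\<^sup>p = E tr X\<^sup>2\<^sup>p / d\<close>. The numbers \<open>b\<^sub>n / \<mu>\<^sup>n\<close>, \<open>n \<le> 2p\<close>, sum to less than 2 if \<open>4 \<sigma>\<^sup>2 / \<mu>\<^sup>2\<close> plus the
  errors stays below 1, while \<open>b\<^sub>0 = 1\<close> and \<open>b\<^sub>2\<^sub>p \<ge> \<mu>\<^sup>2\<^sup>p\<close>. Hence \<open>\<mu> \<le> 2 \<sigma> + O(p\<^sup>3) (v + R)\<close>, and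
  \<open>p \<approx> log (d + n) / \<epsilon>\<close> compares \<open>\<mu>\<close> with the operator norm. Mixed moments, hence \<open>\<mu>\<close>, depend on the
  laws of the linear forms only, so \<open>Y\<close> may be replaced by an explicit Gaussian model.
\<close>


section \<open>Symmetric matrices and the spectral theorem\<close>

text \<open>The leading constant 2 leaves no room in the main term: only one term of the integration
  by parts may keep its full size. The others contain the random vectors \<open>Yv g i\<close> and
  covariances between powers of \<open>X g\<close>, and nothing commutes, so trace Hoelder
  inequalities do not apply to them. Hence their coefficients are isolated in random numbers
  (\<open>cond1\<close>, \<open>cond2\<close>, \<open>cond3\<close>), whose moments follow from
  integration by parts again, while the powers of \<open>X g\<close> are treated by a bound that
  sees sorted eigenvalues only. The mean powers enter through the numbers \<open>om n r\<close>,
  n-th roots of absolute eigenvalues; thus one integer exponent \<open>2 * p\<close> and AM-GM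
  suffice. The condition \<open>real d \<le> 2 ^ (2 * p)\<close> turns dimension factors into
  constants. The cube of \<open>p\<close> is the size of the total error: with
  \<open>x = (sqrt v + R) / \<mu>\<close>, the error of the k-th step consists of about k, k^2 and
  k^3 terms of relative sizes p x, x and p x^3, and \<open>2 * p\<close> steps add up to p^3 x and a
  negligible p^5 x^3.\<close>

locale dimn = fixes d :: nat
begin

definition ip :: "(nat \<Rightarrow> real) \<Rightarrow> (nat \<Rightarrow> real) \<Rightarrow> real" where
  "ip x y = (\<Sum>a<d. x a * y a)"

definition mv :: "(nat \<Rightarrow> nat \<Rightarrow> real) \<Rightarrow> (nat \<Rightarrow> real) \<Rightarrow> nat \<Rightarrow> real" where
  "mv G y = (\<lambda>a. \<Sum>b<d. G a b * y b)"

definition bil :: "(nat \<Rightarrow> real) \<Rightarrow> (nat \<Rightarrow> nat \<Rightarrow> real) \<Rightarrow> (nat \<Rightarrow> real) \<Rightarrow> real" where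
  "bil x G y = ip x (mv G y)"

definition mm :: "(nat \<Rightarrow> nat \<Rightarrow> real) \<Rightarrow> (nat \<Rightarrow> nat \<Rightarrow> real) \<Rightarrow> nat \<Rightarrow> nat \<Rightarrow> real" where
  "mm A B = (\<lambda>a b. \<Sum>c<d. A a c * B c b)"

fun mpow :: "(nat \<Rightarrow> nat \<Rightarrow> real) \<Rightarrow> nat \<Rightarrow> nat \<Rightarrow> nat \<Rightarrow> real" where
  "mpow A 0 = (\<lambda>a b. if a = b then 1 else 0)"
| "mpow A (Suc n) = mm A (mpow A n)"

definition tr :: "(nat \<Rightarrow> nat \<Rightarrow> real) \<Rightarrow> real" where
  "tr A = (\<Sum>a<d. A a a)"

definition nrm :: "(nat \<Rightarrow> real) \<Rightarrow> real" where
  "nrm x = sqrt (ip x x)"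

definition symm :: "(nat \<Rightarrow> nat \<Rightarrow> real) \<Rightarrow> bool" where
  "symm G \<longleftrightarrow> (\<forall>a<d. \<forall>b<d. G a b = G b a)"

definition orthon :: "nat \<Rightarrow> (nat \<Rightarrow> nat \<Rightarrow> real) \<Rightarrow> bool" where
  "orthon m e \<longleftrightarrow> (\<forall>r<m. \<forall>s<m. ip (e r) (e s) = (if r = s then 1 else 0))"

lemma ip_commute: "ip x y = ip y x"
  by (simp add: ip_def mult.commute)

lemma ip_lin [simp]:
  "ip (\<lambda>a. f a + g a) y = ip f y + ip g y" "ip (\<lambda>a. f a - g a) y = ip f y - ip g y"
  "ip (\<lambda>a. c * f a) y = c * ip f y" "ip (\<lambda>a. - f a) y = - ip f y"
  "ip y (\<lambda>a. f a + g a) = ip y f + ip y g" "ip y (\<lambda>a. f a - g a) = ip y f - ip y g"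
  "ip y (\<lambda>a. c * f a) = c * ip y f" "ip y (\<lambda>a. - f a) = - ip y f"
  "ip (\<lambda>a. 0) y = 0" "ip y (\<lambda>a. 0) = 0"
  by (simp_all add: ip_def algebra_simps sum.distrib sum_subtractf sum_distrib_left sum_negf)

lemma ip_sum [simp]:
  "ip (\<lambda>a. \<Sum>i\<in>I. f i a) y = (\<Sum>i\<in>I. ip (f i) y)"
  "ip y (\<lambda>a. \<Sum>i\<in>I. f i a) = (\<Sum>i\<in>I. ip y (f i))"
  unfolding ip_def sum_distrib_left sum_distrib_right by (rule sum.swap)+

lemma mv_lin [simp]:
  "mv G (\<lambda>a. f a + g a) = (\<lambda>a. mv G f a + mv G g a)" "mv G (\<lambda>a. f a - g a) = (\<lambda>a. mv G f a - mv G g a)"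
  "mv G (\<lambda>a. c * f a) = (\<lambda>a. c * mv G f a)" "mv G (\<lambda>a. \<Sum>i\<in>I. h i a) = (\<lambda>a. \<Sum>i\<in>I. mv G (h i) a)"
proof -
  show "mv G (\<lambda>a. \<Sum>i\<in>I. h i a) = (\<lambda>a. \<Sum>i\<in>I. mv G (h i) a)"
    unfolding mv_def sum_distrib_left by (rule ext) (rule sum.swap)
qed (simp_all add: mv_def algebra_simps sum.distrib sum_subtractf sum_distrib_left fun_eq_iff)

lemma bil_lin [simp]:
  "bil (\<lambda>a. f a + g a) G y = bil f G y + bil g G y" "bil (\<lambda>a. f a - g a) G y = bil f G y - bil g G y"
  "bil (\<lambda>a. c * f a) G y = c * bil f G y"
  "bil y G (\<lambda>a. f a + g a) = bil y G f + bil y G g" "bil y G (\<lambda>a. f a - g a) = bil y G f - bil y G g"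
  "bil y G (\<lambda>a. c * f a) = c * bil y G f"
  "bil (\<lambda>a. \<Sum>i\<in>I. h i a) G y = (\<Sum>i\<in>I. bil (h i) G y)"
  "bil y G (\<lambda>a. \<Sum>i\<in>I. h i a) = (\<Sum>i\<in>I. bil y G (h i))"
  by (simp_all add: bil_def)

lemma bil_sum2: "bil x G y = (\<Sum>a<d. \<Sum>b<d. x a * G a b * y b)"
  unfolding bil_def ip_def mv_def by (simp add: sum_distrib_left mult.assoc)

lemma bil_symm: assumes "symm G" shows "bil x G y = bil y G x"
proof -
  have "bil x G y = (\<Sum>a<d. \<Sum>b<d. y b * G b a * x a)"
    unfolding bil_sum2 using assms by (intro sum.cong) (auto simp: symm_def)
  also have "\<dots> = bil y G x" unfolding bil_sum2 by (rule sum.swap)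
  finally show ?thesis .
qed

lemma ip_nonneg [simp]: "0 \<le> ip x x" by (auto simp: ip_def intro: sum_nonneg)

lemma nrm_nonneg [simp]: "0 \<le> nrm x" by (simp add: nrm_def)

lemma nrm_sq: "(nrm x)\<^sup>2 = ip x x" by (simp add: nrm_def)

lemma ip_zeroD: assumes "ip x x = 0" "a < d" shows "x a = 0"
proof -
  have "(\<Sum>a<d. x a * x a) = 0" using assms by (simp add: ip_def)
  then have "\<forall>a\<in>{..<d}. x a * x a = 0" by (subst (asm) sum_nonneg_eq_0_iff) auto
  then show ?thesis using assms by auto
qed

lemma ip_cong: "(\<And>a. a < d \<Longrightarrow> x a = x' a) \<Longrightarrow> (\<And>a. a < d \<Longrightarrow> y a = y' a) \<Longrightarrow> ip x y = ip x' y'"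
  by (simp add: ip_def)

lemma mv_cong: "(\<And>b. b < d \<Longrightarrow> G a b = G' a b) \<Longrightarrow> (\<And>b. b < d \<Longrightarrow> y b = y' b) \<Longrightarrow> mv G y a = mv G' y' a"
  by (simp add: mv_def)

lemma bil_cong: "(\<And>a. a < d \<Longrightarrow> x a = x' a) \<Longrightarrow> (\<And>a b. a < d \<Longrightarrow> b < d \<Longrightarrow> G a b = G' a b)
   \<Longrightarrow> (\<And>a. a < d \<Longrightarrow> y a = y' a) \<Longrightarrow> bil x G y = bil x' G' y'"
  unfolding bil_def by (intro ip_cong mv_cong) auto

lemma abs_ip_le: "\<bar>ip x y\<bar> \<le> nrm x * nrm y"
proof -
  have "(\<Sum>a<d. \<bar>x a\<bar> * \<bar>y a\<bar>) \<le> L2_set x {..<d} * L2_set y {..<d}" by (rule L2_set_mult_ineq)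
  moreover have "\<bar>ip x y\<bar> \<le> (\<Sum>a<d. \<bar>x a\<bar> * \<bar>y a\<bar>)"
    unfolding ip_def abs_mult[symmetric] by (rule sum_abs)
  moreover have "nrm z = L2_set z {..<d}" for z by (simp add: nrm_def L2_set_def ip_def power2_eq_square)
  ultimately show ?thesis by simp
qed

text \<open>The left side is the squared Hilbert-Schmidt norm of the projection onto the complement
  of the span of \<open>e\<close>, which equals its trace. It serves twice: for \<open>m < d\<close>
  it is positive, which yields a new direction, and for \<open>m = d\<close> it vanishes, which
  yields completeness.\<close>

lemma residual_sum:
  assumes "orthon m e"
  shows "(\<Sum>a<d. ip (\<lambda>b. (if a = b then 1 else 0) - (\<Sum>s<m. e s a * e s b)) (\<lambda>b. (if a = b then 1 else 0) - (\<Sum>s<m. e s a * e s b)))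
     = real d - real m"
proof -
  have del: "ip (\<lambda>b. if a = b then 1 else 0) y = y a" "ip y (\<lambda>b. if a = b then 1 else 0) = y a" if "a < d" for a y
    using that unfolding ip_def by (simp_all add: if_distrib[of "\<lambda>t. t * _"] if_distrib[of "\<lambda>t. _ * t"] sum.If_cases Int_absorb1 cong: if_cong)
  have ee: "(\<Sum>s<m. e s a * ip (e s) (\<lambda>b. \<Sum>s<m. e s a * e s b)) = (\<Sum>s<m. e s a * e s a)" for a
  proof (intro sum.cong refl)
    fix s assume s: "s \<in> {..<m}"
    have "ip (e s) (\<lambda>b. \<Sum>t<m. e t a * e t b) = (\<Sum>t<m. if s = t then e t a else 0)"
      unfolding ip_sum ip_lin using assms s by (intro sum.cong) (auto simp: orthon_def)
    also have "\<dots> = e s a" using s by simp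
    finally show "e s a * ip (e s) (\<lambda>b. \<Sum>s<m. e s a * e s b) = e s a * e s a" by simp
  qed
  have "(\<Sum>a<d. ip (\<lambda>b. (if a = b then 1 else 0) - (\<Sum>s<m. e s a * e s b)) (\<lambda>b. (if a = b then 1 else 0) - (\<Sum>s<m. e s a * e s b)))
      = (\<Sum>a<d. 1 - (\<Sum>s<m. e s a * e s a))"
  proof (intro sum.cong refl)
    fix a assume "a \<in> {..<d}" then have a: "a < d" by simp
    show "ip (\<lambda>b. (if a = b then 1 else 0) - (\<Sum>s<m. e s a * e s b)) (\<lambda>b. (if a = b then 1 else 0) - (\<Sum>s<m. e s a * e s b)) = 1 - (\<Sum>s<m. e s a * e s a)"
      using ee[of a] by (simp add: del[OF a] sum_distrib_left)
  qed
  also have "\<dots> = real d - (\<Sum>s<m. \<Sum>a<d. e s a * e s a)"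
    by (simp add: sum_subtractf) (rule sum.swap)
  also have "(\<Sum>s<m. \<Sum>a<d. e s a * e s a) = (\<Sum>s<m. 1)"
    using assms by (intro sum.cong) (auto simp: orthon_def ip_def)
  finally show ?thesis by simp
qed

lemma orthon_extend_ex:
  assumes o: "orthon m e" and m: "m < d"
  shows "\<exists>x. ip x x = 1 \<and> (\<forall>s<m. ip x (e s) = 0)"
proof -
  define \<rho> where "\<rho> a = (\<lambda>b. (if a = b then 1 else 0) - (\<Sum>s<m. e s a * e s b))" for a
  have "(\<Sum>a<d. ip (\<rho> a) (\<rho> a)) = real d - real m" using residual_sum[OF o] by (simp add: \<rho>_def)
  also have "\<dots> \<noteq> 0" using m by simp
  finally obtain a where a: "a < d" "ip (\<rho> a) (\<rho> a) \<noteq> 0"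
    by (metis (mono_tags, lifting) lessThan_iff sum.neutral)
  have del: "ip (\<lambda>b. if a = b then 1 else 0) y = y a" for y
    using a unfolding ip_def by (simp add: if_distrib[of "\<lambda>t. t * _"] sum.If_cases Int_absorb1 cong: if_cong)
  have orth: "ip (\<rho> a) (e s) = 0" if s: "s < m" for s
  proof -
    have "(\<Sum>t<m. e t a * ip (e t) (e s)) = (\<Sum>t<m. if s = t then e t a else 0)"
      using o s by (intro sum.cong) (auto simp: orthon_def)
    also have "\<dots> = e s a" using s by simp
    finally show ?thesis by (simp add: \<rho>_def del)
  qed
  let ?c = "nrm (\<rho> a)"
  have c: "?c \<noteq> 0" using a by (simp add: nrm_def)
  have "ip (\<lambda>b. (1/?c) * \<rho> a b) (\<lambda>b. (1/?c) * \<rho> a b) = 1"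
    unfolding ip_lin using c by (simp add: nrm_sq[symmetric] power2_eq_square field_simps)
  moreover have "\<forall>s<m. ip (\<lambda>b. (1/?c) * \<rho> a b) (e s) = 0" using orth by (simp only: ip_lin) simp
  ultimately show ?thesis by blast
qed

lemma orthon_complete:
  assumes o: "orthon d e"
  shows "ip x y = (\<Sum>r<d. ip x (e r) * ip (e r) y)"
proof -
  define \<rho> where "\<rho> a = (\<lambda>b. (if a = b then 1 else 0) - (\<Sum>s<d. e s a * e s b))" for a
  have "(\<Sum>a<d. ip (\<rho> a) (\<rho> a)) = 0" using residual_sum[OF o] by (simp add: \<rho>_def)
  then have "\<forall>a\<in>{..<d}. ip (\<rho> a) (\<rho> a) = 0" by (subst (asm) sum_nonneg_eq_0_iff) auto
  then have *: "(if a = b then 1 else 0) = (\<Sum>s<d. e s a * e s b)" if "a < d" "b < d" for a b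
    using ip_zeroD[of "\<rho> a" b] that by (auto simp: \<rho>_def)
  have "ip x y = (\<Sum>a<d. \<Sum>b<d. x a * (if a = b then 1 else 0) * y b)"
    unfolding ip_def by (intro sum.cong refl) (simp add: if_distrib[of "\<lambda>t. t * _"] if_distrib[of "\<lambda>t. _ * t"] sum.If_cases Int_absorb1 cong: if_cong)
  also have "\<dots> = (\<Sum>a<d. \<Sum>b<d. \<Sum>s<d. x a * e s a * (e s b * y b))"
    using * by (intro sum.cong refl) (simp add: sum_distrib_left sum_distrib_right mult.assoc)
  also have "\<dots> = (\<Sum>a<d. \<Sum>s<d. \<Sum>b<d. x a * e s a * (e s b * y b))"
    by (intro sum.cong refl sum.swap)
  also have "\<dots> = (\<Sum>s<d. \<Sum>a<d. \<Sum>b<d. x a * e s a * (e s b * y b))" by (rule sum.swap)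
  also have "\<dots> = (\<Sum>r<d. ip x (e r) * ip (e r) y)"
    by (simp add: ip_def sum_product)
  finally show ?thesis .
qed

section \<open>Eigenvectors as maximisers of the quadratic form\<close>

lemma continuous_ip: "continuous_on UNIV (\<lambda>x. ip x y)" "continuous_on UNIV (\<lambda>x. ip x x)" "continuous_on UNIV (\<lambda>x. bil x G x)"
  unfolding ip_def bil_sum2 by (intro continuous_intros continuous_on_product_coordinates)+

text \<open>Vectors are functions on all of \<open>nat\<close> of which only the entries below
  \<open>d\<close> count. Pinning the other entries to 0 makes the cube a product of compact sets,
  so that Tychonoff's theorem applies.\<close>

lemma compact_cube: "compact {x::nat \<Rightarrow> real. \<forall>a. x a \<in> (if a < d then {-1..1} else {0})}"
proof -
  have "compactin (product_topology (\<lambda>_. euclidean) UNIV) (PiE UNIV (\<lambda>a. if a < d then {-1..1::real} else {0}))"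
    by (subst compactin_PiE) auto
  moreover have "PiE UNIV (\<lambda>a. if a < d then {-1..1::real} else {0}) = {x. \<forall>a. x a \<in> (if a < d then {-1..1} else {0})}"
    by (auto simp: PiE_def Pi_def)
  ultimately show ?thesis by (simp add: euclidean_product_topology)
qed

text \<open>A continuous function attains its maximum on the unit sphere of the complement of
  \<open>e\<close>. The absolute value of the form is maximised, not the form itself, because the
  eigenvalues are wanted in decreasing order of absolute value.\<close>

lemma max_quadratic_form:
  assumes o: "orthon m e" and m: "m < d"
  shows "\<exists>x. ip x x = 1 \<and> (\<forall>s<m. ip x (e s) = 0) \<and>
     (\<forall>y. (\<forall>s<m. ip y (e s) = 0) \<longrightarrow> \<bar>bil y G y\<bar> \<le> \<bar>bil x G x\<bar> * ip y y)"
proof -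
  define K where "K = {x::nat \<Rightarrow> real. \<forall>a. x a \<in> (if a < d then {-1..1} else {0})} \<inter>
     ({x. ip x x = 1} \<inter> (\<Inter>s<m. {x. ip x (e s) = 0}))"
  have cl: "closed ({x. ip x x = 1} \<inter> (\<Inter>s<m. {x. ip x (e s) = 0}))"
    by (intro closed_Int closed_INT closed_Collect_eq continuous_ip continuous_on_const ballI)
  have K: "compact K" unfolding K_def by (rule compact_Int_closed[OF compact_cube cl])
  have trunc: "(\<lambda>a. if a < d then y a else 0) \<in> K" if y: "ip y y = 1" "\<forall>s<m. ip y (e s) = 0" for y
  proof -
    have "\<bar>y a\<bar> \<le> 1" if "a < d" for a
    proof -
      have "y a * y a \<le> ip y y" unfolding ip_def by (rule member_le_sum) (use that in auto)
      then show ?thesis using y by (metis abs_le_square_iff abs_one one_power2 power2_eq_square)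
    qed
    moreover have "ip (\<lambda>a. if a < d then y a else 0) (\<lambda>a. if a < d then y a else 0) = ip y y"
      "ip (\<lambda>a. if a < d then y a else 0) z = ip y z" for z
      by (auto intro: ip_cong)
    ultimately show ?thesis using y by (auto simp: K_def abs_le_iff minus_le_iff)
  qed
  have "K \<noteq> {}" using orthon_extend_ex[OF o m] trunc by blast
  moreover have "continuous_on K (\<lambda>x. \<bar>bil x G x\<bar>)"
    by (intro continuous_on_rabs continuous_on_subset[OF continuous_ip(3)]) auto
  ultimately obtain x where x: "x \<in> K" "\<And>y. y \<in> K \<Longrightarrow> \<bar>bil y G y\<bar> \<le> \<bar>bil x G x\<bar>"
    using continuous_attains_sup[OF K] by blast
  have "\<bar>bil y G y\<bar> \<le> \<bar>bil x G x\<bar> * ip y y" if y: "\<forall>s<m. ip y (e s) = 0" for y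
  proof (cases "ip y y = 0")
    case True
    then have "bil y G y = bil (\<lambda>_. 0) G (\<lambda>_. 0)" by (intro bil_cong) (auto dest: ip_zeroD)
    then show ?thesis by (simp add: bil_def)
  next
    case False
    let ?c = "nrm y"
    have c: "?c > 0" using False by (simp add: nrm_def less_le)
    define z where "z = (\<lambda>a. (1/?c) * y a)"
    have "ip z z = 1" unfolding z_def ip_lin using c by (simp add: nrm_sq[symmetric] power2_eq_square field_simps)
    moreover have "\<forall>s<m. ip z (e s) = 0" unfolding z_def ip_lin using y by simp
    ultimately have "(\<lambda>a. if a < d then z a else 0) \<in> K" by (rule trunc)
    from x(2)[OF this] have "\<bar>bil z G z\<bar> \<le> \<bar>bil x G x\<bar>"
      by (subst (asm) bil_cong[of _ z _ G _ z]) auto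
    moreover have "bil z G z = bil y G y / (?c)\<^sup>2" unfolding z_def bil_lin by (simp add: power2_eq_square)
    ultimately show ?thesis using c by (simp add: nrm_sq field_simps False less_le)
  qed
  then show ?thesis using x(1) by (intro exI[of _ x]) (auto simp: K_def)
qed

lemma quadratic_zero: assumes "\<And>t::real. 2 * t * B \<le> t\<^sup>2 * K" shows "B = 0"
proof (rule ccontr)
  assume B: "B \<noteq> 0"
  have K: "K > 0"
  proof (rule ccontr)
    assume "\<not> 0 < K"
    then have "B\<^sup>2 * K \<le> 0" by (simp add: mult_nonneg_nonpos)
    moreover have "2 * B\<^sup>2 \<le> B\<^sup>2 * K" using assms[of B] by (simp add: power2_eq_square mult.assoc)
    moreover have "B\<^sup>2 > 0" using B by simp
    ultimately show False by linarith
  qed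
  have "2 * (B/K) * B \<le> (B/K)\<^sup>2 * K" by (rule assms)
  then have "2 * B\<^sup>2 / K \<le> B\<^sup>2 / K" using K by (simp add: power2_eq_square)
  then show False using K B by (simp add: divide_le_cancel)
qed

text \<open>First variation: replacing \<open>x\<close> by \<open>x + t z\<close>, with
  \<open>z\<close> orthogonal to \<open>x\<close> and to all \<open>e s\<close>, changes the form by
  \<open>2 * t * bil z G x\<close> up to second order in t, so maximality forces
  \<open>bil z G x = 0\<close>. The residual \<open>mv G x - bil x G x * x\<close> is itself such a
  \<open>z\<close>, hence it vanishes.\<close>

lemma max_is_eigenvector:
  assumes sym: "symm G" and x1: "ip x x = 1" and xe: "\<forall>s<m. ip x (e s) = 0"
    and ev: "\<forall>s<m. \<forall>a<d. mv G (e s) a = l s * e s a"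
    and mx: "\<And>y. (\<forall>s<m. ip y (e s) = 0) \<Longrightarrow> \<bar>bil y G y\<bar> \<le> \<bar>bil x G x\<bar> * ip y y"
  shows "\<forall>a<d. mv G x a = bil x G x * x a"
proof -
  let ?M = "bil x G x"
  have B0: "bil z G x = 0" if z: "\<forall>s<m. ip z (e s) = 0" "ip z x = 0" for z
  proof -
    have xz: "ip x z = 0" "bil x G z = bil z G x" using z bil_symm[OF sym] by (auto simp: ip_commute)
    have *: "\<bar>?M + 2 * t * bil z G x + t\<^sup>2 * bil z G z\<bar> \<le> \<bar>?M\<bar> * (1 + t\<^sup>2 * ip z z)" for t
    proof -
      have "\<forall>s<m. ip (\<lambda>a. x a + t * z a) (e s) = 0" using z xe by simp
      from mx[OF this] show ?thesis using z xz x1 by (simp add: algebra_simps power2_eq_square)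
    qed
    show ?thesis
    \<comment> \<open>The extremal value of the form may be negative; the maximality is then read
      for the negated form.\<close>
    proof (cases "?M \<ge> 0")
      case True
      show ?thesis
      proof (rule quadratic_zero)
        fix t show "2 * t * bil z G x \<le> t\<^sup>2 * (?M * ip z z - bil z G z)"
          using *[of t] True by (simp add: algebra_simps)
      qed
    next
      case False
      have "- bil z G x = 0"
      proof (rule quadratic_zero)
        fix t show "2 * t * - bil z G x \<le> t\<^sup>2 * (- ?M * ip z z + bil z G z)"
          using *[of t] False by (simp add: algebra_simps abs_if split: if_splits)
      qed
      then show ?thesis by simp
    qed
  qed
  define z where "z = (\<lambda>a. mv G x a - ?M * x a)"
  have "ip z (e s) = 0" if "s < m" for s
  proof -
    have "ip (mv G x) (e s) = bil (e s) G x" by (simp add: bil_def ip_commute)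
    also have "\<dots> = bil x G (e s)" by (rule bil_symm[OF sym])
    also have "\<dots> = ip x (\<lambda>a. l s * e s a)" unfolding bil_def using ev that by (intro ip_cong) auto
    finally show ?thesis using xe that by (simp add: z_def)
  qed
  moreover have zx: "ip z x = 0" by (simp add: z_def x1 bil_def ip_commute)
  ultimately have "bil z G x = 0" using B0 by blast
  then have "ip z z = 0" using zx by (simp add: bil_def z_def ip_commute)
  then show ?thesis using ip_zeroD[of z] by (auto simp: z_def)
qed

text \<open>Deflation: each maximiser on the complement of the earlier ones is an eigenvector. The
  maximality of every step is kept in the third conjunct, since it is what orders the
  eigenvalues.\<close>

lemma spectral_partial:
  assumes sym: "symm G"
  shows "m \<le> d \<Longrightarrow> \<exists>e l. orthon m e \<and> (\<forall>s<m. \<forall>a<d. mv G (e s) a = l s * e s a) \<and>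
     (\<forall>r<m. \<forall>y. (\<forall>s<r. ip y (e s) = 0) \<longrightarrow> \<bar>bil y G y\<bar> \<le> \<bar>l r\<bar> * ip y y)"
proof (induction m)
  case 0 then show ?case by (auto simp: orthon_def)
next
  case (Suc m)
  then obtain e l where e: "orthon m e" "\<forall>s<m. \<forall>a<d. mv G (e s) a = l s * e s a"
     "\<forall>r<m. \<forall>y. (\<forall>s<r. ip y (e s) = 0) \<longrightarrow> \<bar>bil y G y\<bar> \<le> \<bar>l r\<bar> * ip y y" by auto
  obtain x where x: "ip x x = 1" "\<forall>s<m. ip x (e s) = 0"
     "\<And>y. (\<forall>s<m. ip y (e s) = 0) \<Longrightarrow> \<bar>bil y G y\<bar> \<le> \<bar>bil x G x\<bar> * ip y y"
    using max_quadratic_form[OF e(1), of G] Suc by auto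
  have ev: "\<forall>a<d. mv G x a = bil x G x * x a" by (rule max_is_eigenvector[OF sym x(1,2) e(2) x(3)])
  show ?case
  proof (intro exI[of _ "e(m := x)"] exI[of _ "l(m := bil x G x)"] conjI)
    show "orthon (Suc m) (e(m := x))" using e(1) x by (auto simp: orthon_def less_Suc_eq ip_commute)
    show "\<forall>s<Suc m. \<forall>a<d. mv G ((e(m := x)) s) a = (l(m := bil x G x)) s * (e(m := x)) s a"
      using e(2) ev by (auto simp: less_Suc_eq)
    show "\<forall>r<Suc m. \<forall>y. (\<forall>s<r. ip y ((e(m := x)) s) = 0) \<longrightarrow> \<bar>bil y G y\<bar> \<le> \<bar>(l(m := bil x G x)) r\<bar> * ip y y"
      using e(3) x(3) by (auto simp: less_Suc_eq)
  qed
qed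

text \<open>Ordering the eigenvalues by absolute value, with signs left free, is what later makes
  the coefficients of the Abel summation over truncations nonnegative.\<close>

definition spec :: "(nat \<Rightarrow> nat \<Rightarrow> real) \<Rightarrow> (nat \<Rightarrow> nat \<Rightarrow> real) \<Rightarrow> (nat \<Rightarrow> real) \<Rightarrow> bool" where
  "spec G e l \<longleftrightarrow> orthon d e \<and> (\<forall>a<d. \<forall>b<d. G a b = (\<Sum>r<d. l r * e r a * e r b)) \<and>
     (\<forall>r s. r \<le> s \<longrightarrow> s < d \<longrightarrow> \<bar>l s\<bar> \<le> \<bar>l r\<bar>)"

lemma spec_bil: assumes "spec G e l" shows "bil x G y = (\<Sum>r<d. l r * ip x (e r) * ip (e r) y)"
proof -
  have "bil x G y = bil x (\<lambda>a b. \<Sum>r<d. l r * e r a * e r b) y"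
    using assms by (intro bil_cong) (auto simp: spec_def)
  also have "\<dots> = (\<Sum>a<d. \<Sum>b<d. \<Sum>r<d. l r * (x a * e r a) * (e r b * y b))"
    by (simp add: bil_sum2 sum_distrib_left sum_distrib_right mult_ac)
  also have "\<dots> = (\<Sum>a<d. \<Sum>r<d. \<Sum>b<d. l r * (x a * e r a) * (e r b * y b))"
    by (intro sum.cong refl sum.swap)
  also have "\<dots> = (\<Sum>r<d. \<Sum>a<d. \<Sum>b<d. l r * (x a * e r a) * (e r b * y b))" by (rule sum.swap)
  also have "\<dots> = (\<Sum>r<d. l r * ip x (e r) * ip (e r) y)"
    by (simp add: ip_def sum_product sum_distrib_left sum_distrib_right mult_ac)
  finally show ?thesis .
qed

theorem spectral: assumes sym: "symm G" shows "\<exists>e l. spec G e l"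
proof -
  obtain e l where e: "orthon d e" "\<forall>s<d. \<forall>a<d. mv G (e s) a = l s * e s a"
     "\<forall>r<d. \<forall>y. (\<forall>s<r. ip y (e s) = 0) \<longrightarrow> \<bar>bil y G y\<bar> \<le> \<bar>l r\<bar> * ip y y"
    using spectral_partial[OF sym, of d] by auto
  have Ge: "bil y G (e s) = l s * ip y (e s)" if "s < d" for s y
  proof -
    have "bil y G (e s) = ip y (\<lambda>a. l s * e s a)" unfolding bil_def using e(2) that by (intro ip_cong) auto
    then show ?thesis by simp
  qed
  have "G a b = (\<Sum>r<d. l r * e r a * e r b)" if ab: "a < d" "b < d" for a b
  proof -
    define \<delta> where "\<delta> a = (\<lambda>b::nat. if a = b then 1 else 0::real)" for a
    have del: "ip (\<delta> a) y = y a" "ip y (\<delta> a) = y a" if "a < d" for y a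
      using that unfolding ip_def \<delta>_def by (simp_all add: if_distrib[of "\<lambda>t. t * _"] if_distrib[of "\<lambda>t. _ * t"] sum.If_cases Int_absorb1 cong: if_cong)
    have "mv G (\<delta> b) a = G a b"
      using ab(2) unfolding mv_def \<delta>_def by (simp add: if_distrib[of "\<lambda>t. _ * t"] sum.If_cases Int_absorb1 cong: if_cong)
    then have "G a b = ip (\<delta> a) (mv G (\<delta> b))" using ab by (simp add: del)
    also have "\<dots> = (\<Sum>r<d. ip (\<delta> a) (e r) * ip (e r) (mv G (\<delta> b)))" by (rule orthon_complete[OF e(1)])
    also have "\<dots> = (\<Sum>r<d. e r a * bil (\<delta> b) G (e r))"
      using bil_symm[OF sym] ab by (simp add: del bil_def)
    also have "\<dots> = (\<Sum>r<d. l r * e r a * e r b)"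
      using ab by (intro sum.cong) (auto simp: Ge del)
    finally show ?thesis .
  qed
  moreover have "\<bar>l s\<bar> \<le> \<bar>l r\<bar>" if "r \<le> s" "s < d" for r s
  proof -
    have "\<forall>t<r. ip (e s) (e t) = 0" using e(1) that by (auto simp: orthon_def)
    then have "\<bar>bil (e s) G (e s)\<bar> \<le> \<bar>l r\<bar> * ip (e s) (e s)" using e(3) that by auto
    moreover have "ip (e s) (e s) = 1" using e(1) that by (auto simp: orthon_def)
    ultimately show ?thesis using that by (simp add: Ge)
  qed
  ultimately have "spec G e l" using e(1) by (auto simp: spec_def)
  then show ?thesis by blast
qed

end

section \<open>Schatten norms and spectral truncation\<close>

text \<open>Convexity of \<open>exp\<close> at the logarithms of the \<open>a i\<close>, with
  weights \<open>n i / N\<close>. A vanishing base with positive exponent has no logarithm, but then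
  the product is 0.\<close>

lemma weighted_am_gm:
  fixes a :: "'i \<Rightarrow> real" and n :: "'i \<Rightarrow> nat"
  assumes fin: "finite I" and nn: "\<And>i. i \<in> I \<Longrightarrow> 0 \<le> a i" and N: "(\<Sum>i\<in>I. n i) = N" "0 < N"
  shows "(\<Prod>i\<in>I. a i ^ n i) \<le> (\<Sum>i\<in>I. real (n i) * a i ^ N) / real N"
proof (cases "\<exists>i\<in>I. a i = 0 \<and> 0 < n i")
  case True
  then obtain i where i: "i \<in> I" "a i ^ n i = 0" by auto
  have "(\<Prod>i\<in>I. a i ^ n i) = 0" by (rule prod_zero[OF fin]) (use i in blast)
  also have "\<dots> \<le> (\<Sum>i\<in>I. real (n i) * a i ^ N) / real N"
    using nn by (intro divide_nonneg_nonneg sum_nonneg mult_nonneg_nonneg) auto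
  finally show ?thesis .
next
  case False
  have pos: "0 < a i \<or> n i = 0" if "i \<in> I" for i using False nn[OF that] that by (metis less_eq_real_def neq0_conv)
  have "(\<Prod>i\<in>I. a i ^ n i) = (\<Prod>i\<in>I. exp (real (n i) * ln (a i)))"
  proof (intro prod.cong refl)
    fix i assume "i \<in> I"
    then show "a i ^ n i = exp (real (n i) * ln (a i))"
      using pos[of i] by (auto simp: exp_of_nat_mult)
  qed
  also have "\<dots> = exp (\<Sum>i\<in>I. (real (n i) / real N) *\<^sub>R (real N * ln (a i)))"
    using fin N by (simp add: exp_sum)
  also have "\<dots> \<le> (\<Sum>i\<in>I. (real (n i) / real N) * exp (real N * ln (a i)))"
  proof (rule convex_on_sum[OF fin])
    show "I \<noteq> {}" using N by auto
    show "convex_on UNIV (exp :: real \<Rightarrow> real)" by (rule exp_convex)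
    show "(\<Sum>i\<in>I. real (n i) / real N) = 1"
      using N by (simp add: sum_divide_distrib[symmetric] flip: of_nat_sum)
  qed auto
  also have "\<dots> = (\<Sum>i\<in>I. real (n i) * a i ^ N / real N)"
  proof (intro sum.cong refl)
    fix i assume "i \<in> I"
    then show "(real (n i) / real N) * exp (real N * ln (a i)) = real (n i) * a i ^ N / real N"
      using pos[of i] by (auto simp: exp_of_nat_mult)
  qed
  finally show ?thesis by (simp add: sum_divide_distrib)
qed

lemma abel_sum: "(\<Sum>\<rho><n. (b \<rho> - b (Suc \<rho>)) * (\<Sum>r<Suc \<rho>. h r)) = (\<Sum>r<n. b r * h r) - b n * (\<Sum>r<n. h r :: real)"
  by (induction n) (simp_all add: algebra_simps)

section \<open>Linear functionals of matrices, spectral truncation and the layer-cake bound\<close>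

context dimn
begin

definition contr :: "(nat \<Rightarrow> nat \<Rightarrow> real) \<Rightarrow> bool" where
  "contr G \<longleftrightarrow> (\<forall>x y. \<bar>bil x G y\<bar> \<le> nrm x * nrm y)"

definition dyad :: "(nat \<Rightarrow> real) \<Rightarrow> (nat \<Rightarrow> real) \<Rightarrow> nat \<Rightarrow> nat \<Rightarrow> real" where
  "dyad x y = (\<lambda>a b. x a * y b)"

text \<open>The third clause makes the functional blind to entries outside the \<open>d\<close> by
  \<open>d\<close> block, which the function type cannot exclude.\<close>

definition lin :: "((nat \<Rightarrow> nat \<Rightarrow> real) \<Rightarrow> real) \<Rightarrow> bool" where
  "lin L \<longleftrightarrow> (\<forall>A B. L (\<lambda>a b. A a b + B a b) = L A + L B) \<and> (\<forall>c A. L (\<lambda>a b. c * A a b) = c * L A) \<and>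
     (\<forall>A B. (\<forall>a<d. \<forall>b<d. A a b = B a b) \<longrightarrow> L A = L B)"

lemma mv_dyad: "mv (dyad x y) z = (\<lambda>a. ip y z * x a)"
  by (simp add: mv_def dyad_def ip_def sum_distrib_left sum_distrib_right mult_ac fun_eq_iff)

lemma bil_dyad [simp]: "bil z (dyad x y) w = ip z x * ip y w"
  by (simp add: bil_def mv_dyad)

lemma lin_sum: assumes "lin L" shows "L (\<lambda>a b. \<Sum>r\<in>I. A r a b) = (\<Sum>r\<in>I. L (A r))"
proof -
  have sc: "\<And>c A. L (\<lambda>a b. c * A a b) = c * L A" using assms unfolding lin_def by simp
  have add: "\<And>A B. L (\<lambda>a b. A a b + B a b) = L A + L B" using assms unfolding lin_def by simp
  from sc[of 0 "\<lambda>a b. 0"] have z: "L (\<lambda>a b. 0) = 0" by simp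
  show ?thesis
  proof (cases "finite I")
    case True
    then show ?thesis
    proof (induction I rule: finite_induct)
      case (insert r I)
      have "L (\<lambda>a b. A r a b + (\<Sum>r\<in>I. A r a b)) = L (A r) + L (\<lambda>a b. \<Sum>r\<in>I. A r a b)"
        by (rule add)
      with insert show ?case by simp
    qed (simp add: z)
  qed (simp add: z)
qed

lemma lin_scale: "lin L \<Longrightarrow> L (\<lambda>a b. c * A a b) = c * L A" by (auto simp: lin_def)

lemma lin_cong: "lin L \<Longrightarrow> (\<And>a b. a < d \<Longrightarrow> b < d \<Longrightarrow> A a b = B a b) \<Longrightarrow> L A = L B" by (auto simp: lin_def)

lemma lin_bil: "lin (\<lambda>A. bil x A y)"
  unfolding lin_def bil_sum2 by (auto simp: algebra_simps sum.distrib sum_distrib_left)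

lemma lin_cmult: "lin L \<Longrightarrow> lin (\<lambda>A. c * L A)" "lin L \<Longrightarrow> lin (\<lambda>A. L A * c)"
  unfolding lin_def by (auto simp: algebra_simps)

lemma lin_sumI: "(\<And>i. i \<in> I \<Longrightarrow> lin (L i)) \<Longrightarrow> lin (\<lambda>A. \<Sum>i\<in>I. L i A)"
  unfolding lin_def by (auto simp: sum.distrib sum_distrib_left intro!: sum.cong)

lemma orthon_delta:
  assumes o: "orthon d e" and "a < d" "b < d"
  shows "(\<Sum>s<d. e s a * e s b) = (if a = b then 1 else 0)"
proof -
  define \<delta> where "\<delta> a = (\<lambda>b::nat. if a = b then 1 else 0::real)" for a
  have del: "ip (\<delta> a) y = y a" "ip y (\<delta> a) = y a" if "a < d" for y a
    using that unfolding ip_def \<delta>_def by (simp_all add: if_distrib[of "\<lambda>t. t * _"] if_distrib[of "\<lambda>t. _ * t"] sum.If_cases Int_absorb1 cong: if_cong)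
  have "\<delta> a b = ip (\<delta> a) (\<delta> b)" using assms by (simp add: del)
  also have "\<dots> = (\<Sum>r<d. ip (\<delta> a) (e r) * ip (e r) (\<delta> b))" by (rule orthon_complete[OF o])
  also have "\<dots> = (\<Sum>s<d. e s a * e s b)" using assms by (simp add: del)
  finally show ?thesis by (simp add: \<delta>_def)
qed

lemma parseval_le:
  assumes o: "orthon d e" and c: "\<And>r. r < d \<Longrightarrow> \<bar>c r\<bar> \<le> q" and R: "R \<le> d"
  shows "\<bar>\<Sum>r<R. c r * ip x (e r) * ip (e r) y\<bar> \<le> q * (nrm x * nrm y)"
proof (cases "d = 0")
  case True
  then have "nrm x = 0" unfolding nrm_def ip_def by simp
  then show ?thesis using True R by simp
next
  case False
  then have q: "0 \<le> q" using c[of 0] by (meson abs_ge_zero gr0I order_trans)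
  have n: "nrm z = L2_set (\<lambda>r. ip z (e r)) {..<d}" for z
    using orthon_complete[OF o, of z z] by (simp add: nrm_def L2_set_def power2_eq_square ip_commute)
  have "\<bar>\<Sum>r<R. c r * ip x (e r) * ip (e r) y\<bar> \<le> (\<Sum>r<R. \<bar>c r * ip x (e r) * ip (e r) y\<bar>)" by (rule sum_abs)
  also have "\<dots> \<le> (\<Sum>r<d. \<bar>c r * ip x (e r) * ip (e r) y\<bar>)" using R by (intro sum_mono2) auto
  also have "\<dots> \<le> (\<Sum>r<d. q * (\<bar>ip x (e r)\<bar> * \<bar>ip y (e r)\<bar>))"
    using c by (intro sum_mono) (simp add: abs_mult mult.assoc ip_commute mult_right_mono)
  also have "\<dots> \<le> q * (nrm x * nrm y)"
    unfolding sum_distrib_left[symmetric] n by (intro mult_left_mono L2_set_mult_ineq q)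
  finally show ?thesis .
qed

lemma spec_bound:
  assumes "spec G e l" "\<And>r. r < d \<Longrightarrow> \<bar>l r\<bar> \<le> q"
  shows "\<bar>bil x G y\<bar> \<le> q * (nrm x * nrm y)"
  using parseval_le[of e l q d x y] assms unfolding spec_bil[OF assms(1)] by (auto simp: spec_def)

text \<open>The matrix sign function cut down to the eigenvectors of the \<open>\<rho>\<close>
  largest absolute eigenvalues: a contraction of rank at most \<open>\<rho>\<close>. A symmetric
  matrix is a nonnegative combination of its truncations.\<close>

definition trunc :: "(nat \<Rightarrow> nat \<Rightarrow> real) \<Rightarrow> (nat \<Rightarrow> real) \<Rightarrow> nat \<Rightarrow> nat \<Rightarrow> nat \<Rightarrow> real" where
  "trunc e l \<rho> = (\<lambda>a b. \<Sum>r<\<rho>. sgn (l r) * (e r a * e r b))"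

lemma contr_trunc: assumes "orthon d e" "\<rho> \<le> d" shows "contr (trunc e l \<rho>)"
  unfolding contr_def
proof (intro allI)
  fix x y
  have "bil x (trunc e l \<rho>) y = (\<Sum>r<\<rho>. sgn (l r) * bil x (dyad (e r) (e r)) y)"
    unfolding trunc_def lin_sum[OF lin_bil] lin_scale[OF lin_bil] by (simp add: dyad_def)
  then have "bil x (trunc e l \<rho>) y = (\<Sum>r<\<rho>. sgn (l r) * ip x (e r) * ip (e r) y)" by (simp add: mult.assoc)
  then show "\<bar>bil x (trunc e l \<rho>) y\<bar> \<le> nrm x * nrm y"
    using parseval_le[of e "\<lambda>r. sgn (l r)" 1 \<rho> x y] assms by (auto simp: abs_sgn_eq)
qed

text \<open>Summation by parts writes \<open>B\<close> as a combination of its truncations whose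
  coefficients are the drops of the absolute eigenvalues, nonnegative by their ordering. Bounds for
  the truncations by partial sums of \<open>g\<close> then sum back to \<open>g\<close> weighted by
  the absolute eigenvalues.\<close>

lemma layer_cake_step:
  assumes L: "lin L" and B: "spec B e l" and g: "\<And>r. r < d \<Longrightarrow> 0 \<le> g r"
    and bd: "\<And>\<rho>. \<rho> \<le> d \<Longrightarrow> \<bar>L (trunc e l \<rho>)\<bar> \<le> (\<Sum>r<\<rho>. g r)"
  shows "\<bar>L B\<bar> \<le> (\<Sum>r<d. g r * \<bar>l r\<bar>)"
proof -
  \<comment> \<open>The value 0 from index \<open>d\<close> on removes the boundary term of
    \<open>abel_sum\<close>.\<close>
  define b where "b r = (if r < d then \<bar>l r\<bar> else 0)" for r
  have mono: "b (Suc \<rho>) \<le> b \<rho>" for \<rho> using B by (auto simp: b_def spec_def)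
  have "B a c = (\<Sum>\<rho><d. (b \<rho> - b (Suc \<rho>)) * trunc e l (Suc \<rho>) a c)" if "a < d" "c < d" for a c
  proof -
    have "B a c = (\<Sum>r<d. b r * (sgn (l r) * (e r a * e r c)))"
      using B that by (simp add: spec_def b_def abs_mult_sgn mult.assoc[symmetric])
    also have "\<dots> = (\<Sum>\<rho><d. (b \<rho> - b (Suc \<rho>)) * trunc e l (Suc \<rho>) a c)"
      unfolding trunc_def abel_sum by (simp add: b_def)
    finally show ?thesis .
  qed
  then have "L B = L (\<lambda>a c. \<Sum>\<rho><d. (b \<rho> - b (Suc \<rho>)) * trunc e l (Suc \<rho>) a c)" by (intro lin_cong[OF L])
  also have "\<dots> = (\<Sum>\<rho><d. (b \<rho> - b (Suc \<rho>)) * L (trunc e l (Suc \<rho>)))"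
    by (simp add: lin_sum[OF L] lin_scale[OF L])
  finally have "\<bar>L B\<bar> \<le> (\<Sum>\<rho><d. \<bar>(b \<rho> - b (Suc \<rho>)) * L (trunc e l (Suc \<rho>))\<bar>)" by (simp add: sum_abs)
  also have "\<dots> \<le> (\<Sum>\<rho><d. (b \<rho> - b (Suc \<rho>)) * (\<Sum>r<Suc \<rho>. g r))"
  proof (intro sum_mono)
    fix \<rho> assume "\<rho> \<in> {..<d}"
    then show "\<bar>(b \<rho> - b (Suc \<rho>)) * L (trunc e l (Suc \<rho>))\<bar> \<le> (b \<rho> - b (Suc \<rho>)) * (\<Sum>r<Suc \<rho>. g r)"
      unfolding abs_mult using mono[of \<rho>] bd[of "Suc \<rho>"] by (intro mult_mono) auto
  qed
  also have "\<dots> = (\<Sum>r<d. b r * g r)" unfolding abel_sum by (simp add: b_def)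
  also have "\<dots> = (\<Sum>r<d. g r * \<bar>l r\<bar>)" by (intro sum.cong) (auto simp: b_def)
  finally show ?thesis .
qed

text \<open>If all arguments are truncations, the one of smallest rank is expanded into dyads, each
  costing \<open>K\<close>, while the others remain contractions. This gives \<open>K\<close> times
  the smallest level, and that level counts the indices lying below all levels. Then the truncations
  are replaced by the full matrices one at a time, each replacement contributing its factor of
  absolute eigenvalues. So eigenvalues of equal position get multiplied although the matrices share
  no eigenvectors.\<close>

theorem layer_cake:
  fixes F :: "(nat \<Rightarrow> nat \<Rightarrow> nat \<Rightarrow> real) \<Rightarrow> real"
  assumes L: "\<And>s G. s < m \<Longrightarrow> lin (\<lambda>A. F (G(s := A)))" and m: "0 < m"
    and B: "\<And>s. s < m \<Longrightarrow> spec (B s) (e s) (l s)" and K: "0 \<le> K"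
    and dy: "\<And>s G x y. s < m \<Longrightarrow> (\<And>t. t < m \<Longrightarrow> t \<noteq> s \<Longrightarrow> contr (G t)) \<Longrightarrow> nrm x \<le> 1 \<Longrightarrow> nrm y \<le> 1 \<Longrightarrow>
       \<bar>F (G(s := dyad x y))\<bar> \<le> K"
  shows "\<bar>F B\<bar> \<le> K * (\<Sum>r<d. \<Prod>s<m. \<bar>l s r\<bar>)"
proof -
  define H where "H k \<rho> = (\<lambda>s. if s < k then B s else if s < m then trunc (e s) (l s) (\<rho> s) else B s)" for k \<rho>
  have main: "\<bar>F (H k \<rho>)\<bar> \<le> (\<Sum>r<d. if \<forall>s\<in>{k..<m}. r < \<rho> s then K * (\<Prod>s<k. \<bar>l s r\<bar>) else 0)"
    if "k \<le> m" "\<And>s. \<rho> s \<le> d" for k \<rho>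
    using that
  proof (induction k arbitrary: \<rho>)
    case 0
    define s where "s = arg_min_on \<rho> {..<m}"
    have s: "s < m" "\<And>t. t < m \<Longrightarrow> \<rho> s \<le> \<rho> t"
      using arg_min_if_finite[of "{..<m}" \<rho>] m by (auto simp: s_def not_less lessThan_empty_iff)
    have Hs: "H 0 \<rho> = (H 0 \<rho>)(s := trunc (e s) (l s) (\<rho> s))" using s by (auto simp: H_def)
    have os: "orthon d (e t)" if "t < m" for t using B[OF that] by (simp add: spec_def)
    have "F (H 0 \<rho>) = (\<Sum>r<\<rho> s. F ((H 0 \<rho>)(s := dyad (\<lambda>a. sgn (l s r) * e s r a) (e s r))))"
      by (subst Hs, unfold trunc_def, subst lin_sum[OF L[OF s(1)]]) (simp add: dyad_def mult.assoc)
    also have "\<bar>\<dots>\<bar> \<le> (\<Sum>r<\<rho> s. K)"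
    proof (rule order_trans[OF sum_abs sum_mono])
      fix r assume r: "r \<in> {..<\<rho> s}"
      then have "ip (e s r) (e s r) = 1" using os[OF s(1)] 0(2)[of s] by (auto simp: orthon_def)
      then have n: "nrm (e s r) \<le> 1" "nrm (\<lambda>a. sgn (l s r) * e s r a) \<le> 1"
        by (auto simp: nrm_def sgn_if)
      show "\<bar>F ((H 0 \<rho>)(s := dyad (\<lambda>a. sgn (l s r) * e s r a) (e s r)))\<bar> \<le> K"
        using n 0(2) by (intro dy s) (auto simp: H_def intro!: contr_trunc os)
    qed
    also have "\<dots> = (\<Sum>r<d. if r < \<rho> s then K else 0)"
      by (rule sum.mono_neutral_cong_left) (use 0(2)[of s] in auto)
    also have "\<dots> = (\<Sum>r<d. if \<forall>s\<in>{0..<m}. r < \<rho> s then K * (\<Prod>s<0. \<bar>l s r\<bar>) else 0)"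
      using s by (intro sum.cong) (auto intro: less_le_trans)
    finally show ?case .
  next
    case (Suc k)
    have k: "k < m" using Suc by simp
    \<comment> \<open>In the induction hypothesis slot \<open>k\<close> is truncated at
      \<open>R\<close>. There the condition \<open>r < R\<close> cuts the sum down to the partial
      sum that \<open>layer_cake_step\<close> asks for.\<close>
    have *: "\<bar>F ((H (Suc k) \<rho>)(k := B k))\<bar> \<le> (\<Sum>r<d. (if \<forall>s\<in>{Suc k..<m}. r < \<rho> s then K * (\<Prod>s<k. \<bar>l s r\<bar>) else 0) * \<bar>l k r\<bar>)"
    proof (rule layer_cake_step[OF L[OF k] B[OF k]])
      fix R assume R: "R \<le> d"
      have "(H (Suc k) \<rho>)(k := trunc (e k) (l k) R) = H k (\<rho>(k := R))"
        using k by (auto simp: H_def)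
      then have "\<bar>F ((H (Suc k) \<rho>)(k := trunc (e k) (l k) R))\<bar> = \<bar>F (H k (\<rho>(k := R)))\<bar>" by simp
      also have "\<dots> \<le> (\<Sum>r<d. if \<forall>s\<in>{k..<m}. r < (\<rho>(k := R)) s then K * (\<Prod>s<k. \<bar>l s r\<bar>) else 0)"
        by (rule Suc.IH) (use Suc.prems R in auto)
      also have "\<dots> = (\<Sum>r\<in>{..<d}. if r < R then (if \<forall>s\<in>{Suc k..<m}. r < \<rho> s then K * (\<Prod>s<k. \<bar>l s r\<bar>) else 0) else 0)"
      proof (intro sum.cong refl)
        fix r
        have "(\<forall>s\<in>{k..<m}. r < (\<rho>(k := R)) s) \<longleftrightarrow> r < R \<and> (\<forall>s\<in>{Suc k..<m}. r < \<rho> s)"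
          using k by (auto simp: Suc_le_eq le_less)
        then show "(if \<forall>s\<in>{k..<m}. r < (\<rho>(k := R)) s then K * (\<Prod>s<k. \<bar>l s r\<bar>) else 0) =
          (if r < R then (if \<forall>s\<in>{Suc k..<m}. r < \<rho> s then K * (\<Prod>s<k. \<bar>l s r\<bar>) else 0) else 0)" by simp
      qed
      also have "\<dots> = (\<Sum>r<R. if \<forall>s\<in>{Suc k..<m}. r < \<rho> s then K * (\<Prod>s<k. \<bar>l s r\<bar>) else 0)"
        by (rule sum.mono_neutral_cong_right) (use R in auto)
      finally show "\<bar>F ((H (Suc k) \<rho>)(k := trunc (e k) (l k) R))\<bar> \<le> \<dots>" .
    qed (use K in \<open>auto intro!: mult_nonneg_nonneg prod_nonneg\<close>)
    moreover have "(H (Suc k) \<rho>)(k := B k) = H (Suc k) \<rho>" by (auto simp: H_def)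
    ultimately have "\<bar>F (H (Suc k) \<rho>)\<bar> \<le> (\<Sum>r<d. (if \<forall>s\<in>{Suc k..<m}. r < \<rho> s then K * (\<Prod>s<k. \<bar>l s r\<bar>) else 0) * \<bar>l k r\<bar>)" by simp
    also have "\<dots> = (\<Sum>r<d. if \<forall>s\<in>{Suc k..<m}. r < \<rho> s then K * (\<Prod>s<Suc k. \<bar>l s r\<bar>) else 0)"
      by (intro sum.cong) auto
    finally show ?case .
  qed
  have "H m (\<lambda>_. 0) = B" by (auto simp: H_def)
  with main[of m "\<lambda>_. 0"] show ?thesis by (simp add: sum_distrib_left)
qed

section \<open>Powers, traces and Schatten norms\<close>

lemma spec_symm: "spec G e l \<Longrightarrow> symm G"
  by (auto simp: spec_def symm_def mult_ac)

lemma spec_mpow: assumes G: "spec G e l" shows "spec (mpow G n) e (\<lambda>r. l r ^ n)"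
proof -
  have o: "orthon d e" using G by (simp add: spec_def)
  have "mpow G n a b = (\<Sum>r<d. l r ^ n * e r a * e r b)" if "a < d" "b < d" for a b
    using that
  proof (induction n arbitrary: a)
    case 0 then show ?case using orthon_delta[OF o] by simp
  next
    case (Suc n)
    have "mpow G (Suc n) a b = (\<Sum>c<d. (\<Sum>r<d. l r * e r a * e r c) * (\<Sum>s<d. l s ^ n * e s c * e s b))"
      using Suc G by (auto simp: mm_def spec_def intro!: sum.cong)
    also have "\<dots> = (\<Sum>c<d. \<Sum>r<d. \<Sum>s<d. l r * e r a * (l s ^ n * e s b) * (e r c * e s c))"
      by (simp add: sum_product mult_ac)
    also have "\<dots> = (\<Sum>r<d. \<Sum>c<d. \<Sum>s<d. l r * e r a * (l s ^ n * e s b) * (e r c * e s c))" by (rule sum.swap)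
    also have "\<dots> = (\<Sum>r<d. \<Sum>s<d. \<Sum>c<d. l r * e r a * (l s ^ n * e s b) * (e r c * e s c))"
      by (intro sum.cong refl sum.swap)
    also have "\<dots> = (\<Sum>r<d. \<Sum>s<d. l r * e r a * (l s ^ n * e s b) * ip (e r) (e s))"
      by (simp add: ip_def sum_distrib_left)
    also have "\<dots> = (\<Sum>r<d. \<Sum>s<d. if s = r then l r * e r a * (l r ^ n * e r b) else 0)"
      using o by (intro sum.cong) (auto simp: orthon_def)
    also have "\<dots> = (\<Sum>r<d. l r ^ Suc n * e r a * e r b)" by (simp add: mult_ac)
    finally show ?case .
  qed
  then show ?thesis using G by (auto simp: spec_def power_abs intro!: power_mono)
qed

lemma spec_tr: assumes G: "spec G e l" shows "tr G = (\<Sum>r<d. l r)"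
proof -
  have "tr G = (\<Sum>a<d. \<Sum>r<d. l r * e r a * e r a)" using G by (simp add: tr_def spec_def)
  also have "\<dots> = (\<Sum>r<d. \<Sum>a<d. l r * e r a * e r a)" by (rule sum.swap)
  also have "\<dots> = (\<Sum>r<d. l r * ip (e r) (e r))" by (simp add: ip_def sum_distrib_left mult.assoc)
  finally show ?thesis using G by (simp add: spec_def orthon_def)
qed

lemma spec_tr_mpow: "spec G e l \<Longrightarrow> tr (mpow G n) = (\<Sum>r<d. l r ^ n)"
  using spec_tr[OF spec_mpow] .

lemma tr_mpow_even_nonneg: "symm G \<Longrightarrow> 0 \<le> tr (mpow G (2 * p))"
  using spectral[of G] by (auto simp: spec_tr_mpow power_mult intro!: sum_nonneg)

text \<open>The unnormalised Schatten norm of exponent \<open>2 * p\<close>, not \<open>p\<close>.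
  For an even exponent the trace of the plain power is already the sum of the absolute eigenvalues
  to that power.\<close>

definition schatten :: "nat \<Rightarrow> (nat \<Rightarrow> nat \<Rightarrow> real) \<Rightarrow> real" where
  "schatten p G = root (2 * p) (tr (mpow G (2 * p)))"

lemma schatten_nonneg: "symm G \<Longrightarrow> 0 < p \<Longrightarrow> 0 \<le> schatten p G"
  by (simp add: schatten_def tr_mpow_even_nonneg)

lemma schatten_pow: "symm G \<Longrightarrow> 0 < p \<Longrightarrow> schatten p G ^ (2 * p) = tr (mpow G (2 * p))"
  by (simp add: schatten_def tr_mpow_even_nonneg)

lemma schatten_bound: assumes "symm G" "0 < p" shows "\<bar>bil x G y\<bar> \<le> schatten p G * (nrm x * nrm y)"
proof -
  obtain e l where G: "spec G e l" using spectral[OF assms(1)] by blast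
  show ?thesis
  proof (rule spec_bound[OF G])
    fix r assume r: "r < d"
    have "\<bar>l r\<bar> ^ (2 * p) = l r ^ (2 * p)" by (simp add: power_even_abs)
    also have "\<dots> \<le> (\<Sum>r<d. l r ^ (2 * p))" by (rule member_le_sum) (use r in \<open>auto simp: power_mult\<close>)
    also have "\<dots> = schatten p G ^ (2 * p)" by (simp only: schatten_pow[OF assms] spec_tr_mpow[OF G])
    finally have "\<bar>l r\<bar> ^ (2 * p) \<le> schatten p G ^ (2 * p)" .
    then show "\<bar>l r\<bar> \<le> schatten p G"
      using power_le_imp_le_base[of "\<bar>l r\<bar>" "2 * p - 1" "schatten p G"] schatten_nonneg[OF assms] assms by simp
  qed
qed

end

section \<open>Gaussian integration by parts\<close>

text \<open>The mean value theorem dominates all difference quotients by \<open>B\<close>; then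
  dominated convergence along an arbitrary sequence.\<close>

lemma deriv_under_integral:
  fixes G G' :: "real \<Rightarrow> 'a \<Rightarrow> real"
  assumes int: "\<And>t. integrable M (G t)"
    and der: "\<And>t z. ((\<lambda>t. G t z) has_real_derivative G' t z) (at t)"
    and bd: "\<And>t z. \<bar>G' t z\<bar> \<le> B z" and B: "integrable M B"
  shows "((\<lambda>t. \<integral>z. G t z \<partial>M) has_real_derivative (\<integral>z. G' t z \<partial>M)) (at t)"
  unfolding has_field_derivative_iff tendsto_at_iff_sequentially
proof (intro allI impI)
  fix X :: "nat \<Rightarrow> real" assume X: "\<forall>i. X i \<in> UNIV - {t}" "X \<longlonglongrightarrow> t"
  define s where "s i z = (G (X i) z - G t z) / (X i - t)" for i z
  have lim: "(\<lambda>i. s i z) \<longlonglongrightarrow> G' t z" for z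
    using der[of z t] X unfolding has_field_derivative_iff tendsto_at_iff_sequentially s_def comp_def by auto
  have meas[measurable]: "s i \<in> borel_measurable M" for i
    unfolding s_def using borel_measurable_integrable[OF int] by measurable
  have [measurable]: "G' t \<in> borel_measurable M"
    by (rule borel_measurable_LIMSEQ_real[OF lim]) measurable
  have sb: "norm (s i z) \<le> B z" for i z
  proof -
    have "norm (G (X i) z - G t z) \<le> B z * norm (X i - t)"
      by (rule field_differentiable_bound[of UNIV "\<lambda>t. G t z" "\<lambda>t. G' t z"]) (use der bd in auto)
    moreover have "X i \<noteq> t" using X(1) by auto
    ultimately show ?thesis by (simp add: s_def divide_le_eq)
  qed
  have "(\<lambda>i. integral\<^sup>L M (s i)) \<longlonglongrightarrow> integral\<^sup>L M (G' t)"
    by (rule integral_dominated_convergence[where w = B]) (use lim sb B in auto)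
  then show "((\<lambda>y. (integral\<^sup>L M (G y) - integral\<^sup>L M (G t)) / (y - t)) \<circ> X) \<longlonglongrightarrow> integral\<^sup>L M (G' t)"
    unfolding s_def comp_def by (simp add: int)
qed

text \<open>All integrands are polynomials in finitely many coordinates. As a class of functions
  closed under sums and products they bring measurability, integrability and differentiability with
  them.\<close>

inductive polyfun :: "'k set \<Rightarrow> (('k \<Rightarrow> real) \<Rightarrow> real) \<Rightarrow> bool" for J where
  polyfun_const: "polyfun J (\<lambda>w. c)"
| polyfun_var: "k \<in> J \<Longrightarrow> polyfun J (\<lambda>w. w k)"
| polyfun_add: "polyfun J F \<Longrightarrow> polyfun J G \<Longrightarrow> polyfun J (\<lambda>w. F w + G w)"
| polyfun_mult: "polyfun J F \<Longrightarrow> polyfun J G \<Longrightarrow> polyfun J (\<lambda>w. F w * G w)"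

lemma polyfun_sum: "(\<And>i. i \<in> I \<Longrightarrow> polyfun J (F i)) \<Longrightarrow> polyfun J (\<lambda>w. \<Sum>i\<in>I. F i w)"
  by (induction I rule: infinite_finite_induct) (auto intro: polyfun.intros)

lemma polyfun_power: "polyfun J F \<Longrightarrow> polyfun J (\<lambda>w. F w ^ n)"
  by (induction n) (auto intro: polyfun.intros)

lemma polyfun_diff: assumes "polyfun J F" "polyfun J G" shows "polyfun J (\<lambda>w. F w - G w)"
  using polyfun_add[OF assms(1) polyfun_mult[OF polyfun_const[of J "-1"] assms(2)]] by simp

lemmas polyfun_intros = polyfun.intros polyfun_sum polyfun_power polyfun_diff

definition haspd :: "'k \<Rightarrow> (('k \<Rightarrow> real) \<Rightarrow> real) \<Rightarrow> (('k \<Rightarrow> real) \<Rightarrow> real) \<Rightarrow> bool" where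
  "haspd k F F' \<longleftrightarrow> (\<forall>w. ((\<lambda>t. F (w(k := t))) has_real_derivative F' w) (at (w k)))"

lemma haspd_const: "haspd k (\<lambda>w. c) (\<lambda>w. 0)" by (simp add: haspd_def)

lemma haspd_var: "haspd k (\<lambda>w. w k') (\<lambda>w. if k' = k then 1 else 0)"
  by (cases "k' = k") (auto simp: haspd_def)

lemma haspd_diff: "haspd k F F' \<Longrightarrow> haspd k G G' \<Longrightarrow> haspd k (\<lambda>w. F w - G w) (\<lambda>w. F' w - G' w)"
  unfolding haspd_def by (auto intro: DERIV_diff)

lemma haspd_mult: "haspd k F F' \<Longrightarrow> haspd k G G' \<Longrightarrow> haspd k (\<lambda>w. F w * G w) (\<lambda>w. F' w * G w + F w * G' w)"
  unfolding haspd_def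
proof (intro allI)
  fix w assume *: "\<forall>w. ((\<lambda>t. F (w(k := t))) has_real_derivative F' w) (at (w k))"
    "\<forall>w. ((\<lambda>t. G (w(k := t))) has_real_derivative G' w) (at (w k))"
  from DERIV_mult[OF *(1)[rule_format, of w] *(2)[rule_format, of w]]
  show "((\<lambda>t. F (w(k := t)) * G (w(k := t))) has_real_derivative F' w * G w + F w * G' w) (at (w k))"
    by (simp add: mult.commute)
qed

lemma haspd_sum: "(\<And>i. i \<in> I \<Longrightarrow> haspd k (F i) (F' i)) \<Longrightarrow> haspd k (\<lambda>w. \<Sum>i\<in>I. F i w) (\<lambda>w. \<Sum>i\<in>I. F' i w)"
  unfolding haspd_def by (auto intro!: DERIV_sum)

lemma haspd_cmult: "haspd k F F' \<Longrightarrow> haspd k (\<lambda>w. c * F w) (\<lambda>w. c * F' w)"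
  unfolding haspd_def by (auto intro!: DERIV_cmult)

lemma haspd_cong: "haspd k F F' \<Longrightarrow> (\<And>w. F' w = G' w) \<Longrightarrow> haspd k F G'"
  by (simp add: haspd_def)

lemma polyfun_1d: "polyfun J F \<Longrightarrow> \<exists>q. \<forall>t. F (w(k := t)) = poly q t"
proof (induction rule: polyfun.induct)
  case (polyfun_const c)
  show ?case by (intro exI[of _ "[:c:]"]) simp
next
  case (polyfun_var k')
  show ?case
  proof (cases "k' = k")
    case True then show ?thesis by (intro exI[of _ "[:0, 1:]"]) simp
  next
    case False then show ?thesis by (intro exI[of _ "[:w k':]"]) simp
  qed
next
  case (polyfun_add F G)
  then obtain q r where "\<forall>t. F (w(k := t)) = poly q t" "\<forall>t. G (w(k := t)) = poly r t" by blast
  then show ?case by (intro exI[of _ "q + r"]) (simp del: fun_upd_apply)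
next
  case (polyfun_mult F G)
  then obtain q r where "\<forall>t. F (w(k := t)) = poly q t" "\<forall>t. G (w(k := t)) = poly r t" by blast
  then show ?case by (intro exI[of _ "q * r"]) (simp del: fun_upd_apply)
qed

text \<open>The derivative is recorded as a chain rule along differentiable curves, since the
  rotation between two Gaussian copies moves all coordinates at once. Partial derivatives are the
  case of a curve that moves a single coordinate.\<close>

definition grad :: "'k set \<Rightarrow> (('k \<Rightarrow> real) \<Rightarrow> real) \<Rightarrow> ('k \<Rightarrow> ('k \<Rightarrow> real) \<Rightarrow> real) \<Rightarrow> bool" where
  "grad J f df \<longleftrightarrow> polyfun J f \<and> (\<forall>k. polyfun J (df k)) \<and>
     (\<forall>g g' t. (\<forall>k\<in>J. ((\<lambda>t. g t k) has_real_derivative g' k) (at t)) \<longrightarrow>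
        ((\<lambda>t. f (g t)) has_real_derivative (\<Sum>k\<in>J. df k (g t) * g' k)) (at t))"

lemma gradD: "grad J f df \<Longrightarrow> (\<And>k. k \<in> J \<Longrightarrow> ((\<lambda>t. g t k) has_real_derivative g' k) (at t)) \<Longrightarrow>
    ((\<lambda>t. f (g t)) has_real_derivative (\<Sum>k\<in>J. df k (g t) * g' k)) (at t)"
  by (simp add: grad_def)

lemma grad_haspd: assumes g: "grad J f df" and J: "finite J" "k \<in> J" shows "haspd k f (df k)"
  unfolding haspd_def
proof
  fix w
  have "((\<lambda>t. f (w(k := t))) has_real_derivative (\<Sum>k'\<in>J. df k' (w(k := w k)) * (if k' = k then 1 else 0))) (at (w k))"
    by (rule gradD[OF g]) auto
  then show "((\<lambda>t. f (w(k := t))) has_real_derivative df k w) (at (w k))"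
    using J by (simp add: if_distrib[of "\<lambda>t. _ * t"] cong: if_cong)
qed

lemma grad_ex: assumes "polyfun J F" "finite J" shows "\<exists>dF. grad J F dF"
  using assms
proof (induction rule: polyfun.induct)
  case (polyfun_const c)
  show ?case by (intro exI[of _ "\<lambda>k w. 0"]) (auto simp: grad_def intro: polyfun_intros)
next
  case (polyfun_var k')
  then show ?case
    by (intro exI[of _ "\<lambda>k w. if k = k' then 1 else 0"])
      (auto simp: grad_def if_distrib[of "\<lambda>t. t * _"] intro: polyfun_intros cong: if_cong)
next
  case (polyfun_add F G)
  then obtain dF dG where *: "grad J F dF" "grad J G dG" by blast
  have "grad J (\<lambda>w. F w + G w) (\<lambda>k w. dF k w + dG k w)"
    using * unfolding grad_def by (auto simp: algebra_simps sum.distrib intro!: polyfun_intros DERIV_add)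
  then show ?case by blast
next
  case (polyfun_mult F G)
  then obtain dF dG where *: "grad J F dF" "grad J G dG" by blast
  have "grad J (\<lambda>w. F w * G w) (\<lambda>k w. dF k w * G w + F w * dG k w)"
    unfolding grad_def
  proof (intro conjI allI impI)
    fix g g' and t :: real
    assume g: "\<forall>k\<in>J. ((\<lambda>t. g t k) has_real_derivative g' k) (at t)"
    show "((\<lambda>t. F (g t) * G (g t)) has_real_derivative (\<Sum>k\<in>J. (dF k (g t) * G (g t) + F (g t) * dG k (g t)) * g' k)) (at t)"
      by (rule DERIV_cong[OF DERIV_mult[OF gradD[OF *(1)] gradD[OF *(2)]]])
        (use g in \<open>auto simp: algebra_simps sum.distrib sum_distrib_left\<close>)
  qed (use * in \<open>auto simp: grad_def intro!: polyfun_intros\<close>)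
  then show ?case by blast
qed

section \<open>The one-dimensional Stein identity for polynomials\<close>

abbreviation stdn :: "real measure" where "stdn \<equiv> density lborel std_normal_density"

lemma prob_stdn: "prob_space stdn" by (rule prob_space_normal_density) simp

lemma stdn_power: "integrable stdn (\<lambda>x. x ^ k)"
  by (subst integrable_density) (auto simp: integrable_std_normal_moment normal_density_nonneg)

lemma stdn_integral: "f \<in> borel_measurable borel \<Longrightarrow> (\<integral>x. f x \<partial>stdn) = (\<integral>x. std_normal_density x * f x \<partial>lborel)"
  by (subst integral_density) (auto simp: normal_density_nonneg)

lemma stdn_poly: "integrable stdn (poly q)"
  unfolding poly_altdef by (intro Bochner_Integration.integrable_sum integrable_mult_right stdn_power)

text \<open>Read off from the explicit moments of the standard normal law. At \<open>k = 0\<close>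
  the truncated \<open>k - 1\<close> is harmless because of the factor
  \<open>real k\<close>.\<close>

lemma stdn_moment_rec: "(\<integral>x. x ^ Suc k \<partial>stdn) = real k * (\<integral>x. x ^ (k - 1) \<partial>stdn)"
proof (cases "even k")
  case True
  then obtain j where j: "k = 2 * j" by blast
  have "(\<integral>x. x ^ Suc k \<partial>stdn) = 0"
    using integral_std_normal_moment_odd[of j] by (simp add: stdn_integral j)
  moreover have "real k * (\<integral>x. x ^ (k - 1) \<partial>stdn) = 0"
  proof (cases j)
    case (Suc i)
    then have "k - 1 = 2 * i + 1" using j by simp
    then show ?thesis using integral_std_normal_moment_odd[of i] by (simp add: stdn_integral)
  qed (simp add: j)
  ultimately show ?thesis by simp
next
  case False
  then obtain j where j: "k = 2 * j + 1" using oddE by blast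
  have 1: "Suc k = 2 * Suc j" "k - 1 = 2 * j" using j by auto
  have "(\<integral>x. x ^ Suc k \<partial>stdn) = fact (2 * Suc j) / (2 ^ Suc j * fact (Suc j))"
    unfolding 1 using integral_std_normal_moment_even[of "Suc j"] by (simp add: stdn_integral del: fact_Suc power_Suc mult_Suc_right)
  also have "\<dots> = (2 * (real j + 1)) * (real k * fact (2 * j)) / ((2 * (real j + 1)) * (2 ^ j * fact j))"
    by (simp add: j algebra_simps)
  also have "\<dots> = real k * fact (2 * j) / (2 ^ j * fact j)"
    by (rule mult_divide_mult_cancel_left) (simp add: add_nonneg_eq_0_iff)
  also have "\<dots> = real k * (fact (2 * j) / (2 ^ j * fact j))" by simp
  also have "(fact (2 * j) / (2 ^ j * fact j)) = (\<integral>x. x ^ (k - 1) \<partial>stdn)"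
    unfolding 1 using integral_std_normal_moment_even[of j] by (simp add: stdn_integral)
  finally show ?thesis .
qed

lemma stein_1d: "(\<integral>x. x * poly q x \<partial>stdn) = (\<integral>x. poly (pderiv q) x \<partial>stdn)"
proof -
  have "(\<integral>x. x * poly q x \<partial>stdn) = (\<integral>x. (\<Sum>i\<le>degree q. coeff q i * x ^ Suc i) \<partial>stdn)"
    by (simp add: poly_altdef sum_distrib_left mult_ac)
  also have "\<dots> = (\<Sum>i\<le>degree q. coeff q i * (\<integral>x. x ^ Suc i \<partial>stdn))"
    using stdn_power by (subst Bochner_Integration.integral_sum) (auto simp del: power_Suc)
  also have "\<dots> = (\<Sum>i\<le>degree q. coeff q i * (real i * (\<integral>x. x ^ (i - 1) \<partial>stdn)))"
    by (simp only: stdn_moment_rec)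
  also have "\<dots> = (\<integral>x. (\<Sum>i\<le>degree q. coeff q i * (real i * x ^ (i - 1))) \<partial>stdn)"
    using stdn_power by (subst Bochner_Integration.integral_sum) auto
  also have "\<dots> = (\<integral>x. poly (pderiv q) x \<partial>stdn)"
  proof (intro Bochner_Integration.integral_cong refl)
    fix x :: real
    have "((\<lambda>x. \<Sum>i\<le>degree q. coeff q i * x ^ i) has_real_derivative (\<Sum>i\<le>degree q. coeff q i * (real i * x ^ (i - 1)))) (at x)"
      by (auto intro!: derivative_eq_intros sum.cong)
    then have "(poly q has_real_derivative (\<Sum>i\<le>degree q. coeff q i * (real i * x ^ (i - 1)))) (at x)"
      by (simp add: poly_altdef[abs_def])
    then show "(\<Sum>i\<le>degree q. coeff q i * (real i * x ^ (i - 1))) = poly (pderiv q) x"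
      using poly_DERIV DERIV_unique by blast
  qed
  finally show ?thesis .
qed

text \<open>The dominating weights factor over the coordinates, so their integrability reduces to
  one-dimensional moments. They multiply by adding exponents and grow with \<open>m\<close>, which
  carries the induction through products and sums.\<close>

lemma polyfun_bound:
  assumes "polyfun J F" "finite J"
  shows "\<exists>C m. 0 \<le> C \<and> (\<forall>w. \<bar>F w\<bar> \<le> C * (\<Prod>k\<in>J. (1 + (w k)\<^sup>2) ^ m))"
  using assms
proof (induction rule: polyfun.induct)
  case (polyfun_const c)
  show ?case by (intro exI[of _ "\<bar>c\<bar>"] exI[of _ 0]) simp
next
  case (polyfun_var k)
  have "\<bar>w k\<bar> \<le> 1 * (\<Prod>k\<in>J. (1 + (w k)\<^sup>2) ^ 1)" for w :: "'a \<Rightarrow> real"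
  proof -
    have "2 * \<bar>w k\<bar> \<le> 1 + (w k)\<^sup>2" using zero_le_power2[of "\<bar>w k\<bar> - 1"] by (simp add: power2_diff)
    then have "\<bar>w k\<bar> \<le> 1 + (w k)\<^sup>2" by linarith
    also have "\<dots> = (1 + (w k)\<^sup>2) * 1" by simp
    also have "\<dots> \<le> (1 + (w k)\<^sup>2) * (\<Prod>k\<in>J - {k}. 1 + (w k)\<^sup>2)"
      by (intro mult_left_mono prod_ge_1) auto
    also have "\<dots> = (\<Prod>k\<in>J. 1 + (w k)\<^sup>2)" using polyfun_var by (intro prod.remove[symmetric]) auto
    finally show ?thesis by simp
  qed
  then show ?case by (intro exI[of _ 1]) auto
next
  case (polyfun_add F G)
  then obtain C m D n where *: "0 \<le> C" "\<forall>w. \<bar>F w\<bar> \<le> C * (\<Prod>k\<in>J. (1 + (w k)\<^sup>2) ^ m)"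
    "0 \<le> D" "\<forall>w. \<bar>G w\<bar> \<le> D * (\<Prod>k\<in>J. (1 + (w k)\<^sup>2) ^ n)" by blast
  have "\<bar>F w + G w\<bar> \<le> (C + D) * (\<Prod>k\<in>J. (1 + (w k)\<^sup>2) ^ (m + n))" for w
  proof -
    have m: "(\<Prod>k\<in>J. (1 + (w k)\<^sup>2) ^ i) \<le> (\<Prod>k\<in>J. (1 + (w k)\<^sup>2) ^ (m + n))" if "i \<le> m + n" for i
      using that by (intro prod_mono conjI power_increasing) auto
    have "\<bar>F w + G w\<bar> \<le> \<bar>F w\<bar> + \<bar>G w\<bar>" by simp
    also have "\<dots> \<le> C * (\<Prod>k\<in>J. (1 + (w k)\<^sup>2) ^ (m + n)) + D * (\<Prod>k\<in>J. (1 + (w k)\<^sup>2) ^ (m + n))"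
      using * m[of m] m[of n] by (intro add_mono) (auto intro: order_trans mult_left_mono)
    finally show ?thesis by (simp add: algebra_simps)
  qed
  then show ?case using * by (intro exI[of _ "C + D"] exI[of _ "m + n"]) auto
next
  case (polyfun_mult F G)
  then obtain C m D n where *: "0 \<le> C" "\<forall>w. \<bar>F w\<bar> \<le> C * (\<Prod>k\<in>J. (1 + (w k)\<^sup>2) ^ m)"
    "0 \<le> D" "\<forall>w. \<bar>G w\<bar> \<le> D * (\<Prod>k\<in>J. (1 + (w k)\<^sup>2) ^ n)" by blast
  have "\<bar>F w * G w\<bar> \<le> (C * D) * (\<Prod>k\<in>J. (1 + (w k)\<^sup>2) ^ (m + n))" for w
  proof -
    have "\<bar>F w * G w\<bar> \<le> (C * (\<Prod>k\<in>J. (1 + (w k)\<^sup>2) ^ m)) * (D * (\<Prod>k\<in>J. (1 + (w k)\<^sup>2) ^ n))"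
      unfolding abs_mult using * by (intro mult_mono) (auto intro!: mult_nonneg_nonneg prod_nonneg)
    then show ?thesis by (simp add: power_add prod.distrib mult_ac)
  qed
  then show ?case using * by (intro exI[of _ "C * D"] exI[of _ "m + n"]) auto
qed

lemma polyfun_measurable:
  assumes "polyfun J f" "\<And>k. k \<in> J \<Longrightarrow> (\<lambda>z. g z k) \<in> borel_measurable N"
  shows "(\<lambda>z. f (g z)) \<in> borel_measurable N"
  using assms by (induction rule: polyfun.induct) auto

section \<open>The standard Gaussian product space\<close>

locale gauss_space = fixes J :: "'k set" assumes finite_J: "finite J"
begin

definition \<gamma> :: "('k \<Rightarrow> real) measure" where "\<gamma> = PiM J (\<lambda>_. stdn)"

sublocale P: finite_product_prob_space "\<lambda>_::'k. stdn" J
  by (intro finite_product_prob_space.intro finite_product_sigma_finite.intro product_prob_space.intro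
     product_sigma_finite.intro product_prob_space_axioms.intro finite_product_sigma_finite_axioms.intro
     prob_space_imp_sigma_finite prob_stdn finite_J)

lemma prob_gauss: "prob_space \<gamma>" unfolding \<gamma>_def by (rule P.prob_space_axioms)

sublocale G: prob_space \<gamma> by (rule prob_gauss)

lemma coord_measurable: "k \<in> J \<Longrightarrow> (\<lambda>w. w k) \<in> borel_measurable \<gamma>"
  unfolding \<gamma>_def using measurable_component_singleton[of k J "\<lambda>_. stdn"] by simp

lemma polyfun_meas: "polyfun J f \<Longrightarrow> f \<in> borel_measurable \<gamma>"
  using polyfun_measurable[of J f "\<lambda>w. w" \<gamma>] coord_measurable by simp

definition wt :: "nat \<Rightarrow> ('k \<Rightarrow> real) \<Rightarrow> real" where "wt m w = (\<Prod>k\<in>J. (1 + (w k)\<^sup>2) ^ m)"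

lemma wt_nonneg: "0 \<le> wt m w" unfolding wt_def by (intro prod_nonneg) auto

lemma wt_integrable: "integrable \<gamma> (wt m)"
proof -
  have "integrable stdn (poly ([:1, 0, 1:] ^ m))" by (rule stdn_poly)
  moreover have "poly ([:1, 0, 1:] ^ m) = (\<lambda>x::real. (1 + x\<^sup>2) ^ m)"
    by (rule ext) (simp add: poly_power power2_eq_square)
  ultimately have "integrable stdn (\<lambda>x. (1 + x\<^sup>2) ^ m)" by metis
  then show ?thesis unfolding \<gamma>_def wt_def
    by (intro P.product_integrable_prod finite_J)
qed

lemma polyfun_integrable: assumes "polyfun J F" shows "integrable \<gamma> F"
proof -
  obtain C m where "0 \<le> C" "\<And>w. \<bar>F w\<bar> \<le> C * wt m w"
    using polyfun_bound[OF assms finite_J] unfolding wt_def by blast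
  then show ?thesis
    by (intro Bochner_Integration.integrable_bound[OF integrable_mult_right[OF wt_integrable[of m], of C] polyfun_meas[OF assms]])
      (auto simp: wt_nonneg)
qed

lemma haspd_polyfun: assumes F: "polyfun J F" and k: "k \<in> J" and d: "haspd k F F'" shows "polyfun J F'"
proof -
  obtain dF where g: "grad J F dF" using grad_ex[OF F finite_J] by blast
  have "F' = dF k" using grad_haspd[OF g finite_J k] d unfolding haspd_def by (blast intro: DERIV_unique)
  then show ?thesis using g by (simp add: grad_def)
qed

text \<open>Fubini isolates the coordinate \<open>k\<close>. On each line in that direction the
  integrand is a polynomial in one variable, where \<open>stein_1d\<close> applies.\<close>

lemma gauss_ibp:
  assumes F: "polyfun J F" and k: "k \<in> J" and d: "haspd k F F'"
  shows "(\<integral>w. w k * F w \<partial>\<gamma>) = (\<integral>w. F' w \<partial>\<gamma>)"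
proof -
  have J: "J = insert k (J - {k})" using k by auto
  have iF': "integrable \<gamma> F'" by (rule polyfun_integrable[OF haspd_polyfun[OF F k d]])
  have iF: "integrable \<gamma> (\<lambda>w. w k * F w)" by (intro polyfun_integrable polyfun_intros k F)
  have "(\<integral>w. w k * F w \<partial>\<gamma>) = (\<integral>x. (\<integral>y. (x(k := y)) k * F (x(k := y)) \<partial>stdn) \<partial>PiM (J - {k}) (\<lambda>_. stdn))"
    using iF unfolding \<gamma>_def by (subst J, subst P.product_integral_insert) (use finite_J J in \<open>auto\<close>)
  also have "\<dots> = (\<integral>x. (\<integral>y. F' (x(k := y)) \<partial>stdn) \<partial>PiM (J - {k}) (\<lambda>_. stdn))"
  proof (rule Bochner_Integration.integral_cong[OF refl])
    fix x
    obtain q where q: "\<And>t. F (x(k := t)) = poly q t" using polyfun_1d[OF F] by blast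
    have "F' (x(k := y)) = poly (pderiv q) y" for y
    proof -
      have "((\<lambda>t. F ((x(k := y))(k := t))) has_real_derivative F' (x(k := y))) (at ((x(k := y)) k))"
        using d unfolding haspd_def by blast
      then have "(poly q has_real_derivative F' (x(k := y))) (at y)" by (simp add: q)
      then show ?thesis using poly_DERIV DERIV_unique by blast
    qed
    then show "(\<integral>y. (x(k := y)) k * F (x(k := y)) \<partial>stdn) = (\<integral>y. F' (x(k := y)) \<partial>stdn)"
      using stein_1d[of q] by (simp add: q)
  qed
  also have "\<dots> = (\<integral>w. F' w \<partial>\<gamma>)"
    using iF' unfolding \<gamma>_def by (subst (2) J, subst P.product_integral_insert) (use finite_J J in \<open>auto\<close>)
  finally show ?thesis .
qed

end

lemma polyfun_subst:
  assumes "polyfun J f" "\<And>k. k \<in> J \<Longrightarrow> polyfun I (\<lambda>w. g w k)"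
  shows "polyfun I (\<lambda>w. f (g w))"
  using assms by (induction rule: polyfun.induct) (auto intro: polyfun_intros)

section \<open>Two independent copies and the rotation between them\<close>

context gauss_space
begin

definition PP :: "(('k \<Rightarrow> real) \<times> ('k \<Rightarrow> real)) measure" where "PP = \<gamma> \<Otimes>\<^sub>M \<gamma>"

text \<open>A path from the first copy at angle 0 to the independent second copy at angle pi / 2
  which has the same polynomial moments all along (\<open>rot_invariant\<close>).\<close>

definition rot :: "real \<Rightarrow> ('k \<Rightarrow> real) \<times> ('k \<Rightarrow> real) \<Rightarrow> 'k \<Rightarrow> real" where
  "rot \<theta> z k = cos \<theta> * fst z k + sin \<theta> * snd z k"

sublocale PG: pair_prob_space \<gamma> \<gamma> by unfold_locales

lemma prob_PP: "prob_space PP" unfolding PP_def by (rule PG.prob_space_axioms)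

definition wt2 :: "nat \<Rightarrow> ('k \<Rightarrow> real) \<times> ('k \<Rightarrow> real) \<Rightarrow> real" where "wt2 m z = wt m (fst z) * wt m (snd z)"

lemma wt_ge1: "1 \<le> wt m w" unfolding wt_def by (intro prod_ge_1) auto

lemma wt2_ge1: "1 \<le> wt2 m z" unfolding wt2_def using wt_ge1[of m "fst z"] wt_ge1[of m "snd z"]
  by (metis mult_mono mult_1 zero_le_one wt_nonneg)

lemma wt2_mult: "wt2 a z * wt2 b z = wt2 (a + b) z"
  by (simp add: wt2_def wt_def power_add prod.distrib mult_ac)

lemma wt2_mono: "wt2 a z \<le> wt2 (a + b) z"
  using wt2_ge1[of a z] wt2_ge1[of b z] by (simp add: wt2_mult[symmetric] mult_left_le[of "wt2 b z"] mult_le_cancel_left1)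

lemma wt2_integrable: "integrable PP (wt2 m)"
proof -
  have m: "wt2 m \<in> borel_measurable PP"
    unfolding wt2_def PP_def using borel_measurable_integrable[OF wt_integrable] by measurable
  show ?thesis unfolding PP_def
  proof (rule PG.Fubini_integrable)
    show "wt2 m \<in> borel_measurable (\<gamma> \<Otimes>\<^sub>M \<gamma>)" using m unfolding PP_def .
    show "integrable \<gamma> (\<lambda>x. \<integral>y. norm (wt2 m (x, y)) \<partial>\<gamma>)"
      using wt_integrable[of m] by (simp add: wt2_def wt_nonneg abs_mult)
    show "AE x in \<gamma>. integrable \<gamma> (\<lambda>y. wt2 m (x, y))"
      using wt_integrable[of m] by (simp add: wt2_def)
  qed
qed

text \<open>One integrable weight dominates for all angles simultaneously, as differentiation under
  the integral requires.\<close>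

definition good :: "(real \<Rightarrow> ('k \<Rightarrow> real) \<times> ('k \<Rightarrow> real) \<Rightarrow> real) \<Rightarrow> bool" where
  "good \<Psi> \<longleftrightarrow> (\<forall>\<theta>. \<Psi> \<theta> \<in> borel_measurable PP) \<and> (\<exists>C m. 0 \<le> C \<and> (\<forall>\<theta> z. \<bar>\<Psi> \<theta> z\<bar> \<le> C * wt2 m z))"

lemma good_bounded: "(\<And>\<theta>. \<bar>c \<theta>\<bar> \<le> C) \<Longrightarrow> good (\<lambda>\<theta> z. c \<theta>)"
  unfolding good_def
proof (intro conjI allI exI[of _ C] exI[of _ "0::nat"])
  assume *: "\<And>\<theta>. \<bar>c \<theta>\<bar> \<le> C"
  show "0 \<le> C" using *[of 0] by (meson abs_ge_zero order_trans)
qed (auto simp: wt2_def wt_def)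

lemma good_add: assumes "good \<Psi>" "good \<Phi>" shows "good (\<lambda>\<theta> z. \<Psi> \<theta> z + \<Phi> \<theta> z)"
proof -
  obtain C m D n where *: "0 \<le> C" "\<And>\<theta> z. \<bar>\<Psi> \<theta> z\<bar> \<le> C * wt2 m z" "0 \<le> D" "\<And>\<theta> z. \<bar>\<Phi> \<theta> z\<bar> \<le> D * wt2 n z"
    using assms unfolding good_def by blast
  have "\<bar>\<Psi> \<theta> z + \<Phi> \<theta> z\<bar> \<le> (C + D) * wt2 (m + n) z" for \<theta> z
  proof -
    have "\<bar>\<Psi> \<theta> z + \<Phi> \<theta> z\<bar> \<le> C * wt2 m z + D * wt2 n z" using *(2,4)[of \<theta> z] by linarith
    also have "\<dots> \<le> C * wt2 (m + n) z + D * wt2 (m + n) z"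
      using * wt2_mono[of m z n] wt2_mono[of n z m] by (intro add_mono mult_left_mono) (auto simp: add.commute)
    finally show ?thesis by (simp add: algebra_simps)
  qed
  moreover have "(\<lambda>z. \<Psi> \<theta> z + \<Phi> \<theta> z) \<in> borel_measurable PP" for \<theta>
    using assms unfolding good_def by (intro borel_measurable_add) blast+
  ultimately show ?thesis unfolding good_def using * by (meson add_nonneg_nonneg)
qed

lemma good_mult: assumes "good \<Psi>" "good \<Phi>" shows "good (\<lambda>\<theta> z. \<Psi> \<theta> z * \<Phi> \<theta> z)"
proof -
  obtain C m D n where *: "0 \<le> C" "\<And>\<theta> z. \<bar>\<Psi> \<theta> z\<bar> \<le> C * wt2 m z" "0 \<le> D" "\<And>\<theta> z. \<bar>\<Phi> \<theta> z\<bar> \<le> D * wt2 n z"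
    using assms unfolding good_def by blast
  have "\<bar>\<Psi> \<theta> z * \<Phi> \<theta> z\<bar> \<le> (C * D) * wt2 (m + n) z" for \<theta> z
  proof -
    have "\<bar>\<Psi> \<theta> z * \<Phi> \<theta> z\<bar> \<le> (C * wt2 m z) * (D * wt2 n z)"
      unfolding abs_mult using * wt2_ge1[of m z] by (intro mult_mono) auto
    then show ?thesis by (simp add: wt2_mult[symmetric] mult_ac)
  qed
  moreover have "(\<lambda>z. \<Psi> \<theta> z * \<Phi> \<theta> z) \<in> borel_measurable PP" for \<theta>
    using assms unfolding good_def by (intro borel_measurable_times) blast+
  ultimately show ?thesis unfolding good_def using * by (meson mult_nonneg_nonneg)
qed

lemma good_sum: "(\<And>i. i \<in> I \<Longrightarrow> good (\<Psi> i)) \<Longrightarrow> good (\<lambda>\<theta> z. \<Sum>i\<in>I. \<Psi> i \<theta> z)"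
  by (induction I rule: infinite_finite_induct) (auto intro: good_add good_bounded[of "\<lambda>_. 0" 0])

lemma abs_le_wt1: assumes "k \<in> J" shows "\<bar>w k\<bar> \<le> wt 1 w"
proof -
  have "2 * \<bar>w k\<bar> \<le> 1 + (w k)\<^sup>2" using zero_le_power2[of "\<bar>w k\<bar> - 1"] by (simp add: power2_diff)
  then have "\<bar>w k\<bar> \<le> 1 + (w k)\<^sup>2" by linarith
  also have "\<dots> = (1 + (w k)\<^sup>2) * 1" by simp
  also have "\<dots> \<le> (1 + (w k)\<^sup>2) * (\<Prod>k\<in>J - {k}. 1 + (w k)\<^sup>2)"
    by (intro mult_left_mono prod_ge_1) auto
  also have "\<dots> = wt 1 w" unfolding wt_def power_one_right
    using assms finite_J by (intro prod.remove[symmetric]) auto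
  finally show ?thesis .
qed

lemma good_coord: assumes "k \<in> J" shows "good (\<lambda>\<theta> z. fst z k)" "good (\<lambda>\<theta> z. snd z k)"
proof -
  note [measurable] = coord_measurable[OF assms]
  have "\<bar>fst z k\<bar> \<le> 1 * wt2 1 z" "\<bar>snd z k\<bar> \<le> 1 * wt2 1 z" for z
  proof -
    have "wt 1 (fst z) * 1 \<le> wt 1 (fst z) * wt 1 (snd z)" "1 * wt 1 (snd z) \<le> wt 1 (fst z) * wt 1 (snd z)"
      using wt_ge1 wt_nonneg by (intro mult_left_mono mult_right_mono; blast)+
    then show "\<bar>fst z k\<bar> \<le> 1 * wt2 1 z" "\<bar>snd z k\<bar> \<le> 1 * wt2 1 z"
      using abs_le_wt1[OF assms, of "fst z"] abs_le_wt1[OF assms, of "snd z"] unfolding wt2_def by linarith+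
  qed
  moreover have "(\<lambda>z. fst z k) \<in> borel_measurable PP" "(\<lambda>z. snd z k) \<in> borel_measurable PP"
    unfolding PP_def by measurable
  ultimately show "good (\<lambda>\<theta> z. fst z k)" "good (\<lambda>\<theta> z. snd z k)"
    unfolding good_def by (metis zero_le_one)+
qed

lemma good_polyfun:
  assumes "polyfun J f" "\<And>k. k \<in> J \<Longrightarrow> good (\<lambda>\<theta> z. g \<theta> z k)"
  shows "good (\<lambda>\<theta> z. f (g \<theta> z))"
  using assms
  by (induction rule: polyfun.induct) (auto intro: good_add good_mult good_bounded[of "\<lambda>_. c" "\<bar>c\<bar>" for c])

lemma good_fst: "polyfun J f \<Longrightarrow> good (\<lambda>\<theta> z. f (fst z))"
  by (rule good_polyfun[where g = "\<lambda>\<theta> z. fst z"]) (auto intro: good_coord)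

lemma good_snd: "polyfun J f \<Longrightarrow> good (\<lambda>\<theta> z. f (snd z))"
  by (rule good_polyfun[where g = "\<lambda>\<theta> z. snd z"]) (auto intro: good_coord)

lemma good_cos: "good (\<lambda>\<theta> z. cos \<theta>)" and good_sin: "good (\<lambda>\<theta> z. sin \<theta>)"
  by (rule good_bounded[where C = 1]; simp)+

lemma good_rot: "polyfun J f \<Longrightarrow> good (\<lambda>\<theta> z. f (rot \<theta> z))"
  by (rule good_polyfun[where g = rot])
    (auto simp: rot_def intro!: good_add good_mult good_cos good_sin good_coord)

lemma good_integrable: assumes "good \<Psi>" shows "integrable PP (\<Psi> \<theta>)"
proof -
  obtain C m where *: "0 \<le> C" "\<And>z. \<bar>\<Psi> \<theta> z\<bar> \<le> C * wt2 m z" using assms unfolding good_def by blast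
  have "\<Psi> \<theta> \<in> borel_measurable PP" using assms unfolding good_def by blast
  then show ?thesis
    by (rule Bochner_Integration.integrable_bound[OF integrable_mult_right[OF wt2_integrable[of m], of C]])
      (use * in \<open>auto intro!: AE_I2 order_trans[OF *(2) abs_ge_self]\<close>)
qed

lemma PP_fst: assumes "polyfun J f" shows "(\<integral>z. f (fst z) \<partial>PP) = (\<integral>w. f w \<partial>\<gamma>)"
proof -
  have "integrable PP (\<lambda>z. f (fst z))" using good_integrable[OF good_fst[OF assms]] .
  then have "(\<integral>x. (\<integral>y. f (fst (x, y)) \<partial>\<gamma>) \<partial>\<gamma>) = (\<integral>z. f (fst z) \<partial>PP)" unfolding PP_def by (rule PG.integral_fst')
  then show ?thesis by (simp add: G.prob_space)
qed

lemma PP_prod: assumes "polyfun J f" "polyfun J g" shows "(\<integral>z. f (fst z) * g (snd z) \<partial>PP) = (\<integral>w. f w \<partial>\<gamma>) * (\<integral>w. g w \<partial>\<gamma>)"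
proof -
  have "integrable PP (\<lambda>z. f (fst z) * g (snd z))"
    using good_integrable[OF good_mult[OF good_fst[OF assms(1)] good_snd[OF assms(2)]]] .
  then have "(\<integral>x. (\<integral>y. f (fst (x, y)) * g (snd (x, y)) \<partial>\<gamma>) \<partial>\<gamma>) = (\<integral>z. f (fst z) * g (snd z) \<partial>PP)"
    unfolding PP_def by (rule PG.integral_fst')
  then show ?thesis by simp
qed

lemma ibp_fst:
  assumes k: "k \<in> J" and p: "\<And>w'. polyfun J (\<lambda>w. \<Psi> (w, w'))" "\<And>w'. haspd k (\<lambda>w. \<Psi> (w, w')) (\<lambda>w. \<Psi>' (w, w'))"
    and i: "integrable PP (\<lambda>z. fst z k * \<Psi> z)" "integrable PP \<Psi>'"
  shows "(\<integral>z. fst z k * \<Psi> z \<partial>PP) = (\<integral>z. \<Psi>' z \<partial>PP)"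
proof -
  have "(\<integral>z. fst z k * \<Psi> z \<partial>PP) = (\<integral>y. (\<integral>x. x k * \<Psi> (x, y) \<partial>\<gamma>) \<partial>\<gamma>)"
    using PG.integral_snd[of "\<lambda>x y. x k * \<Psi> (x, y)"] i(1) unfolding PP_def by (simp add: case_prod_unfold)
  also have "\<dots> = (\<integral>y. (\<integral>x. \<Psi>' (x, y) \<partial>\<gamma>) \<partial>\<gamma>)"
    by (rule Bochner_Integration.integral_cong[OF refl]) (rule gauss_ibp[OF p(1) k p(2)])
  also have "\<dots> = (\<integral>z. \<Psi>' z \<partial>PP)"
    using PG.integral_snd[of "\<lambda>x y. \<Psi>' (x, y)"] i(2) unfolding PP_def by (simp add: case_prod_unfold)
  finally show ?thesis .
qed

lemma ibp_snd:
  assumes k: "k \<in> J" and p: "\<And>w. polyfun J (\<lambda>w'. \<Psi> (w, w'))" "\<And>w. haspd k (\<lambda>w'. \<Psi> (w, w')) (\<lambda>w'. \<Psi>' (w, w'))"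
    and i: "integrable PP (\<lambda>z. snd z k * \<Psi> z)" "integrable PP \<Psi>'"
  shows "(\<integral>z. snd z k * \<Psi> z \<partial>PP) = (\<integral>z. \<Psi>' z \<partial>PP)"
proof -
  have "(\<integral>z. snd z k * \<Psi> z \<partial>PP) = (\<integral>x. (\<integral>y. y k * \<Psi> (x, y) \<partial>\<gamma>) \<partial>\<gamma>)"
    using PG.integral_fst'[of "\<lambda>z. snd z k * \<Psi> z"] i(1) unfolding PP_def by simp
  also have "\<dots> = (\<integral>x. (\<integral>y. \<Psi>' (x, y) \<partial>\<gamma>) \<partial>\<gamma>)"
    by (rule Bochner_Integration.integral_cong[OF refl]) (rule gauss_ibp[OF p(1) k p(2)])
  also have "\<dots> = (\<integral>z. \<Psi>' z \<partial>PP)"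
    using PG.integral_fst'[of \<Psi>'] i(2) unfolding PP_def by simp
  finally show ?thesis .
qed

text \<open>The angular derivative of \<open>f (rot \<theta> z)\<close> contains both
  \<open>fst z k\<close> and \<open>snd z k\<close>. Integrating them by parts creates second
  derivatives of \<open>f\<close> with the factors \<open>- sin \<theta> * cos \<theta>\<close> and
  \<open>cos \<theta> * sin \<theta>\<close>. These cancel, and only the term where the derivative
  falls on \<open>\<phi>\<close> survives.\<close>

lemma rot_derivative:
  assumes \<phi>: "grad J \<phi> d\<phi>" and f: "grad J f df"
  shows "((\<lambda>\<theta>. \<integral>z. \<phi> (fst z) * f (rot \<theta> z) \<partial>PP) has_real_derivative
     - sin \<theta> * (\<Sum>k\<in>J. \<integral>z. d\<phi> k (fst z) * df k (rot \<theta> z) \<partial>PP)) (at \<theta>)"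
proof -
  have p\<phi>: "polyfun J \<phi>" "polyfun J (d\<phi> k)" and pf: "polyfun J f" "polyfun J (df k)" for k
    using \<phi> f by (auto simp: grad_def)
  define G' where "G' \<theta> z = (\<Sum>k\<in>J. (- sin \<theta>) * (fst z k * (\<phi> (fst z) * df k (rot \<theta> z))) + cos \<theta> * (snd z k * (\<phi> (fst z) * df k (rot \<theta> z))))" for \<theta> z
  have gG: "good (\<lambda>\<theta> z. \<phi> (fst z) * f (rot \<theta> z))" by (intro good_mult good_fst good_rot p\<phi> pf)
  have gs: "good (\<lambda>\<theta> z. - sin \<theta>)" by (rule good_bounded[where C = 1]) simp
  have gG': "good G'" unfolding G'_def
    by (intro good_sum good_add good_mult good_fst good_rot good_cos gs good_coord p\<phi> pf)
  obtain C m where C: "\<And>\<theta> z. \<bar>G' \<theta> z\<bar> \<le> C * wt2 m z" using gG' unfolding good_def by blast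
  have der: "((\<lambda>\<theta>. \<integral>z. \<phi> (fst z) * f (rot \<theta> z) \<partial>PP) has_real_derivative (\<integral>z. G' \<theta> z \<partial>PP)) (at \<theta>)"
  proof (rule deriv_under_integral[where B = "\<lambda>z. C * wt2 m z"])
    show "integrable PP (\<lambda>z. \<phi> (fst z) * f (rot t z))" for t by (rule good_integrable[OF gG])
    show "integrable PP (\<lambda>z. C * wt2 m z)" by (intro integrable_mult_right wt2_integrable)
    show "\<bar>G' t z\<bar> \<le> C * wt2 m z" for t z by (rule C)
    fix t z
    have "((\<lambda>t. f (rot t z)) has_real_derivative (\<Sum>k\<in>J. df k (rot t z) * (- sin t * fst z k + cos t * snd z k))) (at t)"
      by (rule gradD[OF f]) (auto simp: rot_def intro!: derivative_eq_intros)
    from DERIV_cmult[OF this, of "\<phi> (fst z)"]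
    show "((\<lambda>t. \<phi> (fst z) * f (rot t z)) has_real_derivative G' t z) (at t)"
      by (rule DERIV_cong) (simp add: G'_def sum_distrib_left algebra_simps)
  qed
  have step: "(\<integral>z. - sin \<theta> * (fst z k * (\<phi> (fst z) * df k (rot \<theta> z))) + cos \<theta> * (snd z k * (\<phi> (fst z) * df k (rot \<theta> z))) \<partial>PP)
     = - sin \<theta> * (\<integral>z. d\<phi> k (fst z) * df k (rot \<theta> z) \<partial>PP)" if k: "k \<in> J" for k
  proof -
    obtain ddf where ddf: "grad J (df k) ddf" using grad_ex[OF pf(2) finite_J] by blast
    have pd: "polyfun J (ddf k)" using ddf by (simp add: grad_def)
    have rp: "rot \<theta> (w, w') = (\<lambda>j. cos \<theta> * w j + sin \<theta> * w' j)" for w w' by (simp add: rot_def fun_eq_iff)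
    have i1: "integrable PP (\<lambda>z. fst z k * (\<phi> (fst z) * df k (rot \<theta> z)))" "integrable PP (\<lambda>z. snd z k * (\<phi> (fst z) * df k (rot \<theta> z)))"
      by (rule good_integrable[where \<Psi> = "\<lambda>\<theta> z. fst z k * (\<phi> (fst z) * df k (rot \<theta> z))"]
             good_integrable[where \<Psi> = "\<lambda>\<theta> z. snd z k * (\<phi> (fst z) * df k (rot \<theta> z))"],
          intro good_mult good_fst good_rot good_coord k p\<phi> pf)+
    have i2: "integrable PP (\<lambda>z. d\<phi> k (fst z) * df k (rot \<theta> z))"
      by (rule good_integrable[where \<Psi> = "\<lambda>\<theta> z. d\<phi> k (fst z) * df k (rot \<theta> z)"], intro good_mult good_fst good_rot p\<phi> pf)
    have i3: "integrable PP (\<lambda>z. \<phi> (fst z) * ddf k (rot \<theta> z))"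
      by (rule good_integrable[where \<Psi> = "\<lambda>\<theta> z. \<phi> (fst z) * ddf k (rot \<theta> z)"], intro good_mult good_fst good_rot p\<phi> pd)
    have c: "((\<lambda>t. df k (\<lambda>j. a * (w(k := t)) j + b * w' j)) has_real_derivative ddf k (\<lambda>j. a * w j + b * w' j) * a) (at (w k))"
      "((\<lambda>t. df k (\<lambda>j. b * w' j + a * (w(k := t)) j)) has_real_derivative ddf k (\<lambda>j. b * w' j + a * w j) * a) (at (w k))" for w w' a b
    proof -
      have "((\<lambda>t. df k (\<lambda>j. a * (w(k := t)) j + b * w' j)) has_real_derivative
         (\<Sum>j\<in>J. ddf j (\<lambda>j. a * (w(k := w k)) j + b * w' j) * (if j = k then a else 0))) (at (w k))"
        by (rule gradD[OF ddf]) (auto intro!: derivative_eq_intros)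
      then show "((\<lambda>t. df k (\<lambda>j. a * (w(k := t)) j + b * w' j)) has_real_derivative ddf k (\<lambda>j. a * w j + b * w' j) * a) (at (w k))"
        using k finite_J by (simp add: if_distrib[of "\<lambda>t. _ * t"] cong: if_cong)
      then show "((\<lambda>t. df k (\<lambda>j. b * w' j + a * (w(k := t)) j)) has_real_derivative ddf k (\<lambda>j. b * w' j + a * w j) * a) (at (w k))"
        by (simp only: add.commute)
    qed
    have "(\<integral>z. fst z k * (\<phi> (fst z) * df k (rot \<theta> z)) \<partial>PP) = (\<integral>z. d\<phi> k (fst z) * df k (rot \<theta> z) + cos \<theta> * (\<phi> (fst z) * ddf k (rot \<theta> z)) \<partial>PP)"
    proof (rule ibp_fst[OF k])
      fix w'
      show "polyfun J (\<lambda>w. \<phi> (fst (w, w')) * df k (rot \<theta> (w, w')))"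
        unfolding rp fst_conv by (intro polyfun_mult p\<phi> polyfun_subst[OF pf(2)]) (auto intro!: polyfun_intros)
      have "haspd k (\<lambda>w. df k (\<lambda>j. cos \<theta> * w j + sin \<theta> * w' j)) (\<lambda>w. ddf k (\<lambda>j. cos \<theta> * w j + sin \<theta> * w' j) * cos \<theta>)"
        unfolding haspd_def using c(1) by blast
      from haspd_mult[OF grad_haspd[OF \<phi> finite_J k] this]
      show "haspd k (\<lambda>w. \<phi> (fst (w, w')) * df k (rot \<theta> (w, w'))) (\<lambda>w. d\<phi> k (fst (w, w')) * df k (rot \<theta> (w, w')) + cos \<theta> * (\<phi> (fst (w, w')) * ddf k (rot \<theta> (w, w'))))"
        unfolding rp fst_conv by (rule haspd_cong) simp
    qed (use i1 i2 i3 in auto)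
    moreover have "(\<integral>z. snd z k * (\<phi> (fst z) * df k (rot \<theta> z)) \<partial>PP) = (\<integral>z. sin \<theta> * (\<phi> (fst z) * ddf k (rot \<theta> z)) \<partial>PP)"
    proof (rule ibp_snd[OF k])
      fix w
      show "polyfun J (\<lambda>w'. \<phi> (fst (w, w')) * df k (rot \<theta> (w, w')))"
        unfolding rp fst_conv by (intro polyfun_mult polyfun_const polyfun_subst[OF pf(2)]) (auto intro!: polyfun_intros)
      have "haspd k (\<lambda>w'. df k (\<lambda>j. cos \<theta> * w j + sin \<theta> * w' j)) (\<lambda>w'. ddf k (\<lambda>j. cos \<theta> * w j + sin \<theta> * w' j) * sin \<theta>)"
        unfolding haspd_def using c(2) by blast
      from haspd_cmult[OF this, of "\<phi> w"]
      show "haspd k (\<lambda>w'. \<phi> (fst (w, w')) * df k (rot \<theta> (w, w'))) (\<lambda>w'. sin \<theta> * (\<phi> (fst (w, w')) * ddf k (rot \<theta> (w, w'))))"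
        unfolding rp fst_conv by (rule haspd_cong) simp
    qed (use i1 i3 in auto)
    ultimately show ?thesis using i1 i2 i3 by (simp add: algebra_simps)
  qed
  have "(\<integral>z. G' \<theta> z \<partial>PP) = (\<Sum>k\<in>J. - sin \<theta> * (\<integral>z. d\<phi> k (fst z) * df k (rot \<theta> z) \<partial>PP))"
  proof -
    have "(\<integral>z. G' \<theta> z \<partial>PP) = (\<Sum>k\<in>J. \<integral>z. - sin \<theta> * (fst z k * (\<phi> (fst z) * df k (rot \<theta> z))) + cos \<theta> * (snd z k * (\<phi> (fst z) * df k (rot \<theta> z))) \<partial>PP)"
      unfolding G'_def
    proof (rule Bochner_Integration.integral_sum)
      fix k assume k: "k \<in> J"
      show "integrable PP (\<lambda>z. - sin \<theta> * (fst z k * (\<phi> (fst z) * df k (rot \<theta> z))) + cos \<theta> * (snd z k * (\<phi> (fst z) * df k (rot \<theta> z))))"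
        by (rule good_integrable[where \<Psi> = "\<lambda>\<theta> z. - sin \<theta> * (fst z k * (\<phi> (fst z) * df k (rot \<theta> z))) + cos \<theta> * (snd z k * (\<phi> (fst z) * df k (rot \<theta> z)))"],
          intro good_add good_mult good_fst good_rot good_cos gs good_coord k p\<phi> pf)
    qed
    also have "\<dots> = (\<Sum>k\<in>J. - sin \<theta> * (\<integral>z. d\<phi> k (fst z) * df k (rot \<theta> z) \<partial>PP))"
      by (intro sum.cong refl step)
    finally show ?thesis .
  qed
  then show ?thesis using der by (simp only: sum_distrib_left[symmetric])
qed

lemma rot_0: "rot 0 z = fst z" and rot_pi2: "rot (pi / 2) z = snd z"
  by (simp_all add: rot_def fun_eq_iff)

text \<open>For a constant \<open>\<phi>\<close> the derivative in \<open>rot_derivative\<close> is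
  0, so the angle may be moved to 0.\<close>

lemma rot_invariant: assumes f: "polyfun J f" shows "(\<integral>z. f (rot \<theta> z) \<partial>PP) = (\<integral>w. f w \<partial>\<gamma>)"
proof -
  obtain df where df: "grad J f df" using grad_ex[OF f finite_J] by blast
  have one: "grad J (\<lambda>w. 1) (\<lambda>k w. 0)" by (auto simp: grad_def intro: polyfun_intros)
  have "((\<lambda>\<theta>. \<integral>z. f (rot \<theta> z) \<partial>PP) has_real_derivative 0) (at \<theta>)" for \<theta>
    using rot_derivative[OF one df, of \<theta>] by simp
  then have "(\<integral>z. f (rot \<theta> z) \<partial>PP) = (\<integral>z. f (rot 0 z) \<partial>PP)"
    using DERIV_isconst_all[of "\<lambda>\<theta>. \<integral>z. f (rot \<theta> z) \<partial>PP"] by blast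
  then show ?thesis by (simp add: rot_0 PP_fst[OF f])
qed

end

section \<open>Multilinear forms in matrices\<close>

context dimn
begin

lemma mv_mm: "mv (mm A B) y = mv A (mv B y)"
proof
  fix a
  have "mv (mm A B) y a = (\<Sum>b<d. \<Sum>c<d. A a c * B c b * y b)"
    by (simp add: mv_def mm_def sum_distrib_right)
  also have "\<dots> = (\<Sum>c<d. \<Sum>b<d. A a c * B c b * y b)" by (rule sum.swap)
  also have "\<dots> = mv A (mv B y) a" unfolding mv_def sum_distrib_left mult.assoc ..
  finally show "mv (mm A B) y a = mv A (mv B y) a" .
qed

lemma mm_assoc: "mm (mm A B) C = mm A (mm B C)"
proof (intro ext)
  fix a b
  have "mm (mm A B) C a b = (\<Sum>e<d. \<Sum>c<d. A a c * B c e * C e b)" by (simp add: mm_def sum_distrib_right)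
  also have "\<dots> = (\<Sum>c<d. \<Sum>e<d. A a c * B c e * C e b)" by (rule sum.swap)
  also have "\<dots> = mm A (mm B C) a b" by (simp add: mm_def sum_distrib_left mult.assoc)
  finally show "mm (mm A B) C a b = mm A (mm B C) a b" .
qed

lemma bil_mm: "bil x (mm A B) y = bil x A (mv B y)"
  by (simp add: bil_def mv_mm)

definition mtr :: "(nat \<Rightarrow> nat \<Rightarrow> real) \<Rightarrow> nat \<Rightarrow> nat \<Rightarrow> real" where "mtr G = (\<lambda>a b. G b a)"

lemma bil_mtr: "bil x G y = ip (mv (mtr G) x) y"
proof -
  have "bil x G y = (\<Sum>b<d. \<Sum>a<d. x a * G a b * y b)" unfolding bil_sum2 by (rule sum.swap)
  also have "\<dots> = ip (mv (mtr G) x) y"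
    unfolding ip_def mv_def mtr_def sum_distrib_right by (simp add: mult_ac)
  finally show ?thesis .
qed

lemma contr_bil: "contr G \<Longrightarrow> \<bar>bil x G y\<bar> \<le> nrm x * nrm y" by (simp add: contr_def)

lemma nrm_le_of_ip: assumes "\<And>z. \<bar>ip z w\<bar> \<le> nrm z * c" "0 \<le> c" shows "nrm w \<le> c"
proof (cases "nrm w = 0")
  case False
  have "nrm w * nrm w \<le> nrm w * c" using assms(1)[of w] by (simp add: nrm_sq[symmetric] power2_eq_square)
  then show ?thesis using False by (simp add: less_le)
qed (use assms in simp)

lemma contr_mv: assumes "contr G" shows "nrm (mv G x) \<le> nrm x"
proof (rule nrm_le_of_ip)
  show "\<bar>ip z (mv G x)\<bar> \<le> nrm z * nrm x" for z using contr_bil[OF assms, of z x] by (simp only: bil_def)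
qed simp

lemma contr_mtr: assumes "contr G" shows "nrm (mv (mtr G) x) \<le> nrm x"
proof (rule nrm_le_of_ip)
  show "\<bar>ip z (mv (mtr G) x)\<bar> \<le> nrm z * nrm x" for z
    using contr_bil[OF assms, of x z] by (simp only: bil_mtr ip_commute[of z] mult.commute)
qed simp

lemma contr_mm: assumes "contr A" "contr B" shows "contr (mm A B)"
  unfolding contr_def bil_mm
proof (intro allI)
  fix x y
  have "\<bar>bil x A (mv B y)\<bar> \<le> nrm x * nrm (mv B y)" by (rule contr_bil[OF assms(1)])
  also have "\<dots> \<le> nrm x * nrm y" by (intro mult_left_mono contr_mv assms(2)) simp
  finally show "\<bar>bil x A (mv B y)\<bar> \<le> nrm x * nrm y" .
qed

lemma mm_dyad_left: "mm (dyad x y) B = dyad x (mv (mtr B) y)"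
  by (simp add: mm_def dyad_def mv_def mtr_def sum_distrib_left mult_ac fun_eq_iff)

lemma mm_dyad_right: "mm A (dyad x y) = dyad (mv A x) y"
  by (simp add: mm_def dyad_def mv_def sum_distrib_left mult_ac fun_eq_iff)

lemma lin_mm: assumes "lin L" shows "lin (\<lambda>A. L (mm A B))" "lin (\<lambda>A. L (mm B A))"
proof -
  have a: "\<And>A B. L (\<lambda>a b. A a b + B a b) = L A + L B" and s: "\<And>c A. L (\<lambda>a b. c * A a b) = c * L A"
    and c: "\<And>A B. (\<And>a b. a < d \<Longrightarrow> b < d \<Longrightarrow> A a b = B a b) \<Longrightarrow> L A = L B"
    using assms unfolding lin_def by auto
  have 1: "mm (\<lambda>a b. A a b + A' a b) B = (\<lambda>a b. mm A B a b + mm A' B a b)"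
    "mm B (\<lambda>a b. A a b + A' a b) = (\<lambda>a b. mm B A a b + mm B A' a b)"
    "mm (\<lambda>a b. c * A a b) B = (\<lambda>a b. c * mm A B a b)"
    "mm B (\<lambda>a b. c * A a b) = (\<lambda>a b. c * mm B A a b)" for A A' B c
    by (simp_all add: mm_def algebra_simps sum.distrib sum_distrib_left)
  show "lin (\<lambda>A. L (mm A B))" unfolding lin_def 1 a s by (auto simp: mm_def intro!: c)
  show "lin (\<lambda>A. L (mm B A))" unfolding lin_def 1 a s by (auto simp: mm_def intro!: c)
qed

text \<open>Forms read their arguments off a sequence of matrices and ignore all entries from \<open>m\<close> on.\<close>

definition mlf :: "nat \<Rightarrow> ((nat \<Rightarrow> nat \<Rightarrow> nat \<Rightarrow> real) \<Rightarrow> real) \<Rightarrow> real \<Rightarrow> bool" where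
  "mlf m \<Phi> K \<longleftrightarrow> 0 \<le> K \<and> (\<forall>s<m. \<forall>G. lin (\<lambda>A. \<Phi> (G(s := A)))) \<and> (\<forall>s\<ge>m. \<forall>G A. \<Phi> (G(s := A)) = \<Phi> G) \<and>
     (\<forall>s<m. \<forall>G x y. (\<forall>t<m. t \<noteq> s \<longrightarrow> contr (G t)) \<longrightarrow> nrm x \<le> 1 \<longrightarrow> nrm y \<le> 1 \<longrightarrow> \<bar>\<Phi> (G(s := dyad x y))\<bar> \<le> K)"

lemma mlf_layer_cake:
  assumes "mlf m \<Phi> K" "0 < m" "\<And>s. s < m \<Longrightarrow> spec (B s) (e s) (l s)"
  shows "\<bar>\<Phi> B\<bar> \<le> K * (\<Sum>r<d. \<Prod>s<m. \<bar>l s r\<bar>)"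
  by (rule layer_cake[where e = e]) (use assms in \<open>unfold mlf_def, blast+\<close>)

text \<open>A dyad times a contraction is again a dyad of vectors of norm at most 1, and products of
  contractions are contractions, so the constant survives when a slot is split into two factors.
  This gives the test matrix, which the expansions contain only multiplied by a power of
  \<open>X\<close>, a slot and hence a spectral truncation of its own.\<close>

lemma mlf_comp:
  assumes \<Phi>: "mlf m \<Phi> K" and p: "p < m"
  shows "mlf (Suc m) (\<lambda>G. \<Phi> (G(p := mm (G p) (G m)))) K" "mlf (Suc m) (\<lambda>G. \<Phi> (G(p := mm (G m) (G p)))) K"
proof -
  have K: "0 \<le> K" and L: "\<And>s G. s < m \<Longrightarrow> lin (\<lambda>A. \<Phi> (G(s := A)))" and ind: "\<And>s G A. s \<ge> m \<Longrightarrow> \<Phi> (G(s := A)) = \<Phi> G"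
    and dy: "\<And>s G x y. s < m \<Longrightarrow> (\<And>t. t < m \<Longrightarrow> t \<noteq> s \<Longrightarrow> contr (G t)) \<Longrightarrow> nrm x \<le> 1 \<Longrightarrow> nrm y \<le> 1 \<Longrightarrow> \<bar>\<Phi> (G(s := dyad x y))\<bar> \<le> K"
    using \<Phi> unfolding mlf_def by blast+
  have e1: "(G(s := A))(p := mm ((G(s := A)) p) ((G(s := A)) m)) = (G(p := mm (G p) (G m)))(s := A)"
    "(G(s := A))(p := mm ((G(s := A)) m) ((G(s := A)) p)) = (G(p := mm (G m) (G p)))(s := A)" if "s \<noteq> p" "s \<noteq> m" for s G A
    using that by (auto simp: fun_upd_twist)
  have e2: "(G(p := A))(p := mm ((G(p := A)) p) ((G(p := A)) m)) = G(p := mm A (G m))"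
    "(G(p := A))(p := mm ((G(p := A)) m) ((G(p := A)) p)) = G(p := mm (G m) A)" for G A
    using p by auto
  have e3: "\<Phi> ((G(m := A))(p := mm ((G(m := A)) p) ((G(m := A)) m))) = \<Phi> (G(p := mm (G p) A))"
    "\<Phi> ((G(m := A))(p := mm ((G(m := A)) m) ((G(m := A)) p))) = \<Phi> (G(p := mm A (G p)))" for G A
    using p ind[of m "G(p := mm (G p) A)" A] ind[of m "G(p := mm A (G p))" A] by (simp_all add: fun_upd_twist)
  have cm: "\<bar>\<Phi> ((G(p := mm (G p) (G m)))(s := dyad x y))\<bar> \<le> K" "\<bar>\<Phi> ((G(p := mm (G m) (G p)))(s := dyad x y))\<bar> \<le> K"
    if "s < m" "s \<noteq> p" "\<And>t. t < Suc m \<Longrightarrow> t \<noteq> s \<Longrightarrow> contr (G t)" "nrm x \<le> 1" "nrm y \<le> 1" for s G x y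
    using that p by (auto intro!: dy contr_mm)
  have cp: "\<bar>\<Phi> (G(p := mm (dyad x y) (G m)))\<bar> \<le> K" "\<bar>\<Phi> (G(p := mm (G m) (dyad x y)))\<bar> \<le> K"
    if "\<And>t. t < Suc m \<Longrightarrow> t \<noteq> p \<Longrightarrow> contr (G t)" "nrm x \<le> 1" "nrm y \<le> 1" for G x y
    unfolding mm_dyad_left mm_dyad_right
    using that p contr_mv[of "G m" x] contr_mtr[of "G m" y] by (auto intro!: dy)
  have cM: "\<bar>\<Phi> (G(p := mm (G p) (dyad x y)))\<bar> \<le> K" "\<bar>\<Phi> (G(p := mm (dyad x y) (G p)))\<bar> \<le> K"
    if "\<And>t. t < Suc m \<Longrightarrow> t \<noteq> m \<Longrightarrow> contr (G t)" "nrm x \<le> 1" "nrm y \<le> 1" for G x y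
    unfolding mm_dyad_left mm_dyad_right
    using that p contr_mv[of "G p" x] contr_mtr[of "G p" y] by (auto intro!: dy)
  have i1: "\<Phi> ((G(s := A))(p := mm ((G(s := A)) p) ((G(s := A)) m))) = \<Phi> (G(p := mm (G p) (G m)))"
    "\<Phi> ((G(s := A))(p := mm ((G(s := A)) m) ((G(s := A)) p))) = \<Phi> (G(p := mm (G m) (G p)))" if "Suc m \<le> s" for s G A
    using that p ind[of s] e1[of s G A] by auto
  show "mlf (Suc m) (\<lambda>G. \<Phi> (G(p := mm (G p) (G m)))) K"
    unfolding mlf_def
  proof (intro conjI K allI impI)
    fix s G assume "s < Suc m"
    then consider "s = p" | "s = m" | "s < m" "s \<noteq> p" "s \<noteq> m" by linarith
    then show "lin (\<lambda>A. \<Phi> ((G(s := A))(p := mm ((G(s := A)) p) ((G(s := A)) m))))"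
    proof cases
      case 1 show ?thesis unfolding 1 e2 by (rule lin_mm(1)[OF L[OF p]])
    next
      case 2 show ?thesis unfolding 2 e3 by (rule lin_mm(2)[OF L[OF p]])
    next
      case 3 show ?thesis unfolding e1[OF 3(2,3)] by (rule L[OF 3(1)])
    qed
  next
    fix s G x y assume "s < Suc m" and c: "\<forall>t<Suc m. t \<noteq> s \<longrightarrow> contr (G t)" "nrm x \<le> 1" "nrm y \<le> 1"
    then consider "s = p" | "s = m" | "s < m" "s \<noteq> p" "s \<noteq> m" by linarith
    then show "\<bar>\<Phi> ((G(s := dyad x y))(p := mm ((G(s := dyad x y)) p) ((G(s := dyad x y)) m)))\<bar> \<le> K"
    proof cases
      case 1 show ?thesis unfolding 1 e2 by (rule cp(1)) (use c 1 in auto)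
    next
      case 2 show ?thesis unfolding 2 e3 by (rule cM(1)) (use c 2 in auto)
    next
      case 3 show ?thesis unfolding e1[OF 3(2,3)] by (rule cm(1)) (use c 3 in auto)
    qed
  qed (rule i1)
  show "mlf (Suc m) (\<lambda>G. \<Phi> (G(p := mm (G m) (G p)))) K"
    unfolding mlf_def
  proof (intro conjI K allI impI)
    fix s G assume "s < Suc m"
    then consider "s = p" | "s = m" | "s < m" "s \<noteq> p" "s \<noteq> m" by linarith
    then show "lin (\<lambda>A. \<Phi> ((G(s := A))(p := mm ((G(s := A)) m) ((G(s := A)) p))))"
    proof cases
      case 1 show ?thesis unfolding 1 e2 by (rule lin_mm(2)[OF L[OF p]])
    next
      case 2 show ?thesis unfolding 2 e3 by (rule lin_mm(1)[OF L[OF p]])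
    next
      case 3 show ?thesis unfolding e1[OF 3(2,3)] by (rule L[OF 3(1)])
    qed
  next
    fix s G x y assume "s < Suc m" and c: "\<forall>t<Suc m. t \<noteq> s \<longrightarrow> contr (G t)" "nrm x \<le> 1" "nrm y \<le> 1"
    then consider "s = p" | "s = m" | "s < m" "s \<noteq> p" "s \<noteq> m" by linarith
    then show "\<bar>\<Phi> ((G(s := dyad x y))(p := mm ((G(s := dyad x y)) m) ((G(s := dyad x y)) p)))\<bar> \<le> K"
    proof cases
      case 1 show ?thesis unfolding 1 e2 by (rule cp(2)) (use c 1 in auto)
    next
      case 2 show ?thesis unfolding 2 e3 by (rule cM(2)) (use c 2 in auto)
    next
      case 3 show ?thesis unfolding e1[OF 3(2,3)] by (rule cm(2)) (use c 3 in auto)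
    qed
  qed (rule i1)
qed

end

text \<open>The i-th covariance is given by a factorisation into vectors \<open>u i b\<close>, and
  the i-th Gaussian vector will be their combination with independent standard coefficients. Below,
  \<open>S i\<close> is that covariance as an operator, \<open>\<tau> i\<close> its trace, and
  \<open>trS i G\<close> the trace of its product with \<open>G\<close>.\<close>

locale gmodel = dimn d for d +
  fixes I :: "nat set" and u :: "nat \<Rightarrow> nat \<Rightarrow> nat \<Rightarrow> real"
  assumes finite_I: "finite I"
begin

definition S :: "nat \<Rightarrow> (nat \<Rightarrow> real) \<Rightarrow> nat \<Rightarrow> real" where
  "S i x = (\<lambda>a. \<Sum>b<d. ip (u i b) x * u i b a)"

definition \<tau> :: "nat \<Rightarrow> real" where "\<tau> i = (\<Sum>b<d. ip (u i b) (u i b))"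

definition trS :: "nat \<Rightarrow> (nat \<Rightarrow> nat \<Rightarrow> real) \<Rightarrow> real" where
  "trS i G = (\<Sum>b<d. bil (u i b) G (u i b))"

lemma ip_S: "ip x (S i y) = (\<Sum>b<d. ip x (u i b) * ip (u i b) y)"
  unfolding S_def ip_sum ip_lin by (simp only: mult.commute)

lemma ip_S_left: "ip (S i x) y = (\<Sum>b<d. ip x (u i b) * ip (u i b) y)"
  unfolding S_def ip_sum ip_lin by (simp only: ip_commute)

lemma bil_S: "bil (S i x) G y = (\<Sum>b<d. ip x (u i b) * bil (u i b) G y)" "bil x G (S i y) = (\<Sum>b<d. bil x G (u i b) * ip (u i b) y)"
  unfolding S_def bil_lin by (simp_all only: ip_commute mult.commute)

lemma \<tau>_nonneg: "0 \<le> \<tau> i" by (auto simp: \<tau>_def intro: sum_nonneg)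

lemma ip_S_nonneg: "0 \<le> ip x (S i x)"
  unfolding ip_S ip_commute[of x "u i _"] by (intro sum_nonneg) simp

lemma ip_S_le: "ip x (S i x) \<le> \<tau> i * ip x x"
proof -
  have "ip x (u i b) * ip (u i b) x \<le> ip (u i b) (u i b) * ip x x" for b
  proof -
    have "\<bar>ip x (u i b)\<bar>\<^sup>2 \<le> (nrm x * nrm (u i b))\<^sup>2" by (intro power_mono abs_ip_le) simp
    then have "(ip x (u i b))\<^sup>2 \<le> ip x x * ip (u i b) (u i b)" by (simp add: power_mult_distrib nrm_sq)
    then show ?thesis by (simp only: ip_commute[of "u i b" x] power2_eq_square mult.commute)
  qed
  then show ?thesis unfolding ip_S \<tau>_def sum_distrib_right by (intro sum_mono)
qed

lemma abs_ip_S: "\<bar>ip x (S i y)\<bar> \<le> (ip x (S i x) + ip y (S i y)) / 2"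
proof -
  have "\<bar>ip x (u i b) * ip (u i b) y\<bar> \<le> (ip x (u i b) * ip (u i b) x + ip y (u i b) * ip (u i b) y) / 2" for b
  proof -
    have "0 \<le> (\<bar>ip x (u i b)\<bar> - \<bar>ip y (u i b)\<bar>)\<^sup>2" by simp
    then have "2 * (\<bar>ip x (u i b)\<bar> * \<bar>ip y (u i b)\<bar>) \<le> (ip x (u i b))\<^sup>2 + (ip y (u i b))\<^sup>2" by (simp add: power2_diff)
    then show ?thesis unfolding abs_mult ip_commute[of "u i b"] power2_eq_square by (simp add: field_simps)
  qed
  then have "\<bar>ip x (S i y)\<bar> \<le> (\<Sum>b<d. (ip x (u i b) * ip (u i b) x + ip y (u i b) * ip (u i b) y) / 2)"
    unfolding ip_S by (intro order_trans[OF sum_abs] sum_mono) auto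
  then show ?thesis unfolding ip_S sum.distrib[symmetric] sum_divide_distrib .
qed

text \<open>This is the matrix inequality
  \<open>\<Sigma>\<^sub>i\<^sup>2 \<le> \<tau> i \<Sigma>\<^sub>i\<close>. It follows by
  Cauchy-Schwarz between the coefficients \<open>ip (u i b) x\<close> and the lengths of the
  \<open>u i b\<close>.\<close>

lemma S_norm_le: "ip (S i x) (S i x) \<le> \<tau> i * ip x (S i x)"
proof -
  have 1: "ip (S i x) (S i x) = ip (S i x) (\<lambda>a. \<Sum>b<d. ip (u i b) x * u i b a)" by (simp add: S_def)
  also have "\<dots> = (\<Sum>b<d. ip (u i b) x * ip (S i x) (u i b))" by simp
  also have "\<dots> \<le> (\<Sum>b<d. \<bar>ip (u i b) x\<bar> * (nrm (S i x) * nrm (u i b)))"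
  proof (intro sum_mono)
    fix b
    have "ip (u i b) x * ip (S i x) (u i b) \<le> \<bar>ip (u i b) x\<bar> * \<bar>ip (S i x) (u i b)\<bar>"
      by (metis abs_ge_self abs_mult)
    also have "\<dots> \<le> \<bar>ip (u i b) x\<bar> * (nrm (S i x) * nrm (u i b))" by (intro mult_left_mono abs_ip_le) auto
    finally show "ip (u i b) x * ip (S i x) (u i b) \<le> \<dots>" .
  qed
  also have "\<dots> = nrm (S i x) * (\<Sum>b<d. \<bar>ip (u i b) x\<bar> * \<bar>nrm (u i b)\<bar>)" by (simp add: sum_distrib_left mult_ac)
  also have "\<dots> \<le> nrm (S i x) * (L2_set (\<lambda>b. ip (u i b) x) {..<d} * L2_set (\<lambda>b. nrm (u i b)) {..<d})"
    by (intro mult_left_mono L2_set_mult_ineq) auto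
  also have "L2_set (\<lambda>b. ip (u i b) x) {..<d} = sqrt (ip x (S i x))"
    unfolding L2_set_def ip_S ip_commute[of x "u i _"] power2_eq_square ..
  also have "L2_set (\<lambda>b. nrm (u i b)) {..<d} = sqrt (\<tau> i)"
    by (simp add: L2_set_def \<tau>_def nrm_sq)
  finally have *: "nrm (S i x) * nrm (S i x) \<le> nrm (S i x) * (sqrt (ip x (S i x)) * sqrt (\<tau> i))"
    by (simp add: nrm_sq[symmetric] power2_eq_square)
  then have "nrm (S i x) \<le> sqrt (ip x (S i x)) * sqrt (\<tau> i)"
    using ip_S_nonneg \<tau>_nonneg by (cases "nrm (S i x) = 0") (auto simp: less_le)
  then have "(nrm (S i x))\<^sup>2 \<le> (sqrt (ip x (S i x)) * sqrt (\<tau> i))\<^sup>2" by (intro power_mono) auto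
  then show ?thesis using ip_S_nonneg \<tau>_nonneg by (simp add: nrm_sq power_mult_distrib mult.commute)
qed

lemma nrm_S_le: "nrm (S i x) \<le> \<tau> i * nrm x"
proof -
  have "ip (S i x) (S i x) \<le> \<tau> i * (\<tau> i * ip x x)"
    using S_norm_le[of i x] ip_S_le[of x i] \<tau>_nonneg[of i] by (meson mult_left_mono order_trans)
  then have "(nrm (S i x))\<^sup>2 \<le> (\<tau> i * nrm x)\<^sup>2" unfolding power_mult_distrib nrm_sq by (simp add: power2_eq_square mult.assoc)
  then show ?thesis by (rule power2_le_imp_le) (intro mult_nonneg_nonneg \<tau>_nonneg nrm_nonneg)
qed

lemma abs_trS_le: assumes "contr G" shows "\<bar>trS i G\<bar> \<le> \<tau> i"
  unfolding trS_def \<tau>_def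
proof (intro order_trans[OF sum_abs] sum_mono)
  fix b show "\<bar>bil (u i b) G (u i b)\<bar> \<le> ip (u i b) (u i b)"
    using contr_bil[OF assms, of "u i b" "u i b"] by (simp only: nrm_sq[symmetric] power2_eq_square)
qed

lemma trS_dyad: "trS i (dyad x y) = ip x (S i y)"
  unfolding trS_def ip_S bil_dyad by (simp only: ip_commute)

lemma lin_trS: "lin (trS i)"
  unfolding trS_def[abs_def] by (intro lin_sumI lin_bil)

text \<open>AM-GM with a free weight \<open>c\<close> that is balanced much later. At
  \<open>t = 0\<close> the quotient is 0 by convention, consistent with
  \<open>b = 0\<close>.\<close>

lemma am_split: assumes "0 < c" "0 < t \<or> b = 0" "0 \<le> t"
  shows "a * b \<le> (c * (t * a\<^sup>2) + b\<^sup>2 / t / c) / (2::real)"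
proof (cases "b = 0")
  case False
  then have t: "0 < t" using assms by auto
  have "0 \<le> (c * t * a - b)\<^sup>2 / (t * c)" using assms t by simp
  also have "\<dots> = c * (t * a\<^sup>2) - 2 * a * b + b\<^sup>2 / t / c"
    using assms t by (simp add: power2_eq_square field_simps)
  finally show ?thesis by simp
qed (use assms in auto)

lemma \<tau>_zero: "\<tau> i = 0 \<Longrightarrow> nrm (S i x) = 0"
  using nrm_S_le[of i x] nrm_nonneg[of "S i x"] by simp

lemma S_scale: "S i (\<lambda>a. c * f a) = (\<lambda>a. c * S i f a)"
  by (simp add: S_def sum_distrib_left mult.assoc)

lemma ip_S_sym: "ip x (S i y) = ip (S i x) y"
  by (simp only: ip_S ip_S_left)

lemma bil_S_mv: "bil x G (S i (mv H z)) = bil (S i (mv (mtr G) x)) H z"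
  by (simp only: bil_mtr[of x G] ip_S_sym) (simp only: bil_def)

lemma bil_S_right: "bil x G (S i y) = ip (S i (mv (mtr G) x)) y"
  by (simp only: bil_mtr[of x G] ip_S_sym)

section \<open>The main form, the error forms and the conditions on their coefficients\<close>

definition formM :: "(nat \<Rightarrow> nat \<Rightarrow> nat \<Rightarrow> real) \<Rightarrow> real" where
  "formM G = (\<Sum>i\<in>I. trS i (G 0) * trS i (G 1))"

text \<open>\<open>formB\<close> is the error of the first integration by parts;
  \<open>formC1\<close>, \<open>formC2\<close> and \<open>formC3\<close> are those of the second;
  \<open>formD\<close> comes from decoupling the two traces of the main term. In
  \<open>formD\<close> the outer vectors and the matrices next to them belong to two different
  points of the rotation, hence the two families \<open>Y\<close> and \<open>Y'\<close>.\<close>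

definition formB :: "(nat \<Rightarrow> nat \<Rightarrow> real) \<Rightarrow> (nat \<Rightarrow> nat \<Rightarrow> nat \<Rightarrow> real) \<Rightarrow> real" where
  "formB Y G = (\<Sum>i\<in>I. bil (Y i) (G 0) (S i (mv (G 1) (Y i))))"

definition formC1 :: "(nat \<Rightarrow> nat \<Rightarrow> real) \<Rightarrow> (nat \<Rightarrow> nat \<Rightarrow> nat \<Rightarrow> real) \<Rightarrow> real" where
  "formC1 Y G = (\<Sum>i\<in>I. trS i (G 0) * bil (Y i) (G 1) (Y i) * trS i (G 2))"

definition formC2 :: "(nat \<Rightarrow> nat \<Rightarrow> real) \<Rightarrow> (nat \<Rightarrow> nat \<Rightarrow> nat \<Rightarrow> real) \<Rightarrow> real" where
  "formC2 Y G = (\<Sum>i\<in>I. bil (Y i) (G 0) (S i (mv (G 1) (Y i))) * trS i (G 2))"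

definition formC3 :: "(nat \<Rightarrow> nat \<Rightarrow> real) \<Rightarrow> (nat \<Rightarrow> nat \<Rightarrow> nat \<Rightarrow> real) \<Rightarrow> real" where
  "formC3 Y G = (\<Sum>i\<in>I. bil (Y i) (G 0) (S i (mv (G 1) (S i (mv (G 2) (Y i))))))"

definition formD :: "(nat \<Rightarrow> nat \<Rightarrow> real) \<Rightarrow> (nat \<Rightarrow> nat \<Rightarrow> real) \<Rightarrow> (nat \<Rightarrow> nat \<Rightarrow> nat \<Rightarrow> real) \<Rightarrow> real" where
  "formD Y Y' G = (\<Sum>l\<in>I. \<Sum>i\<in>I. bil (Y l) (G 0) (S i (mv (G 1) (S l (mv (G 2) (S i (mv (G 3) (Y' l))))))))"

text \<open>These six conditions bound, in this order, the operator norms of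
  \<open>\<Sum> \<tau> i Y\<^sub>i Y\<^sub>i\<^sup>T\<close>,
  \<open>\<Sum> \<tau> i |Y\<^sub>i|\<^sup>2 \<Sigma>\<^sub>i\<close>, \<open>\<Sum>
  |Y\<^sub>i|\<^sup>2 \<Sigma>\<^sub>i\<^sup>2 / \<tau> i\<close>,
  \<open>\<Sum> \<Sigma>\<^sub>i\<^sup>2\<close>, \<open>\<Sum> \<tau> i \<Sigma>\<^sub>i\<close>,
  and the traces themselves. The first three are random, the others deterministic.
  \<open>condv\<close> asks for a positive \<open>v\<close> because \<open>v\<close> enters as a
  weight of AM-GM.\<close>

definition cond1 :: "(nat \<Rightarrow> nat \<Rightarrow> real) \<Rightarrow> real \<Rightarrow> bool" where
  "cond1 Y q \<longleftrightarrow> 0 \<le> q \<and> (\<forall>x. (\<Sum>i\<in>I. \<tau> i * (ip (Y i) x)\<^sup>2) \<le> q * ip x x)"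
definition cond2 :: "(nat \<Rightarrow> nat \<Rightarrow> real) \<Rightarrow> real \<Rightarrow> bool" where
  "cond2 Y q \<longleftrightarrow> 0 \<le> q \<and> (\<forall>x. (\<Sum>i\<in>I. \<tau> i * ip (Y i) (Y i) * ip x (S i x)) \<le> q * ip x x)"
definition cond3 :: "(nat \<Rightarrow> nat \<Rightarrow> real) \<Rightarrow> real \<Rightarrow> bool" where
  "cond3 Y q \<longleftrightarrow> 0 \<le> q \<and> (\<forall>x. (\<Sum>i\<in>I. ip (Y i) (Y i) * ip (S i x) (S i x) / \<tau> i) \<le> q * ip x x)"
definition condv :: "real \<Rightarrow> bool" where
  "condv v \<longleftrightarrow> 0 < v \<and> (\<forall>x. (\<Sum>i\<in>I. ip (S i x) (S i x)) \<le> v * ip x x)"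
definition conds :: "real \<Rightarrow> bool" where
  "conds s \<longleftrightarrow> 0 \<le> s \<and> (\<forall>x. (\<Sum>i\<in>I. \<tau> i * ip x (S i x)) \<le> s * ip x x)"
definition condR :: "real \<Rightarrow> bool" where
  "condR R \<longleftrightarrow> (\<forall>i\<in>I. \<tau> i \<le> R)"

lemma cond_unit:
  "cond1 Y q \<Longrightarrow> nrm x \<le> 1 \<Longrightarrow> (\<Sum>i\<in>I. \<tau> i * (ip (Y i) x)\<^sup>2) \<le> q"
  "cond2 Y q \<Longrightarrow> nrm x \<le> 1 \<Longrightarrow> (\<Sum>i\<in>I. \<tau> i * ip (Y i) (Y i) * ip x (S i x)) \<le> q"
  "cond3 Y q \<Longrightarrow> nrm x \<le> 1 \<Longrightarrow> (\<Sum>i\<in>I. ip (Y i) (Y i) * ip (S i x) (S i x) / \<tau> i) \<le> q"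
  "condv v \<Longrightarrow> nrm x \<le> 1 \<Longrightarrow> (\<Sum>i\<in>I. ip (S i x) (S i x)) \<le> v"
  "conds s \<Longrightarrow> nrm x \<le> 1 \<Longrightarrow> (\<Sum>i\<in>I. \<tau> i * ip x (S i x)) \<le> s"
proof -
  have 1: "ip x x \<le> 1" if "nrm x \<le> 1" for x
    using that power_mono[OF that, of 2] by (simp add: nrm_sq)
  have 2: "a \<le> q" if "a \<le> q * ip x x" "0 \<le> q" "nrm x \<le> 1" for a q x
    using that 1[OF that(3)] mult_left_mono[of "ip x x" 1 q] by simp
  show "cond1 Y q \<Longrightarrow> nrm x \<le> 1 \<Longrightarrow> (\<Sum>i\<in>I. \<tau> i * (ip (Y i) x)\<^sup>2) \<le> q"
    "cond2 Y q \<Longrightarrow> nrm x \<le> 1 \<Longrightarrow> (\<Sum>i\<in>I. \<tau> i * ip (Y i) (Y i) * ip x (S i x)) \<le> q"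
    "cond3 Y q \<Longrightarrow> nrm x \<le> 1 \<Longrightarrow> (\<Sum>i\<in>I. ip (Y i) (Y i) * ip (S i x) (S i x) / \<tau> i) \<le> q"
    "condv v \<Longrightarrow> nrm x \<le> 1 \<Longrightarrow> (\<Sum>i\<in>I. ip (S i x) (S i x)) \<le> v"
    "conds s \<Longrightarrow> nrm x \<le> 1 \<Longrightarrow> (\<Sum>i\<in>I. \<tau> i * ip x (S i x)) \<le> s"
    unfolding cond1_def cond2_def cond3_def condv_def conds_def by (rule 2[where x = x]; simp)+
qed

section \<open>Bounds of the forms when one argument is a dyad\<close>

lemma weighted_split:
  assumes c: "0 < c" and b: "\<And>i. i \<in> I \<Longrightarrow> \<tau> i = 0 \<Longrightarrow> b i = 0"
  shows "(\<Sum>i\<in>I. \<bar>a i\<bar> * b i) \<le> (c * (\<Sum>i\<in>I. \<tau> i * (a i)\<^sup>2) + (\<Sum>i\<in>I. (b i)\<^sup>2 / \<tau> i) / c) / 2"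
proof -
  have "(\<Sum>i\<in>I. \<bar>a i\<bar> * b i) \<le> (\<Sum>i\<in>I. (c * (\<tau> i * \<bar>a i\<bar>\<^sup>2) + (b i)\<^sup>2 / \<tau> i / c) / 2)"
  proof (intro sum_mono am_split c \<tau>_nonneg)
    fix i assume "i \<in> I"
    then show "0 < \<tau> i \<or> b i = 0" using b \<tau>_nonneg[of i] by (auto simp: less_le)
  qed
  also have "\<dots> = (c * (\<Sum>i\<in>I. \<tau> i * (a i)\<^sup>2) + (\<Sum>i\<in>I. (b i)\<^sup>2 / \<tau> i) / c) / 2"
    by (simp only: sum_divide_distrib[symmetric] sum.distrib sum_distrib_left[symmetric] power2_abs)
  finally show ?thesis .
qed

text \<open>Each summand is a product of \<open>sqrt (\<tau> i) * \<bar>ip (Y i) x\<bar>\<close>,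
  square-summable by \<open>cond1\<close>, and
  \<open>nrm (S i y) * nrm (Y i) / sqrt (\<tau> i)\<close>, square-summable by \<open>cond3\<close>;
  \<open>c\<close> weighs the two.\<close>

lemma boundB:
  assumes "cond1 Y q1" "cond3 Y q3" "0 < c" "nrm x \<le> 1" "nrm y \<le> 1"
  shows "(\<Sum>i\<in>I. \<bar>ip (Y i) x\<bar> * (nrm (S i y) * nrm (Y i))) \<le> (c * q1 + q3 / c) / 2"
proof -
  have "(\<Sum>i\<in>I. \<bar>ip (Y i) x\<bar> * (nrm (S i y) * nrm (Y i)))
     \<le> (c * (\<Sum>i\<in>I. \<tau> i * (ip (Y i) x)\<^sup>2) + (\<Sum>i\<in>I. (nrm (S i y) * nrm (Y i))\<^sup>2 / \<tau> i) / c) / 2"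
    using assms by (intro weighted_split) (auto simp: \<tau>_zero)
  also have "(\<Sum>i\<in>I. (nrm (S i y) * nrm (Y i))\<^sup>2 / \<tau> i) = (\<Sum>i\<in>I. ip (Y i) (Y i) * ip (S i y) (S i y) / \<tau> i)"
    by (simp add: power_mult_distrib nrm_sq mult.commute)
  also have "(c * (\<Sum>i\<in>I. \<tau> i * (ip (Y i) x)\<^sup>2) + (\<Sum>i\<in>I. ip (Y i) (Y i) * ip (S i y) (S i y) / \<tau> i) / c) / 2 \<le> (c * q1 + q3 / c) / 2"
    using assms cond_unit(1)[OF assms(1,4)] cond_unit(3)[OF assms(2,5)]
    by (intro divide_right_mono add_mono mult_left_mono) auto
  finally show ?thesis .
qed

text \<open>A dyad in either slot cuts the form into a scalar product with \<open>Y i\<close> and a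
  rest in which the remaining contraction stands between \<open>Y i\<close> and \<open>S i\<close>
  of the other dyad vector. Both cases are instances of \<open>boundB\<close>.\<close>

lemma mlf_formB:
  assumes "cond1 Y q1" "cond3 Y q3" "0 < c"
  shows "mlf 2 (formB Y) ((c * q1 + q3 / c) / 2)"
  unfolding mlf_def
proof (intro conjI allI impI)
  show "0 \<le> (c * q1 + q3 / c) / 2" using assms by (auto simp: cond1_def cond3_def)
next
  fix s :: nat and G assume "s < 2"
  then consider "s = 0" | "s = 1" by linarith
  then show "lin (\<lambda>A. formB Y (G(s := A)))"
  proof cases
    case 1 then show ?thesis unfolding formB_def by (auto intro!: lin_sumI lin_bil)
  next
    case 2 then show ?thesis unfolding formB_def bil_S_mv by (auto intro!: lin_sumI lin_bil)
  qed
next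
  fix s :: nat and G A assume "2 \<le> s" then show "formB Y (G(s := A)) = formB Y G" by (simp add: formB_def)
next
  fix s :: nat and G x y assume s: "s < 2" and G: "\<forall>t<2. t \<noteq> s \<longrightarrow> contr (G t)" and xy: "nrm x \<le> 1" "nrm y \<le> 1"
  consider "s = 0" | "s = 1" using s by linarith
  then show "\<bar>formB Y (G(s := dyad x y))\<bar> \<le> (c * q1 + q3 / c) / 2"
  proof cases
    case 1
    have c1: "contr (G 1)" using G 1 by auto
    have "\<bar>formB Y (G(s := dyad x y))\<bar> \<le> (\<Sum>i\<in>I. \<bar>ip (Y i) x\<bar> * (nrm (S i y) * nrm (Y i)))"
      unfolding formB_def using 1
    proof (intro order_trans[OF sum_abs] sum_mono, simp add: abs_mult)
      fix i
      have "\<bar>ip y (S i (mv (G (Suc 0)) (Y i)))\<bar> \<le> nrm (S i y) * nrm (Y i)"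
        using contr_bil[OF c1, of "S i y" "Y i"] by (simp add: ip_S_sym bil_def)
      then show "\<bar>ip (Y i) x\<bar> * \<bar>ip y (S i (mv (G (Suc 0)) (Y i)))\<bar> \<le> \<bar>ip (Y i) x\<bar> * (nrm (S i y) * nrm (Y i))"
        by (intro mult_left_mono) auto
    qed
    also have "\<dots> \<le> (c * q1 + q3 / c) / 2" by (rule boundB[OF assms xy])
    finally show ?thesis .
  next
    case 2
    have c1: "contr (G 0)" using G 2 by auto
    have "\<bar>formB Y (G(s := dyad x y))\<bar> \<le> (\<Sum>i\<in>I. \<bar>ip (Y i) y\<bar> * (nrm (S i x) * nrm (Y i)))"
      unfolding formB_def using 2
    proof (intro order_trans[OF sum_abs] sum_mono, simp add: abs_mult mv_dyad S_scale)
      fix i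
      have "\<bar>bil (Y i) (G 0) (S i x)\<bar> \<le> nrm (S i x) * nrm (Y i)"
        using contr_bil[OF c1, of "Y i" "S i x"] by (simp add: mult.commute)
      then show "\<bar>ip y (Y i)\<bar> * \<bar>bil (Y i) (G 0) (S i x)\<bar> \<le> \<bar>ip (Y i) y\<bar> * (nrm (S i x) * nrm (Y i))"
        unfolding ip_commute[of y] by (intro mult_left_mono) auto
    qed
    also have "\<dots> \<le> (c * q1 + q3 / c) / 2" by (rule boundB[OF assms xy(2,1)])
    finally show ?thesis .
  qed
qed

text \<open>The constant must be exactly that of \<open>conds\<close>, since it becomes the
  coefficient of the Catalan recursion. Positivity of the covariances provides it: a dyad leaves
  \<open>ip x (S i y)\<close>, at most the mean of the two quadratic forms at \<open>x\<close> and
  \<open>y\<close>.\<close>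

lemma mlf_formM:
  assumes "conds s2"
  shows "mlf 2 formM s2"
  unfolding mlf_def
proof (intro conjI allI impI)
  show "0 \<le> s2" using assms by (auto simp: conds_def)
next
  fix s :: nat and G assume "s < 2"
  then consider "s = 0" | "s = 1" by linarith
  then show "lin (\<lambda>A. formM (G(s := A)))"
    by cases (auto simp: formM_def intro!: lin_sumI lin_cmult lin_trS)
next
  fix s :: nat and G A assume "2 \<le> s" then show "formM (G(s := A)) = formM G" by (simp add: formM_def)
next
  fix s :: nat and G x y assume s: "s < 2" and G: "\<forall>t<2. t \<noteq> s \<longrightarrow> contr (G t)" and xy: "nrm x \<le> 1" "nrm y \<le> 1"
  have *: "(\<Sum>i\<in>I. \<bar>ip x (S i y)\<bar> * \<tau> i) \<le> s2"
  proof -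
    have "(\<Sum>i\<in>I. \<bar>ip x (S i y)\<bar> * \<tau> i) \<le> (\<Sum>i\<in>I. (\<tau> i * ip x (S i x) + \<tau> i * ip y (S i y)) / 2)"
    proof (intro sum_mono)
      fix i show "\<bar>ip x (S i y)\<bar> * \<tau> i \<le> (\<tau> i * ip x (S i x) + \<tau> i * ip y (S i y)) / 2"
        using mult_right_mono[OF abs_ip_S[of x i y] \<tau>_nonneg[of i]] by (simp add: algebra_simps)
    qed
    also have "\<dots> \<le> s2"
      using cond_unit(5)[OF assms xy(1)] cond_unit(5)[OF assms xy(2)] by (simp add: sum_divide_distrib[symmetric] sum.distrib)
    finally show ?thesis .
  qed
  consider "s = 0" | "s = 1" using s by linarith
  then have "\<bar>formM (G(s := dyad x y))\<bar> \<le> (\<Sum>i\<in>I. \<bar>ip x (S i y)\<bar> * \<tau> i)"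
  proof cases
    case 1
    have "contr (G 1)" using G 1 by auto
    then show ?thesis unfolding formM_def using 1
      by (auto simp: abs_mult trS_dyad intro!: order_trans[OF sum_abs] sum_mono mult_left_mono abs_trS_le)
  next
    case 2
    have "contr (G 0)" using G 2 by auto
    then show ?thesis unfolding formM_def using 2
      by (auto simp: abs_mult trS_dyad mult.commute[of "\<bar>trS _ _\<bar>"] intro!: order_trans[OF sum_abs] sum_mono mult_left_mono abs_trS_le)
  qed
  with * show "\<bar>formM (G(s := dyad x y))\<bar> \<le> s2" by linarith
qed

lemma boundC1:
  assumes "cond2 Y q2" "nrm x \<le> 1" "nrm y \<le> 1"
  shows "(\<Sum>i\<in>I. \<bar>ip x (S i y)\<bar> * (ip (Y i) (Y i) * \<tau> i)) \<le> q2"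
proof -
  have "(\<Sum>i\<in>I. \<bar>ip x (S i y)\<bar> * (ip (Y i) (Y i) * \<tau> i)) \<le> (\<Sum>i\<in>I. (\<tau> i * ip (Y i) (Y i) * ip x (S i x) + \<tau> i * ip (Y i) (Y i) * ip y (S i y)) / 2)"
  proof (intro sum_mono)
    fix i
    have "0 \<le> ip (Y i) (Y i) * \<tau> i" by (simp add: \<tau>_nonneg)
    from mult_right_mono[OF abs_ip_S[of x i y] this]
    show "\<bar>ip x (S i y)\<bar> * (ip (Y i) (Y i) * \<tau> i) \<le> (\<tau> i * ip (Y i) (Y i) * ip x (S i x) + \<tau> i * ip (Y i) (Y i) * ip y (S i y)) / 2"
      by (simp add: algebra_simps)
  qed
  also have "\<dots> \<le> q2"
    using cond_unit(2)[OF assms(1,2)] cond_unit(2)[OF assms(1,3)] by (simp add: sum_divide_distrib[symmetric] sum.distrib)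
  finally show ?thesis .
qed

lemma boundC2:
  assumes "cond1 Y q1" "condR R" "nrm x \<le> 1" "nrm y \<le> 1" "0 \<le> R"
  shows "(\<Sum>i\<in>I. \<tau> i * \<bar>ip (Y i) x\<bar> * \<bar>ip y (Y i)\<bar> * \<tau> i) \<le> R * q1"
proof -
  have "(\<Sum>i\<in>I. \<tau> i * \<bar>ip (Y i) x\<bar> * \<bar>ip y (Y i)\<bar> * \<tau> i) \<le> (\<Sum>i\<in>I. R * ((\<tau> i * (ip (Y i) x)\<^sup>2 + \<tau> i * (ip (Y i) y)\<^sup>2) / 2))"
  proof (intro sum_mono)
    fix i assume i: "i \<in> I"
    have "0 \<le> (\<bar>ip (Y i) x\<bar> - \<bar>ip (Y i) y\<bar>)\<^sup>2" by simp
    then have "\<bar>ip (Y i) x\<bar> * \<bar>ip y (Y i)\<bar> \<le> ((ip (Y i) x)\<^sup>2 + (ip (Y i) y)\<^sup>2) / 2"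
      by (simp add: power2_diff ip_commute[of y])
    then have 1: "\<tau> i * (\<bar>ip (Y i) x\<bar> * \<bar>ip y (Y i)\<bar>) \<le> \<tau> i * (((ip (Y i) x)\<^sup>2 + (ip (Y i) y)\<^sup>2) / 2)"
      by (intro mult_left_mono \<tau>_nonneg)
    have 2: "\<tau> i \<le> R" using assms(2) i by (simp add: condR_def)
    have "0 \<le> \<tau> i * (((ip (Y i) x)\<^sup>2 + (ip (Y i) y)\<^sup>2) / 2)" by (simp add: \<tau>_nonneg)
    from mult_mono[OF 1 2 this \<tau>_nonneg]
    have "(\<tau> i * (\<bar>ip (Y i) x\<bar> * \<bar>ip y (Y i)\<bar>)) * \<tau> i \<le> (\<tau> i * (((ip (Y i) x)\<^sup>2 + (ip (Y i) y)\<^sup>2) / 2)) * R" .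
    then show "\<tau> i * \<bar>ip (Y i) x\<bar> * \<bar>ip y (Y i)\<bar> * \<tau> i \<le> R * ((\<tau> i * (ip (Y i) x)\<^sup>2 + \<tau> i * (ip (Y i) y)\<^sup>2) / 2)"
      by (simp add: algebra_simps)
  qed
  also have "\<dots> = R * (((\<Sum>i\<in>I. \<tau> i * (ip (Y i) x)\<^sup>2) + (\<Sum>i\<in>I. \<tau> i * (ip (Y i) y)\<^sup>2)) / 2)"
    unfolding sum_distrib_left[symmetric] sum_divide_distrib[symmetric] sum.distrib ..
  also have "\<dots> \<le> R * q1"
    using cond_unit(1)[OF assms(1,3)] cond_unit(1)[OF assms(1,4)] assms(5) by (intro mult_left_mono) auto
  finally show ?thesis .
qed

text \<open>Cruder than \<open>boundB\<close>, without a free weight: the extra factor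
  \<open>\<tau> i\<close> goes to \<open>ip (Y i) x\<close>, where one of the two resulting powers
  of \<open>\<tau> i\<close> is replaced by \<open>R\<close>, and \<open>S_norm_le\<close> turns the
  other square into a term of \<open>cond2\<close>.\<close>

lemma boundC3:
  assumes "cond1 Y q1" "cond2 Y q2" "condR R" "nrm x \<le> 1" "nrm y \<le> 1" "0 \<le> R"
  shows "(\<Sum>i\<in>I. \<bar>ip (Y i) x\<bar> * (nrm (S i y) * nrm (Y i)) * \<tau> i) \<le> q2 + R * q1"
proof -
  have "(\<Sum>i\<in>I. \<bar>ip (Y i) x\<bar> * (nrm (S i y) * nrm (Y i)) * \<tau> i)
     \<le> (\<Sum>i\<in>I. R * (\<tau> i * (ip (Y i) x)\<^sup>2) + \<tau> i * ip (Y i) (Y i) * ip y (S i y))"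
  proof (intro sum_mono)
    fix i assume i: "i \<in> I"
    let ?a = "\<bar>ip (Y i) x\<bar> * \<tau> i" and ?b = "nrm (S i y) * nrm (Y i)"
    have "0 \<le> (?a - ?b)\<^sup>2" "0 \<le> ?a\<^sup>2" "0 \<le> ?b\<^sup>2" by simp_all
    then have "?a * ?b \<le> ?a\<^sup>2 + ?b\<^sup>2" unfolding power2_diff by linarith
    moreover have "?a\<^sup>2 = \<tau> i * (\<tau> i * (ip (Y i) x)\<^sup>2)" by (simp add: power_mult_distrib power2_eq_square)
    moreover have "\<dots> \<le> R * (\<tau> i * (ip (Y i) x)\<^sup>2)"
      using assms(3) i by (intro mult_right_mono) (auto simp: condR_def \<tau>_nonneg)
    moreover have "?b\<^sup>2 \<le> \<tau> i * ip (Y i) (Y i) * ip y (S i y)"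
      using mult_right_mono[OF S_norm_le[of i y] ip_nonneg[of "Y i"]] by (simp add: power_mult_distrib nrm_sq mult_ac)
    ultimately show "\<bar>ip (Y i) x\<bar> * (nrm (S i y) * nrm (Y i)) * \<tau> i \<le> R * (\<tau> i * (ip (Y i) x)\<^sup>2) + \<tau> i * ip (Y i) (Y i) * ip y (S i y)"
      by (simp add: mult_ac)
  qed
  also have "\<dots> = R * (\<Sum>i\<in>I. \<tau> i * (ip (Y i) x)\<^sup>2) + (\<Sum>i\<in>I. \<tau> i * ip (Y i) (Y i) * ip y (S i y))"
    by (simp add: sum.distrib sum_distrib_left)
  also have "\<dots> \<le> R * q1 + q2"
    using cond_unit(1)[OF assms(1,4)] cond_unit(2)[OF assms(2,5)] assms(6) by (intro add_mono mult_left_mono) auto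
  finally show ?thesis by simp
qed

lemma mlf_formC1:
  assumes c: "cond1 Y q1" "cond2 Y q2" "condR R" "0 \<le> R"
  shows "mlf 3 (formC1 Y) (q2 + R * q1)"
  unfolding mlf_def
proof (intro conjI allI impI)
  show K: "0 \<le> q2 + R * q1" using assms by (auto simp: cond1_def cond2_def)
next
  fix s :: nat and G assume "s < 3"
  then consider "s = 0" | "s = 1" | "s = 2" by linarith
  then show "lin (\<lambda>A. formC1 Y (G(s := A)))"
    by cases (auto simp: formC1_def intro!: lin_sumI lin_cmult lin_trS lin_bil)
next
  fix s :: nat and G A assume "3 \<le> s" then show "formC1 Y (G(s := A)) = formC1 Y G" by (simp add: formC1_def)
next
  fix s :: nat and G x y assume s: "s < 3" and G: "\<forall>t<3. t \<noteq> s \<longrightarrow> contr (G t)" and xy: "nrm x \<le> 1" "nrm y \<le> 1"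
  have q: "0 \<le> q2" "0 \<le> R * q1" using assms by (auto simp: cond1_def cond2_def)
  have bY: "\<bar>bil (Y i) H (Y i)\<bar> \<le> ip (Y i) (Y i)" if "contr H" for H i
    using contr_bil[OF that, of "Y i" "Y i"] by (simp add: nrm_sq[symmetric] power2_eq_square)
  consider "s = 0" | "s = 1" | "s = 2" using s by linarith
  then show "\<bar>formC1 Y (G(s := dyad x y))\<bar> \<le> q2 + R * q1"
  proof cases
    case 1
    have g: "contr (G 1)" "contr (G 2)" using G 1 by auto
    have "\<bar>formC1 Y (G(s := dyad x y))\<bar> \<le> (\<Sum>i\<in>I. \<bar>ip x (S i y)\<bar> * (ip (Y i) (Y i) * \<tau> i))"
      unfolding formC1_def
    proof (intro order_trans[OF sum_abs] sum_mono)
      fix i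
      show "\<bar>trS i ((G(s := dyad x y)) 0) * bil (Y i) ((G(s := dyad x y)) 1) (Y i) * trS i ((G(s := dyad x y)) 2)\<bar> \<le> \<bar>ip x (S i y)\<bar> * (ip (Y i) (Y i) * \<tau> i)"
        using 1 mult_mono[OF bY[OF g(1), of i] abs_trS_le[OF g(2), of i]]
        by (simp add: trS_dyad abs_mult mult.assoc mult_left_mono)
    qed
    with boundC1[OF c(2) xy] q show ?thesis by linarith
  next
    case 2
    have g: "contr (G 0)" "contr (G 2)" using G 2 by auto
    have "\<bar>formC1 Y (G(s := dyad x y))\<bar> \<le> (\<Sum>i\<in>I. \<tau> i * \<bar>ip (Y i) x\<bar> * \<bar>ip y (Y i)\<bar> * \<tau> i)"
      unfolding formC1_def
    proof (intro order_trans[OF sum_abs] sum_mono)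
      fix i
      show "\<bar>trS i ((G(s := dyad x y)) 0) * bil (Y i) ((G(s := dyad x y)) 1) (Y i) * trS i ((G(s := dyad x y)) 2)\<bar> \<le> \<tau> i * \<bar>ip (Y i) x\<bar> * \<bar>ip y (Y i)\<bar> * \<tau> i"
        using 2 abs_trS_le[OF g(1), of i] abs_trS_le[OF g(2), of i] \<tau>_nonneg[of i]
        by (auto simp: abs_mult mult.assoc intro!: mult_mono)
    qed
    with boundC2[OF c(1,3) xy c(4)] q show ?thesis by linarith
  next
    case 3
    have g: "contr (G 0)" "contr (G 1)" using G 3 by auto
    have "\<bar>formC1 Y (G(s := dyad x y))\<bar> \<le> (\<Sum>i\<in>I. \<bar>ip x (S i y)\<bar> * (ip (Y i) (Y i) * \<tau> i))"
      unfolding formC1_def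
    proof (intro order_trans[OF sum_abs] sum_mono)
      fix i
      show "\<bar>trS i ((G(s := dyad x y)) 0) * bil (Y i) ((G(s := dyad x y)) 1) (Y i) * trS i ((G(s := dyad x y)) 2)\<bar> \<le> \<bar>ip x (S i y)\<bar> * (ip (Y i) (Y i) * \<tau> i)"
        using 3 mult_left_mono[OF mult_mono[OF bY[OF g(2), of i] abs_trS_le[OF g(1), of i] ip_nonneg abs_ge_zero] abs_ge_zero[of "ip x (S i y)"]]
        by (simp add: trS_dyad abs_mult mult_ac)
    qed
    with boundC1[OF c(2) xy] q show ?thesis by linarith
  qed
qed

lemma mlf_formC2:
  assumes c: "cond1 Y q1" "cond2 Y q2" "condR R" "0 \<le> R"
  shows "mlf 3 (formC2 Y) (q2 + R * q1)"
  unfolding mlf_def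
proof (intro conjI allI impI)
  show K: "0 \<le> q2 + R * q1" using assms by (auto simp: cond1_def cond2_def)
next
  fix s :: nat and G assume "s < 3"
  then consider "s = 0" | "s = 1" | "s = 2" by linarith
  then show "lin (\<lambda>A. formC2 Y (G(s := A)))"
  proof cases
    case 2 then show ?thesis unfolding formC2_def bil_S_mv by (auto intro!: lin_sumI lin_cmult lin_bil)
  qed (auto simp: formC2_def intro!: lin_sumI lin_cmult lin_trS lin_bil)
next
  fix s :: nat and G A assume "3 \<le> s" then show "formC2 Y (G(s := A)) = formC2 Y G" by (simp add: formC2_def)
next
  fix s :: nat and G x y assume s: "s < 3" and G: "\<forall>t<3. t \<noteq> s \<longrightarrow> contr (G t)" and xy: "nrm x \<le> 1" "nrm y \<le> 1"
  have q: "0 \<le> q2" "0 \<le> R * q1" using assms by (auto simp: cond1_def cond2_def)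
  consider "s = 0" | "s = 1" | "s = 2" using s by linarith
  then show "\<bar>formC2 Y (G(s := dyad x y))\<bar> \<le> q2 + R * q1"
  proof cases
    case 1
    have g: "contr (G 1)" "contr (G 2)" using G 1 by auto
    have "\<bar>formC2 Y (G(s := dyad x y))\<bar> \<le> (\<Sum>i\<in>I. \<bar>ip (Y i) x\<bar> * (nrm (S i y) * nrm (Y i)) * \<tau> i)"
      unfolding formC2_def
    proof (intro order_trans[OF sum_abs] sum_mono)
      fix i
      have "\<bar>ip y (S i (mv (G 1) (Y i)))\<bar> \<le> nrm (S i y) * nrm (Y i)"
        using contr_bil[OF g(1), of "S i y" "Y i"] by (simp add: ip_S_sym bil_def)
      then show "\<bar>bil (Y i) ((G(s := dyad x y)) 0) (S i (mv ((G(s := dyad x y)) 1) (Y i))) * trS i ((G(s := dyad x y)) 2)\<bar>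
          \<le> \<bar>ip (Y i) x\<bar> * (nrm (S i y) * nrm (Y i)) * \<tau> i"
        using 1 abs_trS_le[OF g(2), of i] by (auto simp: abs_mult intro!: mult_mono)
    qed
    with boundC3[OF c(1-3) xy c(4)] show ?thesis by linarith
  next
    case 2
    have g: "contr (G 0)" "contr (G 2)" using G 2 by auto
    have "\<bar>formC2 Y (G(s := dyad x y))\<bar> \<le> (\<Sum>i\<in>I. \<bar>ip (Y i) y\<bar> * (nrm (S i x) * nrm (Y i)) * \<tau> i)"
      unfolding formC2_def
    proof (intro order_trans[OF sum_abs] sum_mono)
      fix i
      have "\<bar>bil (Y i) (G 0) (S i x)\<bar> \<le> nrm (S i x) * nrm (Y i)"
        using contr_bil[OF g(1), of "Y i" "S i x"] by (simp add: mult.commute)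
      then show "\<bar>bil (Y i) ((G(s := dyad x y)) 0) (S i (mv ((G(s := dyad x y)) 1) (Y i))) * trS i ((G(s := dyad x y)) 2)\<bar>
          \<le> \<bar>ip (Y i) y\<bar> * (nrm (S i x) * nrm (Y i)) * \<tau> i"
        using 2 abs_trS_le[OF g(2), of i] by (auto simp: abs_mult mv_dyad S_scale ip_commute[of y] intro!: mult_mono)
    qed
    with boundC3[OF c(1-3) xy(2,1) c(4)] show ?thesis by linarith
  next
    case 3
    have g: "contr (G 0)" "contr (G 1)" using G 3 by auto
    have "\<bar>formC2 Y (G(s := dyad x y))\<bar> \<le> (\<Sum>i\<in>I. \<bar>ip x (S i y)\<bar> * (ip (Y i) (Y i) * \<tau> i))"
      unfolding formC2_def
    proof (intro order_trans[OF sum_abs] sum_mono)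
      fix i
      have "\<bar>bil (Y i) (G 0) (S i (mv (G 1) (Y i)))\<bar> \<le> nrm (Y i) * nrm (S i (mv (G 1) (Y i)))" by (rule contr_bil[OF g(1)])
      also have "\<dots> \<le> nrm (Y i) * (\<tau> i * nrm (Y i))"
        by (intro mult_left_mono order_trans[OF nrm_S_le] contr_mv g \<tau>_nonneg) auto
      also have "\<dots> = ip (Y i) (Y i) * \<tau> i" by (simp add: nrm_sq[symmetric] power2_eq_square)
      finally show "\<bar>bil (Y i) ((G(s := dyad x y)) 0) (S i (mv ((G(s := dyad x y)) 1) (Y i))) * trS i ((G(s := dyad x y)) 2)\<bar>
          \<le> \<bar>ip x (S i y)\<bar> * (ip (Y i) (Y i) * \<tau> i)"
        using 3 by (simp add: abs_mult trS_dyad mult.commute mult_left_mono)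
    qed
    with boundC1[OF c(2) xy] q show ?thesis by linarith
  qed
qed

lemma mlf_formC3:
  assumes c: "cond1 Y q1" "cond2 Y q2" "condR R" "0 \<le> R"
  shows "mlf 3 (formC3 Y) (q2 + R * q1)"
  unfolding mlf_def
proof (intro conjI allI impI)
  show K: "0 \<le> q2 + R * q1" using assms by (auto simp: cond1_def cond2_def)
next
  fix s :: nat and G assume "s < 3"
  then consider "s = 0" | "s = 1" | "s = 2" by linarith
  then show "lin (\<lambda>A. formC3 Y (G(s := A)))"
  proof cases
    case 1 then show ?thesis unfolding formC3_def by (auto intro!: lin_sumI lin_bil)
  next
    case 2 then show ?thesis unfolding formC3_def
      by (simp add: bil_S_mv[of "Y _" "G 0" _ _ "S _ _"]) (auto intro!: lin_sumI lin_bil)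
  next
    case 3 then show ?thesis unfolding formC3_def bil_S_mv by (auto intro!: lin_sumI lin_bil)
  qed
next
  fix s :: nat and G A assume "3 \<le> s" then show "formC3 Y (G(s := A)) = formC3 Y G" by (simp add: formC3_def)
next
  fix s :: nat and G x y assume s: "s < 3" and G: "\<forall>t<3. t \<noteq> s \<longrightarrow> contr (G t)" and xy: "nrm x \<le> 1" "nrm y \<le> 1"
  have q: "0 \<le> q2" "0 \<le> R * q1" using assms by (auto simp: cond1_def cond2_def)
  consider "s = 0" | "s = 1" | "s = 2" using s by linarith
  then show "\<bar>formC3 Y (G(s := dyad x y))\<bar> \<le> q2 + R * q1"
  proof cases
    case 1
    have g: "contr (G 1)" "contr (G 2)" using G 1 by auto
    have "\<bar>formC3 Y (G(s := dyad x y))\<bar> \<le> (\<Sum>i\<in>I. \<bar>ip (Y i) x\<bar> * (nrm (S i y) * nrm (Y i)) * \<tau> i)"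
      unfolding formC3_def
    proof (intro order_trans[OF sum_abs] sum_mono)
      fix i
      have "\<bar>bil (S i y) (G 1) (S i (mv (G 2) (Y i)))\<bar> \<le> nrm (S i y) * nrm (S i (mv (G 2) (Y i)))" by (rule contr_bil[OF g(1)])
      also have "\<dots> \<le> nrm (S i y) * (\<tau> i * nrm (Y i))"
        by (intro mult_left_mono order_trans[OF nrm_S_le] contr_mv g \<tau>_nonneg) auto
      finally have *: "\<bar>ip y (S i (mv (G 1) (S i (mv (G 2) (Y i)))))\<bar> \<le> nrm (S i y) * (\<tau> i * nrm (Y i))"
        by (simp only: ip_S_sym[of y] bil_def)
      show "\<bar>bil (Y i) ((G(s := dyad x y)) 0) (S i (mv ((G(s := dyad x y)) 1) (S i (mv ((G(s := dyad x y)) 2) (Y i)))))\<bar>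
          \<le> \<bar>ip (Y i) x\<bar> * (nrm (S i y) * nrm (Y i)) * \<tau> i"
        using 1 mult_left_mono[OF * abs_ge_zero[of "ip (Y i) x"]] by (simp add: abs_mult mult_ac)
    qed
    with boundC3[OF c(1-3) xy c(4)] show ?thesis by linarith
  next
    case 2
    have g: "contr (G 0)" "contr (G 2)" using G 2 by auto
    have "\<bar>formC3 Y (G(s := dyad x y))\<bar> \<le> (\<Sum>i\<in>I. (\<tau> i * ip (Y i) (Y i) * ip x (S i x) + \<tau> i * ip (Y i) (Y i) * ip y (S i y)) / 2)"
      unfolding formC3_def
    proof (intro order_trans[OF sum_abs] sum_mono)
      fix i
      have 1: "\<bar>bil (Y i) (G 0) (S i x)\<bar> \<le> nrm (Y i) * nrm (S i x)" by (rule contr_bil[OF g(1)])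
      have b2: "\<bar>ip y (S i (mv (G 2) (Y i)))\<bar> \<le> nrm (S i y) * nrm (Y i)"
        using contr_bil[OF g(2), of "S i y" "Y i"] by (simp add: ip_S_sym bil_def)
      have "\<bar>ip y (S i (mv (G 2) (Y i)))\<bar> * \<bar>bil (Y i) (G 0) (S i x)\<bar> \<le> (nrm (S i y) * nrm (Y i)) * (nrm (Y i) * nrm (S i x))"
        by (intro mult_mono 1 b2) auto
      also have "\<dots> = ip (Y i) (Y i) * (nrm (S i x) * nrm (S i y))" by (simp add: nrm_sq[symmetric] power2_eq_square)
      also have "\<dots> \<le> ip (Y i) (Y i) * (((nrm (S i x))\<^sup>2 + (nrm (S i y))\<^sup>2) / 2)"
        using zero_le_power2[of "nrm (S i x) - nrm (S i y)"] by (intro mult_left_mono) (auto simp: power2_diff)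
      also have "\<dots> \<le> ip (Y i) (Y i) * ((\<tau> i * ip x (S i x) + \<tau> i * ip y (S i y)) / 2)"
        using S_norm_le[of i x] S_norm_le[of i y] by (intro mult_left_mono divide_right_mono add_mono) (auto simp: nrm_sq)
      also have "\<dots> = (\<tau> i * ip (Y i) (Y i) * ip x (S i x) + \<tau> i * ip (Y i) (Y i) * ip y (S i y)) / 2"
        by (simp add: algebra_simps)
      finally show "\<bar>bil (Y i) ((G(s := dyad x y)) 0) (S i (mv ((G(s := dyad x y)) 1) (S i (mv ((G(s := dyad x y)) 2) (Y i)))))\<bar>
          \<le> (\<tau> i * ip (Y i) (Y i) * ip x (S i x) + \<tau> i * ip (Y i) (Y i) * ip y (S i y)) / 2"
        using 2 by (simp add: abs_mult mv_dyad S_scale)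
    qed
    also have "\<dots> \<le> q2"
      using cond_unit(2)[OF c(2) xy(1)] cond_unit(2)[OF c(2) xy(2)] by (simp add: sum_divide_distrib[symmetric] sum.distrib)
    finally show ?thesis using q by linarith
  next
    case 3
    have g: "contr (G 0)" "contr (G 1)" using G 3 by auto
    have "\<bar>formC3 Y (G(s := dyad x y))\<bar> \<le> (\<Sum>i\<in>I. \<bar>ip (Y i) y\<bar> * (nrm (S i x) * nrm (Y i)) * \<tau> i)"
      unfolding formC3_def
    proof (intro order_trans[OF sum_abs] sum_mono)
      fix i
      have "\<bar>bil (Y i) (G 0) (S i (mv (G 1) (S i x)))\<bar> \<le> nrm (Y i) * nrm (S i (mv (G 1) (S i x)))" by (rule contr_bil[OF g(1)])
      also have "\<dots> \<le> nrm (Y i) * (\<tau> i * nrm (S i x))"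
        by (intro mult_left_mono order_trans[OF nrm_S_le] contr_mv g \<tau>_nonneg) auto
      finally have *: "\<bar>bil (Y i) (G 0) (S i (mv (G 1) (S i x)))\<bar> \<le> nrm (S i x) * nrm (Y i) * \<tau> i" by (simp add: mult_ac)
      show "\<bar>bil (Y i) ((G(s := dyad x y)) 0) (S i (mv ((G(s := dyad x y)) 1) (S i (mv ((G(s := dyad x y)) 2) (Y i)))))\<bar>
          \<le> \<bar>ip (Y i) y\<bar> * (nrm (S i x) * nrm (Y i)) * \<tau> i"
        using 3 mult_left_mono[OF * abs_ge_zero[of "ip (Y i) y"]]
        by (simp add: abs_mult mv_dyad S_scale ip_commute[of y] mult.assoc)
    qed
    with boundC3[OF c(1-3) xy(2,1) c(4)] show ?thesis by linarith
  qed
qed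

text \<open>The case of a dyad in an outer slot of \<open>formD\<close>. Cauchy-Schwarz over
  \<open>i\<close> uses \<open>condv\<close> for the vectors \<open>a l\<close>, then the sum over
  \<open>l\<close> is split with weight \<open>v * c\<close>. In its second half
  \<open>cond3\<close> is applied to every \<open>w i\<close>, and \<open>condv\<close> once more to
  their sum.\<close>

lemma boundD0:
  assumes c1: "cond1 Z q1" and c3: "cond3 Z' q3" and v: "condv v" and c: "0 < c" and xy: "nrm x \<le> 1" "nrm y \<le> 1"
    and a: "\<And>l. nrm (a l) \<le> nrm (Z' l)" and w: "\<And>i. nrm (w i) \<le> nrm (S i x)"
  shows "(\<Sum>l\<in>I. \<Sum>i\<in>I. \<bar>ip (Z l) y\<bar> * (nrm (S i (a l)) * nrm (S l (w i)))) \<le> v * (c * q1 + q3 / c) / 2"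
proof -
  have v0: "0 < v" and vv: "\<And>x. (\<Sum>i\<in>I. ip (S i x) (S i x)) \<le> v * ip x x" using v by (auto simp: condv_def)
  have q3: "0 \<le> q3" "\<And>x. (\<Sum>l\<in>I. ip (Z' l) (Z' l) * ip (S l x) (S l x) / \<tau> l) \<le> q3 * ip x x" using c3 by (auto simp: cond3_def)
  define T where "T l = (\<Sum>i\<in>I. (nrm (S l (w i)))\<^sup>2)" for l
  have T0: "0 \<le> T l" for l by (auto simp: T_def intro: sum_nonneg)
  define b where "b l = sqrt v * nrm (Z' l) * sqrt (T l)" for l
  have "(\<Sum>l\<in>I. \<Sum>i\<in>I. \<bar>ip (Z l) y\<bar> * (nrm (S i (a l)) * nrm (S l (w i)))) \<le> (\<Sum>l\<in>I. \<bar>ip (Z l) y\<bar> * b l)"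
    unfolding sum_distrib_left[symmetric]
  proof (intro sum_mono mult_left_mono abs_ge_zero)
    fix l
    have "(\<Sum>i\<in>I. nrm (S i (a l)) * nrm (S l (w i))) \<le> L2_set (\<lambda>i. nrm (S i (a l))) I * L2_set (\<lambda>i. nrm (S l (w i))) I"
      using L2_set_mult_ineq[of "\<lambda>i. nrm (S i (a l))" "\<lambda>i. nrm (S l (w i))" I] by simp
    also have "\<dots> \<le> (sqrt v * nrm (Z' l)) * sqrt (T l)"
    proof (intro mult_mono)
      have "(\<Sum>i\<in>I. (nrm (S i (a l)))\<^sup>2) \<le> v * (nrm (a l))\<^sup>2" using vv[of "a l"] by (simp add: nrm_sq)
      also have "\<dots> \<le> v * (nrm (Z' l))\<^sup>2" using a[of l] v0 by (intro mult_left_mono power_mono) auto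
      finally show "L2_set (\<lambda>i. nrm (S i (a l))) I \<le> sqrt v * nrm (Z' l)"
        unfolding L2_set_def by (intro real_le_lsqrt) (use v0 in \<open>auto simp: power_mult_distrib intro!: sum_nonneg\<close>)
    qed (auto simp: L2_set_def T_def intro!: sum_nonneg mult_nonneg_nonneg less_imp_le[OF v0])
    finally show "(\<Sum>i\<in>I. nrm (S i (a l)) * nrm (S l (w i))) \<le> b l" by (simp add: b_def)
  qed
  also have "\<dots> \<le> ((v * c) * (\<Sum>l\<in>I. \<tau> l * (ip (Z l) y)\<^sup>2) + (\<Sum>l\<in>I. (b l)\<^sup>2 / \<tau> l) / (v * c)) / 2"
  proof (rule weighted_split)
    show "0 < v * c" using v0 c by simp
    show "b l = 0" if "\<tau> l = 0" for l using \<tau>_zero[OF that] by (simp add: b_def T_def)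
  qed
  also have "\<dots> \<le> ((v * c) * q1 + (v * (q3 * v)) / (v * c)) / 2"
  proof (intro divide_right_mono add_mono mult_left_mono)
    show "(\<Sum>l\<in>I. \<tau> l * (ip (Z l) y)\<^sup>2) \<le> q1" by (rule cond_unit(1)[OF c1 xy(2)])
    have "(\<Sum>l\<in>I. (b l)\<^sup>2 / \<tau> l) = (\<Sum>l\<in>I. \<Sum>i\<in>I. v * (ip (Z' l) (Z' l) * ip (S l (w i)) (S l (w i)) / \<tau> l))"
      using v0 T0 by (simp add: b_def power_mult_distrib nrm_sq) (simp add: T_def nrm_sq sum_distrib_left sum_divide_distrib mult.assoc)
    also have "\<dots> = v * (\<Sum>i\<in>I. \<Sum>l\<in>I. ip (Z' l) (Z' l) * ip (S l (w i)) (S l (w i)) / \<tau> l)"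
      by (subst sum.swap) (simp add: sum_distrib_left)
    also have "\<dots> \<le> v * (\<Sum>i\<in>I. q3 * ip (S i x) (S i x))"
    proof (intro mult_left_mono sum_mono order_trans[OF q3(2)] q3(1))
      fix i show "ip (w i) (w i) \<le> ip (S i x) (S i x)" using power_mono[OF w[of i], of 2] by (simp add: nrm_sq)
    qed (use v0 in auto)
    also have "\<dots> \<le> v * (q3 * v)"
      unfolding sum_distrib_left[symmetric] using v0 q3(1) cond_unit(4)[OF v xy(1)] by (intro mult_left_mono) auto
    finally show "(\<Sum>l\<in>I. (b l)\<^sup>2 / \<tau> l) \<le> v * (q3 * v)" .
  qed (use v0 c in auto)
  also have "\<dots> = v * (c * q1 + q3 / c) / 2" using v0 c by (simp add: field_simps)
  finally show ?thesis .
qed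

text \<open>The case of a dyad in an inner slot of \<open>formD\<close>. Here the split over
  \<open>l\<close> is done for each fixed \<open>i\<close>: one half is \<open>cond1\<close> at
  \<open>p i\<close> followed by \<open>condv\<close>, the other \<open>condv\<close> at
  \<open>z l\<close> followed by \<open>cond3\<close>.\<close>

lemma boundD1:
  assumes c1: "cond1 Z q1" and c3: "cond3 Z' q3" and v: "condv v" and c: "0 < c" and xy: "nrm x \<le> 1" "nrm y \<le> 1"
    and p: "\<And>i. nrm (p i) \<le> nrm (S i x)" and z: "\<And>l. nrm (z l) \<le> nrm (S l y)"
  shows "(\<Sum>l\<in>I. \<Sum>i\<in>I. \<bar>ip (Z l) (p i)\<bar> * (nrm (Z' l) * nrm (S i (z l)))) \<le> v * (c * q1 + q3 / c) / 2"
proof -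
  have v0: "0 < v" and vv: "\<And>x. (\<Sum>i\<in>I. ip (S i x) (S i x)) \<le> v * ip x x" using v by (auto simp: condv_def)
  have q1: "0 \<le> q1" "\<And>x. (\<Sum>l\<in>I. \<tau> l * (ip (Z l) x)\<^sup>2) \<le> q1 * ip x x" using c1 by (auto simp: cond1_def)
  have "(\<Sum>l\<in>I. \<Sum>i\<in>I. \<bar>ip (Z l) (p i)\<bar> * (nrm (Z' l) * nrm (S i (z l))))
      = (\<Sum>i\<in>I. \<Sum>l\<in>I. \<bar>ip (Z l) (p i)\<bar> * (nrm (Z' l) * nrm (S i (z l))))" by (rule sum.swap)
  also have "\<dots> \<le> (\<Sum>i\<in>I. (c * (\<Sum>l\<in>I. \<tau> l * (ip (Z l) (p i))\<^sup>2) + (\<Sum>l\<in>I. (nrm (Z' l) * nrm (S i (z l)))\<^sup>2 / \<tau> l) / c) / 2)"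
  proof (intro sum_mono weighted_split c)
    fix i l assume "\<tau> l = 0"
    then have "nrm (z l) = 0" using z[of l] nrm_nonneg[of "z l"] by (simp add: \<tau>_zero)
    then have "nrm (S i (z l)) = 0" using nrm_S_le[of i "z l"] nrm_nonneg[of "S i (z l)"] by simp
    then show "nrm (Z' l) * nrm (S i (z l)) = 0" by simp
  qed
  also have "\<dots> = (c * (\<Sum>i\<in>I. \<Sum>l\<in>I. \<tau> l * (ip (Z l) (p i))\<^sup>2) + (\<Sum>i\<in>I. \<Sum>l\<in>I. (nrm (Z' l) * nrm (S i (z l)))\<^sup>2 / \<tau> l) / c) / 2"
    by (simp only: sum_divide_distrib[symmetric] sum.distrib sum_distrib_left[symmetric])
  also have "\<dots> \<le> (c * (q1 * v) + (v * q3) / c) / 2"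
  proof (intro divide_right_mono add_mono mult_left_mono)
    have "(\<Sum>i\<in>I. \<Sum>l\<in>I. \<tau> l * (ip (Z l) (p i))\<^sup>2) \<le> (\<Sum>i\<in>I. q1 * ip (S i x) (S i x))"
    proof (intro sum_mono order_trans[OF q1(2)] mult_left_mono q1(1))
      fix i show "ip (p i) (p i) \<le> ip (S i x) (S i x)" using power_mono[OF p[of i], of 2] by (simp add: nrm_sq)
    qed
    also have "\<dots> \<le> q1 * v"
      unfolding sum_distrib_left[symmetric] using q1(1) cond_unit(4)[OF v xy(1)] by (intro mult_left_mono) auto
    finally show "(\<Sum>i\<in>I. \<Sum>l\<in>I. \<tau> l * (ip (Z l) (p i))\<^sup>2) \<le> q1 * v" .
    have "(\<Sum>i\<in>I. \<Sum>l\<in>I. (nrm (Z' l) * nrm (S i (z l)))\<^sup>2 / \<tau> l) = (\<Sum>l\<in>I. \<Sum>i\<in>I. (nrm (Z' l) * nrm (S i (z l)))\<^sup>2 / \<tau> l)" by (rule sum.swap)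
    also have "\<dots> = (\<Sum>l\<in>I. ip (Z' l) (Z' l) / \<tau> l * (\<Sum>i\<in>I. ip (S i (z l)) (S i (z l))))"
      by (simp add: power_mult_distrib nrm_sq sum_distrib_left)
    also have "\<dots> \<le> (\<Sum>l\<in>I. ip (Z' l) (Z' l) / \<tau> l * (v * ip (S l y) (S l y)))"
    proof (intro sum_mono mult_left_mono order_trans[OF vv])
      fix l show "ip (z l) (z l) \<le> ip (S l y) (S l y)" using power_mono[OF z[of l], of 2] by (simp add: nrm_sq)
    qed (use v0 \<tau>_nonneg in \<open>auto intro!: divide_nonneg_nonneg\<close>)
    also have "\<dots> = v * (\<Sum>l\<in>I. ip (Z' l) (Z' l) * ip (S l y) (S l y) / \<tau> l)"
      by (simp add: sum_distrib_left mult_ac)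
    also have "\<dots> \<le> v * q3" using v0 cond_unit(3)[OF c3 xy(2)] by (intro mult_left_mono) auto
    finally show "(\<Sum>i\<in>I. \<Sum>l\<in>I. (nrm (Z' l) * nrm (S i (z l)))\<^sup>2 / \<tau> l) \<le> v * q3" .
  qed (use c in auto)
  also have "\<dots> = v * (c * q1 + q3 / c) / 2" using c by (simp add: field_simps)
  finally show ?thesis .
qed

lemma mlf_formD:
  assumes c1: "cond1 Y q1" "cond1 Y' q1'" and c3: "cond3 Y q3" "cond3 Y' q3'" and v: "condv v" and c: "0 < c"
  shows "mlf 4 (formD Y Y') (v * (c * (q1 + q1') + (q3 + q3') / c) / 2)"
  unfolding mlf_def
proof (intro conjI allI impI)
  show "0 \<le> v * (c * (q1 + q1') + (q3 + q3') / c) / 2" using assms by (auto simp: cond1_def cond3_def condv_def)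
next
  fix s :: nat and G assume "s < 4"
  then consider "s = 0" | "s = 1" | "s = 2" | "s = 3" by linarith
  then show "lin (\<lambda>A. formD Y Y' (G(s := A)))"
  proof cases
    case 1 then show ?thesis unfolding formD_def by (auto intro!: lin_sumI lin_bil)
  next
    case 2 then show ?thesis unfolding formD_def
      by (simp add: bil_S_right[of "Y _" "G 0"]) (auto simp: bil_def[symmetric] intro!: lin_sumI lin_bil)
  next
    case 3 then show ?thesis unfolding formD_def
      by (simp add: bil_S_mv[of "Y _" "G 0"] bil_S_right[of _ "G (Suc 0)"]) (auto simp: bil_def[symmetric] intro!: lin_sumI lin_bil)
  next
    case 4 then show ?thesis unfolding formD_def
      by (simp add: bil_S_mv[of "Y _" "G 0"] bil_S_mv[of _ "G (Suc 0)"] bil_S_right[of _ "G 2"]) (auto simp: bil_def[symmetric] intro!: lin_sumI lin_bil)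
  qed
next
  fix s :: nat and G A assume "4 \<le> s" then show "formD Y Y' (G(s := A)) = formD Y Y' G" by (simp add: formD_def)
next
  fix s :: nat and G x y assume s: "s < 4" and G: "\<forall>t<4. t \<noteq> s \<longrightarrow> contr (G t)" and xy: "nrm x \<le> 1" "nrm y \<le> 1"
  have q: "0 \<le> q1" "0 \<le> q1'" "0 \<le> q3" "0 \<le> q3'" "0 < v" using assms by (auto simp: cond1_def cond3_def condv_def)
  \<comment> \<open>Dyads in the first two slots pair \<open>q1\<close> with \<open>q3'\<close>,
    those in the last two pair \<open>q1'\<close> with \<open>q3\<close>; the symmetric constant
    dominates both.\<close>
  have le: "v * (c * q1 + q3' / c) / 2 \<le> v * (c * (q1 + q1') + (q3 + q3') / c) / 2"
    "v * (c * q1' + q3 / c) / 2 \<le> v * (c * (q1 + q1') + (q3 + q3') / c) / 2"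
    using q c by (auto intro!: divide_right_mono mult_left_mono add_mono)
  let ?t = "\<lambda>l i G. bil (Y l) (G 0) (S i (mv (G 1) (S l (mv (G 2) (S i (mv (G 3) (Y' l)))))))"
  have sumle: "\<bar>formD Y Y' H\<bar> \<le> (\<Sum>l\<in>I. \<Sum>i\<in>I. f l i)" if "\<And>l i. \<bar>?t l i H\<bar> \<le> f l i" for H f
    unfolding formD_def using that
    by (intro order_trans[OF sum_abs] sum_mono order_trans[OF sum_abs] sum_mono)
  consider "s = 0" | "s = 1" | "s = 2" | "s = 3" using s by linarith
  then show "\<bar>formD Y Y' (G(s := dyad x y))\<bar> \<le> v * (c * (q1 + q1') + (q3 + q3') / c) / 2"
  proof cases
    case 1
    have g: "contr (G 1)" "contr (G 2)" "contr (G 3)" using G 1 by auto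
    have "\<bar>formD Y Y' (G(s := dyad x y))\<bar> \<le> (\<Sum>l\<in>I. \<Sum>i\<in>I. \<bar>ip (Y l) x\<bar> * (nrm (S i (mv (G 3) (Y' l))) * nrm (S l (mv (mtr (G 1)) (S i y)))))"
    proof (rule sumle)
      fix l i
      have "ip y (S i (mv (G 1) (S l (mv (G 2) (S i (mv (G 3) (Y' l))))))) = bil (S i y) (G 1) (S l (mv (G 2) (S i (mv (G 3) (Y' l)))))"
        by (simp only: ip_S_sym[of y] bil_def)
      also have "\<dots> = bil (S l (mv (mtr (G 1)) (S i y))) (G 2) (S i (mv (G 3) (Y' l)))" by (rule bil_S_mv)
      finally have "\<bar>ip y (S i (mv (G 1) (S l (mv (G 2) (S i (mv (G 3) (Y' l)))))))\<bar> \<le> nrm (S l (mv (mtr (G 1)) (S i y))) * nrm (S i (mv (G 3) (Y' l)))"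
        using contr_bil[OF g(2)] by simp
      from mult_left_mono[OF this abs_ge_zero[of "ip (Y l) x"]]
      show "\<bar>?t l i (G(s := dyad x y))\<bar> \<le> \<bar>ip (Y l) x\<bar> * (nrm (S i (mv (G 3) (Y' l))) * nrm (S l (mv (mtr (G 1)) (S i y))))"
        using 1 by (simp add: abs_mult mult.commute)
    qed
    also have "\<dots> \<le> v * (c * q1 + q3' / c) / 2"
      by (rule boundD0[OF c1(1) c3(2) v c xy(2,1)]) (intro contr_mv contr_mtr g)+
    finally show ?thesis using le by linarith
  next
    case 2
    have g: "contr (G 0)" "contr (G 2)" "contr (G 3)" using G 2 by auto
    have "\<bar>formD Y Y' (G(s := dyad x y))\<bar> \<le> (\<Sum>l\<in>I. \<Sum>i\<in>I. \<bar>ip (Y l) (mv (G 0) (S i x))\<bar> * (nrm (Y' l) * nrm (S i (mv (mtr (G 2)) (S l y)))))"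
    proof (rule sumle)
      fix l i
      have "ip y (S l (mv (G 2) (S i (mv (G 3) (Y' l))))) = bil (S l y) (G 2) (S i (mv (G 3) (Y' l)))"
        by (simp only: ip_S_sym[of y] bil_def)
      also have "\<dots> = bil (S i (mv (mtr (G 2)) (S l y))) (G 3) (Y' l)" by (rule bil_S_mv)
      finally have "\<bar>ip y (S l (mv (G 2) (S i (mv (G 3) (Y' l)))))\<bar> \<le> nrm (Y' l) * nrm (S i (mv (mtr (G 2)) (S l y)))"
        using contr_bil[OF g(3), of "S i (mv (mtr (G 2)) (S l y))" "Y' l"] by (simp add: mult.commute)
      from mult_left_mono[OF this abs_ge_zero[of "ip (Y l) (mv (G 0) (S i x))"]]
      show "\<bar>?t l i (G(s := dyad x y))\<bar> \<le> \<bar>ip (Y l) (mv (G 0) (S i x))\<bar> * (nrm (Y' l) * nrm (S i (mv (mtr (G 2)) (S l y))))"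
        using 2 by (simp add: abs_mult mv_dyad S_scale bil_def mult.commute[of "\<bar>ip y (S l _)\<bar>"])
    qed
    also have "\<dots> \<le> v * (c * q1 + q3' / c) / 2"
      by (rule boundD1[OF c1(1) c3(2) v c xy]) (intro contr_mv contr_mtr g)+
    finally show ?thesis using le by linarith
  next
    case 3
    have g: "contr (G 0)" "contr (G 1)" "contr (G 3)" using G 3 by auto
    have "\<bar>formD Y Y' (G(s := dyad x y))\<bar> \<le> (\<Sum>l\<in>I. \<Sum>i\<in>I. \<bar>ip (Y' l) (mv (mtr (G 3)) (S i y))\<bar> * (nrm (Y l) * nrm (S i (mv (G 1) (S l x)))))"
    proof (rule sumle)
      fix l i
      have e: "ip y (S i (mv (G 3) (Y' l))) = ip (Y' l) (mv (mtr (G 3)) (S i y))"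
        by (simp only: ip_S_sym[of y] bil_def[symmetric] bil_mtr[of "S i y"]) (simp add: bil_def ip_commute)
      have "\<bar>bil (Y l) (G 0) (S i (mv (G 1) (S l x)))\<bar> \<le> nrm (Y l) * nrm (S i (mv (G 1) (S l x)))"
        by (rule contr_bil[OF g(1)])
      from mult_left_mono[OF this abs_ge_zero[of "ip (Y' l) (mv (mtr (G 3)) (S i y))"]]
      show "\<bar>?t l i (G(s := dyad x y))\<bar> \<le> \<bar>ip (Y' l) (mv (mtr (G 3)) (S i y))\<bar> * (nrm (Y l) * nrm (S i (mv (G 1) (S l x))))"
        using 3 by (simp add: abs_mult mv_dyad S_scale e)
    qed
    also have "\<dots> \<le> v * (c * q1' + q3 / c) / 2"
      by (rule boundD1[OF c1(2) c3(1) v c xy(2,1)]) (intro contr_mv contr_mtr g)+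
    finally show ?thesis using le by linarith
  next
    case 4
    have g: "contr (G 0)" "contr (G 1)" "contr (G 2)" using G 4 by auto
    have "\<bar>formD Y Y' (G(s := dyad x y))\<bar> \<le> (\<Sum>l\<in>I. \<Sum>i\<in>I. \<bar>ip (Y' l) y\<bar> * (nrm (S i (mv (mtr (G 0)) (Y l))) * nrm (S l (mv (G 2) (S i x)))))"
    proof (rule sumle)
      fix l i
      have "bil (Y l) (G 0) (S i (mv (G 1) (S l (mv (G 2) (S i x))))) = bil (S i (mv (mtr (G 0)) (Y l))) (G 1) (S l (mv (G 2) (S i x)))"
        by (rule bil_S_mv)
      then have "\<bar>bil (Y l) (G 0) (S i (mv (G 1) (S l (mv (G 2) (S i x)))))\<bar> \<le> nrm (S i (mv (mtr (G 0)) (Y l))) * nrm (S l (mv (G 2) (S i x)))"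
        using contr_bil[OF g(2)] by simp
      from mult_left_mono[OF this abs_ge_zero[of "ip (Y' l) y"]]
      show "\<bar>?t l i (G(s := dyad x y))\<bar> \<le> \<bar>ip (Y' l) y\<bar> * (nrm (S i (mv (mtr (G 0)) (Y l))) * nrm (S l (mv (G 2) (S i x))))"
        using 4 by (simp add: abs_mult mv_dyad S_scale ip_commute[of y])
    qed
    also have "\<dots> \<le> v * (c * q1' + q3 / c) / 2"
      by (rule boundD0[OF c1(2) c3(1) v c xy]) (intro contr_mv contr_mtr g)+
    finally show ?thesis using le by linarith
  qed
qed

end

section \<open>The Gaussian matrix model\<close>

context dimn
begin

lemma mv_mpow_0: "a < d \<Longrightarrow> mv (mpow M 0) y a = y a"
  unfolding mv_def by (simp add: if_distrib[of "\<lambda>t. t * _"] sum.If_cases Int_absorb1 cong: if_cong)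

lemma mv_mpow_Suc: "mv (mpow M (Suc k)) y = mv M (mv (mpow M k) y)"
  by (simp add: mv_mm)

lemma symm_mpow: assumes "symm M" shows "symm (mpow M k)"
  using spectral[OF assms] spec_mpow spec_symm by blast

lemma polyfun_mv:
  assumes "\<And>a c. a < d \<Longrightarrow> c < d \<Longrightarrow> polyfun J (\<lambda>g. M g a c)" "\<And>a. a < d \<Longrightarrow> polyfun J (\<lambda>g. y g a)" "a < d"
  shows "polyfun J (\<lambda>g. mv (M g) (y g) a)"
  unfolding mv_def using assms by (intro polyfun_sum polyfun_mult) auto

lemma polyfun_mpow:
  assumes M: "\<And>a c. a < d \<Longrightarrow> c < d \<Longrightarrow> polyfun J (\<lambda>g. M g a c)"
  shows "a < d \<Longrightarrow> c < d \<Longrightarrow> polyfun J (\<lambda>g. mpow (M g) k a c)"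
proof (induction k arbitrary: a)
  case 0 then show ?case by (auto intro: polyfun_const)
next
  case (Suc k) then show ?case by (auto simp: mm_def intro!: polyfun_sum polyfun_mult M)
qed

lemma polyfun_bil:
  assumes "\<And>a c. a < d \<Longrightarrow> c < d \<Longrightarrow> polyfun J (\<lambda>g. M g a c)" "\<And>a. a < d \<Longrightarrow> polyfun J (\<lambda>g. x g a)" "\<And>a. a < d \<Longrightarrow> polyfun J (\<lambda>g. y g a)"
  shows "polyfun J (\<lambda>g. bil (x g) (M g) (y g))"
  unfolding bil_sum2 using assms by (intro polyfun_sum polyfun_mult) auto

lemma polyfun_mm:
  assumes "\<And>a c. a < d \<Longrightarrow> c < d \<Longrightarrow> polyfun J (\<lambda>g. M g a c)" "\<And>a c. a < d \<Longrightarrow> c < d \<Longrightarrow> polyfun J (\<lambda>g. M' g a c)" "a < d" "c < d"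
  shows "polyfun J (\<lambda>g. mm (M g) (M' g) a c)"
  unfolding mm_def using assms by (intro polyfun_sum polyfun_mult) auto

lemma polyfun_tr: "(\<And>a c. a < d \<Longrightarrow> c < d \<Longrightarrow> polyfun J (\<lambda>g. M g a c)) \<Longrightarrow> polyfun J (\<lambda>g. tr (M g))"
  unfolding tr_def by (intro polyfun_sum) auto

text \<open>Leibniz rule for a noncommutative power: the derivative replaces one factor at a time,
  with the powers \<open>j\<close> and \<open>k - 1 - j\<close> left on its two sides.\<close>

lemma haspd_mv_mpow:
  assumes M: "\<And>a c. a < d \<Longrightarrow> c < d \<Longrightarrow> haspd \<kappa> (\<lambda>g. M g a c) (\<lambda>g. M' g a c)"
    and y: "\<And>a. a < d \<Longrightarrow> haspd \<kappa> (\<lambda>g. y g a) (\<lambda>g. y' g a)"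
  shows "a < d \<Longrightarrow> haspd \<kappa> (\<lambda>g. mv (mpow (M g) k) (y g) a)
     (\<lambda>g. mv (mpow (M g) k) (y' g) a + (\<Sum>j<k. mv (mpow (M g) j) (mv (M' g) (mv (mpow (M g) (k - 1 - j)) (y g))) a))"
proof (induction k arbitrary: a)
  case 0 then show ?case using y by (simp add: mv_mpow_0 del: mpow.simps)
next
  case (Suc k)
  have "haspd \<kappa> (\<lambda>g. \<Sum>c<d. M g a c * mv (mpow (M g) k) (y g) c)
     (\<lambda>g. \<Sum>c<d. M' g a c * mv (mpow (M g) k) (y g) c + M g a c * (mv (mpow (M g) k) (y' g) c + (\<Sum>j<k. mv (mpow (M g) j) (mv (M' g) (mv (mpow (M g) (k - 1 - j)) (y g))) c)))"
    using Suc by (intro haspd_sum haspd_mult M) auto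
  note h = this
  have e: "mv (M g) z a = (\<Sum>c<d. M g a c * z c)" "mv (M' g) z a = (\<Sum>c<d. M' g a c * z c)" for g z
    by (simp_all only: mv_def)
  have *: "haspd \<kappa> (\<lambda>g. mv (mpow (M g) (Suc k)) (y g) a)
     (\<lambda>g. mv (M' g) (mv (mpow (M g) k) (y g)) a + mv (M g) (\<lambda>c. mv (mpow (M g) k) (y' g) c + (\<Sum>j<k. mv (mpow (M g) j) (mv (M' g) (mv (mpow (M g) (k - 1 - j)) (y g))) c)) a)"
    unfolding mv_mpow_Suc e using h by (simp only: sum.distrib)
  show ?case
  proof (rule haspd_cong[OF *])
    fix g
    have "(\<Sum>j<Suc k. mv (mpow (M g) j) (mv (M' g) (mv (mpow (M g) (Suc k - 1 - j)) (y g))) a) =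
       mv (M' g) (mv (mpow (M g) k) (y g)) a + (\<Sum>j<k. mv (mpow (M g) (Suc j)) (mv (M' g) (mv (mpow (M g) (k - 1 - j)) (y g))) a)"
      using Suc.prems by (subst sum.lessThan_Suc_shift) (simp add: mv_mpow_0 del: mpow.simps)
    then show "mv (M' g) (mv (mpow (M g) k) (y g)) a + mv (M g) (\<lambda>c. mv (mpow (M g) k) (y' g) c + (\<Sum>j<k. mv (mpow (M g) j) (mv (M' g) (mv (mpow (M g) (k - 1 - j)) (y g))) c)) a =
      mv (mpow (M g) (Suc k)) (y' g) a + (\<Sum>j<Suc k. mv (mpow (M g) j) (mv (M' g) (mv (mpow (M g) (Suc k - 1 - j)) (y g))) a)"
      by (simp add: mv_mpow_Suc del: mpow.simps)
  qed
qed

lemma haspd_bil_mpow: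
  assumes M: "\<And>a c. a < d \<Longrightarrow> c < d \<Longrightarrow> haspd \<kappa> (\<lambda>g. M g a c) (\<lambda>g. M' g a c)"
    and x: "\<And>a. a < d \<Longrightarrow> haspd \<kappa> (\<lambda>g. x g a) (\<lambda>g. x' g a)"
    and y: "\<And>a. a < d \<Longrightarrow> haspd \<kappa> (\<lambda>g. y g a) (\<lambda>g. y' g a)"
  shows "haspd \<kappa> (\<lambda>g. bil (x g) (mpow (M g) k) (y g))
     (\<lambda>g. bil (x' g) (mpow (M g) k) (y g) + bil (x g) (mpow (M g) k) (y' g) +
        (\<Sum>j<k. bil (x g) (mpow (M g) j) (mv (M' g) (mv (mpow (M g) (k - 1 - j)) (y g)))))"
proof -
  have "haspd \<kappa> (\<lambda>g. \<Sum>a<d. x g a * mv (mpow (M g) k) (y g) a)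
     (\<lambda>g. \<Sum>a<d. x' g a * mv (mpow (M g) k) (y g) a + x g a * (mv (mpow (M g) k) (y' g) a + (\<Sum>j<k. mv (mpow (M g) j) (mv (M' g) (mv (mpow (M g) (k - 1 - j)) (y g))) a)))"
    by (intro haspd_sum haspd_mult x haspd_mv_mpow[OF M y]) auto
  then have *: "haspd \<kappa> (\<lambda>g. bil (x g) (mpow (M g) k) (y g))
     (\<lambda>g. ip (x' g) (mv (mpow (M g) k) (y g)) + ip (x g) (\<lambda>a. mv (mpow (M g) k) (y' g) a + (\<Sum>j<k. mv (mpow (M g) j) (mv (M' g) (mv (mpow (M g) (k - 1 - j)) (y g))) a)))"
    unfolding bil_def ip_def by (simp only: sum.distrib)
  show ?thesis by (rule haspd_cong[OF *]) (simp add: bil_def)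
qed

end

section \<open>The random matrix and its partial derivatives\<close>

context gmodel
begin

sublocale gauss_space "I \<times> {..<d}" by unfold_locales (use finite_I in auto)

definition Yv :: "(nat \<times> nat \<Rightarrow> real) \<Rightarrow> nat \<Rightarrow> nat \<Rightarrow> real" where
  "Yv g i = (\<lambda>a. \<Sum>b<d. g (i, b) * u i b a)"

definition Sg :: "nat \<Rightarrow> nat \<Rightarrow> nat \<Rightarrow> real" where
  "Sg i = (\<lambda>a c. \<Sum>b<d. u i b a * u i b c)"

definition X :: "(nat \<times> nat \<Rightarrow> real) \<Rightarrow> nat \<Rightarrow> nat \<Rightarrow> real" where
  "X g = (\<lambda>a c. \<Sum>i\<in>I. Yv g i a * Yv g i c - Sg i a c)"

abbreviation XP :: "(nat \<times> nat \<Rightarrow> real) \<Rightarrow> nat \<Rightarrow> nat \<Rightarrow> nat \<Rightarrow> real" where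
  "XP g k \<equiv> mpow (X g) k"

lemma symm_X: "symm (X g)" by (simp add: symm_def X_def Sg_def mult.commute)

lemma symm_XP: "symm (XP g k)" by (rule symm_mpow[OF symm_X])

lemma poly_Y: "i \<in> I \<Longrightarrow> polyfun (I \<times> {..<d}) (\<lambda>g. Yv g i a)"
  unfolding Yv_def by (intro polyfun_intros) auto

lemma poly_X: "polyfun (I \<times> {..<d}) (\<lambda>g. X g a c)"
  unfolding X_def by (intro polyfun_intros poly_Y) auto

lemma poly_XP: "a < d \<Longrightarrow> c < d \<Longrightarrow> polyfun (I \<times> {..<d}) (\<lambda>g. XP g k a c)"
  by (rule polyfun_mpow) (rule poly_X)

lemma poly_bil_XP:
  assumes "\<And>a. a < d \<Longrightarrow> polyfun (I \<times> {..<d}) (\<lambda>g. x g a)" "\<And>a. a < d \<Longrightarrow> polyfun (I \<times> {..<d}) (\<lambda>g. y g a)"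
  shows "polyfun (I \<times> {..<d}) (\<lambda>g. bil (x g) (XP g k) (y g))"
  using assms by (intro polyfun_bil poly_XP)

lemma poly_mv: "(\<And>a. a < d \<Longrightarrow> polyfun J (\<lambda>g. y g a)) \<Longrightarrow> polyfun J (\<lambda>g. mv W (y g) a)"
  unfolding mv_def by (intro polyfun_sum polyfun_mult) (auto intro: polyfun_const)

lemma pd_Y: "b < d \<Longrightarrow> haspd (i, b) (\<lambda>g. Yv g l a) (\<lambda>g. if l = i then u i b a else 0)"
proof -
  assume b: "b < d"
  have "haspd (i, b) (\<lambda>g. \<Sum>c<d. g (l, c) * u l c a) (\<lambda>g. \<Sum>c<d. (if (l, c) = (i, b) then 1 else 0) * u l c a + g (l, c) * 0)"
    by (intro haspd_sum haspd_mult haspd_var haspd_const)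
  then show ?thesis unfolding Yv_def
    by (rule haspd_cong) (use b in \<open>auto simp: if_distrib[of "\<lambda>t. t * _"] cong: if_cong\<close>)
qed

lemma pd_X: assumes "i \<in> I" "b < d"
  shows "haspd (i, b) (\<lambda>g. X g a c) (\<lambda>g. u i b a * Yv g i c + Yv g i a * u i b c)"
proof -
  have "haspd (i, b) (\<lambda>g. X g a c) (\<lambda>g. \<Sum>l\<in>I. (if l = i then u i b a else 0) * Yv g l c + Yv g l a * (if l = i then u i b c else 0) - 0)"
    unfolding X_def by (intro haspd_sum haspd_diff haspd_mult haspd_const pd_Y assms)
  then show ?thesis
    by (rule haspd_cong) (use assms finite_I in \<open>simp add: sum.distrib if_distrib[of "\<lambda>t. t * _"] if_distrib[of "\<lambda>t. _ * t"] cong: if_cong\<close>)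
qed

text \<open>The partial derivative of \<open>X g\<close> is the sum of the dyads of
  \<open>u i b\<close> with \<open>Yv g i\<close> in both orders, so every Leibniz term falls apart
  into products of two scalars.\<close>

lemma pd_bil_XP:
  assumes ib: "i \<in> I" "b < d"
    and x: "\<And>a. a < d \<Longrightarrow> haspd (i, b) (\<lambda>g. x g a) (\<lambda>g. x' g a)"
    and y: "\<And>a. a < d \<Longrightarrow> haspd (i, b) (\<lambda>g. y g a) (\<lambda>g. y' g a)"
  shows "haspd (i, b) (\<lambda>g. bil (x g) (XP g k) (y g))
     (\<lambda>g. bil (x' g) (XP g k) (y g) + bil (x g) (XP g k) (y' g) +
        (\<Sum>j<k. bil (x g) (XP g j) (u i b) * bil (Yv g i) (XP g (k - 1 - j)) (y g)
           + bil (x g) (XP g j) (Yv g i) * bil (u i b) (XP g (k - 1 - j)) (y g)))"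
proof (rule haspd_cong[OF haspd_bil_mpow[where M' = "\<lambda>g a c. u i b a * Yv g i c + Yv g i a * u i b c", OF pd_X[OF ib] x y]])
  fix g
  have "mv (\<lambda>a c. u i b a * Yv g i c + Yv g i a * u i b c) z = (\<lambda>a. ip (Yv g i) z * u i b a + ip (u i b) z * Yv g i a)" for z
    unfolding mv_def ip_def distrib_right sum.distrib sum_distrib_right by (auto simp: mult_ac add_ac)
  then show "bil (x' g) (XP g k) (y g) + bil (x g) (XP g k) (y' g) +
        (\<Sum>j<k. bil (x g) (mpow (X g) j) (mv (\<lambda>a c. u i b a * Yv g i c + Yv g i a * u i b c) (mv (mpow (X g) (k - 1 - j)) (y g)))) =
      bil (x' g) (XP g k) (y g) + bil (x g) (XP g k) (y' g) +
        (\<Sum>j<k. bil (x g) (XP g j) (u i b) * bil (Yv g i) (XP g (k - 1 - j)) (y g)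
           + bil (x g) (XP g j) (Yv g i) * bil (u i b) (XP g (k - 1 - j)) (y g))"
    by (simp only: bil_def mv_lin ip_lin) (simp only: mult.commute)
qed

lemma bil_zero [simp]: "bil (\<lambda>a. 0) G y = 0" "bil x G (\<lambda>a. 0) = 0"
  by (simp_all add: bil_sum2)

lemma Yv_bil: "bil (Yv g i) G z = (\<Sum>b<d. g (i, b) * bil (u i b) G z)"
  by (simp add: Yv_def)

lemma S_bil: "(\<Sum>b<d. bil x G (u i b) * bil (u i b) H z) = bil x G (S i (mv H z))"
  by (simp only: bil_S(2)) (simp only: bil_def)

section \<open>Integration by parts against powers of the random matrix\<close>

lemma integral_sum_poly: "(\<And>i. i \<in> T \<Longrightarrow> polyfun (I \<times> {..<d}) (f i)) \<Longrightarrow> (\<integral>g. (\<Sum>i\<in>T. f i g) \<partial>\<gamma>) = (\<Sum>i\<in>T. \<integral>g. f i g \<partial>\<gamma>)"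
  by (intro Bochner_Integration.integral_sum polyfun_integrable)

lemma poly_trS: "(\<And>a c. a < d \<Longrightarrow> c < d \<Longrightarrow> polyfun J (\<lambda>g. M g a c)) \<Longrightarrow> polyfun J (\<lambda>g. trS i (M g))"
  unfolding trS_def by (intro polyfun_sum polyfun_bil) (auto intro: polyfun_const)

lemma poly_S: "(\<And>a. a < d \<Longrightarrow> polyfun J (\<lambda>g. y g a)) \<Longrightarrow> polyfun J (\<lambda>g. S i (y g) a)"
  unfolding S_def ip_def by (intro polyfun_sum polyfun_mult) (auto intro: polyfun_const)

lemmas poly_intros = poly_trS polyfun_mm poly_XP poly_Y polyfun_bil poly_S polyfun_mv poly_mv polyfun_intros

text \<open>Only the left one of the two vectors \<open>Yv g i\<close> is expanded in the
  coordinates \<open>g (i, b)\<close>. The derivative hits the right one, a factor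
  \<open>X g\<close> (with \<open>u i b\<close> facing left or right), or \<open>\<phi>\<close>;
  these are the four terms, in this order. Summation over \<open>b\<close> reassembles the
  covariance from the \<open>u i b\<close> in the first three.\<close>

lemma ibp_Y:
  assumes i: "i \<in> I" and \<phi>: "polyfun (I \<times> {..<d}) \<phi>" and d\<phi>: "\<And>b. b < d \<Longrightarrow> haspd (i, b) \<phi> (d\<phi> b)"
  shows "(\<integral>g. \<phi> g * bil (Yv g i) (XP g k) (mv W (Yv g i)) \<partial>\<gamma>) =
     (\<integral>g. \<phi> g * trS i (mm (XP g k) W) \<partial>\<gamma>)
     + (\<Sum>j<k. \<integral>g. \<phi> g * (trS i (XP g j) * bil (Yv g i) (XP g (k - 1 - j)) (mv W (Yv g i))) \<partial>\<gamma>)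
     + (\<Sum>j<k. \<integral>g. \<phi> g * bil (Yv g i) (XP g j) (S i (mv (XP g (k - 1 - j)) (mv W (Yv g i)))) \<partial>\<gamma>)
     + (\<integral>g. (\<Sum>b<d. d\<phi> b g * bil (u i b) (XP g k) (mv W (Yv g i))) \<partial>\<gamma>)" (is "?L = ?R")
proof -
  have pd\<phi>: "polyfun (I \<times> {..<d}) (d\<phi> b)" if "b < d" for b
    using haspd_polyfun[OF \<phi> _ d\<phi>] that i by auto
  define T where "T b g = d\<phi> b g * bil (u i b) (XP g k) (mv W (Yv g i)) + \<phi> g * (bil (u i b) (XP g k) (mv W (u i b)) +
     (\<Sum>j<k. bil (u i b) (XP g j) (u i b) * bil (Yv g i) (XP g (k - 1 - j)) (mv W (Yv g i))
           + bil (u i b) (XP g j) (Yv g i) * bil (u i b) (XP g (k - 1 - j)) (mv W (Yv g i))))" for b g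
  have "?L = (\<integral>g. (\<Sum>b<d. g (i, b) * (\<phi> g * bil (u i b) (XP g k) (mv W (Yv g i)))) \<partial>\<gamma>)"
    by (simp add: Yv_bil[of _ i "XP _ k"] sum_distrib_left mult_ac)
  also have "\<dots> = (\<Sum>b<d. \<integral>g. g (i, b) * (\<phi> g * bil (u i b) (XP g k) (mv W (Yv g i))) \<partial>\<gamma>)"
    using i \<phi> by (intro integral_sum_poly) (auto intro!: poly_intros)
  also have "\<dots> = (\<Sum>b<d. \<integral>g. T b g \<partial>\<gamma>)"
  proof (intro sum.cong refl)
    fix b assume "b \<in> {..<d}" then have b: "b < d" by simp
    have "haspd (i, b) (\<lambda>g. bil (u i b) (XP g k) (mv W (Yv g i)))
       (\<lambda>g. bil (\<lambda>a. 0) (XP g k) (mv W (Yv g i)) + bil (u i b) (XP g k) (mv W (u i b)) +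
         (\<Sum>j<k. bil (u i b) (XP g j) (u i b) * bil (Yv g i) (XP g (k - 1 - j)) (mv W (Yv g i))
           + bil (u i b) (XP g j) (Yv g i) * bil (u i b) (XP g (k - 1 - j)) (mv W (Yv g i))))"
    proof (rule pd_bil_XP[OF i b haspd_const])
      fix a
      have "haspd (i, b) (\<lambda>g. \<Sum>c<d. W a c * Yv g i c) (\<lambda>g. \<Sum>c<d. W a c * u i b c)"
        using pd_Y[OF b, of i i] by (intro haspd_sum haspd_cmult) simp
      then show "haspd (i, b) (\<lambda>g. mv W (Yv g i) a) (\<lambda>g. mv W (u i b) a)" by (simp add: mv_def)
    qed
    from haspd_mult[OF d\<phi>[OF b] this]
    have h: "haspd (i, b) (\<lambda>g. \<phi> g * bil (u i b) (XP g k) (mv W (Yv g i))) (T b)"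
      by (rule haspd_cong) (simp add: T_def)
    show "(\<integral>g. g (i, b) * (\<phi> g * bil (u i b) (XP g k) (mv W (Yv g i))) \<partial>\<gamma>) = (\<integral>g. T b g \<partial>\<gamma>)"
      by (rule gauss_ibp[OF _ _ h]) (use i b \<phi> in \<open>auto intro!: poly_intros\<close>)
  qed
  also have "\<dots> = (\<integral>g. (\<Sum>b<d. T b g) \<partial>\<gamma>)"
    unfolding T_def using i \<phi> pd\<phi> by (intro integral_sum_poly[symmetric]) (auto intro!: poly_intros)
  also have "\<dots> = (\<integral>g. \<phi> g * trS i (mm (XP g k) W)
     + (\<Sum>j<k. \<phi> g * (trS i (XP g j) * bil (Yv g i) (XP g (k - 1 - j)) (mv W (Yv g i))))
     + (\<Sum>j<k. \<phi> g * bil (Yv g i) (XP g j) (S i (mv (XP g (k - 1 - j)) (mv W (Yv g i)))))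
     + (\<Sum>b<d. d\<phi> b g * bil (u i b) (XP g k) (mv W (Yv g i))) \<partial>\<gamma>)"
  proof (rule Bochner_Integration.integral_cong[OF refl])
    fix g
    have 1: "(\<Sum>b<d. bil (u i b) (XP g k) (mv W (u i b))) = trS i (mm (XP g k) W)"
      by (simp add: trS_def bil_mm)
    have 2: "(\<Sum>b<d. \<Sum>j<k. bil (u i b) (XP g j) (u i b) * bil (Yv g i) (XP g (k - 1 - j)) (mv W (Yv g i))) =
       (\<Sum>j<k. trS i (XP g j) * bil (Yv g i) (XP g (k - 1 - j)) (mv W (Yv g i)))"
      by (subst sum.swap) (simp add: trS_def sum_distrib_right)
    have 3: "(\<Sum>b<d. \<Sum>j<k. bil (u i b) (XP g j) (Yv g i) * bil (u i b) (XP g (k - 1 - j)) (mv W (Yv g i))) =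
       (\<Sum>j<k. bil (Yv g i) (XP g j) (S i (mv (XP g (k - 1 - j)) (mv W (Yv g i)))))"
      by (subst sum.swap) (simp only: bil_symm[OF symm_XP, of "u i _" g _ "Yv g i"] S_bil)
    have "(\<Sum>b<d. T b g) = (\<Sum>b<d. d\<phi> b g * bil (u i b) (XP g k) (mv W (Yv g i))) + \<phi> g * ((\<Sum>b<d. bil (u i b) (XP g k) (mv W (u i b)))
       + ((\<Sum>b<d. \<Sum>j<k. bil (u i b) (XP g j) (u i b) * bil (Yv g i) (XP g (k - 1 - j)) (mv W (Yv g i)))
       + (\<Sum>b<d. \<Sum>j<k. bil (u i b) (XP g j) (Yv g i) * bil (u i b) (XP g (k - 1 - j)) (mv W (Yv g i)))))"
      by (simp only: T_def sum.distrib sum_distrib_left[symmetric])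
    then show "(\<Sum>b<d. T b g) = \<phi> g * trS i (mm (XP g k) W)
     + (\<Sum>j<k. \<phi> g * (trS i (XP g j) * bil (Yv g i) (XP g (k - 1 - j)) (mv W (Yv g i))))
     + (\<Sum>j<k. \<phi> g * bil (Yv g i) (XP g j) (S i (mv (XP g (k - 1 - j)) (mv W (Yv g i)))))
     + (\<Sum>b<d. d\<phi> b g * bil (u i b) (XP g k) (mv W (Yv g i)))"
      unfolding 1 2 3 by (simp add: sum_distrib_left algebra_simps)
  qed
  also have "\<dots> = ?R"
  proof -
    have p: "polyfun (I \<times> {..<d}) (\<lambda>g. \<phi> g * trS i (mm (XP g k) W))"
      "polyfun (I \<times> {..<d}) (\<lambda>g. \<phi> g * (trS i (XP g j) * bil (Yv g i) (XP g (k - 1 - j)) (mv W (Yv g i))))"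
      "polyfun (I \<times> {..<d}) (\<lambda>g. \<phi> g * bil (Yv g i) (XP g j) (S i (mv (XP g (k - 1 - j)) (mv W (Yv g i)))))"
      "polyfun (I \<times> {..<d}) (\<lambda>g. \<Sum>b<d. d\<phi> b g * bil (u i b) (XP g k) (mv W (Yv g i)))" for j
      using i \<phi> pd\<phi> by (auto intro!: poly_intros)
    show ?thesis
      by (subst Bochner_Integration.integral_add, (intro polyfun_integrable polyfun_add polyfun_sum p)+)+
         (simp only: integral_sum_poly[OF p(2)] integral_sum_poly[OF p(3)])
  qed
  finally show ?thesis .
qed

end

section \<open>The approximate Dyson equation\<close>

context gauss_space
begin

lemma haspd_unique: "haspd k F F' \<Longrightarrow> haspd k F F'' \<Longrightarrow> F' w = F'' w"
  unfolding haspd_def by (blast intro: DERIV_unique)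

text \<open>The two sums are the values of the interpolation \<open>H\<close> at the angles 0 and pi
  / 2, and its derivative is the correlation of the gradients times \<open>- sin \<theta>\<close>.
  Bounding the sine by 1 and pi / 2 by 2 gives the factor 2. The bound is asked of the whole sum
  over \<open>T\<close>, because the error form is small only after summation.\<close>

theorem gaussian_covariance:
  assumes \<phi>: "\<And>i. i \<in> T \<Longrightarrow> polyfun J (\<phi> i)" and f: "\<And>i. i \<in> T \<Longrightarrow> polyfun J (f i)"
    and d\<phi>: "\<And>i k. i \<in> T \<Longrightarrow> k \<in> J \<Longrightarrow> haspd k (\<phi> i) (d\<phi> i k)" and df: "\<And>i k. i \<in> T \<Longrightarrow> k \<in> J \<Longrightarrow> haspd k (f i) (df i k)"
    and S: "\<And>\<theta>. \<bar>\<integral>z. (\<Sum>i\<in>T. \<Sum>k\<in>J. d\<phi> i k (fst z) * df i k (rot \<theta> z)) \<partial>PP\<bar> \<le> S"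
  shows "\<bar>(\<Sum>i\<in>T. \<integral>w. \<phi> i w * f i w \<partial>\<gamma>) - (\<Sum>i\<in>T. (\<integral>w. \<phi> i w \<partial>\<gamma>) * (\<integral>w. f i w \<partial>\<gamma>))\<bar> \<le> 2 * S"
proof -
  have "\<forall>i\<in>T. \<exists>d. grad J (\<phi> i) d" using \<phi> grad_ex finite_J by blast
  then obtain D\<phi> where D\<phi>: "\<And>i. i \<in> T \<Longrightarrow> grad J (\<phi> i) (D\<phi> i)" by metis
  have "\<forall>i\<in>T. \<exists>d. grad J (f i) d" using f grad_ex finite_J by blast
  then obtain Df where Df: "\<And>i. i \<in> T \<Longrightarrow> grad J (f i) (Df i)" by metis
  define H where "H \<theta> = (\<Sum>i\<in>T. \<integral>z. \<phi> i (fst z) * f i (rot \<theta> z) \<partial>PP)" for \<theta>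
  have eq: "(\<Sum>i\<in>T. - sin \<theta> * (\<Sum>k\<in>J. \<integral>z. D\<phi> i k (fst z) * Df i k (rot \<theta> z) \<partial>PP))
     = - sin \<theta> * (\<integral>z. (\<Sum>i\<in>T. \<Sum>k\<in>J. d\<phi> i k (fst z) * df i k (rot \<theta> z)) \<partial>PP)" for \<theta>
  proof -
    have int: "integrable PP (\<lambda>z. D\<phi> i k (fst z) * Df i k (rot \<theta> z))" if "i \<in> T" for i k
      by (rule good_integrable[where \<Psi> = "\<lambda>\<theta> z. D\<phi> i k (fst z) * Df i k (rot \<theta> z)"])
        (use D\<phi>[OF that] Df[OF that] in \<open>auto simp: grad_def intro!: good_mult good_fst good_rot\<close>)
    have "(\<integral>z. (\<Sum>i\<in>T. \<Sum>k\<in>J. d\<phi> i k (fst z) * df i k (rot \<theta> z)) \<partial>PP) = (\<integral>z. (\<Sum>i\<in>T. \<Sum>k\<in>J. D\<phi> i k (fst z) * Df i k (rot \<theta> z)) \<partial>PP)"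
    proof (rule Bochner_Integration.integral_cong[OF refl], intro sum.cong refl)
      fix z i k assume i: "i \<in> T" and k: "k \<in> J"
      have "d\<phi> i k w = D\<phi> i k w" "df i k w = Df i k w" for w
        using haspd_unique[OF d\<phi>[OF i k] grad_haspd[OF D\<phi>[OF i] finite_J k]]
          haspd_unique[OF df[OF i k] grad_haspd[OF Df[OF i] finite_J k]] by auto
      then show "d\<phi> i k (fst z) * df i k (rot \<theta> z) = D\<phi> i k (fst z) * Df i k (rot \<theta> z)" by simp
    qed
    also have "\<dots> = (\<Sum>i\<in>T. \<Sum>k\<in>J. \<integral>z. D\<phi> i k (fst z) * Df i k (rot \<theta> z) \<partial>PP)"
      using int by (simp add: Bochner_Integration.integral_sum)
    finally show ?thesis by (simp only: sum_distrib_left[symmetric])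
  qed
  have "norm (H 0 - H (pi/2)) \<le> S * norm (0 - pi/2)"
  proof (rule field_differentiable_bound[of UNIV H])
    fix \<theta>
    have "(H has_field_derivative (\<Sum>i\<in>T. - sin \<theta> * (\<Sum>k\<in>J. \<integral>z. D\<phi> i k (fst z) * Df i k (rot \<theta> z) \<partial>PP))) (at \<theta>)"
      unfolding H_def by (intro DERIV_sum rot_derivative D\<phi> Df)
    then show "(H has_field_derivative - sin \<theta> * (\<integral>z. (\<Sum>i\<in>T. \<Sum>k\<in>J. d\<phi> i k (fst z) * df i k (rot \<theta> z)) \<partial>PP)) (at \<theta> within UNIV)"
      unfolding eq by simp
    have "\<bar>sin \<theta>\<bar> * \<bar>\<integral>z. (\<Sum>i\<in>T. \<Sum>k\<in>J. d\<phi> i k (fst z) * df i k (rot \<theta> z)) \<partial>PP\<bar> \<le> 1 * S"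
      using S[of \<theta>] by (intro mult_mono) auto
    then show "norm (- sin \<theta> * (\<integral>z. (\<Sum>i\<in>T. \<Sum>k\<in>J. d\<phi> i k (fst z) * df i k (rot \<theta> z)) \<partial>PP)) \<le> S" by (simp add: abs_mult)
  qed auto
  also have "\<dots> \<le> S * 2"
  proof (intro mult_left_mono)
    show "0 \<le> S" using S[of 0] by (meson abs_ge_zero order_trans)
    show "norm (0 - pi/2) \<le> 2" using pi_less_4 by simp
  qed
  finally have "\<bar>H 0 - H (pi/2)\<bar> \<le> 2 * S" by simp
  moreover have "H 0 = (\<Sum>i\<in>T. \<integral>w. \<phi> i w * f i w \<partial>\<gamma>)"
    unfolding H_def rot_0 by (intro sum.cong refl PP_fst polyfun_mult \<phi> f)
  moreover have "H (pi/2) = (\<Sum>i\<in>T. (\<integral>w. \<phi> i w \<partial>\<gamma>) * (\<integral>w. f i w \<partial>\<gamma>))"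
    unfolding H_def rot_pi2 by (intro sum.cong refl PP_prod \<phi> f)
  ultimately show ?thesis by simp
qed

end

section \<open>Two successive expansions of the trace moments\<close>

context gmodel
begin

lemma tr_mm_X: "tr (mm (X g) C) = (\<Sum>i\<in>I. bil (Yv g i) C (Yv g i) - trS i C)"
proof -
  have t: "trS i C = (\<Sum>a<d. \<Sum>c<d. Sg i a c * C c a)" for i
  proof -
    have "trS i C = (\<Sum>b<d. \<Sum>c<d. \<Sum>a<d. u i b a * u i b c * C c a)"
      unfolding trS_def bil_sum2 by (simp add: mult_ac)
    also have "\<dots> = (\<Sum>c<d. \<Sum>b<d. \<Sum>a<d. u i b a * u i b c * C c a)" by (rule sum.swap)
    also have "\<dots> = (\<Sum>c<d. \<Sum>a<d. \<Sum>b<d. u i b a * u i b c * C c a)" by (intro sum.cong refl sum.swap)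
    also have "\<dots> = (\<Sum>a<d. \<Sum>c<d. \<Sum>b<d. u i b a * u i b c * C c a)" by (rule sum.swap)
    finally show ?thesis by (simp add: Sg_def sum_distrib_right)
  qed
  have q: "bil y C y = (\<Sum>a<d. \<Sum>c<d. y a * y c * C c a)" for y
    unfolding bil_sum2 by (subst sum.swap) (simp add: mult_ac)
  have "tr (mm (X g) C) = (\<Sum>a<d. \<Sum>c<d. \<Sum>i\<in>I. Yv g i a * Yv g i c * C c a - Sg i a c * C c a)"
    by (simp add: tr_def mm_def X_def sum_distrib_right left_diff_distrib)
  also have "\<dots> = (\<Sum>a<d. \<Sum>i\<in>I. \<Sum>c<d. Yv g i a * Yv g i c * C c a - Sg i a c * C c a)"
    by (intro sum.cong refl sum.swap)
  also have "\<dots> = (\<Sum>i\<in>I. \<Sum>a<d. \<Sum>c<d. Yv g i a * Yv g i c * C c a - Sg i a c * C c a)" by (rule sum.swap)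
  finally show ?thesis by (simp add: t q sum_subtractf)
qed

text \<open>Splitting off one factor \<open>X g\<close> leaves quadratic forms in
  \<open>Yv g i\<close> minus their centering. The centering cancels the term of
  \<open>ibp_Y\<close> in which the derivative hits the other vector \<open>Yv g i\<close>.\<close>

lemma expansion1:
  "(\<integral>g. tr (mm (XP g (Suc k)) W) \<partial>\<gamma>) =
    (\<Sum>j<k. (\<Sum>i\<in>I. \<integral>g. trS i (XP g j) * bil (Yv g i) (XP g (k - 1 - j)) (mv W (Yv g i)) \<partial>\<gamma>)
       + (\<integral>g. formB (Yv g) ((!) [XP g j, mm (XP g (k - 1 - j)) W]) \<partial>\<gamma>))"
proof -
  let ?J = "I \<times> {..<d}"
  have pW: "polyfun ?J (\<lambda>g. W a c)" for a c by (rule polyfun_const)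
  have "(\<integral>g. tr (mm (XP g (Suc k)) W) \<partial>\<gamma>) = (\<integral>g. (\<Sum>i\<in>I. bil (Yv g i) (XP g k) (mv W (Yv g i)) - trS i (mm (XP g k) W)) \<partial>\<gamma>)"
    by (simp add: mm_assoc tr_mm_X bil_mm)
  also have "\<dots> = (\<Sum>i\<in>I. \<integral>g. bil (Yv g i) (XP g k) (mv W (Yv g i)) - trS i (mm (XP g k) W) \<partial>\<gamma>)"
    by (intro integral_sum_poly polyfun_diff) (auto intro!: poly_intros)
  also have "\<dots> = (\<Sum>i\<in>I. (\<Sum>j<k. \<integral>g. trS i (XP g j) * bil (Yv g i) (XP g (k - 1 - j)) (mv W (Yv g i)) \<partial>\<gamma>)
      + (\<Sum>j<k. \<integral>g. bil (Yv g i) (XP g j) (S i (mv (XP g (k - 1 - j)) (mv W (Yv g i)))) \<partial>\<gamma>))"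
  proof (intro sum.cong refl)
    fix i assume i: "i \<in> I"
    have "(\<integral>g. bil (Yv g i) (XP g k) (mv W (Yv g i)) - trS i (mm (XP g k) W) \<partial>\<gamma>) =
      (\<integral>g. bil (Yv g i) (XP g k) (mv W (Yv g i)) \<partial>\<gamma>) - (\<integral>g. trS i (mm (XP g k) W) \<partial>\<gamma>)"
      using i by (intro Bochner_Integration.integral_diff polyfun_integrable) (auto intro!: poly_intros)
    with ibp_Y[OF i polyfun_const[of _ 1] haspd_const, of k W]
    show "(\<integral>g. bil (Yv g i) (XP g k) (mv W (Yv g i)) - trS i (mm (XP g k) W) \<partial>\<gamma>) =
      (\<Sum>j<k. \<integral>g. trS i (XP g j) * bil (Yv g i) (XP g (k - 1 - j)) (mv W (Yv g i)) \<partial>\<gamma>)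
      + (\<Sum>j<k. \<integral>g. bil (Yv g i) (XP g j) (S i (mv (XP g (k - 1 - j)) (mv W (Yv g i)))) \<partial>\<gamma>)" by simp
  qed
  also have "\<dots> = (\<Sum>j<k. \<Sum>i\<in>I. \<integral>g. trS i (XP g j) * bil (Yv g i) (XP g (k - 1 - j)) (mv W (Yv g i)) \<partial>\<gamma>)
      + (\<Sum>j<k. \<Sum>i\<in>I. \<integral>g. bil (Yv g i) (XP g j) (S i (mv (XP g (k - 1 - j)) (mv W (Yv g i)))) \<partial>\<gamma>)"
    unfolding sum.distrib by (simp only: sum.swap[of _ "{..<k}" I])
  also have "(\<Sum>j<k. \<Sum>i\<in>I. \<integral>g. bil (Yv g i) (XP g j) (S i (mv (XP g (k - 1 - j)) (mv W (Yv g i)))) \<partial>\<gamma>)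
      = (\<Sum>j<k. \<integral>g. formB (Yv g) ((!) [XP g j, mm (XP g (k - 1 - j)) W]) \<partial>\<gamma>)"
  proof (intro sum.cong refl)
    fix j
    have "(\<integral>g. formB (Yv g) ((!) [XP g j, mm (XP g (k - 1 - j)) W]) \<partial>\<gamma>) =
       (\<integral>g. (\<Sum>i\<in>I. bil (Yv g i) (XP g j) (S i (mv (XP g (k - 1 - j)) (mv W (Yv g i))))) \<partial>\<gamma>)"
      by (simp add: formB_def mv_mm)
    also have "\<dots> = (\<Sum>i\<in>I. \<integral>g. bil (Yv g i) (XP g j) (S i (mv (XP g (k - 1 - j)) (mv W (Yv g i)))) \<partial>\<gamma>)"
      by (intro integral_sum_poly) (auto intro!: poly_intros)
    finally show "(\<Sum>i\<in>I. \<integral>g. bil (Yv g i) (XP g j) (S i (mv (XP g (k - 1 - j)) (mv W (Yv g i)))) \<partial>\<gamma>) =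
       (\<integral>g. formB (Yv g) ((!) [XP g j, mm (XP g (k - 1 - j)) W]) \<partial>\<gamma>)" by simp
  qed
  finally show ?thesis by (simp only: sum.distrib)
qed

lemma pd_trS_XP:
  assumes "l \<in> I" "b < d"
  shows "haspd (l, b) (\<lambda>g. trS i (XP g j))
    (\<lambda>g. \<Sum>a<j. bil (Yv g l) (XP g (j - 1 - a)) (S i (mv (XP g a) (u l b))) + bil (Yv g l) (XP g a) (S i (mv (XP g (j - 1 - a)) (u l b))))"
proof -
  have "haspd (l, b) (\<lambda>g. trS i (XP g j)) (\<lambda>g. \<Sum>c<d. bil (\<lambda>a. 0) (XP g j) (u i c) + bil (u i c) (XP g j) (\<lambda>a. 0) +
      (\<Sum>a<j. bil (u i c) (XP g a) (u l b) * bil (Yv g l) (XP g (j - 1 - a)) (u i c) + bil (u i c) (XP g a) (Yv g l) * bil (u l b) (XP g (j - 1 - a)) (u i c)))"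
    unfolding trS_def by (intro haspd_sum pd_bil_XP[where x = "\<lambda>g. u i _" and y = "\<lambda>g. u i _"] assms haspd_const)
  then show ?thesis
  proof (rule haspd_cong)
    fix g
    show "(\<Sum>c<d. bil (\<lambda>a. 0) (XP g j) (u i c) + bil (u i c) (XP g j) (\<lambda>a. 0) +
      (\<Sum>a<j. bil (u i c) (XP g a) (u l b) * bil (Yv g l) (XP g (j - 1 - a)) (u i c) + bil (u i c) (XP g a) (Yv g l) * bil (u l b) (XP g (j - 1 - a)) (u i c)))
     = (\<Sum>a<j. bil (Yv g l) (XP g (j - 1 - a)) (S i (mv (XP g a) (u l b))) + bil (Yv g l) (XP g a) (S i (mv (XP g (j - 1 - a)) (u l b))))"
      unfolding bil_zero add_0_left S_bil[symmetric] sum.distrib[symmetric]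
      by (subst sum.swap) (simp only: mult.commute[of "bil (u i _) (XP g _) (u l b)"] bil_symm[OF symm_XP, of "u l b"] bil_symm[OF symm_XP, of "u i _" g _ "Yv g l"])
  qed
qed

lemma bil_two_symm: assumes "symm P" "symm W" shows "bil y P (mv W x) = bil x (mm W P) y"
proof -
  have "bil y P (mv W x) = bil (mv W x) P y" by (rule bil_symm[OF assms(1)])
  also have "\<dots> = bil (mv P y) W x" by (simp only: bil_def ip_commute)
  also have "\<dots> = bil x W (mv P y)" by (rule bil_symm[OF assms(2)])
  finally show ?thesis by (simp only: bil_mm)
qed

text \<open>Symmetry of \<open>W\<close> is used to transpose the Leibniz terms so that
  \<open>u l b\<close> stands at the left end of each; the sum over \<open>b\<close> against the
  gradient of the other trace then contracts to \<open>S l\<close>.\<close>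

lemma pd_trS_XPW:
  assumes "l \<in> I" "b < d" "symm W"
  shows "haspd (l, b) (\<lambda>g. trS i (mm (XP g k) W))
    (\<lambda>g. \<Sum>e<k. bil (u l b) (XP g e) (S i (mv (mm W (XP g (k - 1 - e))) (Yv g l))) + bil (u l b) (mm (XP g (k - 1 - e)) W) (S i (mv (XP g e) (Yv g l))))"
proof -
  have "haspd (l, b) (\<lambda>g. trS i (mm (XP g k) W)) (\<lambda>g. \<Sum>c<d. bil (\<lambda>a. 0) (XP g k) (mv W (u i c)) + bil (u i c) (XP g k) (\<lambda>a. 0) +
      (\<Sum>e<k. bil (u i c) (XP g e) (u l b) * bil (Yv g l) (XP g (k - 1 - e)) (mv W (u i c)) + bil (u i c) (XP g e) (Yv g l) * bil (u l b) (XP g (k - 1 - e)) (mv W (u i c))))"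
    unfolding trS_def bil_mm
    by (intro haspd_sum pd_bil_XP[where x = "\<lambda>g. u i _" and y = "\<lambda>g. mv W (u i _)"] assms(1,2) haspd_const)
  then show ?thesis
  proof (rule haspd_cong)
    fix g
    show "(\<Sum>c<d. bil (\<lambda>a. 0) (XP g k) (mv W (u i c)) + bil (u i c) (XP g k) (\<lambda>a. 0) +
      (\<Sum>e<k. bil (u i c) (XP g e) (u l b) * bil (Yv g l) (XP g (k - 1 - e)) (mv W (u i c)) + bil (u i c) (XP g e) (Yv g l) * bil (u l b) (XP g (k - 1 - e)) (mv W (u i c))))
     = (\<Sum>e<k. bil (u l b) (XP g e) (S i (mv (mm W (XP g (k - 1 - e))) (Yv g l))) + bil (u l b) (mm (XP g (k - 1 - e)) W) (S i (mv (XP g e) (Yv g l))))"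
      unfolding bil_zero add_0_left S_bil[symmetric] sum.distrib[symmetric]
      by (subst sum.swap) (simp only: bil_two_symm[OF symm_XP assms(3), of "Yv g l"] bil_mm[of "u l b" "XP g _"]
         bil_symm[OF symm_XP, of "u i _" g _ "u l b"] mult.commute[of "bil (u i _) (XP g _) (Yv g l)"])
  qed
qed

text \<open>A second integration by parts, now with the trace \<open>trS i (XP g j)\<close> as the
  prefactor \<open>\<phi>\<close>. Its first term is the product of two traces that becomes the main
  term; the derivative of \<open>\<phi>\<close> yields the last sum.\<close>

lemma expansion2:
  assumes i: "i \<in> I"
  shows "(\<integral>g. trS i (XP g j) * bil (Yv g i) (XP g k) (mv W (Yv g i)) \<partial>\<gamma>) =
     (\<integral>g. trS i (XP g j) * trS i (mm (XP g k) W) \<partial>\<gamma>)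
     + (\<Sum>l<k. \<integral>g. trS i (XP g l) * bil (Yv g i) (mm (XP g (k - 1 - l)) W) (Yv g i) * trS i (XP g j) \<partial>\<gamma>)
     + (\<Sum>l<k. \<integral>g. bil (Yv g i) (XP g l) (S i (mv (mm (XP g (k - 1 - l)) W) (Yv g i))) * trS i (XP g j) \<partial>\<gamma>)
     + (\<Sum>l<j. (\<integral>g. bil (Yv g i) (XP g (j - 1 - l)) (S i (mv (XP g l) (S i (mv (mm (XP g k) W) (Yv g i))))) \<partial>\<gamma>)
         + (\<integral>g. bil (Yv g i) (XP g l) (S i (mv (XP g (j - 1 - l)) (S i (mv (mm (XP g k) W) (Yv g i))))) \<partial>\<gamma>))"
proof -
  let ?J = "I \<times> {..<d}"
  have p: "polyfun ?J (\<lambda>g. trS i (XP g j))" by (auto intro!: poly_intros)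
  have pW: "polyfun ?J (\<lambda>g. W a c)" for a c by (rule polyfun_const)
  have last: "(\<integral>g. (\<Sum>b<d. (\<Sum>a<j. bil (Yv g i) (XP g (j - 1 - a)) (S i (mv (XP g a) (u i b))) + bil (Yv g i) (XP g a) (S i (mv (XP g (j - 1 - a)) (u i b))))
       * bil (u i b) (XP g k) (mv W (Yv g i))) \<partial>\<gamma>) =
     (\<Sum>l<j. (\<integral>g. bil (Yv g i) (XP g (j - 1 - l)) (S i (mv (XP g l) (S i (mv (mm (XP g k) W) (Yv g i))))) \<partial>\<gamma>)
         + (\<integral>g. bil (Yv g i) (XP g l) (S i (mv (XP g (j - 1 - l)) (S i (mv (mm (XP g k) W) (Yv g i))))) \<partial>\<gamma>))"
  proof -
    have pt: "(\<Sum>b<d. (\<Sum>a<j. bil (Yv g i) (XP g (j - 1 - a)) (S i (mv (XP g a) (u i b))) + bil (Yv g i) (XP g a) (S i (mv (XP g (j - 1 - a)) (u i b))))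
       * bil (u i b) (XP g k) (mv W (Yv g i))) =
       (\<Sum>l<j. bil (Yv g i) (XP g (j - 1 - l)) (S i (mv (XP g l) (S i (mv (mm (XP g k) W) (Yv g i)))))
         + bil (Yv g i) (XP g l) (S i (mv (XP g (j - 1 - l)) (S i (mv (mm (XP g k) W) (Yv g i))))))" for g
    proof -
      have e: "(\<Sum>b<d. bil y A (S i (mv B (u i b))) * bil (u i b) (XP g k) (mv W (Yv g i))) = bil y A (S i (mv B (S i (mv (mm (XP g k) W) (Yv g i)))))" for y A B
        unfolding bil_S_mv[of y A i B] S_bil by (simp only: mv_mm)
      show ?thesis
        unfolding sum_distrib_right distrib_right by (subst sum.swap) (simp only: sum.distrib e)
    qed
    have q: "polyfun ?J (\<lambda>g. bil (Yv g i) (XP g (j - 1 - l)) (S i (mv (XP g l) (S i (mv (mm (XP g k) W) (Yv g i))))))"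
      "polyfun ?J (\<lambda>g. bil (Yv g i) (XP g l) (S i (mv (XP g (j - 1 - l)) (S i (mv (mm (XP g k) W) (Yv g i))))))" for l
      using i by (auto intro!: poly_intros pW)
    show ?thesis unfolding pt
      by (subst integral_sum_poly, intro polyfun_add q)
        (intro sum.cong refl Bochner_Integration.integral_add polyfun_integrable q)
  qed
  have "(\<integral>g. trS i (XP g j) * bil (Yv g i) (XP g k) (mv W (Yv g i)) \<partial>\<gamma>) =
     (\<integral>g. trS i (XP g j) * trS i (mm (XP g k) W) \<partial>\<gamma>)
     + (\<Sum>l<k. \<integral>g. trS i (XP g j) * (trS i (XP g l) * bil (Yv g i) (XP g (k - 1 - l)) (mv W (Yv g i))) \<partial>\<gamma>)
     + (\<Sum>l<k. \<integral>g. trS i (XP g j) * bil (Yv g i) (XP g l) (S i (mv (XP g (k - 1 - l)) (mv W (Yv g i)))) \<partial>\<gamma>)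
     + (\<integral>g. (\<Sum>b<d. (\<Sum>a<j. bil (Yv g i) (XP g (j - 1 - a)) (S i (mv (XP g a) (u i b))) + bil (Yv g i) (XP g a) (S i (mv (XP g (j - 1 - a)) (u i b))))
       * bil (u i b) (XP g k) (mv W (Yv g i))) \<partial>\<gamma>)"
    by (rule ibp_Y[OF i p pd_trS_XP[OF i]])
  then show ?thesis unfolding last by (simp only: mv_mm bil_mm mult_ac)
qed

text \<open>Summing over the coordinates \<open>b\<close> of index \<open>l\<close> replaces the
  pair \<open>u l b\<close>, \<open>u l b\<close> by \<open>S l\<close>. Each gradient consists of
  two Leibniz families, which makes four forms.\<close>

lemma form_D_pointwise:
  assumes W: "symm W"
  shows "(\<Sum>i\<in>I. \<Sum>\<kappa>\<in>I \<times> {..<d}.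
      (\<Sum>a<j. bil (Yv g (fst \<kappa>)) (XP g (j - 1 - a)) (S i (mv (XP g a) (u (fst \<kappa>) (snd \<kappa>)))) + bil (Yv g (fst \<kappa>)) (XP g a) (S i (mv (XP g (j - 1 - a)) (u (fst \<kappa>) (snd \<kappa>)))))
      * (\<Sum>e<k. bil (u (fst \<kappa>) (snd \<kappa>)) (XP h e) (S i (mv (mm W (XP h (k - 1 - e))) (Yv h (fst \<kappa>)))) + bil (u (fst \<kappa>) (snd \<kappa>)) (mm (XP h (k - 1 - e)) W) (S i (mv (XP h e) (Yv h (fst \<kappa>))))))
    = (\<Sum>a<j. \<Sum>e<k.
        formD (Yv g) (Yv h) ((!) [XP g (j - 1 - a), XP g a, XP h e, mm W (XP h (k - 1 - e))])
      + formD (Yv g) (Yv h) ((!) [XP g (j - 1 - a), XP g a, mm (XP h (k - 1 - e)) W, XP h e])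
      + (formD (Yv g) (Yv h) ((!) [XP g a, XP g (j - 1 - a), XP h e, mm W (XP h (k - 1 - e))])
      + formD (Yv g) (Yv h) ((!) [XP g a, XP g (j - 1 - a), mm (XP h (k - 1 - e)) W, XP h e])))" (is "?L = ?R")
proof -
  define F where "F l i A B C E = bil (Yv g l) A (S i (mv B (S l (mv C (S i (mv E (Yv h l)))))))" for l i A B C E
  have e: "(\<Sum>b<d. bil (Yv g l) A (S i (mv B (u l b))) * bil (u l b) C (S i (mv E (Yv h l)))) = F l i A B C E" for l i A B C E
    unfolding F_def bil_S_mv[of "Yv g l" A i B] S_bil ..
  have "?L = (\<Sum>i\<in>I. \<Sum>l\<in>I. \<Sum>b<d.
      (\<Sum>a<j. bil (Yv g l) (XP g (j - 1 - a)) (S i (mv (XP g a) (u l b))) + bil (Yv g l) (XP g a) (S i (mv (XP g (j - 1 - a)) (u l b))))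
      * (\<Sum>e<k. bil (u l b) (XP h e) (S i (mv (mm W (XP h (k - 1 - e))) (Yv h l))) + bil (u l b) (mm (XP h (k - 1 - e)) W) (S i (mv (XP h e) (Yv h l)))))"
    unfolding sum.cartesian_product by (simp add: case_prod_unfold)
  also have "\<dots> = (\<Sum>l\<in>I. \<Sum>i\<in>I. \<Sum>b<d. \<Sum>a<j. \<Sum>e<k.
      (bil (Yv g l) (XP g (j - 1 - a)) (S i (mv (XP g a) (u l b))) + bil (Yv g l) (XP g a) (S i (mv (XP g (j - 1 - a)) (u l b))))
      * (bil (u l b) (XP h e) (S i (mv (mm W (XP h (k - 1 - e))) (Yv h l))) + bil (u l b) (mm (XP h (k - 1 - e)) W) (S i (mv (XP h e) (Yv h l)))))"
    unfolding sum_product by (rule sum.swap)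
  also have "\<dots> = (\<Sum>l\<in>I. \<Sum>i\<in>I. \<Sum>a<j. \<Sum>e<k. \<Sum>b<d.
      (bil (Yv g l) (XP g (j - 1 - a)) (S i (mv (XP g a) (u l b))) + bil (Yv g l) (XP g a) (S i (mv (XP g (j - 1 - a)) (u l b))))
      * (bil (u l b) (XP h e) (S i (mv (mm W (XP h (k - 1 - e))) (Yv h l))) + bil (u l b) (mm (XP h (k - 1 - e)) W) (S i (mv (XP h e) (Yv h l)))))"
    by (simp only: sum.swap[of _ _ "{..<d}"])
  also have "\<dots> = (\<Sum>l\<in>I. \<Sum>i\<in>I. \<Sum>a<j. \<Sum>e<k.
      F l i (XP g (j - 1 - a)) (XP g a) (XP h e) (mm W (XP h (k - 1 - e))) + F l i (XP g (j - 1 - a)) (XP g a) (mm (XP h (k - 1 - e)) W) (XP h e)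
      + (F l i (XP g a) (XP g (j - 1 - a)) (XP h e) (mm W (XP h (k - 1 - e))) + F l i (XP g a) (XP g (j - 1 - a)) (mm (XP h (k - 1 - e)) W) (XP h e)))"
    unfolding distrib_left distrib_right sum.distrib e by (simp only: add_ac)
  also have "\<dots> = (\<Sum>a<j. \<Sum>e<k. \<Sum>l\<in>I. \<Sum>i\<in>I.
      F l i (XP g (j - 1 - a)) (XP g a) (XP h e) (mm W (XP h (k - 1 - e))) + F l i (XP g (j - 1 - a)) (XP g a) (mm (XP h (k - 1 - e)) W) (XP h e)
      + (F l i (XP g a) (XP g (j - 1 - a)) (XP h e) (mm W (XP h (k - 1 - e))) + F l i (XP g a) (XP g (j - 1 - a)) (mm (XP h (k - 1 - e)) W) (XP h e)))"
    by (simp only: sum.swap[of _ I "{..<j}"] sum.swap[of _ I "{..<k}"])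
  also have "\<dots> = ?R"
    by (simp add: formD_def F_def sum.distrib)
  finally show ?thesis .
qed

end

lemma integral_double_sum4:
  fixes A B C D :: "nat \<Rightarrow> nat \<Rightarrow> 'a \<Rightarrow> real"
  assumes "\<And>a e. integrable M (A a e)" "\<And>a e. integrable M (B a e)" "\<And>a e. integrable M (C a e)" "\<And>a e. integrable M (D a e)"
  shows "(\<integral>z. (\<Sum>a<j. \<Sum>e<k. A a e z + B a e z + (C a e z + D a e z)) \<partial>M) =
    (\<Sum>a<j. \<Sum>e<k. (\<integral>z. A a e z \<partial>M) + (\<integral>z. B a e z \<partial>M) + ((\<integral>z. C a e z \<partial>M) + (\<integral>z. D a e z \<partial>M)))"
  using assms by (simp add: Bochner_Integration.integral_sum)

lemma abs_add4: "\<bar>a\<bar> \<le> D \<Longrightarrow> \<bar>b\<bar> \<le> D \<Longrightarrow> \<bar>c\<bar> \<le> D \<Longrightarrow> \<bar>e\<bar> \<le> D \<Longrightarrow> \<bar>a + b + (c + e)\<bar> \<le> 4 * (D :: real)"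
  by linarith

lemma abs_sum5: "\<bar>t - m\<bar> \<le> A \<Longrightarrow> \<bar>c1\<bar> \<le> B \<Longrightarrow> \<bar>c2\<bar> \<le> B \<Longrightarrow> \<bar>c3\<bar> \<le> 2 * B \<Longrightarrow> \<bar>b\<bar> \<le> D \<Longrightarrow>
    \<bar>((t + c1 + c2 + c3) + b) - m\<bar> \<le> A + 4 * B + (D :: real)"
  by linarith

section \<open>Mean powers and collection of the error terms\<close>

context gmodel
begin

definition Mm :: "nat \<Rightarrow> nat \<Rightarrow> nat \<Rightarrow> real" where
  "Mm j = (\<lambda>a c. \<integral>g. XP g j a c \<partial>\<gamma>)"

lemma int_bil: "(\<integral>g. bil x (XP g j) y \<partial>\<gamma>) = bil x (Mm j) y"
proof -
  have "(\<integral>g. bil x (XP g j) y \<partial>\<gamma>) = (\<integral>g. (\<Sum>a<d. \<Sum>c<d. x a * XP g j a c * y c) \<partial>\<gamma>)" by (simp add: bil_sum2)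
  also have "\<dots> = (\<Sum>a<d. \<integral>g. (\<Sum>c<d. x a * XP g j a c * y c) \<partial>\<gamma>)"
    by (intro integral_sum_poly polyfun_sum polyfun_mult polyfun_const poly_XP) auto
  also have "\<dots> = (\<Sum>a<d. \<Sum>c<d. \<integral>g. x a * XP g j a c * y c \<partial>\<gamma>)"
    by (intro sum.cong refl integral_sum_poly polyfun_mult polyfun_const poly_XP) auto
  also have "\<dots> = (\<Sum>a<d. \<Sum>c<d. x a * Mm j a c * y c)" by (simp add: Mm_def)
  finally show ?thesis by (simp add: bil_sum2)
qed

lemma int_trS: "(\<integral>g. trS i (XP g j) \<partial>\<gamma>) = trS i (Mm j)"
  unfolding trS_def by (subst integral_sum_poly) (auto intro!: poly_bil_XP polyfun_const simp: int_bil)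

lemma int_trS_mm: "(\<integral>g. trS i (mm (XP g j) W) \<partial>\<gamma>) = trS i (mm (Mm j) W)"
  unfolding trS_def bil_mm by (subst integral_sum_poly) (auto intro!: poly_bil_XP polyfun_const simp: int_bil)

lemma int_tr_mm: "(\<integral>g. tr (mm (XP g j) W) \<partial>\<gamma>) = tr (mm (Mm j) W)"
proof -
  have "(\<integral>g. tr (mm (XP g j) W) \<partial>\<gamma>) = (\<Sum>a<d. \<integral>g. (\<Sum>c<d. XP g j a c * W c a) \<partial>\<gamma>)"
    unfolding tr_def mm_def by (intro integral_sum_poly polyfun_sum polyfun_mult polyfun_const poly_XP) auto
  also have "\<dots> = (\<Sum>a<d. \<Sum>c<d. \<integral>g. XP g j a c * W c a \<partial>\<gamma>)"
    by (intro sum.cong refl integral_sum_poly polyfun_mult polyfun_const poly_XP) auto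
  finally show ?thesis by (simp add: tr_def mm_def Mm_def)
qed

lemma symm_Mm: "symm (Mm j)"
  using symm_XP by (auto simp: symm_def Mm_def intro!: Bochner_Integration.integral_cong)

lemma expansion3:
  "(\<Sum>i\<in>I. \<integral>g. trS i (XP g j) * bil (Yv g i) (XP g k) (mv W (Yv g i)) \<partial>\<gamma>) =
     (\<Sum>i\<in>I. \<integral>g. trS i (XP g j) * trS i (mm (XP g k) W) \<partial>\<gamma>)
     + (\<Sum>l<k. \<integral>g. formC1 (Yv g) ((!) [XP g l, mm (XP g (k - 1 - l)) W, XP g j]) \<partial>\<gamma>)
     + (\<Sum>l<k. \<integral>g. formC2 (Yv g) ((!) [XP g l, mm (XP g (k - 1 - l)) W, XP g j]) \<partial>\<gamma>)
     + (\<Sum>l<j. (\<integral>g. formC3 (Yv g) ((!) [XP g (j - 1 - l), XP g l, mm (XP g k) W]) \<partial>\<gamma>)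
         + (\<integral>g. formC3 (Yv g) ((!) [XP g l, XP g (j - 1 - l), mm (XP g k) W]) \<partial>\<gamma>))"
proof -
  let ?J = "I \<times> {..<d}"
  have pW: "polyfun ?J (\<lambda>g. W a c)" for a c by (rule polyfun_const)
  have C1: "(\<integral>g. formC1 (Yv g) ((!) [XP g l, mm (XP g m) W, XP g j]) \<partial>\<gamma>) =
     (\<Sum>i\<in>I. \<integral>g. trS i (XP g l) * bil (Yv g i) (mm (XP g m) W) (Yv g i) * trS i (XP g j) \<partial>\<gamma>)" for l m
    by (simp add: formC1_def) (rule integral_sum_poly, auto intro!: poly_intros pW)
  have C2: "(\<integral>g. formC2 (Yv g) ((!) [XP g l, mm (XP g m) W, XP g j]) \<partial>\<gamma>) =
     (\<Sum>i\<in>I. \<integral>g. bil (Yv g i) (XP g l) (S i (mv (mm (XP g m) W) (Yv g i))) * trS i (XP g j) \<partial>\<gamma>)" for l m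
    by (simp add: formC2_def) (rule integral_sum_poly, auto intro!: poly_intros pW)
  have C3: "(\<integral>g. formC3 (Yv g) ((!) [XP g l, XP g m, mm (XP g k) W]) \<partial>\<gamma>) =
     (\<Sum>i\<in>I. \<integral>g. bil (Yv g i) (XP g l) (S i (mv (XP g m) (S i (mv (mm (XP g k) W) (Yv g i))))) \<partial>\<gamma>)" for l m
    by (simp add: formC3_def) (rule integral_sum_poly, auto intro!: poly_intros pW)
  have "(\<Sum>i\<in>I. \<integral>g. trS i (XP g j) * bil (Yv g i) (XP g k) (mv W (Yv g i)) \<partial>\<gamma>) =
    (\<Sum>i\<in>I. (\<integral>g. trS i (XP g j) * trS i (mm (XP g k) W) \<partial>\<gamma>)
     + (\<Sum>l<k. \<integral>g. trS i (XP g l) * bil (Yv g i) (mm (XP g (k - 1 - l)) W) (Yv g i) * trS i (XP g j) \<partial>\<gamma>)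
     + (\<Sum>l<k. \<integral>g. bil (Yv g i) (XP g l) (S i (mv (mm (XP g (k - 1 - l)) W) (Yv g i))) * trS i (XP g j) \<partial>\<gamma>)
     + (\<Sum>l<j. (\<integral>g. bil (Yv g i) (XP g (j - 1 - l)) (S i (mv (XP g l) (S i (mv (mm (XP g k) W) (Yv g i))))) \<partial>\<gamma>)
         + (\<integral>g. bil (Yv g i) (XP g l) (S i (mv (XP g (j - 1 - l)) (S i (mv (mm (XP g k) W) (Yv g i))))) \<partial>\<gamma>)))"
    by (intro sum.cong refl expansion2)
  then show ?thesis
    unfolding C1 C2 C3 sum.distrib by (simp only: sum.swap[of _ I "{..<k}"] sum.swap[of _ I "{..<j}"])
qed

text \<open>The two traces are decoupled by \<open>gaussian_covariance\<close>. The gradient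
  correlation consists of four forms for each of the \<open>j * k\<close> pairs of positions, so
  \<open>8 = 2 * 4\<close>.\<close>

lemma poly_formD_bound:
  assumes W: "symm W"
    and hD: "\<And>\<theta> a b e f. a + b + e + f + 2 = j + k \<Longrightarrow>
        \<bar>\<integral>z. formD (Yv (fst z)) (Yv (rot \<theta> z)) ((!) [XP (fst z) a, XP (fst z) b, XP (rot \<theta> z) e, mm W (XP (rot \<theta> z) f)]) \<partial>PP\<bar> \<le> bD"
      "\<And>\<theta> a b e f. a + b + e + f + 2 = j + k \<Longrightarrow>
        \<bar>\<integral>z. formD (Yv (fst z)) (Yv (rot \<theta> z)) ((!) [XP (fst z) a, XP (fst z) b, mm (XP (rot \<theta> z) e) W, XP (rot \<theta> z) f]) \<partial>PP\<bar> \<le> bD"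
    and hI: "\<And>\<theta> a b e f. integrable PP (\<lambda>z. formD (Yv (fst z)) (Yv (rot \<theta> z)) ((!) [XP (fst z) a, XP (fst z) b, XP (rot \<theta> z) e, mm W (XP (rot \<theta> z) f)]))"
      "\<And>\<theta> a b e f. integrable PP (\<lambda>z. formD (Yv (fst z)) (Yv (rot \<theta> z)) ((!) [XP (fst z) a, XP (fst z) b, mm (XP (rot \<theta> z) e) W, XP (rot \<theta> z) f]))"
  shows "\<bar>(\<Sum>i\<in>I. \<integral>g. trS i (XP g j) * trS i (mm (XP g k) W) \<partial>\<gamma>) - formM ((!) [Mm j, mm (Mm k) W])\<bar> \<le> 8 * real j * real k * bD"
proof -
  let ?d1 = "\<lambda>i \<kappa> g. (\<Sum>a<j. bil (Yv g (fst \<kappa>)) (XP g (j - 1 - a)) (S i (mv (XP g a) (u (fst \<kappa>) (snd \<kappa>)))) + bil (Yv g (fst \<kappa>)) (XP g a) (S i (mv (XP g (j - 1 - a)) (u (fst \<kappa>) (snd \<kappa>)))))"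
  let ?d2 = "\<lambda>i \<kappa> h. (\<Sum>e<k. bil (u (fst \<kappa>) (snd \<kappa>)) (XP h e) (S i (mv (mm W (XP h (k - 1 - e))) (Yv h (fst \<kappa>)))) + bil (u (fst \<kappa>) (snd \<kappa>)) (mm (XP h (k - 1 - e)) W) (S i (mv (XP h e) (Yv h (fst \<kappa>)))))"
  let ?f1 = "\<lambda>\<theta> z a b e f. formD (Yv (fst z)) (Yv (rot \<theta> z)) ((!) [XP (fst z) a, XP (fst z) b, XP (rot \<theta> z) e, mm W (XP (rot \<theta> z) f)])"
  let ?f2 = "\<lambda>\<theta> z a b e f. formD (Yv (fst z)) (Yv (rot \<theta> z)) ((!) [XP (fst z) a, XP (fst z) b, mm (XP (rot \<theta> z) e) W, XP (rot \<theta> z) f])"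
  have pW: "polyfun (I \<times> {..<d}) (\<lambda>g. W a c)" for a c by (rule polyfun_const)
  have "\<bar>(\<Sum>i\<in>I. \<integral>g. trS i (XP g j) * trS i (mm (XP g k) W) \<partial>\<gamma>) - (\<Sum>i\<in>I. (\<integral>g. trS i (XP g j) \<partial>\<gamma>) * (\<integral>g. trS i (mm (XP g k) W) \<partial>\<gamma>))\<bar>
     \<le> 2 * (\<Sum>a<j. \<Sum>e<k. 4 * bD)"
  proof (rule gaussian_covariance[where d\<phi> = ?d1 and df = ?d2])
    show "polyfun (I \<times> {..<d}) (\<lambda>g. trS i (XP g j))" for i by (auto intro!: poly_intros)
    show "polyfun (I \<times> {..<d}) (\<lambda>g. trS i (mm (XP g k) W))" for i by (auto intro!: poly_intros pW)
    show "haspd \<kappa> (\<lambda>g. trS i (XP g j)) (?d1 i \<kappa>)" if "\<kappa> \<in> I \<times> {..<d}" for i \<kappa>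
    proof -
      from that obtain l b where \<kappa>: "\<kappa> = (l, b)" "l \<in> I" "b < d" by auto
      show ?thesis unfolding \<kappa>(1) fst_conv snd_conv by (rule pd_trS_XP[OF \<kappa>(2,3)])
    qed
    show "haspd \<kappa> (\<lambda>g. trS i (mm (XP g k) W)) (?d2 i \<kappa>)" if "\<kappa> \<in> I \<times> {..<d}" for i \<kappa>
    proof -
      from that obtain l b where \<kappa>: "\<kappa> = (l, b)" "l \<in> I" "b < d" by auto
      show ?thesis unfolding \<kappa>(1) fst_conv snd_conv by (rule pd_trS_XPW[OF \<kappa>(2,3) W])
    qed
    fix \<theta>
    have E1: "(\<integral>z. (\<Sum>i\<in>I. \<Sum>\<kappa>\<in>I \<times> {..<d}. ?d1 i \<kappa> (fst z) * ?d2 i \<kappa> (rot \<theta> z)) \<partial>PP) =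
       (\<integral>z. (\<Sum>a<j. \<Sum>e<k. ?f1 \<theta> z (j - 1 - a) a e (k - 1 - e) + ?f2 \<theta> z (j - 1 - a) a (k - 1 - e) e
          + (?f1 \<theta> z a (j - 1 - a) e (k - 1 - e) + ?f2 \<theta> z a (j - 1 - a) (k - 1 - e) e)) \<partial>PP)"
      by (rule Bochner_Integration.integral_cong[OF refl]) (rule form_D_pointwise[OF W])
    have E2: "\<dots> = (\<Sum>a<j. \<Sum>e<k. (\<integral>z. ?f1 \<theta> z (j - 1 - a) a e (k - 1 - e) \<partial>PP) + (\<integral>z. ?f2 \<theta> z (j - 1 - a) a (k - 1 - e) e \<partial>PP)
          + ((\<integral>z. ?f1 \<theta> z a (j - 1 - a) e (k - 1 - e) \<partial>PP) + (\<integral>z. ?f2 \<theta> z a (j - 1 - a) (k - 1 - e) e \<partial>PP)))"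
      by (rule integral_double_sum4) (rule hI)+
    have B: "\<bar>\<dots>\<bar> \<le> (\<Sum>a<j. \<Sum>e<k. 4 * bD)"
    proof (intro order_trans[OF sum_abs] sum_mono)
      fix a assume a: "a \<in> {..<j}"
      fix e assume e: "e \<in> {..<k}"
      have h: "\<bar>\<integral>z. ?f1 \<theta> z (j - 1 - a) a e (k - 1 - e) \<partial>PP\<bar> \<le> bD" "\<bar>\<integral>z. ?f2 \<theta> z (j - 1 - a) a (k - 1 - e) e \<partial>PP\<bar> \<le> bD"
        "\<bar>\<integral>z. ?f1 \<theta> z a (j - 1 - a) e (k - 1 - e) \<partial>PP\<bar> \<le> bD" "\<bar>\<integral>z. ?f2 \<theta> z a (j - 1 - a) (k - 1 - e) e \<partial>PP\<bar> \<le> bD"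
        by (rule hD; use a e in simp)+
      show "\<bar>(\<integral>z. ?f1 \<theta> z (j - 1 - a) a e (k - 1 - e) \<partial>PP) + (\<integral>z. ?f2 \<theta> z (j - 1 - a) a (k - 1 - e) e \<partial>PP)
          + ((\<integral>z. ?f1 \<theta> z a (j - 1 - a) e (k - 1 - e) \<partial>PP) + (\<integral>z. ?f2 \<theta> z a (j - 1 - a) (k - 1 - e) e \<partial>PP))\<bar> \<le> 4 * bD"
        by (rule abs_add4[OF h])
    qed
    show "\<bar>\<integral>z. (\<Sum>i\<in>I. \<Sum>\<kappa>\<in>I \<times> {..<d}. ?d1 i \<kappa> (fst z) * ?d2 i \<kappa> (rot \<theta> z)) \<partial>PP\<bar> \<le> (\<Sum>a<j. \<Sum>e<k. 4 * bD)"
      by (rule ord_eq_le_trans[OF arg_cong[where f = abs, OF trans[OF E1 E2]] B])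
  qed
  then show ?thesis by (simp add: int_trS int_trS_mm formM_def)
qed

lemma good_formD:
  "integrable PP (\<lambda>z. formD (Yv (fst z)) (Yv (rot \<theta> z)) ((!) [XP (fst z) a, XP (fst z) b, XP (rot \<theta> z) e, mm W (XP (rot \<theta> z) f)]))"
  "integrable PP (\<lambda>z. formD (Yv (fst z)) (Yv (rot \<theta> z)) ((!) [XP (fst z) a, XP (fst z) b, mm (XP (rot \<theta> z) e) W, XP (rot \<theta> z) f]))"
proof -
  have gX: "good (\<lambda>\<theta> z. XP (fst z) k a c)" "good (\<lambda>\<theta> z. XP (rot \<theta> z) k a c)" if "a < d" "c < d" for k a c
    using good_fst[OF poly_XP[OF that]] good_rot[OF poly_XP[OF that]] by auto
  have gY: "good (\<lambda>\<theta> z. Yv (fst z) i a)" "good (\<lambda>\<theta> z. Yv (rot \<theta> z) i a)" if "i \<in> I" for i a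
    using good_fst[OF poly_Y[OF that]] good_rot[OF poly_Y[OF that]] by auto
  have gc: "good (\<lambda>\<theta> z. c)" for c :: real by (rule good_bounded[where C = "\<bar>c\<bar>"]) simp
  have gmv: "good (\<lambda>\<theta> z. mv (M \<theta> z) (y \<theta> z) a)" if "\<And>a c. a < d \<Longrightarrow> c < d \<Longrightarrow> good (\<lambda>\<theta> z. M \<theta> z a c)" "\<And>a. a < d \<Longrightarrow> good (\<lambda>\<theta> z. y \<theta> z a)" "a < d" for M y a
    unfolding mv_def using that by (intro good_sum good_mult) auto
  have gmm: "good (\<lambda>\<theta> z. mm (M \<theta> z) (N \<theta> z) a c)" if "\<And>a c. a < d \<Longrightarrow> c < d \<Longrightarrow> good (\<lambda>\<theta> z. M \<theta> z a c)" "\<And>a c. a < d \<Longrightarrow> c < d \<Longrightarrow> good (\<lambda>\<theta> z. N \<theta> z a c)" "a < d" "c < d" for M N a c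
    unfolding mm_def using that by (intro good_sum good_mult) auto
  have gb: "good (\<lambda>\<theta> z. bil (x \<theta> z) (M \<theta> z) (y \<theta> z))" if "\<And>a c. a < d \<Longrightarrow> c < d \<Longrightarrow> good (\<lambda>\<theta> z. M \<theta> z a c)" "\<And>a. a < d \<Longrightarrow> good (\<lambda>\<theta> z. y \<theta> z a)" "\<And>a. a < d \<Longrightarrow> good (\<lambda>\<theta> z. x \<theta> z a)" for M x y
    unfolding bil_sum2 using that by (intro good_sum good_mult) auto
  have gS: "good (\<lambda>\<theta> z. S i (y \<theta> z) a)" if "\<And>a. a < d \<Longrightarrow> good (\<lambda>\<theta> z. y \<theta> z a)" "a < d" for i y a
    unfolding S_def ip_def using that by (intro good_sum good_mult gc) auto
  show "integrable PP (\<lambda>z. formD (Yv (fst z)) (Yv (rot \<theta> z)) ((!) [XP (fst z) a, XP (fst z) b, XP (rot \<theta> z) e, mm W (XP (rot \<theta> z) f)]))"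
    by (rule good_integrable[where \<Psi> = "\<lambda>\<theta> z. formD (Yv (fst z)) (Yv (rot \<theta> z)) ((!) [XP (fst z) a, XP (fst z) b, XP (rot \<theta> z) e, mm W (XP (rot \<theta> z) f)])"])
      (auto simp: formD_def intro!: good_sum gb gS gmv gmm gX gY gc)
  show "integrable PP (\<lambda>z. formD (Yv (fst z)) (Yv (rot \<theta> z)) ((!) [XP (fst z) a, XP (fst z) b, mm (XP (rot \<theta> z) e) W, XP (rot \<theta> z) f]))"
    by (rule good_integrable[where \<Psi> = "\<lambda>\<theta> z. formD (Yv (fst z)) (Yv (rot \<theta> z)) ((!) [XP (fst z) a, XP (fst z) b, mm (XP (rot \<theta> z) e) W, XP (rot \<theta> z) f])"])
      (auto simp: formD_def intro!: good_sum gb gS gmv gmm gX gY gc)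
qed

text \<open>Counting: for each of the \<open>k\<close> values of \<open>j\<close> there are one form
  B, at most \<open>k\<close> forms C1, \<open>k\<close> forms C2 and \<open>2 * k\<close> forms C3,
  and a decoupling error of at most \<open>8 * k\<^sup>2\<close> forms D. The total degrees in
  \<open>X\<close> are \<open>k - 1\<close>, \<open>k - 2\<close> and \<open>k - 3\<close>, so every
  further step costs one more power of \<open>\<mu>\<close>.\<close>

theorem approximate_dyson_equation:
  assumes W: "symm W"
    and hB: "\<And>a b. a + b + 1 = k \<Longrightarrow> \<bar>\<integral>g. formB (Yv g) ((!) [XP g a, mm (XP g b) W]) \<partial>\<gamma>\<bar> \<le> bB"
    and hC1: "\<And>a b c. a + b + c + 2 = k \<Longrightarrow> \<bar>\<integral>g. formC1 (Yv g) ((!) [XP g a, mm (XP g b) W, XP g c]) \<partial>\<gamma>\<bar> \<le> bC"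
    and hC2: "\<And>a b c. a + b + c + 2 = k \<Longrightarrow> \<bar>\<integral>g. formC2 (Yv g) ((!) [XP g a, mm (XP g b) W, XP g c]) \<partial>\<gamma>\<bar> \<le> bC"
    and hC3: "\<And>a b c. a + b + c + 2 = k \<Longrightarrow> \<bar>\<integral>g. formC3 (Yv g) ((!) [XP g a, XP g b, mm (XP g c) W]) \<partial>\<gamma>\<bar> \<le> bC"
    and hD: "\<And>\<theta> a b e f. a + b + e + f + 3 = k \<Longrightarrow>
        \<bar>\<integral>z. formD (Yv (fst z)) (Yv (rot \<theta> z)) ((!) [XP (fst z) a, XP (fst z) b, XP (rot \<theta> z) e, mm W (XP (rot \<theta> z) f)]) \<partial>PP\<bar> \<le> bD"
      "\<And>\<theta> a b e f. a + b + e + f + 3 = k \<Longrightarrow>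
        \<bar>\<integral>z. formD (Yv (fst z)) (Yv (rot \<theta> z)) ((!) [XP (fst z) a, XP (fst z) b, mm (XP (rot \<theta> z) e) W, XP (rot \<theta> z) f]) \<partial>PP\<bar> \<le> bD"
    and nn: "0 \<le> bC" "0 \<le> bD"
  shows "\<bar>tr (mm (Mm (Suc k)) W) - (\<Sum>j<k. formM ((!) [Mm j, mm (Mm (k - 1 - j)) W]))\<bar> \<le> real k * bB + 4 * (real k)\<^sup>2 * bC + 8 * real k ^ 3 * bD"
proof -
  let ?T = "\<lambda>j. \<Sum>i\<in>I. \<integral>g. trS i (XP g j) * trS i (mm (XP g (k - 1 - j)) W) \<partial>\<gamma>"
  let ?B = "\<lambda>j. \<integral>g. formB (Yv g) ((!) [XP g j, mm (XP g (k - 1 - j)) W]) \<partial>\<gamma>"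
  let ?C1 = "\<lambda>j. \<Sum>l<k - 1 - j. \<integral>g. formC1 (Yv g) ((!) [XP g l, mm (XP g (k - 1 - j - 1 - l)) W, XP g j]) \<partial>\<gamma>"
  let ?C2 = "\<lambda>j. \<Sum>l<k - 1 - j. \<integral>g. formC2 (Yv g) ((!) [XP g l, mm (XP g (k - 1 - j - 1 - l)) W, XP g j]) \<partial>\<gamma>"
  let ?C3 = "\<lambda>j. \<Sum>l<j. (\<integral>g. formC3 (Yv g) ((!) [XP g (j - 1 - l), XP g l, mm (XP g (k - 1 - j)) W]) \<partial>\<gamma>)
         + (\<integral>g. formC3 (Yv g) ((!) [XP g l, XP g (j - 1 - l), mm (XP g (k - 1 - j)) W]) \<partial>\<gamma>)"
  let ?M = "\<lambda>j. formM ((!) [Mm j, mm (Mm (k - 1 - j)) W])"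
  have eq: "tr (mm (Mm (Suc k)) W) = (\<Sum>j<k. (?T j + ?C1 j + ?C2 j + ?C3 j) + ?B j)"
    unfolding int_tr_mm[symmetric] expansion1 expansion3 ..
  have one: "\<bar>((?T j + ?C1 j + ?C2 j + ?C3 j) + ?B j) - ?M j\<bar> \<le> 8 * (real k)\<^sup>2 * bD + 4 * (real k * bC) + bB" if j: "j < k" for j
  proof -
    have T: "\<bar>?T j - ?M j\<bar> \<le> 8 * (real k)\<^sup>2 * bD"
    proof -
      have "\<bar>?T j - ?M j\<bar> \<le> 8 * real j * real (k - 1 - j) * bD"
        using j by (intro poly_formD_bound W hD good_formD) auto
      also have "\<dots> \<le> 8 * real k * real k * bD"
        using j nn by (intro mult_right_mono mult_mono) auto
      finally show ?thesis by (simp add: power2_eq_square)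
    qed
    have C1: "\<bar>?C1 j\<bar> \<le> real k * bC"
    proof -
      have "\<bar>?C1 j\<bar> \<le> (\<Sum>l<k - 1 - j. bC)" using j by (intro order_trans[OF sum_abs] sum_mono hC1) auto
      also have "\<dots> = real (k - 1 - j) * bC" by simp
      also have "\<dots> \<le> real k * bC" using nn by (intro mult_right_mono) auto
      finally show ?thesis .
    qed
    have C2: "\<bar>?C2 j\<bar> \<le> real k * bC"
    proof -
      have "\<bar>?C2 j\<bar> \<le> (\<Sum>l<k - 1 - j. bC)" using j by (intro order_trans[OF sum_abs] sum_mono hC2) auto
      also have "\<dots> = real (k - 1 - j) * bC" by simp
      also have "\<dots> \<le> real k * bC" using nn by (intro mult_right_mono) auto
      finally show ?thesis .
    qed
    have C3: "\<bar>?C3 j\<bar> \<le> 2 * (real k * bC)"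
    proof -
      have "\<bar>?C3 j\<bar> \<le> (\<Sum>l<j. bC + bC)"
        using j by (intro order_trans[OF sum_abs] sum_mono order_trans[OF abs_triangle_ineq] add_mono hC3) auto
      also have "\<dots> = 2 * (real j * bC)" by simp
      also have "\<dots> \<le> 2 * (real k * bC)" using nn j by (intro mult_left_mono mult_right_mono) auto
      finally show ?thesis .
    qed
    have B: "\<bar>?B j\<bar> \<le> bB" using j by (intro hB) auto
    show ?thesis by (rule abs_sum5[OF T C1 C2 C3 B])
  qed
  have "\<bar>tr (mm (Mm (Suc k)) W) - (\<Sum>j<k. ?M j)\<bar> \<le> (\<Sum>j<k. 8 * (real k)\<^sup>2 * bD + 4 * (real k * bC) + bB)"
    unfolding eq sum_subtractf[symmetric] by (intro order_trans[OF sum_abs] sum_mono) (rule one, simp)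
  also have "\<dots> = real k * bB + 4 * (real k)\<^sup>2 * bC + 8 * real k ^ 3 * bD"
    by (simp add: power2_eq_square power3_eq_cube algebra_simps)
  finally show ?thesis .
qed

end

section \<open>Moments of the random coefficients\<close>

lemma pow_mult_le_add: assumes "0 \<le> x" "0 \<le> (y::real)" shows "x ^ a * y ^ b \<le> x ^ (a + b) + y ^ (a + b)"
proof (cases "x \<le> y")
  case True
  then have "x ^ a * y ^ b \<le> y ^ a * y ^ b" using assms by (intro mult_right_mono power_mono) auto
  then show ?thesis using assms by (simp add: power_add) (meson add_increasing mult_nonneg_nonneg zero_le_power)
next
  case False
  then have "x ^ a * y ^ b \<le> x ^ a * x ^ b" using assms by (intro mult_left_mono power_mono) auto
  then show ?thesis using assms by (simp add: power_add) (meson add_increasing2 mult_nonneg_nonneg zero_le_power)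
qed

lemma pow_le_pow_add_1: assumes "0 \<le> (x::real)" "k \<le> K" shows "x ^ k \<le> x ^ K + 1"
proof (cases "x \<le> 1")
  case True
  then have "x ^ k \<le> 1" using assms by (simp add: power_le_one)
  then show ?thesis using assms by (simp add: add_increasing)
next
  case False
  then have "x ^ k \<le> x ^ K" using assms by (intro power_increasing) auto
  then show ?thesis by simp
qed

context dimn
begin

lemma tr_mm_comm: "tr (mm A B) = tr (mm B A)"
  unfolding tr_def mm_def by (subst sum.swap) (simp add: mult.commute)

lemma tr_mm_spec: assumes "spec P f p" shows "tr (mm P M) = (\<Sum>t<d. p t * bil (f t) M (f t))"
proof -
  have "tr (mm P M) = (\<Sum>a<d. \<Sum>c<d. \<Sum>t<d. p t * (f t c * M c a * f t a))"
    using assms by (simp add: tr_def mm_def spec_def sum_distrib_right sum_distrib_left mult_ac)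
  also have "\<dots> = (\<Sum>a<d. \<Sum>t<d. \<Sum>c<d. p t * (f t c * M c a * f t a))" by (intro sum.cong refl sum.swap)
  also have "\<dots> = (\<Sum>t<d. \<Sum>a<d. \<Sum>c<d. p t * (f t c * M c a * f t a))" by (rule sum.swap)
  also have "\<dots> = (\<Sum>t<d. p t * bil (f t) M (f t))"
    unfolding bil_sum2 by (simp add: sum_distrib_left) (intro sum.cong refl sum.swap)
  finally show ?thesis .
qed

lemma spec_eig: assumes "spec G e l" "r < d" "s < d" shows "bil (e r) G (e s) = (if r = s then l r else 0)"
proof -
  have o: "orthon d e" using assms(1) by (simp add: spec_def)
  have "bil (e r) G (e s) = (\<Sum>t<d. if t = r then (if r = s then l r else 0) else 0)"
    unfolding spec_bil[OF assms(1)] using o assms by (intro sum.cong) (auto simp: orthon_def)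
  then show ?thesis using assms by simp
qed

lemma spec_eig_nonneg: assumes "spec G e l" "\<And>z. 0 \<le> bil z G z" "r < d" shows "0 \<le> l r"
  using spec_eig[OF assms(1,3,3)] assms(2)[of "e r"] by simp

lemma spec_ip_mv: assumes "spec G e l" shows "ip (mv G f) z = (\<Sum>s<d. l s * ip z (e s) * ip (e s) f)"
  using spec_bil[OF assms, of z f] by (simp only: bil_def ip_commute)

lemma ip_mv_left: "symm P \<Longrightarrow> ip (mv P x) y = bil x P y"
  by (subst bil_symm) (simp_all add: bil_def ip_commute)

text \<open>For commuting \<open>A\<close> and \<open>B\<close> the left side is the trace of
  \<open>P A P B\<close>, written in the eigenbasis of \<open>P\<close>; passing to the common
  eigenbasis of \<open>A\<close> and \<open>B\<close> leaves squared matrix entries of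
  \<open>P\<close>.\<close>

lemma spec_sandwich:
  assumes A: "spec A e \<alpha>" and B: "spec B e \<beta>" and P: "spec P f p"
  shows "(\<Sum>t<d. p t * bil (f t) A (mv P (mv B (f t)))) = (\<Sum>r<d. \<Sum>s<d. \<alpha> r * \<beta> s * (bil (e r) P (e s))\<^sup>2)"
proof -
  have 1: "bil (f t) A (mv P (mv B (f t))) = (\<Sum>r<d. \<Sum>s<d. \<alpha> r * \<beta> s * bil (e r) P (e s) * (ip (e r) (f t) * ip (f t) (e s)))" for t
  proof -
    have "ip (e r) (mv P (mv B (f t))) = (\<Sum>s<d. \<beta> s * bil (e r) P (e s) * ip (f t) (e s))" for r
    proof -
      have "ip (e r) (mv P (mv B (f t))) = bil (mv B (f t)) P (e r)"
        by (simp only: bil_def[symmetric] bil_symm[OF spec_symm[OF P], of "e r"])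
      also have "\<dots> = (\<Sum>s<d. \<beta> s * ip (mv P (e r)) (e s) * ip (e s) (f t))"
        by (simp only: bil_def spec_ip_mv[OF B])
      also have "\<dots> = (\<Sum>s<d. \<beta> s * bil (e r) P (e s) * ip (f t) (e s))"
        by (simp only: ip_mv_left[OF spec_symm[OF P]] ip_commute[of "e _" "f t"])
      finally show ?thesis .
    qed
    then show ?thesis unfolding spec_bil[OF A] by (simp add: sum_distrib_left ip_commute[of "e _" "f t"] mult_ac)
  qed
  have "(\<Sum>t<d. p t * bil (f t) A (mv P (mv B (f t)))) =
     (\<Sum>t<d. \<Sum>r<d. \<Sum>s<d. \<alpha> r * \<beta> s * bil (e r) P (e s) * (p t * ip (e r) (f t) * ip (f t) (e s)))"
    unfolding 1 by (simp add: sum_distrib_left mult_ac)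
  also have "\<dots> = (\<Sum>r<d. \<Sum>t<d. \<Sum>s<d. \<alpha> r * \<beta> s * bil (e r) P (e s) * (p t * ip (e r) (f t) * ip (f t) (e s)))" by (rule sum.swap)
  also have "\<dots> = (\<Sum>r<d. \<Sum>s<d. \<Sum>t<d. \<alpha> r * \<beta> s * bil (e r) P (e s) * (p t * ip (e r) (f t) * ip (f t) (e s)))"
    by (intro sum.cong refl sum.swap)
  also have "\<dots> = (\<Sum>r<d. \<Sum>s<d. \<alpha> r * \<beta> s * (bil (e r) P (e s))\<^sup>2)"
    unfolding sum_distrib_left[symmetric] spec_bil[OF P, symmetric] by (simp add: power2_eq_square mult.assoc)
  finally show ?thesis .
qed

lemma mv_parseval: assumes "orthon d e" "symm P" shows "(\<Sum>s<d. (bil (e r) P (e s))\<^sup>2) = ip (mv P (e r)) (mv P (e r))"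
  using orthon_complete[OF assms(1), of "mv P (e r)" "mv P (e r)"]
  by (simp only: ip_commute[of "e _" "mv P (e r)"] ip_mv_left[OF assms(2)] power2_eq_square)

end

section \<open>Moments of fixed matrices with weights |Y_i|^2\<close>

context gmodel
begin

text \<open>The common shape of \<open>Q2\<close> and \<open>Q3\<close>: only the weights are
  random, while the matrices \<open>P i\<close> are fixed.\<close>

definition Qw :: "(nat \<Rightarrow> nat \<Rightarrow> nat \<Rightarrow> real) \<Rightarrow> (nat \<times> nat \<Rightarrow> real) \<Rightarrow> nat \<Rightarrow> nat \<Rightarrow> real" where
  "Qw P g = (\<lambda>a c. \<Sum>i\<in>I. ip (Yv g i) (Yv g i) * P i a c)"

lemma poly_Qw: "polyfun (I \<times> {..<d}) (\<lambda>g. Qw P g a c)"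
  unfolding Qw_def ip_def by (intro polyfun_sum polyfun_mult polyfun_const poly_Y) auto

lemma bil_Qw: "bil x (Qw P g) y = (\<Sum>i\<in>I. ip (Yv g i) (Yv g i) * bil x (P i) y)"
  unfolding Qw_def lin_sum[OF lin_bil] lin_scale[OF lin_bil] ..

lemma tr_mm_Qw: "tr (mm (Qw P g) M) = (\<Sum>i\<in>I. ip (Yv g i) (Yv g i) * tr (mm (P i) M))"
proof -
  have L: "lin (\<lambda>A. tr (mm A M))"
    unfolding lin_def tr_def mm_def by (auto simp: algebra_simps sum.distrib sum_distrib_left)
  show ?thesis unfolding Qw_def lin_sum[OF L] lin_scale[OF L] ..
qed

lemma symm_Qw: "(\<And>i. i \<in> I \<Longrightarrow> symm (P i)) \<Longrightarrow> symm (Qw P g)"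
  by (auto simp: symm_def Qw_def intro!: sum.cong)

lemma pd_Qw: assumes ib: "i \<in> I" "b < d"
  shows "haspd (i, b) (\<lambda>g. Qw P g a c) (\<lambda>g. 2 * ip (u i b) (Yv g i) * P i a c)"
proof -
  have "haspd (i, b) (\<lambda>g. Qw P g a c) (\<lambda>g. \<Sum>l\<in>I. (\<Sum>e<d. (if l = i then u i b e else 0) * Yv g l e + Yv g l e * (if l = i then u i b e else 0)) * P l a c + (\<Sum>e<d. Yv g l e * Yv g l e) * 0)"
    unfolding Qw_def ip_def by (intro haspd_sum haspd_mult haspd_const pd_Y ib)
  then show ?thesis
  proof (rule haspd_cong)
    fix g
    have "(\<Sum>l\<in>I. (\<Sum>e<d. (if l = i then u i b e else 0) * Yv g l e + Yv g l e * (if l = i then u i b e else 0)) * P l a c + (\<Sum>e<d. Yv g l e * Yv g l e) * 0)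
       = (\<Sum>l\<in>I. if l = i then 2 * ip (u i b) (Yv g i) * P i a c else 0)"
      by (intro sum.cong) (auto simp: ip_def sum_distrib_left mult_ac sum.distrib)
    also have "\<dots> = 2 * ip (u i b) (Yv g i) * P i a c" using ib finite_I by simp
    finally show "(\<Sum>l\<in>I. (\<Sum>e<d. (if l = i then u i b e else 0) * Yv g l e + Yv g l e * (if l = i then u i b e else 0)) * P l a c + (\<Sum>e<d. Yv g l e * Yv g l e) * 0)
       = 2 * ip (u i b) (Yv g i) * P i a c" .
  qed
qed

lemma pd_ip_Y: assumes "b < d" shows "haspd (i, b) (\<lambda>g. ip x (Yv g i)) (\<lambda>g. ip x (u i b))"
  unfolding ip_def using pd_Y[OF assms, of i i] by (intro haspd_sum haspd_cmult) simp

lemma ip_Y_expand: "ip (Yv g i) x = (\<Sum>b<d. g (i, b) * ip (u i b) x)"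
  unfolding Yv_def by simp

text \<open>Integration by parts is applied to one of the two vectors in the weight
  \<open>ip (Yv g i) (Yv g i)\<close>. If the derivative hits the other one, \<open>\<tau> i\<close>
  appears and the hypothesis with \<open>s\<close> applies. If it hits a factor of the power, a
  second \<open>P i\<close> appears, which
  \<open>\<tau> i * P\<^sub>i\<^sup>2 \<le> \<rho> * P\<^sub>i\<close> removes again; so the
  recursion closes on the same traces.\<close>

lemma Qw_moment_step:
  assumes sym: "\<And>i. i \<in> I \<Longrightarrow> symm (P i)" and psd: "\<And>i z. i \<in> I \<Longrightarrow> 0 \<le> bil z (P i) z"
    and \<rho>: "\<And>i z. i \<in> I \<Longrightarrow> \<tau> i * ip (mv (P i) z) (mv (P i) z) \<le> \<rho> * bil z (P i) z" "0 \<le> \<rho>"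
    and s: "\<And>z. (\<Sum>i\<in>I. \<tau> i * bil z (P i) z) \<le> s * ip z z"
  shows "(\<integral>g. tr (mpow (Qw P g) (Suc k)) \<partial>\<gamma>) \<le> (s + 4 * real k * \<rho>) * (\<integral>g. tr (mpow (Qw P g) k) \<partial>\<gamma>)"
proof -
  let ?J = "I \<times> {..<d}"
  have "\<forall>i\<in>I. \<exists>f p. spec (P i) f p" using spectral sym by blast
  then obtain f p where fp: "\<And>i. i \<in> I \<Longrightarrow> spec (P i) (f i) (p i)" by metis
  have pQ: "polyfun ?J (\<lambda>g. mpow (Qw P g) k a c)" if "a < d" "c < d" for a c k
    by (rule polyfun_mpow[OF poly_Qw that])
  have pb: "polyfun ?J (\<lambda>g. bil x (mpow (Qw P g) k) y)" for x y k
    by (intro polyfun_bil pQ polyfun_const)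
  have pip: "polyfun ?J (\<lambda>g. ip x (Yv g i))" if "i \<in> I" for x i
    unfolding ip_def by (intro polyfun_sum polyfun_mult polyfun_const poly_Y that)
  have pipY: "polyfun ?J (\<lambda>g. ip (Yv g i) (Yv g i))" if "i \<in> I" for i
    unfolding ip_def by (intro polyfun_sum polyfun_mult poly_Y that)
  define T where "T i j g = (\<Sum>t<d. p i t * bil (f i t) (mpow (Qw P g) j) (mv (P i) (mv (mpow (Qw P g) (k - 1 - j)) (f i t))))" for i j g
  have pT: "polyfun ?J (T i j)" for i j
    unfolding T_def by (intro polyfun_sum polyfun_mult polyfun_const polyfun_bil polyfun_mv pQ)
  have pS: "polyfun ?J (\<lambda>g. ip (Yv g i) (S i (Yv g i)))" if "i \<in> I" for i
    unfolding ip_S using that by (intro polyfun_sum polyfun_mult pip) (auto simp: ip_commute[of "Yv _ i"] intro: pip)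
  have der: "haspd (i, b) (\<lambda>g. ip (u i b) (Yv g i) * tr (mm (P i) (mpow (Qw P g) k)))
     (\<lambda>g. ip (u i b) (u i b) * tr (mm (P i) (mpow (Qw P g) k)) + ip (u i b) (Yv g i) * (2 * ip (u i b) (Yv g i) * (\<Sum>j<k. T i j g)))"
    if i: "i \<in> I" and b: "b < d" for i b
  proof -
    have "haspd (i, b) (\<lambda>g. \<Sum>t<d. p i t * bil (f i t) (mpow (Qw P g) k) (f i t))
       (\<lambda>g. \<Sum>t<d. p i t * (bil (\<lambda>a. 0) (mpow (Qw P g) k) (f i t) + bil (f i t) (mpow (Qw P g) k) (\<lambda>a. 0) +
         (\<Sum>j<k. bil (f i t) (mpow (Qw P g) j) (mv (\<lambda>a c. 2 * ip (u i b) (Yv g i) * P i a c) (mv (mpow (Qw P g) (k - 1 - j)) (f i t))))))"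
      by (intro haspd_sum haspd_cmult haspd_bil_mpow[where x = "\<lambda>g. f i _" and y = "\<lambda>g. f i _"] pd_Qw i b haspd_const)
    then have h: "haspd (i, b) (\<lambda>g. tr (mm (P i) (mpow (Qw P g) k))) (\<lambda>g. 2 * ip (u i b) (Yv g i) * (\<Sum>j<k. T i j g))"
      unfolding tr_mm_spec[OF fp[OF i]]
    proof (rule haspd_cong)
      fix g
      have mvc: "mv (\<lambda>a c. q * P i a c) z = (\<lambda>a. q * mv (P i) z a)" for q z
        by (simp add: mv_def sum_distrib_left mult.assoc)
      show "(\<Sum>t<d. p i t * (bil (\<lambda>a. 0) (mpow (Qw P g) k) (f i t) + bil (f i t) (mpow (Qw P g) k) (\<lambda>a. 0) +
         (\<Sum>j<k. bil (f i t) (mpow (Qw P g) j) (mv (\<lambda>a c. 2 * ip (u i b) (Yv g i) * P i a c) (mv (mpow (Qw P g) (k - 1 - j)) (f i t))))))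
         = 2 * ip (u i b) (Yv g i) * (\<Sum>j<k. T i j g)"
        unfolding mvc bil_zero bil_lin add_0_left T_def sum_distrib_left
        by (subst sum.swap) (simp add: mult_ac)
    qed
    show ?thesis by (rule haspd_mult[OF pd_ip_Y[OF b] h])
  qed
  have "(\<integral>g. tr (mpow (Qw P g) (Suc k)) \<partial>\<gamma>) = (\<integral>g. (\<Sum>i\<in>I. \<Sum>b<d. g (i, b) * (ip (u i b) (Yv g i) * tr (mm (P i) (mpow (Qw P g) k)))) \<partial>\<gamma>)"
  proof (rule Bochner_Integration.integral_cong[OF refl])
    fix g
    have "tr (mpow (Qw P g) (Suc k)) = (\<Sum>i\<in>I. ip (Yv g i) (Yv g i) * tr (mm (P i) (mpow (Qw P g) k)))" by (simp add: tr_mm_Qw)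
    also have "\<dots> = (\<Sum>i\<in>I. \<Sum>b<d. g (i, b) * (ip (u i b) (Yv g i) * tr (mm (P i) (mpow (Qw P g) k))))"
      unfolding ip_Y_expand[of g _ "Yv g _"] by (simp add: sum_distrib_right mult.assoc)
    finally show "tr (mpow (Qw P g) (Suc k)) = (\<Sum>i\<in>I. \<Sum>b<d. g (i, b) * (ip (u i b) (Yv g i) * tr (mm (P i) (mpow (Qw P g) k))))" .
  qed
  also have "\<dots> = (\<Sum>i\<in>I. \<Sum>b<d. \<integral>g. g (i, b) * (ip (u i b) (Yv g i) * tr (mm (P i) (mpow (Qw P g) k))) \<partial>\<gamma>)"
  proof -
    have q: "polyfun ?J (\<lambda>g. g (i, b) * (ip (u i b) (Yv g i) * tr (mm (P i) (mpow (Qw P g) k))))" if "i \<in> I" "b < d" for i b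
      using that unfolding tr_mm_spec[OF fp[OF that(1)]]
      by (intro polyfun_mult polyfun_sum polyfun_var pip pb polyfun_const) auto
    show ?thesis using q
      by (subst integral_sum_poly) (auto intro!: polyfun_sum sum.cong integral_sum_poly)
  qed
  also have "\<dots> = (\<Sum>i\<in>I. \<Sum>b<d. \<integral>g. ip (u i b) (u i b) * tr (mm (P i) (mpow (Qw P g) k)) + ip (u i b) (Yv g i) * (2 * ip (u i b) (Yv g i) * (\<Sum>j<k. T i j g)) \<partial>\<gamma>)"
  proof (intro sum.cong refl)
    fix i b assume i: "i \<in> I" and "b \<in> {..<d}" then have b: "b < d" by simp
    show "(\<integral>g. g (i, b) * (ip (u i b) (Yv g i) * tr (mm (P i) (mpow (Qw P g) k))) \<partial>\<gamma>) =
      (\<integral>g. ip (u i b) (u i b) * tr (mm (P i) (mpow (Qw P g) k)) + ip (u i b) (Yv g i) * (2 * ip (u i b) (Yv g i) * (\<Sum>j<k. T i j g)) \<partial>\<gamma>)"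
    proof (rule gauss_ibp[OF _ _ der[OF i b]])
      show "polyfun ?J (\<lambda>g. ip (u i b) (Yv g i) * tr (mm (P i) (mpow (Qw P g) k)))"
        unfolding tr_mm_spec[OF fp[OF i]] using i by (intro polyfun_mult polyfun_sum pip pb polyfun_const)
    qed (use i b in simp)
  qed
  also have "\<dots> = (\<integral>g. (\<Sum>i\<in>I. \<Sum>b<d. ip (u i b) (u i b) * tr (mm (P i) (mpow (Qw P g) k)) + ip (u i b) (Yv g i) * (2 * ip (u i b) (Yv g i) * (\<Sum>j<k. T i j g))) \<partial>\<gamma>)"
  proof -
    have q: "polyfun ?J (\<lambda>g. ip (u i b) (u i b) * tr (mm (P i) (mpow (Qw P g) k)) + ip (u i b) (Yv g i) * (2 * ip (u i b) (Yv g i) * (\<Sum>j<k. T i j g)))" if "i \<in> I" for i b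
      unfolding tr_mm_spec[OF fp[OF that]] using that by (intro polyfun_add polyfun_mult polyfun_sum pip pb polyfun_const pT)
    show ?thesis using q
      by (subst integral_sum_poly) (auto intro!: polyfun_sum sum.cong integral_sum_poly[symmetric])
  qed
  also have "\<dots> \<le> (\<integral>g. (s + 4 * real k * \<rho>) * tr (mpow (Qw P g) k) \<partial>\<gamma>)"
  proof (rule integral_mono)
    have q: "polyfun ?J (\<lambda>g. ip (u i b) (u i b) * tr (mm (P i) (mpow (Qw P g) k)) + ip (u i b) (Yv g i) * (2 * ip (u i b) (Yv g i) * (\<Sum>j<k. T i j g)))" if "i \<in> I" for i b
      unfolding tr_mm_spec[OF fp[OF that]] using that by (intro polyfun_add polyfun_mult polyfun_sum pip pb polyfun_const pT)
    show "integrable \<gamma> (\<lambda>g. (\<Sum>i\<in>I. \<Sum>b<d. ip (u i b) (u i b) * tr (mm (P i) (mpow (Qw P g) k)) + ip (u i b) (Yv g i) * (2 * ip (u i b) (Yv g i) * (\<Sum>j<k. T i j g))))"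
      by (intro polyfun_integrable polyfun_sum q)
    show "integrable \<gamma> (\<lambda>g. (s + 4 * real k * \<rho>) * tr (mpow (Qw P g) k))"
      by (intro polyfun_integrable polyfun_mult polyfun_const polyfun_tr pQ)
    fix g
    have "symm (Qw P g)" by (rule symm_Qw) (rule sym)
    then obtain e l where el: "spec (Qw P g) e l" using spectral by blast
    have o: "orthon d e" using el by (simp add: spec_def)
    have l: "0 \<le> l r" if "r < d" for r
      by (rule spec_eig_nonneg[OF el _ that]) (auto simp: bil_Qw intro!: sum_nonneg mult_nonneg_nonneg psd)
    have trP: "tr (mm (P i) (mpow (Qw P g) k)) = (\<Sum>r<d. l r ^ k * bil (e r) (P i) (e r))" for i k
      by (subst tr_mm_comm) (rule tr_mm_spec[OF spec_mpow[OF el]])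
    have first: "(\<Sum>i\<in>I. \<tau> i * tr (mm (P i) (mpow (Qw P g) k))) \<le> s * tr (mpow (Qw P g) k)"
    proof -
      have "(\<Sum>i\<in>I. \<tau> i * tr (mm (P i) (mpow (Qw P g) k))) = (\<Sum>i\<in>I. \<Sum>r<d. l r ^ k * (\<tau> i * bil (e r) (P i) (e r)))"
        by (simp add: trP sum_distrib_left mult_ac)
      also have "\<dots> = (\<Sum>r<d. l r ^ k * (\<Sum>i\<in>I. \<tau> i * bil (e r) (P i) (e r)))"
        by (subst sum.swap) (simp add: sum_distrib_left)
      also have "\<dots> \<le> (\<Sum>r<d. l r ^ k * (s * ip (e r) (e r)))"
        using l by (intro sum_mono mult_left_mono s) auto
      also have "\<dots> = s * tr (mpow (Qw P g) k)"
        using o unfolding spec_tr_mpow[OF el] by (simp add: orthon_def sum_distrib_left mult.commute)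
      finally show ?thesis .
    qed
    have Tb: "ip (Yv g i) (S i (Yv g i)) * (2 * T i j g) \<le> 4 * \<rho> * (ip (Yv g i) (Yv g i) * tr (mm (P i) (mpow (Qw P g) (k - 1))))"
      if i: "i \<in> I" and j: "j < k" for i j
    proof -
      have "T i j g = (\<Sum>r<d. \<Sum>s<d. l r ^ j * l s ^ (k - 1 - j) * (bil (e r) (P i) (e s))\<^sup>2)"
        unfolding T_def by (rule spec_sandwich[OF spec_mpow[OF el] spec_mpow[OF el] fp[OF i]])
      \<comment> \<open>Once the whole power sits on one of the two eigenvalues, the sum over the
        other is a Parseval sum. The two choices and the 2 from the derivative of the weight make
        the factor 4.\<close>
      also have "\<dots> \<le> (\<Sum>r<d. \<Sum>s<d. (l r ^ (k - 1) + l s ^ (k - 1)) * (bil (e r) (P i) (e s))\<^sup>2)"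
      proof (intro sum_mono mult_right_mono)
        fix r s assume "r \<in> {..<d}" "s \<in> {..<d}"
        then show "l r ^ j * l s ^ (k - 1 - j) \<le> l r ^ (k - 1) + l s ^ (k - 1)"
          using pow_mult_le_add[of "l r" "l s" j "k - 1 - j"] l j by auto
      qed simp
      also have "\<dots> = (\<Sum>r<d. l r ^ (k - 1) * (\<Sum>s<d. (bil (e r) (P i) (e s))\<^sup>2)) + (\<Sum>r<d. \<Sum>s<d. l s ^ (k - 1) * (bil (e r) (P i) (e s))\<^sup>2)"
        by (simp add: distrib_right sum.distrib sum_distrib_left)
      also have "(\<Sum>r<d. \<Sum>s<d. l s ^ (k - 1) * (bil (e r) (P i) (e s))\<^sup>2) = (\<Sum>s<d. l s ^ (k - 1) * (\<Sum>r<d. (bil (e s) (P i) (e r))\<^sup>2))"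
        by (subst sum.swap) (simp only: sum_distrib_left bil_symm[OF sym[OF i], of "e _" "e _"])
      finally have T: "T i j g \<le> 2 * (\<Sum>r<d. l r ^ (k - 1) * ip (mv (P i) (e r)) (mv (P i) (e r)))"
        by (simp add: mv_parseval[OF o sym[OF i]])
      have T0: "0 \<le> (\<Sum>r<d. l r ^ (k - 1) * ip (mv (P i) (e r)) (mv (P i) (e r)))"
        using l by (intro sum_nonneg mult_nonneg_nonneg) auto
      have "ip (Yv g i) (S i (Yv g i)) * (2 * T i j g) \<le> (\<tau> i * ip (Yv g i) (Yv g i)) * (4 * (\<Sum>r<d. l r ^ (k - 1) * ip (mv (P i) (e r)) (mv (P i) (e r))))"
      proof -
        have "ip (Yv g i) (S i (Yv g i)) * (2 * T i j g) \<le> ip (Yv g i) (S i (Yv g i)) * (4 * (\<Sum>r<d. l r ^ (k - 1) * ip (mv (P i) (e r)) (mv (P i) (e r))))"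
          using T by (intro mult_left_mono ip_S_nonneg) simp
        also have "\<dots> \<le> (\<tau> i * ip (Yv g i) (Yv g i)) * (4 * (\<Sum>r<d. l r ^ (k - 1) * ip (mv (P i) (e r)) (mv (P i) (e r))))"
          using T0 by (intro mult_right_mono ip_S_le) simp
        finally show ?thesis .
      qed
      also have "\<dots> = 4 * ip (Yv g i) (Yv g i) * (\<Sum>r<d. l r ^ (k - 1) * (\<tau> i * ip (mv (P i) (e r)) (mv (P i) (e r))))"
        by (simp add: sum_distrib_left mult_ac)
      also have "\<dots> \<le> 4 * ip (Yv g i) (Yv g i) * (\<Sum>r<d. l r ^ (k - 1) * (\<rho> * bil (e r) (P i) (e r)))"
        using l i by (intro mult_left_mono sum_mono \<rho>(1)) auto
      also have "\<dots> = 4 * \<rho> * (ip (Yv g i) (Yv g i) * tr (mm (P i) (mpow (Qw P g) (k - 1))))"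
        by (simp add: trP sum_distrib_left mult_ac)
      finally show ?thesis .
    qed
    have "(\<Sum>i\<in>I. \<Sum>b<d. ip (u i b) (u i b) * tr (mm (P i) (mpow (Qw P g) k)) + ip (u i b) (Yv g i) * (2 * ip (u i b) (Yv g i) * (\<Sum>j<k. T i j g)))
       = (\<Sum>i\<in>I. \<tau> i * tr (mm (P i) (mpow (Qw P g) k))) + (\<Sum>i\<in>I. \<Sum>j<k. ip (Yv g i) (S i (Yv g i)) * (2 * T i j g))"
    proof -
      have "(\<Sum>b<d. ip (u i b) (Yv g i) * (2 * ip (u i b) (Yv g i) * (\<Sum>j<k. T i j g))) = (\<Sum>j<k. ip (Yv g i) (S i (Yv g i)) * (2 * T i j g))" for i
        unfolding ip_S ip_commute[of "Yv g i"] by (simp add: sum_distrib_left sum_distrib_right mult_ac) (rule sum.swap)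
      then show ?thesis by (simp add: sum.distrib \<tau>_def sum_distrib_right)
    qed
    also have "\<dots> \<le> s * tr (mpow (Qw P g) k) + (\<Sum>i\<in>I. \<Sum>j<k. 4 * \<rho> * (ip (Yv g i) (Yv g i) * tr (mm (P i) (mpow (Qw P g) (k - 1)))))"
      using first by (intro add_mono sum_mono Tb) auto
    also have "(\<Sum>i\<in>I. \<Sum>j<k. 4 * \<rho> * (ip (Yv g i) (Yv g i) * tr (mm (P i) (mpow (Qw P g) (k - 1))))) = 4 * real k * \<rho> * tr (mpow (Qw P g) k)"
    proof (cases k)
      case (Suc m)
      have "(\<Sum>i\<in>I. \<Sum>j<k. 4 * \<rho> * (ip (Yv g i) (Yv g i) * tr (mm (P i) (mpow (Qw P g) (k - 1))))) = 4 * real k * \<rho> * (\<Sum>i\<in>I. ip (Yv g i) (Yv g i) * tr (mm (P i) (mpow (Qw P g) m)))"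
        using Suc by (simp add: sum_distrib_left algebra_simps)
      also have "\<dots> = 4 * real k * \<rho> * tr (mpow (Qw P g) k)" unfolding Suc by (simp add: tr_mm_Qw)
      finally show ?thesis .
    qed simp
    also have "s * tr (mpow (Qw P g) k) + 4 * real k * \<rho> * tr (mpow (Qw P g) k) = (s + 4 * real k * \<rho>) * tr (mpow (Qw P g) k)"
      by (simp add: algebra_simps)
    finally show "(\<Sum>i\<in>I. \<Sum>b<d. ip (u i b) (u i b) * tr (mm (P i) (mpow (Qw P g) k)) + ip (u i b) (Yv g i) * (2 * ip (u i b) (Yv g i) * (\<Sum>j<k. T i j g)))
       \<le> (s + 4 * real k * \<rho>) * tr (mpow (Qw P g) k)" .
  qed
  also have "\<dots> = (s + 4 * real k * \<rho>) * (\<integral>g. tr (mpow (Qw P g) k) \<partial>\<gamma>)" by simp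
  finally show ?thesis .
qed

lemma Qw_moment:
  assumes sym: "\<And>i. i \<in> I \<Longrightarrow> symm (P i)" and psd: "\<And>i z. i \<in> I \<Longrightarrow> 0 \<le> bil z (P i) z"
    and \<rho>: "\<And>i z. i \<in> I \<Longrightarrow> \<tau> i * ip (mv (P i) z) (mv (P i) z) \<le> \<rho> * bil z (P i) z" "0 \<le> \<rho>"
    and s: "\<And>z. (\<Sum>i\<in>I. \<tau> i * bil z (P i) z) \<le> s * ip z z" "0 \<le> s"
  shows "(\<integral>g. tr (mpow (Qw P g) k) \<partial>\<gamma>) \<le> real d * (s + 4 * real k * \<rho>) ^ k"
proof (induction k)
  case 0 then show ?case by (simp add: tr_def G.prob_space)
next
  case (Suc k)
  have "(\<integral>g. tr (mpow (Qw P g) (Suc k)) \<partial>\<gamma>) \<le> (s + 4 * real k * \<rho>) * (\<integral>g. tr (mpow (Qw P g) k) \<partial>\<gamma>)"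
    by (rule Qw_moment_step[OF sym psd \<rho> s(1)])
  also have "\<dots> \<le> (s + 4 * real k * \<rho>) * (real d * (s + 4 * real k * \<rho>) ^ k)"
    using Suc s(2) \<rho>(2) by (intro mult_left_mono) auto
  also have "\<dots> = real d * (s + 4 * real k * \<rho>) ^ Suc k" by simp
  also have "\<dots> \<le> real d * (s + 4 * real (Suc k) * \<rho>) ^ Suc k"
    using s(2) \<rho>(2) by (intro mult_left_mono power_mono) (auto intro!: mult_right_mono)
  finally show ?case .
qed

end

context dimn
begin

text \<open>In the eigenbasis both products are double sums with weights
  \<open>l r ^ j * l s ^ m\<close>, at most \<open>l r ^ (j + m) + l s ^ (j + m)\<close>. In the
  mixed product the coefficients are first replaced by a symmetric mean of squares. So the full
  power can be moved onto one vector, at the price of the squared length of the other.\<close>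

lemma spec_two_forms:
  assumes Q: "spec Q e l" and l: "\<And>r. r < d \<Longrightarrow> 0 \<le> l r"
  shows "bil x (mpow Q j) x * bil y (mpow Q m) y \<le> bil x (mpow Q (j + m)) x * ip y y + ip x x * bil y (mpow Q (j + m)) y" (is "?A \<le> ?T")
    and "bil x (mpow Q j) y * bil x (mpow Q m) y \<le> bil x (mpow Q (j + m)) x * ip y y + ip x x * bil y (mpow Q (j + m)) y" (is "?B \<le> ?T")
proof -
  have o: "orthon d e" using Q by (simp add: spec_def)
  define a where "a r = ip x (e r)" for r
  define b where "b r = ip y (e r)" for r
  have B: "bil x (mpow Q k) y = (\<Sum>r<d. l r ^ k * (a r * b r))" for k
    unfolding spec_bil[OF spec_mpow[OF Q]] a_def b_def by (simp add: ip_commute[of "e _" y] mult.assoc)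
  have X: "bil x (mpow Q k) x = (\<Sum>r<d. l r ^ k * (a r)\<^sup>2)" for k
    unfolding spec_bil[OF spec_mpow[OF Q]] a_def by (simp add: ip_commute[of "e _" x] mult.assoc power2_eq_square)
  have Y: "bil y (mpow Q k) y = (\<Sum>r<d. l r ^ k * (b r)\<^sup>2)" for k
    unfolding spec_bil[OF spec_mpow[OF Q]] b_def by (simp add: ip_commute[of "e _" y] mult.assoc power2_eq_square)
  have x: "ip x x = (\<Sum>r<d. (a r)\<^sup>2)" and y: "ip y y = (\<Sum>r<d. (b r)\<^sup>2)"
    unfolding a_def b_def orthon_complete[OF o, of x x] orthon_complete[OF o, of y y]
    by (simp_all add: ip_commute[of "e _"] power2_eq_square)
  have T: "?T = (\<Sum>r<d. \<Sum>s<d. (l r ^ (j + m) + l s ^ (j + m)) * ((a r)\<^sup>2 * (b s)\<^sup>2))"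
    unfolding X Y x y sum_product distrib_right sum.distrib by (simp add: mult_ac)
  have T': "?T = (\<Sum>r<d. \<Sum>s<d. (l r ^ (j + m) + l s ^ (j + m)) * (((a r)\<^sup>2 * (b s)\<^sup>2 + (a s)\<^sup>2 * (b r)\<^sup>2) / 2))"
  proof -
    have h: "?T = (\<Sum>r<d. \<Sum>s<d. (l r ^ (j + m) + l s ^ (j + m)) * ((a s)\<^sup>2 * (b r)\<^sup>2))"
      unfolding T by (subst sum.swap) (simp add: add.commute)
    have "2 * ?T = ?T + ?T" by simp
    also have "\<dots> = (\<Sum>r<d. \<Sum>s<d. (l r ^ (j + m) + l s ^ (j + m)) * ((a r)\<^sup>2 * (b s)\<^sup>2)) + (\<Sum>r<d. \<Sum>s<d. (l r ^ (j + m) + l s ^ (j + m)) * ((a s)\<^sup>2 * (b r)\<^sup>2))"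
      by (rule arg_cong2[where f = "(+)", OF T h])
    also have "\<dots> = 2 * (\<Sum>r<d. \<Sum>s<d. (l r ^ (j + m) + l s ^ (j + m)) * (((a r)\<^sup>2 * (b s)\<^sup>2 + (a s)\<^sup>2 * (b r)\<^sup>2) / 2))"
      unfolding sum.distrib[symmetric] sum_distrib_left by (intro sum.cong refl) (simp add: field_simps)
    finally show ?thesis by simp
  qed
  have pw: "l r ^ j * l s ^ m \<le> l r ^ (j + m) + l s ^ (j + m)" if "r < d" "s < d" for r s
    using pow_mult_le_add l that by auto
  have pn: "0 \<le> l r ^ j * l s ^ m" if "r < d" "s < d" for r s using l that by auto
  have "?A = (\<Sum>r<d. \<Sum>s<d. l r ^ j * l s ^ m * ((a r)\<^sup>2 * (b s)\<^sup>2))"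
    unfolding X Y sum_product by (simp add: mult_ac)
  also have "\<dots> \<le> ?T" unfolding T by (intro sum_mono mult_right_mono pw) auto
  finally show "?A \<le> ?T" .
  have "?B = (\<Sum>r<d. \<Sum>s<d. l r ^ j * l s ^ m * (a r * b r * (a s * b s)))"
    unfolding B sum_product by (simp add: mult_ac)
  also have "\<dots> \<le> (\<Sum>r<d. \<Sum>s<d. l r ^ j * l s ^ m * (((a r)\<^sup>2 * (b s)\<^sup>2 + (a s)\<^sup>2 * (b r)\<^sup>2) / 2))"
  proof (intro sum_mono mult_left_mono pn)
    fix r s
    have "0 \<le> (a r * b s - a s * b r)\<^sup>2" by simp
    then show "a r * b r * (a s * b s) \<le> ((a r)\<^sup>2 * (b s)\<^sup>2 + (a s)\<^sup>2 * (b r)\<^sup>2) / 2"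
      by (simp add: power2_diff power_mult_distrib mult_ac)
  qed auto
  also have "\<dots> \<le> ?T" unfolding T' by (intro sum_mono mult_right_mono pw) auto
  finally show "?B \<le> ?T" .
qed

end

section \<open>The matrices governing the random coefficients\<close>

context gmodel
begin

lemma mv_Sg: "mv (Sg i) z = S i z"
  unfolding mv_def Sg_def S_def ip_def by (auto simp: sum_distrib_left sum_distrib_right mult_ac intro: sum.swap)

text \<open>The largest eigenvalues of these matrices are the best constants in \<open>cond1\<close>, \<open>cond2\<close>, \<open>cond3\<close>.
  In \<open>Q3\<close>, indices with \<open>\<tau> i = 0\<close> contribute \<open>0\<close>, as they should: then \<open>Sg i = 0\<close>.\<close>

definition Q1 :: "(nat \<times> nat \<Rightarrow> real) \<Rightarrow> nat \<Rightarrow> nat \<Rightarrow> real" where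
  "Q1 g = (\<lambda>a c. \<Sum>i\<in>I. \<tau> i * (Yv g i a * Yv g i c))"
definition Q2 :: "(nat \<times> nat \<Rightarrow> real) \<Rightarrow> nat \<Rightarrow> nat \<Rightarrow> real" where
  "Q2 = Qw (\<lambda>i a c. \<tau> i * Sg i a c)"
definition Q3 :: "(nat \<times> nat \<Rightarrow> real) \<Rightarrow> nat \<Rightarrow> nat \<Rightarrow> real" where
  "Q3 = Qw (\<lambda>i a c. inverse (\<tau> i) * mm (Sg i) (Sg i) a c)"

lemma symm_Sg: "symm (Sg i)" by (simp add: symm_def Sg_def mult.commute)

lemma symm_Q: "symm (Q1 g)" "symm (Q2 g)" "symm (Q3 g)"
proof -
  have "mm (Sg i) (Sg i) a c = mm (Sg i) (Sg i) c a" for i a c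
    unfolding mm_def Sg_def by (simp add: mult.commute)
  then show "symm (Q1 g)" "symm (Q2 g)" "symm (Q3 g)"
    using symm_Sg unfolding Q1_def Q2_def Q3_def symm_def Qw_def by (simp_all add: mult.commute)
qed

lemma bil_Sg: "bil x (Sg i) y = ip x (S i y)" by (simp add: bil_def mv_Sg)

lemma bil_Q1: "bil x (Q1 g) y = (\<Sum>i\<in>I. \<tau> i * (ip x (Yv g i) * ip (Yv g i) y))"
proof -
  have "Q1 g = (\<lambda>a c. \<Sum>i\<in>I. \<tau> i * dyad (Yv g i) (Yv g i) a c)" by (simp add: Q1_def dyad_def)
  then show ?thesis by (simp only: lin_sum[OF lin_bil] lin_scale[OF lin_bil] bil_dyad)
qed

lemma bil_Q2: "bil x (Q2 g) y = (\<Sum>i\<in>I. ip (Yv g i) (Yv g i) * (\<tau> i * ip x (S i y)))"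
  unfolding Q2_def bil_Qw lin_scale[OF lin_bil] bil_Sg ..

lemma bil_Q3: "bil x (Q3 g) y = (\<Sum>i\<in>I. ip (Yv g i) (Yv g i) * (inverse (\<tau> i) * ip x (S i (S i y))))"
  unfolding Q3_def bil_Qw lin_scale[OF lin_bil] bil_mm mv_Sg bil_Sg ..

lemma cond_Q:
  assumes "0 < p"
  shows "cond1 (Yv g) (schatten p (Q1 g))" "cond2 (Yv g) (schatten p (Q2 g))" "cond3 (Yv g) (schatten p (Q3 g))"
proof -
  have b: "bil x Q x \<le> schatten p Q * ip x x" if "symm Q" for x Q
    using schatten_bound[OF that assms, of x x] by (simp add: nrm_sq[symmetric] power2_eq_square)
  show "cond1 (Yv g) (schatten p (Q1 g))"
    unfolding cond1_def using b[OF symm_Q(1)[of g]] by (simp add: schatten_nonneg symm_Q assms bil_Q1 ip_commute[of "Yv g _"] power2_eq_square)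
  show "cond2 (Yv g) (schatten p (Q2 g))"
    unfolding cond2_def using b[OF symm_Q(2)[of g]] by (simp add: schatten_nonneg symm_Q assms bil_Q2 mult_ac)
  show "cond3 (Yv g) (schatten p (Q3 g))"
    unfolding cond3_def using b[OF symm_Q(3)[of g]] by (simp add: schatten_nonneg symm_Q assms bil_Q3 ip_S_sym divide_inverse mult_ac)
qed

text \<open>With \<open>P\<^sub>i = \<tau> i \<Sigma>\<^sub>i\<close> one has \<open>\<tau> i
  P\<^sub>i\<^sup>2 \<le> (\<tau> i)\<^sup>3 P\<^sub>i\<close> by \<open>S_norm_le\<close>, hence
  \<open>R ^ 3\<close>; the sum of the \<open>\<tau> i P\<^sub>i\<close> loses one factor
  \<open>R\<close> against \<open>conds\<close>.\<close>

lemma moment_Q2: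
  assumes s: "conds s" and R: "condR R" "0 < R"
  shows "(\<integral>g. tr (mpow (Q2 g) k) \<partial>\<gamma>) \<le> real d * (R * s + 4 * real k * R ^ 3) ^ k"
  unfolding Q2_def
proof (rule Qw_moment)
  have mvc: "mv (\<lambda>a c. q * Sg i a c) z = (\<lambda>a. q * S i z a)" for q z i
    unfolding mv_Sg[symmetric] by (simp add: mv_def sum_distrib_left mult.assoc)
  fix i z assume i: "i \<in> I"
  show "symm (\<lambda>a c. \<tau> i * Sg i a c)" using symm_Sg by (simp add: symm_def)
  show "0 \<le> bil z (\<lambda>a c. \<tau> i * Sg i a c) z"
    unfolding lin_scale[OF lin_bil] bil_Sg by (simp add: \<tau>_nonneg ip_S_nonneg)
  have t: "0 \<le> \<tau> i" "\<tau> i \<le> R" using R i by (auto simp: condR_def \<tau>_nonneg)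
  have "\<tau> i * ip (mv (\<lambda>a c. \<tau> i * Sg i a c) z) (mv (\<lambda>a c. \<tau> i * Sg i a c) z) = \<tau> i ^ 3 * ip (S i z) (S i z)"
    by (simp add: mvc power3_eq_cube mult_ac)
  also have "\<dots> \<le> \<tau> i ^ 3 * (\<tau> i * ip z (S i z))" using t by (intro mult_left_mono S_norm_le) auto
  also have "\<dots> \<le> R ^ 3 * (\<tau> i * ip z (S i z))" using t by (intro mult_right_mono power_mono mult_nonneg_nonneg ip_S_nonneg) auto
  finally show "\<tau> i * ip (mv (\<lambda>a c. \<tau> i * Sg i a c) z) (mv (\<lambda>a c. \<tau> i * Sg i a c) z) \<le> R ^ 3 * bil z (\<lambda>a c. \<tau> i * Sg i a c) z"
    unfolding lin_scale[OF lin_bil] bil_Sg .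
next
  fix z
  have "(\<Sum>i\<in>I. \<tau> i * bil z (\<lambda>a c. \<tau> i * Sg i a c) z) \<le> (\<Sum>i\<in>I. R * (\<tau> i * ip z (S i z)))"
    unfolding lin_scale[OF lin_bil] bil_Sg using R by (intro sum_mono mult_right_mono mult_nonneg_nonneg \<tau>_nonneg ip_S_nonneg) (auto simp: condR_def)
  also have "\<dots> \<le> R * (s * ip z z)" using s R unfolding sum_distrib_left[symmetric] conds_def by (intro mult_left_mono) auto
  finally show "(\<Sum>i\<in>I. \<tau> i * bil z (\<lambda>a c. \<tau> i * Sg i a c) z) \<le> R * s * ip z z" by (simp add: mult.assoc)
qed (use s R in \<open>auto simp: conds_def\<close>)

text \<open>Here \<open>\<tau> i P\<^sub>i\<close> is the squared covariance, so the sum is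
  controlled by \<open>condv\<close> directly, and the operator norm of
  \<open>\<Sigma>\<^sub>i\<close>, at most \<open>\<tau> i\<close>, gives
  \<open>R\<^sup>2\<close>.\<close>

lemma moment_Q3:
  assumes v: "condv v" and R: "condR R" "0 < R"
  shows "(\<integral>g. tr (mpow (Q3 g) k) \<partial>\<gamma>) \<le> real d * (v + 4 * real k * R ^ 2) ^ k"
  unfolding Q3_def
proof (rule Qw_moment)
  have mvc: "mv (\<lambda>a c. q * mm (Sg i) (Sg i) a c) z = (\<lambda>a. q * S i (S i z) a)" for q z i
    unfolding mv_Sg[symmetric] mv_mm[symmetric] by (simp add: mv_def sum_distrib_left mult.assoc)
  have bilc: "bil z (\<lambda>a c. inverse (\<tau> i) * mm (Sg i) (Sg i) a c) z = inverse (\<tau> i) * ip (S i z) (S i z)" for i z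
    unfolding lin_scale[OF lin_bil] bil_mm mv_Sg bil_Sg ip_S_sym ..
  fix i z assume i: "i \<in> I"
  show "symm (\<lambda>a c. inverse (\<tau> i) * mm (Sg i) (Sg i) a c)"
    unfolding symm_def mm_def Sg_def by (simp add: mult.commute)
  show "0 \<le> bil z (\<lambda>a c. inverse (\<tau> i) * mm (Sg i) (Sg i) a c) z"
    unfolding bilc by (simp add: \<tau>_nonneg)
  have t: "0 \<le> \<tau> i" "\<tau> i \<le> R" using R i by (auto simp: condR_def \<tau>_nonneg)
  have "\<tau> i * ip (mv (\<lambda>a c. inverse (\<tau> i) * mm (Sg i) (Sg i) a c) z) (mv (\<lambda>a c. inverse (\<tau> i) * mm (Sg i) (Sg i) a c) z) = inverse (\<tau> i) * ip (S i (S i z)) (S i (S i z))"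
    unfolding mvc ip_lin by (cases "\<tau> i = 0") (simp_all add: field_simps)
  also have "\<dots> \<le> inverse (\<tau> i) * (R\<^sup>2 * ip (S i z) (S i z))"
  proof (rule mult_left_mono)
    have "(nrm (S i (S i z)))\<^sup>2 \<le> (\<tau> i * nrm (S i z))\<^sup>2" using nrm_S_le by (intro power_mono) auto
    also have "\<dots> \<le> (R * nrm (S i z))\<^sup>2" using t by (intro power_mono mult_right_mono) auto
    finally show "ip (S i (S i z)) (S i (S i z)) \<le> R\<^sup>2 * ip (S i z) (S i z)" by (simp add: power_mult_distrib nrm_sq)
  qed (use t in simp)
  finally show "\<tau> i * ip (mv (\<lambda>a c. inverse (\<tau> i) * mm (Sg i) (Sg i) a c) z) (mv (\<lambda>a c. inverse (\<tau> i) * mm (Sg i) (Sg i) a c) z)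
     \<le> R\<^sup>2 * bil z (\<lambda>a c. inverse (\<tau> i) * mm (Sg i) (Sg i) a c) z"
    unfolding bilc by (simp add: mult_ac)
next
  have bilc: "bil z (\<lambda>a c. inverse (\<tau> i) * mm (Sg i) (Sg i) a c) z = inverse (\<tau> i) * ip (S i z) (S i z)" for i z
    unfolding lin_scale[OF lin_bil] bil_mm mv_Sg bil_Sg ip_S_sym ..
  fix z
  have "(\<Sum>i\<in>I. \<tau> i * bil z (\<lambda>a c. inverse (\<tau> i) * mm (Sg i) (Sg i) a c) z) \<le> (\<Sum>i\<in>I. ip (S i z) (S i z))"
    unfolding bilc by (intro sum_mono) (case_tac "\<tau> i = 0", auto simp: mult.assoc[symmetric])
  also have "\<dots> \<le> v * ip z z" using v unfolding condv_def by auto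
  finally show "(\<Sum>i\<in>I. \<tau> i * bil z (\<lambda>a c. inverse (\<tau> i) * mm (Sg i) (Sg i) a c) z) \<le> v * ip z z" .
qed (use v R in \<open>auto simp: condv_def\<close>)

end

context dimn
begin

lemma tr_mm_dyad: "tr (mm (dyad x y) M) = bil y M x"
  unfolding tr_def mm_def dyad_def bil_sum2 by (subst sum.swap) (simp add: mult_ac)

lemma lin_tr_mm: "lin (\<lambda>A. tr (mm A M))"
  unfolding lin_def tr_def mm_def by (auto simp: algebra_simps sum.distrib sum_distrib_left)

end

section \<open>Moments of the matrix with random directions\<close>

context gmodel
begin

lemma tr_mm_Q1: "tr (mm (Q1 g) M) = (\<Sum>i\<in>I. \<tau> i * bil (Yv g i) M (Yv g i))"
proof -
  have "Q1 g = (\<lambda>a c. \<Sum>i\<in>I. \<tau> i * dyad (Yv g i) (Yv g i) a c)" by (simp add: Q1_def dyad_def)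
  then show ?thesis by (simp only: lin_sum[OF lin_tr_mm] lin_scale[OF lin_tr_mm] tr_mm_dyad)
qed

lemma tr_mm_Q2: "tr (mm (Q2 g) M) = (\<Sum>i\<in>I. ip (Yv g i) (Yv g i) * (\<tau> i * trS i M))"
proof -
  have "Sg i = (\<lambda>a c. \<Sum>b<d. dyad (u i b) (u i b) a c)" for i by (simp add: Sg_def dyad_def)
  then have "tr (mm (Sg i) M) = trS i M" for i by (simp only: lin_sum[OF lin_tr_mm] tr_mm_dyad trS_def)
  then show ?thesis unfolding Q2_def tr_mm_Qw lin_scale[OF lin_tr_mm] by simp
qed

lemma poly_Q1: "polyfun (I \<times> {..<d}) (\<lambda>g. Q1 g a c)"
  unfolding Q1_def by (intro polyfun_sum polyfun_mult polyfun_const poly_Y) auto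

lemma poly_Q: "polyfun (I \<times> {..<d}) (\<lambda>g. Q2 g a c)" "polyfun (I \<times> {..<d}) (\<lambda>g. Q3 g a c)"
  unfolding Q2_def Q3_def by (rule poly_Qw)+

lemma pd_Q1: assumes ib: "i \<in> I" "b < d"
  shows "haspd (i, b) (\<lambda>g. Q1 g a c) (\<lambda>g. \<tau> i * (u i b a * Yv g i c + Yv g i a * u i b c))"
proof -
  have "haspd (i, b) (\<lambda>g. Q1 g a c) (\<lambda>g. \<Sum>l\<in>I. \<tau> l * ((if l = i then u i b a else 0) * Yv g l c + Yv g l a * (if l = i then u i b c else 0)))"
    unfolding Q1_def by (intro haspd_sum haspd_cmult haspd_mult pd_Y ib)
  then show ?thesis
  proof (rule haspd_cong)
    fix g
    have "(\<Sum>l\<in>I. \<tau> l * ((if l = i then u i b a else 0) * Yv g l c + Yv g l a * (if l = i then u i b c else 0)))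
       = (\<Sum>l\<in>I. if l = i then \<tau> i * (u i b a * Yv g i c + Yv g i a * u i b c) else 0)"
      by (intro sum.cong) auto
    also have "\<dots> = \<tau> i * (u i b a * Yv g i c + Yv g i a * u i b c)" using ib finite_I by simp
    finally show "(\<Sum>l\<in>I. \<tau> l * ((if l = i then u i b a else 0) * Yv g l c + Yv g l a * (if l = i then u i b c else 0)))
       = \<tau> i * (u i b a * Yv g i c + Yv g i a * u i b c)" .
  qed
qed

text \<open>In \<open>Q1\<close> the directions are random as well, so hitting a factor of the power
  does not reproduce \<open>Q1\<close> alone. By \<open>spec_two_forms\<close> the new terms are at
  most one trace of a power of \<open>Q1\<close> and one mixed trace, in which the length of
  \<open>Yv g i\<close> is separated from its direction; the latter is where \<open>Q2\<close>
  enters. At \<open>k = 0\<close> the truncated \<open>k - 1\<close> occurs with coefficient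
  0.\<close>

lemma Q1_step:
  assumes s: "conds s" and R: "condR R"
  shows "(\<integral>g. tr (mpow (Q1 g) (Suc k)) \<partial>\<gamma>) \<le>
    (\<integral>g. (s + 2 * real k * R\<^sup>2) * tr (mpow (Q1 g) k) + 2 * real k * R * tr (mm (Q2 g) (mpow (Q1 g) (k - 1))) \<partial>\<gamma>)"
proof -
  let ?J = "I \<times> {..<d}"
  have pQ: "polyfun ?J (\<lambda>g. mpow (Q1 g) k a c)" if "a < d" "c < d" for a c k
    by (rule polyfun_mpow[OF poly_Q1 that])
  have pb: "polyfun ?J (\<lambda>g. bil (u i b) (mpow (Q1 g) k) (Yv g i))" if "i \<in> I" for i b k
    using that by (intro polyfun_bil pQ polyfun_const poly_Y)
  define T where "T i b g = bil (u i b) (mpow (Q1 g) k) (u i b) + \<tau> i * (\<Sum>j<k. bil (u i b) (mpow (Q1 g) j) (u i b) * bil (Yv g i) (mpow (Q1 g) (k - 1 - j)) (Yv g i)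
      + bil (u i b) (mpow (Q1 g) j) (Yv g i) * bil (u i b) (mpow (Q1 g) (k - 1 - j)) (Yv g i))" for i b g
  have pT: "polyfun ?J (T i b)" if "i \<in> I" for i b
    unfolding T_def using that by (intro polyfun_add polyfun_mult polyfun_const polyfun_sum polyfun_bil pQ poly_Y)
  have der: "haspd (i, b) (\<lambda>g. bil (u i b) (mpow (Q1 g) k) (Yv g i)) (T i b)" if i: "i \<in> I" and b: "b < d" for i b
  proof -
    have "haspd (i, b) (\<lambda>g. Yv g i a) (\<lambda>g. u i b a)" for a using pd_Y[OF b, of i i a] by simp
    then have "haspd (i, b) (\<lambda>g. bil (u i b) (mpow (Q1 g) k) (Yv g i))
       (\<lambda>g. bil (\<lambda>a. 0) (mpow (Q1 g) k) (Yv g i) + bil (u i b) (mpow (Q1 g) k) (u i b) +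
         (\<Sum>j<k. bil (u i b) (mpow (Q1 g) j) (mv (\<lambda>a c. \<tau> i * (u i b a * Yv g i c + Yv g i a * u i b c)) (mv (mpow (Q1 g) (k - 1 - j)) (Yv g i)))))"
      by (intro haspd_bil_mpow[where x = "\<lambda>g. u i b"] pd_Q1 i b haspd_const)
    then show ?thesis
    proof (rule haspd_cong)
      fix g
      have m: "mv (\<lambda>a c. \<tau> i * (u i b a * Yv g i c + Yv g i a * u i b c)) z = (\<lambda>a. \<tau> i * (ip (Yv g i) z * u i b a + ip (u i b) z * Yv g i a))" for z
        unfolding mv_def ip_def by (auto simp: sum_distrib_left sum_distrib_right sum.distrib algebra_simps)
      show "bil (\<lambda>a. 0) (mpow (Q1 g) k) (Yv g i) + bil (u i b) (mpow (Q1 g) k) (u i b) +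
         (\<Sum>j<k. bil (u i b) (mpow (Q1 g) j) (mv (\<lambda>a c. \<tau> i * (u i b a * Yv g i c + Yv g i a * u i b c)) (mv (mpow (Q1 g) (k - 1 - j)) (Yv g i)))) = T i b g"
        unfolding m T_def bil_zero bil_lin bil_def[symmetric] by (simp add: sum_distrib_left algebra_simps)
    qed
  qed
  have "(\<integral>g. tr (mpow (Q1 g) (Suc k)) \<partial>\<gamma>) = (\<integral>g. (\<Sum>i\<in>I. \<Sum>b<d. \<tau> i * (g (i, b) * bil (u i b) (mpow (Q1 g) k) (Yv g i))) \<partial>\<gamma>)"
    by (intro Bochner_Integration.integral_cong refl) (simp add: tr_mm_Q1 Yv_bil sum_distrib_left)
  also have "\<dots> = (\<Sum>i\<in>I. \<Sum>b<d. \<tau> i * (\<integral>g. g (i, b) * bil (u i b) (mpow (Q1 g) k) (Yv g i) \<partial>\<gamma>))"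
  proof -
    have q: "polyfun ?J (\<lambda>g. g (i, b) * bil (u i b) (mpow (Q1 g) k) (Yv g i))" if "i \<in> I" "b < d" for i b
      using that by (intro polyfun_mult pb polyfun_var) auto
    then have q': "polyfun ?J (\<lambda>g. \<tau> i * (g (i, b) * bil (u i b) (mpow (Q1 g) k) (Yv g i)))" if "i \<in> I" "b < d" for i b
      using that by (intro polyfun_mult[OF polyfun_const]) auto
    have "(\<integral>g. (\<Sum>b<d. \<tau> i * (g (i, b) * bil (u i b) (mpow (Q1 g) k) (Yv g i))) \<partial>\<gamma>) =
       (\<Sum>b<d. \<tau> i * (\<integral>g. g (i, b) * bil (u i b) (mpow (Q1 g) k) (Yv g i) \<partial>\<gamma>))" if "i \<in> I" for i
      by (subst integral_sum_poly) (use q' that in auto)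
    then show ?thesis using q'
      by (subst integral_sum_poly) (auto intro!: polyfun_sum)
  qed
  also have "\<dots> = (\<Sum>i\<in>I. \<Sum>b<d. \<tau> i * (\<integral>g. T i b g \<partial>\<gamma>))"
    using der pb by (intro sum.cong refl arg_cong2[where f = times] gauss_ibp) auto
  also have "\<dots> = (\<integral>g. (\<Sum>i\<in>I. \<Sum>b<d. \<tau> i * T i b g) \<partial>\<gamma>)"
  proof -
    have q': "polyfun ?J (\<lambda>g. \<tau> i * T i b g)" if "i \<in> I" for i b
      using pT that by (intro polyfun_mult[OF polyfun_const]) auto
    show ?thesis using q'
      by (subst integral_sum_poly) (auto intro!: polyfun_sum sum.cong simp: integral_sum_poly)
  qed
  also have "\<dots> \<le> (\<integral>g. (s + 2 * real k * R\<^sup>2) * tr (mpow (Q1 g) k) + 2 * real k * R * tr (mm (Q2 g) (mpow (Q1 g) (k - 1))) \<partial>\<gamma>)"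
  proof (rule integral_mono)
    show "integrable \<gamma> (\<lambda>g. \<Sum>i\<in>I. \<Sum>b<d. \<tau> i * T i b g)"
      by (intro polyfun_integrable polyfun_sum polyfun_mult polyfun_const pT)
    show "integrable \<gamma> (\<lambda>g. (s + 2 * real k * R\<^sup>2) * tr (mpow (Q1 g) k) + 2 * real k * R * tr (mm (Q2 g) (mpow (Q1 g) (k - 1))))"
      by (intro polyfun_integrable polyfun_add polyfun_mult polyfun_const polyfun_tr polyfun_mm pQ poly_Q)
    fix g
    obtain e l where el: "spec (Q1 g) e l" using spectral[OF symm_Q(1)] by blast
    have o: "orthon d e" using el by (simp add: spec_def)
    have l: "0 \<le> l r" if "r < d" for r
    proof (rule spec_eig_nonneg[OF el _ that])
      show "0 \<le> bil z (Q1 g) z" for z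
        unfolding bil_Q1 ip_commute[of "Yv g _"] by (intro sum_nonneg mult_nonneg_nonneg[OF \<tau>_nonneg] zero_le_square)
    qed
    have trQ: "trS i (mpow (Q1 g) k) = (\<Sum>r<d. l r ^ k * ip (e r) (S i (e r)))" for i k
      unfolding trS_def spec_bil[OF spec_mpow[OF el]] ip_S sum_distrib_left
      by (subst sum.swap) (simp add: ip_commute[of "u _ _"] mult.assoc)
    have first: "(\<Sum>i\<in>I. \<tau> i * trS i (mpow (Q1 g) k)) \<le> s * tr (mpow (Q1 g) k)"
    proof -
      have "(\<Sum>i\<in>I. \<tau> i * trS i (mpow (Q1 g) k)) = (\<Sum>i\<in>I. \<Sum>r<d. l r ^ k * (\<tau> i * ip (e r) (S i (e r))))"
        by (simp add: trQ sum_distrib_left mult_ac)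
      also have "\<dots> = (\<Sum>r<d. l r ^ k * (\<Sum>i\<in>I. \<tau> i * ip (e r) (S i (e r))))"
        by (subst sum.swap) (simp add: sum_distrib_left)
      also have "\<dots> \<le> (\<Sum>r<d. l r ^ k * (s * ip (e r) (e r)))"
        using l s unfolding conds_def by (intro sum_mono mult_left_mono) auto
      also have "\<dots> = s * tr (mpow (Q1 g) k)"
        using o unfolding spec_tr_mpow[OF el] by (simp add: orthon_def sum_distrib_left mult.commute)
      finally show ?thesis .
    qed
    define V where "V i b = bil (u i b) (mpow (Q1 g) (k - 1)) (u i b) * ip (Yv g i) (Yv g i) + ip (u i b) (u i b) * bil (Yv g i) (mpow (Q1 g) (k - 1)) (Yv g i)" for i b
    have posY: "0 \<le> bil y (mpow (Q1 g) m) y" for y m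
      unfolding spec_bil[OF spec_mpow[OF el]] using l
      by (auto intro!: sum_nonneg simp: ip_commute[of "e _" y] mult.assoc power2_eq_square[symmetric])
    have Tb: "T i b g \<le> bil (u i b) (mpow (Q1 g) k) (u i b) + \<tau> i * (2 * real k * V i b)" for i b
    proof -
      have "(\<Sum>j<k. bil (u i b) (mpow (Q1 g) j) (u i b) * bil (Yv g i) (mpow (Q1 g) (k - 1 - j)) (Yv g i)
         + bil (u i b) (mpow (Q1 g) j) (Yv g i) * bil (u i b) (mpow (Q1 g) (k - 1 - j)) (Yv g i)) \<le> (\<Sum>j<k. 2 * V i b)"
      proof (rule sum_mono)
        fix j assume "j \<in> {..<k}"
        then have "j + (k - 1 - j) = k - 1" by auto
        then show "bil (u i b) (mpow (Q1 g) j) (u i b) * bil (Yv g i) (mpow (Q1 g) (k - 1 - j)) (Yv g i)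
         + bil (u i b) (mpow (Q1 g) j) (Yv g i) * bil (u i b) (mpow (Q1 g) (k - 1 - j)) (Yv g i) \<le> 2 * V i b"
          using spec_two_forms[OF el l, of "u i b" j "Yv g i" "k - 1 - j"] by (simp add: V_def)
      qed
      then show ?thesis unfolding T_def using \<tau>_nonneg[of i] by (intro add_left_mono mult_left_mono) auto
    qed
    have "(\<Sum>i\<in>I. \<Sum>b<d. \<tau> i * T i b g) \<le> (\<Sum>i\<in>I. \<Sum>b<d. \<tau> i * (bil (u i b) (mpow (Q1 g) k) (u i b) + \<tau> i * (2 * real k * V i b)))"
      by (intro sum_mono mult_left_mono Tb \<tau>_nonneg)
    also have "\<dots> = (\<Sum>i\<in>I. \<tau> i * trS i (mpow (Q1 g) k)) + 2 * real k * (\<Sum>i\<in>I. \<tau> i * (\<tau> i * (\<Sum>b<d. V i b)))"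
      unfolding trS_def by (simp add: sum.distrib sum_distrib_left algebra_simps)
    also have "(\<Sum>i\<in>I. \<tau> i * (\<tau> i * (\<Sum>b<d. V i b))) \<le> (\<Sum>i\<in>I. R * (ip (Yv g i) (Yv g i) * (\<tau> i * trS i (mpow (Q1 g) (k - 1)))) + R\<^sup>2 * (\<tau> i * bil (Yv g i) (mpow (Q1 g) (k - 1)) (Yv g i)))"
    proof (rule sum_mono)
      fix i assume i: "i \<in> I"
      have t: "0 \<le> \<tau> i" "\<tau> i \<le> R" using R i by (auto simp: condR_def \<tau>_nonneg)
      have V: "(\<Sum>b<d. V i b) = trS i (mpow (Q1 g) (k - 1)) * ip (Yv g i) (Yv g i) + \<tau> i * bil (Yv g i) (mpow (Q1 g) (k - 1)) (Yv g i)"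
        unfolding V_def trS_def \<tau>_def by (simp add: sum.distrib sum_distrib_right)
      have "\<tau> i * (\<tau> i * (\<Sum>b<d. V i b)) = \<tau> i * (ip (Yv g i) (Yv g i) * (\<tau> i * trS i (mpow (Q1 g) (k - 1)))) + (\<tau> i)\<^sup>2 * (\<tau> i * bil (Yv g i) (mpow (Q1 g) (k - 1)) (Yv g i))"
        unfolding V by (simp add: algebra_simps power2_eq_square)
      also have "\<dots> \<le> R * (ip (Yv g i) (Yv g i) * (\<tau> i * trS i (mpow (Q1 g) (k - 1)))) + R\<^sup>2 * (\<tau> i * bil (Yv g i) (mpow (Q1 g) (k - 1)) (Yv g i))"
        using t posY by (intro add_mono mult_right_mono power_mono) (auto simp: trS_def intro!: mult_nonneg_nonneg sum_nonneg)
      finally show "\<tau> i * (\<tau> i * (\<Sum>b<d. V i b)) \<le> R * (ip (Yv g i) (Yv g i) * (\<tau> i * trS i (mpow (Q1 g) (k - 1)))) + R\<^sup>2 * (\<tau> i * bil (Yv g i) (mpow (Q1 g) (k - 1)) (Yv g i))" .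
    qed
    also have "\<dots> = R * tr (mm (Q2 g) (mpow (Q1 g) (k - 1))) + R\<^sup>2 * tr (mm (Q1 g) (mpow (Q1 g) (k - 1)))"
      unfolding tr_mm_Q1 tr_mm_Q2 by (simp add: sum.distrib sum_distrib_left)
    finally have "(\<Sum>i\<in>I. \<Sum>b<d. \<tau> i * T i b g) \<le> (\<Sum>i\<in>I. \<tau> i * trS i (mpow (Q1 g) k)) + 2 * real k * (R * tr (mm (Q2 g) (mpow (Q1 g) (k - 1))) + R\<^sup>2 * tr (mm (Q1 g) (mpow (Q1 g) (k - 1))))"
      by (simp add: mult_left_mono)
    also have "\<dots> \<le> s * tr (mpow (Q1 g) k) + 2 * real k * (R * tr (mm (Q2 g) (mpow (Q1 g) (k - 1))) + R\<^sup>2 * tr (mpow (Q1 g) k))"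
      using first by (cases k) auto
    finally show "(\<Sum>i\<in>I. \<Sum>b<d. \<tau> i * T i b g) \<le> (s + 2 * real k * R\<^sup>2) * tr (mpow (Q1 g) k) + 2 * real k * R * tr (mm (Q2 g) (mpow (Q1 g) (k - 1)))"
      by (simp add: algebra_simps)
  qed
  finally show ?thesis .
qed

lemma Q1_eig:
  obtains e l where "spec (Q1 g) e l" "\<And>r. r < d \<Longrightarrow> 0 \<le> l r"
proof -
  obtain e l where el: "spec (Q1 g) e l" using spectral[OF symm_Q(1)] by blast
  have "0 \<le> l r" if "r < d" for r
  proof (rule spec_eig_nonneg[OF el _ that])
    show "0 \<le> bil z (Q1 g) z" for z
      unfolding bil_Q1 ip_commute[of "Yv g _"] by (intro sum_nonneg mult_nonneg_nonneg[OF \<tau>_nonneg] zero_le_square)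
  qed
  with el that show ?thesis by blast
qed

lemma tr_Q2_Q1:
  assumes "0 < p" shows "tr (mm (Q2 g) (mpow (Q1 g) m)) \<le> schatten p (Q2 g) * tr (mpow (Q1 g) m)"
proof -
  obtain e l where el: "spec (Q1 g) e l" and l: "\<And>r. r < d \<Longrightarrow> 0 \<le> l r" using Q1_eig by blast
  have o: "nrm (e r) = 1" if "r < d" for r using el that by (simp add: spec_def orthon_def nrm_def)
  have "tr (mm (Q2 g) (mpow (Q1 g) m)) = (\<Sum>r<d. l r ^ m * bil (e r) (Q2 g) (e r))"
    by (subst tr_mm_comm) (rule tr_mm_spec[OF spec_mpow[OF el]])
  also have "\<dots> \<le> (\<Sum>r<d. l r ^ m * schatten p (Q2 g))"
  proof (intro sum_mono mult_left_mono)
    fix r assume "r \<in> {..<d}"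
    then show "bil (e r) (Q2 g) (e r) \<le> schatten p (Q2 g)"
      using schatten_bound[OF symm_Q(2) assms, of "e r" g "e r"] o by simp
  qed (use l in auto)
  also have "\<dots> = schatten p (Q2 g) * tr (mpow (Q1 g) m)"
    by (simp add: spec_tr_mpow[OF el] sum_distrib_right mult.commute)
  finally show ?thesis .
qed

text \<open>After division by \<open>A\<close> the lower powers and the factor from
  \<open>Q2\<close> are bounded by top powers plus constants. \<open>A\<close> is so large that the
  top moment of \<open>Q1\<close> returns with coefficient below 1 and can be absorbed into the left
  side.\<close>

lemma moment_Q1:
  assumes s: "conds s" and R: "condR R" "0 < R" and p: "0 < p" and dp: "real d \<le> 2 ^ (2 * p)"
  shows "(\<integral>g. tr (mpow (Q1 g) (2 * p)) \<partial>\<gamma>) \<le> real d * (8 * s + 64 * real p * R\<^sup>2) ^ (2 * p)"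
proof -
  define A where "A = 8 * s + 64 * real p * R\<^sup>2"
  define K where "K = 2 * p"
  have s0: "0 \<le> s" using s by (simp add: conds_def)
  have A: "0 < A" unfolding A_def using s0 R p by (intro add_nonneg_pos) auto
  have K: "2 \<le> K" "real (K - 1) \<le> 2 * real p" using p by (auto simp: K_def)
  \<comment> \<open>With \<open>q = p * R\<^sup>2\<close>, the value
    \<open>A / 8 = s + 8 * q\<close> covers the coefficient of the pure trace and
    \<open>A / 16\<close> that of the mixed one; this fixes the constants 8 and 64.\<close>
  have gen: "t \<le> 4 * q \<Longrightarrow> 0 \<le> q \<Longrightarrow> A = 8 * s + 64 * q \<Longrightarrow> s + t \<le> A / 8 \<and> t \<le> A / 16" for t q
    using s0 by linarith
  have "2 * real (K - 1) * R\<^sup>2 \<le> 2 * (2 * real p) * R\<^sup>2" using K by (intro mult_right_mono) auto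
  then have c: "2 * real (K - 1) * R\<^sup>2 \<le> 4 * (real p * R\<^sup>2)" by (simp add: mult.assoc)
  have c1: "s + 2 * real (K - 1) * R\<^sup>2 \<le> A / 8" and c2: "2 * real (K - 1) * R\<^sup>2 \<le> A / 16"
    using gen[OF c] by (simp_all add: A_def)
  have pointwise: "(s + 2 * real (K - 1) * R\<^sup>2) * tr (mpow (Q1 g) (K - 1)) + 2 * real (K - 1) * R * tr (mm (Q2 g) (mpow (Q1 g) (K - 1 - 1)))
     \<le> 3 / 16 * tr (mpow (Q1 g) K) + A ^ K * real d / 4 + A ^ K * real d / 16 * (tr (mpow (Q2 g) K) / (R * A) ^ K)" for g
  proof -
    obtain e l where el: "spec (Q1 g) e l" and l: "\<And>r. r < d \<Longrightarrow> 0 \<le> l r" using Q1_eig by blast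
    define y where "y = schatten p (Q2 g) / (R * A)"
    define x where "x r = l r / A" for r
    have lx: "l r = A * x r" for r using A by (simp add: x_def)
    have y0: "0 \<le> y" unfolding y_def using schatten_nonneg[OF symm_Q(2) p] R A by simp
    have x0: "0 \<le> x r" if "r < d" for r using l[OF that] A by (simp add: x_def)
    have yK: "y ^ K = tr (mpow (Q2 g) K) / (R * A) ^ K"
      unfolding y_def K_def power_divide schatten_pow[OF symm_Q(2) p] ..
    have AK: "A ^ K = A * A ^ (K - 1)" "A ^ (K - 1) = A * A ^ (K - 1 - 1)"
      using K by (metis Suc_diff_1 less_le_trans pos2 power_Suc, metis Suc_diff_Suc diff_diff_left le_trans one_add_one plus_1_eq_Suc power_Suc zero_less_diff K(1) Suc_le_lessD numeral_2_eq_2 diff_Suc_1)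
    have A1: "(s + 2 * real (K - 1) * R\<^sup>2) * l r ^ (K - 1) \<le> A ^ K / 8 * (x r ^ K + 1)" if r: "r < d" for r
    proof -
      have "(s + 2 * real (K - 1) * R\<^sup>2) * l r ^ (K - 1) \<le> A / 8 * l r ^ (K - 1)" using c1 l[OF r] by (intro mult_right_mono) auto
      also have "\<dots> = A ^ K / 8 * x r ^ (K - 1)" unfolding AK lx power_mult_distrib by simp
      also have "\<dots> \<le> A ^ K / 8 * (x r ^ K + 1)" using A x0[OF r] by (intro mult_left_mono pow_le_pow_add_1) auto
      finally show ?thesis .
    qed
    have A2: "2 * real (K - 1) * R * (schatten p (Q2 g) * l r ^ (K - 1 - 1)) \<le> A ^ K / 16 * (y ^ K + x r ^ K + 2)" if r: "r < d" for r
    proof -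
      have "2 * real (K - 1) * R * (schatten p (Q2 g) * l r ^ (K - 1 - 1)) = (2 * real (K - 1) * R\<^sup>2) * (A ^ (K - 1) * (y * x r ^ (K - 1 - 1)))"
        using R A unfolding AK(2) lx power_mult_distrib y_def by (simp add: power2_eq_square)
      also have "\<dots> \<le> A / 16 * (A ^ (K - 1) * (y * x r ^ (K - 1 - 1)))"
        using c2 A y0 x0[OF r] by (intro mult_right_mono) auto
      also have "\<dots> = A ^ K / 16 * (y ^ 1 * x r ^ (K - 1 - 1))" unfolding AK(1) by simp
      also have "\<dots> \<le> A ^ K / 16 * (y ^ K + x r ^ K + 2)"
      proof (rule mult_left_mono)
        have "y ^ 1 * x r ^ (K - 1 - 1) \<le> y ^ (1 + (K - 1 - 1)) + x r ^ (1 + (K - 1 - 1))" by (rule pow_mult_le_add[OF y0 x0[OF r]])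
        also have "\<dots> \<le> (y ^ K + 1) + (x r ^ K + 1)" using K by (intro add_mono pow_le_pow_add_1 y0 x0[OF r]) auto
        finally show "y ^ 1 * x r ^ (K - 1 - 1) \<le> y ^ K + x r ^ K + 2" by simp
      qed (use A in simp)
      finally show ?thesis .
    qed
    have "2 * real (K - 1) * R * tr (mm (Q2 g) (mpow (Q1 g) (K - 1 - 1))) \<le> 2 * real (K - 1) * R * (schatten p (Q2 g) * tr (mpow (Q1 g) (K - 1 - 1)))"
      using R by (intro mult_left_mono tr_Q2_Q1 p) auto
    then have "(s + 2 * real (K - 1) * R\<^sup>2) * tr (mpow (Q1 g) (K - 1)) + 2 * real (K - 1) * R * tr (mm (Q2 g) (mpow (Q1 g) (K - 1 - 1)))
       \<le> (\<Sum>r<d. (s + 2 * real (K - 1) * R\<^sup>2) * l r ^ (K - 1) + 2 * real (K - 1) * R * (schatten p (Q2 g) * l r ^ (K - 1 - 1)))"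
      unfolding spec_tr_mpow[OF el] by (simp add: sum.distrib sum_distrib_left)
    also have "\<dots> \<le> (\<Sum>r<d. A ^ K / 8 * (x r ^ K + 1) + A ^ K / 16 * (y ^ K + x r ^ K + 2))"
      by (intro sum_mono add_mono A1 A2) auto
    also have "\<dots> = (\<Sum>r<d. 3 / 16 * (A * x r) ^ K + A ^ K / 4 + A ^ K / 16 * y ^ K)"
      by (intro sum.cong refl) (simp add: power_mult_distrib field_simps)
    also have "\<dots> = 3 / 16 * tr (mpow (Q1 g) K) + A ^ K * real d / 4 + A ^ K * real d / 16 * y ^ K"
      unfolding spec_tr_mpow[OF el] lx by (simp add: sum.distrib sum_distrib_left mult_ac)
    finally show ?thesis unfolding yK .
  qed
  have pQ: "polyfun (I \<times> {..<d}) (\<lambda>g. tr (mpow (Q1 g) k))" "polyfun (I \<times> {..<d}) (\<lambda>g. tr (mpow (Q2 g) k))" for k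
    by (intro polyfun_tr polyfun_mpow poly_Q1 poly_Q, assumption+)+
  define Z where "Z = (\<integral>g. tr (mpow (Q1 g) K) \<partial>\<gamma>)"
  have "Z = (\<integral>g. tr (mpow (Q1 g) (Suc (K - 1))) \<partial>\<gamma>)" using K unfolding Z_def by simp
  also have "\<dots> \<le> (\<integral>g. (s + 2 * real (K - 1) * R\<^sup>2) * tr (mpow (Q1 g) (K - 1)) + 2 * real (K - 1) * R * tr (mm (Q2 g) (mpow (Q1 g) (K - 1 - 1))) \<partial>\<gamma>)"
    by (rule Q1_step[OF s R(1)])
  also have "\<dots> \<le> (\<integral>g. 3 / 16 * tr (mpow (Q1 g) K) + A ^ K * real d / 4 + A ^ K * real d / 16 * (tr (mpow (Q2 g) K) / (R * A) ^ K) \<partial>\<gamma>)"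
  proof (rule integral_mono[OF _ _ pointwise])
    show "integrable \<gamma> (\<lambda>g. (s + 2 * real (K - 1) * R\<^sup>2) * tr (mpow (Q1 g) (K - 1)) + 2 * real (K - 1) * R * tr (mm (Q2 g) (mpow (Q1 g) (K - 1 - 1))))"
      by (intro polyfun_integrable polyfun_add polyfun_mult polyfun_const polyfun_tr polyfun_mm polyfun_mpow poly_Q poly_Q1)
    show "integrable \<gamma> (\<lambda>g. 3 / 16 * tr (mpow (Q1 g) K) + A ^ K * real d / 4 + A ^ K * real d / 16 * (tr (mpow (Q2 g) K) / (R * A) ^ K))"
      unfolding divide_inverse by (intro polyfun_integrable polyfun_add polyfun_mult polyfun_const pQ)
  qed
  also have "\<dots> = 3 / 16 * Z + A ^ K * real d / 4 + A ^ K * real d / 16 * ((\<integral>g. tr (mpow (Q2 g) K) \<partial>\<gamma>) / (R * A) ^ K)"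
    unfolding Z_def using polyfun_integrable[OF pQ(1)] polyfun_integrable[OF pQ(2)] by (simp add: G.prob_space)
  also have "\<dots> \<le> 3 / 16 * Z + A ^ K * real d / 4 + A ^ K * real d / 16 * 1"
  proof (intro add_left_mono mult_left_mono)
    \<comment> \<open>\<open>A\<close> has the shape of the bound for \<open>Q2\<close>: the base is
      \<open>R * A / 8\<close>, and the condition on \<open>d\<close> allows the dimension to be
      paid by a factor 2 per power.\<close>
    have "R * s + 4 * real K * R ^ 3 = R * A / 8" by (simp add: A_def K_def power2_eq_square power3_eq_cube field_simps)
    then have "(\<integral>g. tr (mpow (Q2 g) K) \<partial>\<gamma>) \<le> real d * (R * A / 8) ^ K" using moment_Q2[OF s R, of K] by (simp only:)
    also have "\<dots> \<le> 2 ^ K * (R * A / 2) ^ K"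
      using dp R A K by (intro mult_mono power_mono) (auto simp: K_def)
    also have "\<dots> = (R * A) ^ K" by (simp flip: power_mult_distrib)
    finally show "(\<integral>g. tr (mpow (Q2 g) K) \<partial>\<gamma>) / (R * A) ^ K \<le> 1" using R A by simp
  qed (use A in simp)
  \<comment> \<open>The returned share is \<open>1 / 8 + 1 / 16 = 3 / 16\<close>, the constant part
    \<open>1 / 4 + 1 / 16 = 5 / 16\<close>.\<close>
  finally have "Z * 13 \<le> A ^ K * real d * 5" by (simp add: field_simps)
  moreover have "A ^ K * real d * 5 \<le> A ^ K * real d * 13" using A by (intro mult_left_mono) auto
  ultimately show ?thesis by (simp add: Z_def K_def A_def mult.commute)
qed

text \<open>The dimension factor in front of each moment disappears by doubling the base, since
  \<open>real d \<le> 2 ^ (2 * p)\<close>.\<close>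

lemma moments_Q:
  assumes s: "conds s" and v: "condv v" and R: "condR R" "0 < R" and p: "0 < p" and dp: "real d \<le> 2 ^ (2 * p)"
  shows "(\<integral>g. tr (mpow (Q1 g) (2 * p)) \<partial>\<gamma>) \<le> (16 * s + 128 * real p * R\<^sup>2) ^ (2 * p)"
    and "(\<integral>g. tr (mpow (Q2 g) (2 * p)) \<partial>\<gamma>) \<le> (2 * R * s + 16 * real p * R ^ 3) ^ (2 * p)"
    and "(\<integral>g. tr (mpow (Q3 g) (2 * p)) \<partial>\<gamma>) \<le> (2 * v + 16 * real p * R\<^sup>2) ^ (2 * p)"
proof -
  have t: "t \<le> (2 * a) ^ (2 * p)" if "t \<le> real d * a ^ (2 * p)" "0 \<le> a" for t a :: real
  proof -
    have "t \<le> 2 ^ (2 * p) * a ^ (2 * p)" using that dp by (meson mult_right_mono order_trans zero_le_power)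
    then show ?thesis by (simp add: power_mult_distrib)
  qed
  have s0: "0 \<le> s" and v0: "0 \<le> v" using s v by (auto simp: conds_def condv_def)
  show "(\<integral>g. tr (mpow (Q1 g) (2 * p)) \<partial>\<gamma>) \<le> (16 * s + 128 * real p * R\<^sup>2) ^ (2 * p)"
    using t[OF moment_Q1[OF s R p dp]] s0 R by (simp add: algebra_simps)
  show "(\<integral>g. tr (mpow (Q2 g) (2 * p)) \<partial>\<gamma>) \<le> (2 * R * s + 16 * real p * R ^ 3) ^ (2 * p)"
    using t[OF moment_Q2[OF s R, of "2 * p"]] s0 R by (simp add: algebra_simps)
  show "(\<integral>g. tr (mpow (Q3 g) (2 * p)) \<partial>\<gamma>) \<le> (2 * v + 16 * real p * R\<^sup>2) ^ (2 * p)"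
    using t[OF moment_Q3[OF v R, of "2 * p"]] v0 R by (simp add: algebra_simps)
qed

end

section \<open>The moment recursion\<close>

text \<open>A fifth factor 1 fills the exponents up to \<open>K\<close>. The random coefficient
  \<open>u\<close> occurs to the first power only.\<close>

lemma am_gm4:
  fixes u x y w :: real
  assumes nn: "0 \<le> u" "0 \<le> x" "0 \<le> y" "0 \<le> w" and K: "N1 + N2 + M + 1 \<le> K"
  shows "u * (x ^ N1 * y ^ N2 * w ^ M) \<le> (u ^ K + real N1 * x ^ K + real N2 * y ^ K + real M * w ^ K + real (K - 1 - N1 - N2 - M)) / real K"
proof -
  have "(\<Prod>i<5. ((!) [u, x, y, w, 1]) i ^ ((!) [1, N1, N2, M, K - 1 - N1 - N2 - M]) i)
     \<le> (\<Sum>i<5. real (((!) [1, N1, N2, M, K - 1 - N1 - N2 - M]) i) * ((!) [u, x, y, w, 1]) i ^ K) / real K"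
  proof (rule weighted_am_gm)
    fix i :: nat assume "i \<in> {..<5}"
    then have "i = 0 \<or> i = 1 \<or> i = 2 \<or> i = 3 \<or> i = 4" by auto
    then show "0 \<le> [u, x, y, w, 1] ! i" using nn by auto
  qed (use K in \<open>auto simp: eval_nat_numeral lessThan_Suc\<close>)
  then show ?thesis by (simp add: eval_nat_numeral lessThan_Suc mult_ac add_ac)
qed

lemma scale_monomial:
  fixes x y w :: real
  assumes "0 < \<alpha>" "0 < \<beta>" "0 < \<omega>"
  shows "u * (x ^ a * y ^ b * w ^ c) = \<alpha> ^ a * \<beta> ^ b * \<omega> ^ c * (u * ((x / \<alpha>) ^ a * (y / \<beta>) ^ b * (w / \<omega>) ^ c))"
proof -
  have "x ^ a = \<alpha> ^ a * (x / \<alpha>) ^ a" "y ^ b = \<beta> ^ b * (y / \<beta>) ^ b" "w ^ c = \<omega> ^ c * (w / \<omega>) ^ c"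
    using assms by (simp_all flip: power_mult_distrib)
  then show ?thesis by (simp only: mult_ac)
qed

lemma sum_affine:
  fixes f g h :: "nat \<Rightarrow> real"
  shows "(\<Sum>r<d. q * ((u + a * f r + b * g r + m * h r + sl) / k)) = q / k * (real d * u + a * sum f {..<d} + b * sum g {..<d} + m * sum h {..<d} + sl * real d)"
  unfolding sum_distrib_left[symmetric] sum_divide_distrib[symmetric] sum.distrib by simp

text \<open>A Hoelder inequality for several factors: each factor is divided by its size
  (\<open>\<mu>\<close>, \<open>\<omega>\<close>, and 1 for \<open>U\<close>), AM-GM linearises the
  product in K-th powers, and every K-th power then has normalised mean at most 1. The weights add
  up to \<open>K\<close>, so nothing is lost. Only power sums are compared, so \<open>x\<close> and
  \<open>y\<close> may depend on \<open>z\<close> in any way, measurable or not.\<close>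

lemma holder_integral:
  fixes N :: "'z measure" and U :: "nat \<Rightarrow> 'z \<Rightarrow> real" and d :: nat
  assumes N: "prob_space N" and T: "finite T" and c: "\<And>t. t \<in> T \<Longrightarrow> 0 \<le> c t" and U: "\<And>t z. t \<in> T \<Longrightarrow> 0 \<le> U t z"
    and F: "\<And>z. \<exists>x y. (\<forall>r<d. 0 \<le> x r \<and> 0 \<le> y r) \<and> (\<Sum>r<d. x r ^ K) = SX z \<and> (\<Sum>r<d. y r ^ K) = SY z \<and>
       \<bar>F z\<bar> \<le> (\<Sum>t\<in>T. c t * U t z) * (\<Sum>r<d. x r ^ N1 * y r ^ N2 * w r ^ M)"
    and w: "\<And>r. r < d \<Longrightarrow> 0 \<le> w r" "(\<Sum>r<d. w r ^ K) \<le> real d * \<omega> ^ K" "0 < \<omega>"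
    and UI: "\<And>t. t \<in> T \<Longrightarrow> integrable N (\<lambda>z. U t z ^ K)" "\<And>t. t \<in> T \<Longrightarrow> (\<integral>z. U t z ^ K \<partial>N) \<le> 1"
    and SX: "integrable N SX" "(\<integral>z. SX z \<partial>N) \<le> real d * \<mu> ^ K"
    and SY: "integrable N SY" "(\<integral>z. SY z \<partial>N) \<le> real d * \<mu> ^ K" "0 < \<mu>"
    and K: "N1 + N2 + M + 1 \<le> K"
  shows "\<bar>\<integral>z. F z \<partial>N\<bar> \<le> (\<Sum>t\<in>T. c t) * (\<mu> ^ (N1 + N2) * (real d * \<omega> ^ M))"
proof -
  interpret prob_space N by (rule N)
  define q where "q = \<mu> ^ (N1 + N2) * \<omega> ^ M"
  define sl where "sl = real (K - 1 - N1 - N2 - M)"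
  have q: "0 < q" using SY w by (simp add: q_def)
  define B where "B t z = q / K * (real d * U t z ^ K + N1 * (SX z / \<mu> ^ K) + N2 * (SY z / \<mu> ^ K) + M * real d + sl * d)" for t z
  have pw: "\<bar>F z\<bar> \<le> (\<Sum>t\<in>T. c t * B t z)" for z
  proof -
    obtain x y where h: "(\<forall>r<d. 0 \<le> x r \<and> 0 \<le> y r) \<and> (\<Sum>r<d. x r ^ K) = SX z \<and> (\<Sum>r<d. y r ^ K) = SY z \<and>
       \<bar>F z\<bar> \<le> (\<Sum>t\<in>T. c t * U t z) * (\<Sum>r<d. x r ^ N1 * y r ^ N2 * w r ^ M)" using F[of z] by blast
    then have nn: "\<And>r. r < d \<Longrightarrow> 0 \<le> x r" "\<And>r. r < d \<Longrightarrow> 0 \<le> y r"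
      and xy: "(\<Sum>r<d. x r ^ K) = SX z" "(\<Sum>r<d. y r ^ K) = SY z"
      and Fz: "\<bar>F z\<bar> \<le> (\<Sum>t\<in>T. c t * U t z) * (\<Sum>r<d. x r ^ N1 * y r ^ N2 * w r ^ M)" by blast+
    have one: "U t z * (\<Sum>r<d. x r ^ N1 * y r ^ N2 * w r ^ M) \<le> B t z" if t: "t \<in> T" for t
    proof -
      have "U t z * (\<Sum>r<d. x r ^ N1 * y r ^ N2 * w r ^ M) = (\<Sum>r<d. q * (U t z * ((x r / \<mu>) ^ N1 * (y r / \<mu>) ^ N2 * (w r / \<omega>) ^ M)))"
        unfolding sum_distrib_left q_def power_add by (rule sum.cong[OF refl scale_monomial[OF SY(3) SY(3) w(3)]])
      also have "\<dots> \<le> (\<Sum>r<d. q * ((U t z ^ K + real N1 * (x r / \<mu>) ^ K + real N2 * (y r / \<mu>) ^ K + real M * (w r / \<omega>) ^ K + sl) / real K))"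
      proof (rule sum_mono, rule mult_left_mono)
        fix r assume "r \<in> {..<d}" then have r: "r < d" by simp
        show "U t z * ((x r / \<mu>) ^ N1 * (y r / \<mu>) ^ N2 * (w r / \<omega>) ^ M) \<le> (U t z ^ K + real N1 * (x r / \<mu>) ^ K + real N2 * (y r / \<mu>) ^ K + real M * (w r / \<omega>) ^ K + sl) / real K"
          unfolding sl_def using nn[OF r] w(1)[OF r] w(3) SY(3) by (intro am_gm4 U[OF t] K) auto
      qed (use q in simp)
      also have "\<dots> = q / K * (real d * U t z ^ K + N1 * ((\<Sum>r<d. x r ^ K) / \<mu> ^ K) + N2 * ((\<Sum>r<d. y r ^ K) / \<mu> ^ K) + M * ((\<Sum>r<d. w r ^ K) / \<omega> ^ K) + sl * d)"
        unfolding sum_affine power_divide sum_divide_distrib ..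
      also have "\<dots> \<le> B t z"
      proof -
        have "(\<Sum>r<d. w r ^ K) / \<omega> ^ K \<le> real d" using w(2,3) by (simp add: pos_divide_le_eq)
        then show ?thesis unfolding B_def xy using q by (intro mult_left_mono add_mono order_refl) auto
      qed
      finally show ?thesis .
    qed
    have "(\<Sum>t\<in>T. c t * U t z) * (\<Sum>r<d. x r ^ N1 * y r ^ N2 * w r ^ M) = (\<Sum>t\<in>T. c t * (U t z * (\<Sum>r<d. x r ^ N1 * y r ^ N2 * w r ^ M)))"
      by (simp add: sum_distrib_right mult.assoc)
    also have "\<dots> \<le> (\<Sum>t\<in>T. c t * B t z)" by (intro sum_mono mult_left_mono one c)
    finally show ?thesis using Fz by linarith
  qed
  have Bi: "integrable N (B t)" if "t \<in> T" for t
    unfolding B_def using UI(1)[OF that] SX(1) SY(1) by simp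
  have BI: "(\<integral>z. B t z \<partial>N) \<le> q * d" if t: "t \<in> T" for t
  proof -
    have "(\<integral>z. B t z \<partial>N) = q / K * (real d * (\<integral>z. U t z ^ K \<partial>N) + N1 * ((\<integral>z. SX z \<partial>N) / \<mu> ^ K) + N2 * ((\<integral>z. SY z \<partial>N) / \<mu> ^ K) + M * real d + sl * d)"
      unfolding B_def using UI(1)[OF t] SX(1) SY(1) by (simp add: prob_space)
    also have "\<dots> \<le> q / K * (real d * 1 + N1 * real d + N2 * real d + M * real d + sl * d)"
    proof -
      have "(\<integral>z. SX z \<partial>N) / \<mu> ^ K \<le> real d" "(\<integral>z. SY z \<partial>N) / \<mu> ^ K \<le> real d" using SX(2) SY(2,3) by (simp_all add: pos_divide_le_eq)
      then show ?thesis using q UI(2)[OF t] by (intro mult_left_mono add_mono order_refl) auto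
    qed
    also have "\<dots> = q / K * (real d * (1 + N1 + N2 + M + sl))" by (simp add: algebra_simps)
    also have "1 + N1 + N2 + M + sl = K" unfolding sl_def using K by (simp add: of_nat_diff)
    also have "q / K * (real d * K) = q * d" using K by simp
    finally show ?thesis .
  qed
  have "\<bar>\<integral>z. F z \<partial>N\<bar> \<le> (\<integral>z. (\<Sum>t\<in>T. c t * B t z) \<partial>N)"
  proof (cases "integrable N F")
    case True
    have "\<bar>\<integral>z. F z \<partial>N\<bar> \<le> (\<integral>z. \<bar>F z\<bar> \<partial>N)" by (rule integral_abs_bound)
    also have "\<dots> \<le> (\<integral>z. (\<Sum>t\<in>T. c t * B t z) \<partial>N)"
      using True by (intro integral_mono pw) (auto intro!: Bochner_Integration.integrable_sum Bi)
    finally show ?thesis .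
  next
    \<comment> \<open>A non-integrable \<open>F\<close> has integral 0 by convention, so only the
      sign of the bound matters.\<close>
    case False
    have "0 \<le> (\<integral>z. (\<Sum>t\<in>T. c t * B t z) \<partial>N)" using pw by (intro Bochner_Integration.integral_nonneg) (meson abs_ge_zero order_trans)
    with False show ?thesis by (simp add: not_integrable_integral_eq)
  qed
  also have "\<dots> = (\<Sum>t\<in>T. c t * (\<integral>z. B t z \<partial>N))"
    by (subst Bochner_Integration.integral_sum) (auto intro: Bi)
  also have "\<dots> \<le> (\<Sum>t\<in>T. c t * (q * d))" by (intro sum_mono mult_left_mono BI c)
  finally show ?thesis by (simp add: sum_distrib_left sum_distrib_right q_def mult_ac)
qed

text \<open>The deterministic version. Here the sizes may vanish, since mean powers can be
  0.\<close>

lemma sum_holder: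
  fixes a b w :: "nat \<Rightarrow> real" and d :: nat
  assumes nn: "\<And>r. r < d \<Longrightarrow> 0 \<le> a r" "\<And>r. r < d \<Longrightarrow> 0 \<le> b r" "\<And>r. r < d \<Longrightarrow> 0 \<le> w r" "0 \<le> \<alpha>" "0 \<le> \<beta>" "0 \<le> \<omega>"
    and S: "(\<Sum>r<d. a r ^ K) \<le> real d * \<alpha> ^ K" "(\<Sum>r<d. b r ^ K) \<le> real d * \<beta> ^ K" "(\<Sum>r<d. w r ^ K) \<le> real d * \<omega> ^ K"
    and K: "N1 + N2 + M + 1 \<le> K"
  shows "(\<Sum>r<d. a r ^ N1 * b r ^ N2 * w r ^ M) \<le> real d * (\<alpha> ^ N1 * \<beta> ^ N2 * \<omega> ^ M)"
proof -
  have pos: "(\<Sum>r<d. a r ^ N1 * b r ^ N2 * w r ^ M) \<le> real d * (\<alpha> ^ N1 * \<beta> ^ N2 * \<omega> ^ M)"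
    if p: "0 < \<alpha>" "0 < \<beta>" "0 < \<omega>" and S: "(\<Sum>r<d. a r ^ K) \<le> real d * \<alpha> ^ K" "(\<Sum>r<d. b r ^ K) \<le> real d * \<beta> ^ K" "(\<Sum>r<d. w r ^ K) \<le> real d * \<omega> ^ K" for \<alpha> \<beta> \<omega> :: real
  proof -
    define q where "q = \<alpha> ^ N1 * \<beta> ^ N2 * \<omega> ^ M"
    define sl where "sl = real (K - 1 - N1 - N2 - M)"
    have q: "0 < q" using p by (simp add: q_def)
    have "(\<Sum>r<d. a r ^ N1 * b r ^ N2 * w r ^ M) = (\<Sum>r<d. 1 * (a r ^ N1 * b r ^ N2 * w r ^ M))" by simp
    also have "\<dots> = (\<Sum>r<d. q * (1 * ((a r / \<alpha>) ^ N1 * (b r / \<beta>) ^ N2 * (w r / \<omega>) ^ M)))"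
      unfolding q_def by (rule sum.cong[OF refl scale_monomial[OF p]])
    also have "\<dots> \<le> (\<Sum>r<d. q * ((1 ^ K + real N1 * (a r / \<alpha>) ^ K + real N2 * (b r / \<beta>) ^ K + real M * (w r / \<omega>) ^ K + sl) / real K))"
    proof (rule sum_mono, rule mult_left_mono)
      fix r assume "r \<in> {..<d}" then have r: "r < d" by simp
      show "1 * ((a r / \<alpha>) ^ N1 * (b r / \<beta>) ^ N2 * (w r / \<omega>) ^ M) \<le> (1 ^ K + real N1 * (a r / \<alpha>) ^ K + real N2 * (b r / \<beta>) ^ K + real M * (w r / \<omega>) ^ K + sl) / real K"
        unfolding sl_def using nn(1-3)[OF r] p by (intro am_gm4 K) auto
    qed (use q in simp)
    also have "\<dots> = q / K * (real d * 1 ^ K + N1 * ((\<Sum>r<d. a r ^ K) / \<alpha> ^ K) + N2 * ((\<Sum>r<d. b r ^ K) / \<beta> ^ K) + M * ((\<Sum>r<d. w r ^ K) / \<omega> ^ K) + sl * d)"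
      unfolding sum_affine power_divide sum_divide_distrib ..
    also have "\<dots> \<le> q / K * (real d + N1 * real d + N2 * real d + M * real d + sl * d)"
    proof -
      have "(\<Sum>r<d. a r ^ K) / \<alpha> ^ K \<le> real d" "(\<Sum>r<d. b r ^ K) / \<beta> ^ K \<le> real d" "(\<Sum>r<d. w r ^ K) / \<omega> ^ K \<le> real d"
        using p S by (simp_all add: pos_divide_le_eq)
      then show ?thesis using q by (intro mult_left_mono add_mono order_refl) auto
    qed
    also have "\<dots> = q / K * (real d * (1 + N1 + N2 + M + sl))" by (simp add: algebra_simps)
    also have "1 + N1 + N2 + M + sl = K" unfolding sl_def using K by (simp add: of_nat_diff)
    also have "q / K * (real d * K) = real d * q" using K by simp
    finally show ?thesis by (simp add: q_def)
  qed
  \<comment> \<open>The sizes are enlarged by \<open>\<epsilon>\<close> to allow division by them,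
    and \<open>\<epsilon>\<close> tends to 0.\<close>
  have lim: "((\<lambda>\<epsilon>. real d * ((\<alpha> + \<epsilon>) ^ N1 * (\<beta> + \<epsilon>) ^ N2 * (\<omega> + \<epsilon>) ^ M)) \<longlongrightarrow> real d * ((\<alpha> + 0) ^ N1 * (\<beta> + 0) ^ N2 * (\<omega> + 0) ^ M)) (at_right 0)"
    by (intro tendsto_intros)
  have ev: "\<forall>\<^sub>F \<epsilon> in at_right 0. (\<Sum>r<d. a r ^ N1 * b r ^ N2 * w r ^ M) \<le> real d * ((\<alpha> + \<epsilon>) ^ N1 * (\<beta> + \<epsilon>) ^ N2 * (\<omega> + \<epsilon>) ^ M)"
    unfolding eventually_at_right_field
  proof (intro exI[of _ 1] conjI allI impI)
    fix \<epsilon> :: real assume e: "0 < \<epsilon>"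
    have m: "real d * t ^ K \<le> real d * (t + \<epsilon>) ^ K" if "0 \<le> t" for t
      using e that by (intro mult_left_mono power_mono) auto
    show "(\<Sum>r<d. a r ^ N1 * b r ^ N2 * w r ^ M) \<le> real d * ((\<alpha> + \<epsilon>) ^ N1 * (\<beta> + \<epsilon>) ^ N2 * (\<omega> + \<epsilon>) ^ M)"
      using e nn(4-6) by (intro pos order_trans[OF S(1) m] order_trans[OF S(2) m] order_trans[OF S(3) m]) auto
  qed simp
  show ?thesis using tendsto_lowerbound[OF lim ev] unfolding add_0_right by simp
qed

text \<open>The partial sums satisfy
  \<open>B\<^sub>n \<le> 1 + a * B\<^sub>m\<^sup>2 + K * E\<close> with \<open>m = n - 2\<close>,
  because the convolution runs over a triangle inside a square. If \<open>B\<^sub>m < 2\<close>,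
  then \<open>B\<^sub>n \<le> 1 + 4 * a + K * E < 2\<close>. The threshold 2 is the value of the
  Catalan generating function at its singularity 1 / 4.\<close>

lemma catalan_partial_sum:
  fixes \<beta> :: "nat \<Rightarrow> real"
  assumes nn: "\<And>n. 0 \<le> \<beta> n" and b0: "\<beta> 0 = 1" and b1: "\<beta> 1 = 0" and a: "0 \<le> a" and E: "0 \<le> E"
    and rec: "\<And>k. 0 < k \<Longrightarrow> k < K \<Longrightarrow> \<beta> (Suc k) \<le> a * (\<Sum>j<k. \<beta> j * \<beta> (k - 1 - j)) + E"
    and small: "4 * a + real K * E < 1"
  shows "n \<le> K \<Longrightarrow> (\<Sum>j\<le>n. \<beta> j) < 2"
proof (induction n rule: less_induct)
  case (less n)
  consider "n = 0" | "n = 1" | m where "n = Suc (Suc m)" by (metis One_nat_def not0_implies_Suc)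
  then show ?case
  proof cases
    case (3 m)
    have "(\<Sum>j\<le>n. \<beta> j) = 1 + (\<Sum>i\<le>m. \<beta> (Suc (Suc i)))"
      unfolding 3 sum.atMost_Suc_shift using b0 b1 by simp
    also have "\<dots> \<le> 1 + (\<Sum>i\<le>m. a * (\<Sum>j\<le>i. \<beta> j * \<beta> (i - j)) + E)"
    proof (intro add_left_mono sum_mono)
      fix i assume "i \<in> {..m}"
      then show "\<beta> (Suc (Suc i)) \<le> a * (\<Sum>j\<le>i. \<beta> j * \<beta> (i - j)) + E"
        using rec[of "Suc i"] 3 less.prems by (simp add: lessThan_Suc_atMost)
    qed
    also have "\<dots> = 1 + a * (\<Sum>i\<le>m. \<Sum>j\<le>i. \<beta> j * \<beta> (i - j)) + real (Suc m) * E"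
      by (simp add: sum.distrib sum_distrib_left)
    also have "(\<Sum>i\<le>m. \<Sum>j\<le>i. \<beta> j * \<beta> (i - j)) = (\<Sum>(i, j)\<in>{(i, j). i + j \<le> m}. \<beta> i * \<beta> j)"
      by (rule sum.triangle_reindex_eq[symmetric])
    also have "1 + a * \<dots> + real (Suc m) * E \<le> 1 + a * (\<Sum>(i, j)\<in>{..m} \<times> {..m}. \<beta> i * \<beta> j) + real K * E"
      using a E nn less.prems 3
      by (intro add_mono mult_left_mono mult_right_mono sum_mono2) (auto intro!: mult_nonneg_nonneg)
    also have "(\<Sum>(i, j)\<in>{..m} \<times> {..m}. \<beta> i * \<beta> j) = (\<Sum>j\<le>m. \<beta> j) * (\<Sum>j\<le>m. \<beta> j)"
      by (simp add: sum_product sum.cartesian_product)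
    also have "1 + a * ((\<Sum>j\<le>m. \<beta> j) * (\<Sum>j\<le>m. \<beta> j)) + real K * E \<le> 1 + a * (2 * 2) + real K * E"
      using less.IH[of m] less.prems 3 a nn by (intro add_mono mult_left_mono mult_mono) (auto intro: sum_nonneg)
    finally show ?thesis using small by simp
  qed (use b0 b1 in auto)
qed

section \<open>Forms with the test matrix in a slot of its own\<close>

context gmodel
begin

text \<open>The list has one entry more than the form has slots. By \<open>mlf_comp\<close> the form
  with a product in one slot is a form in all entries of the list, to which the layer-cake bound
  applies.\<close>

lemma mlf_prod2:
  assumes "mlf 2 \<Phi> K" "spec A e1 l1" "spec B e2 l2" "spec W f w"
  shows "\<bar>\<Phi> (((!) [A, B, W])(1 := mm B W))\<bar> \<le> K * (\<Sum>r<d. \<bar>l1 r\<bar> * \<bar>l2 r\<bar> * \<bar>w r\<bar>)"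
proof -
  have h: "spec ([A, B, W] ! s) ([e1, e2, f] ! s) ([l1, l2, w] ! s)" if "s < Suc 2" for s
    using that assms(2-) by (auto simp: eval_nat_numeral less_Suc_eq)
  show "\<bar>\<Phi> (((!) [A, B, W])(1 := mm B W))\<bar> \<le> K * (\<Sum>r<d. \<bar>l1 r\<bar> * \<bar>l2 r\<bar> * \<bar>w r\<bar>)"
    using mlf_layer_cake[OF mlf_comp(1)[OF assms(1), of 1], where B = "(!) [A, B, W]" and e = "(!) [e1, e2, f]" and l = "(!) [l1, l2, w]", OF _ _ h] by (simp add: eval_nat_numeral lessThan_Suc mult_ac)
qed

lemma mlf_prod3:
  assumes "mlf 3 \<Phi> K" "spec A e1 l1" "spec B e2 l2" "spec C e3 l3" "spec W f w"
  shows "\<bar>\<Phi> (((!) [A, B, C, W])(1 := mm B W))\<bar> \<le> K * (\<Sum>r<d. \<bar>l1 r\<bar> * \<bar>l2 r\<bar> * \<bar>l3 r\<bar> * \<bar>w r\<bar>)"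
    and "\<bar>\<Phi> (((!) [A, B, C, W])(2 := mm C W))\<bar> \<le> K * (\<Sum>r<d. \<bar>l1 r\<bar> * \<bar>l2 r\<bar> * \<bar>l3 r\<bar> * \<bar>w r\<bar>)"
proof -
  have h: "spec ([A, B, C, W] ! s) ([e1, e2, e3, f] ! s) ([l1, l2, l3, w] ! s)" if "s < Suc 3" for s
    using that assms(2-) by (auto simp: eval_nat_numeral less_Suc_eq)
  show "\<bar>\<Phi> (((!) [A, B, C, W])(1 := mm B W))\<bar> \<le> K * (\<Sum>r<d. \<bar>l1 r\<bar> * \<bar>l2 r\<bar> * \<bar>l3 r\<bar> * \<bar>w r\<bar>)"
    using mlf_layer_cake[OF mlf_comp(1)[OF assms(1), of 1], where B = "(!) [A, B, C, W]" and e = "(!) [e1, e2, e3, f]" and l = "(!) [l1, l2, l3, w]", OF _ _ h] by (simp add: eval_nat_numeral lessThan_Suc mult_ac)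
  show "\<bar>\<Phi> (((!) [A, B, C, W])(2 := mm C W))\<bar> \<le> K * (\<Sum>r<d. \<bar>l1 r\<bar> * \<bar>l2 r\<bar> * \<bar>l3 r\<bar> * \<bar>w r\<bar>)"
    using mlf_layer_cake[OF mlf_comp(1)[OF assms(1), of 2], where B = "(!) [A, B, C, W]" and e = "(!) [e1, e2, e3, f]" and l = "(!) [l1, l2, l3, w]", OF _ _ h] by (simp add: eval_nat_numeral lessThan_Suc mult_ac)
qed

lemma mlf_prod4:
  assumes "mlf 4 \<Phi> K" "spec A e1 l1" "spec B e2 l2" "spec C e3 l3" "spec D e4 l4" "spec W f w"
  shows "\<bar>\<Phi> (((!) [A, B, C, D, W])(2 := mm C W))\<bar> \<le> K * (\<Sum>r<d. \<bar>l1 r\<bar> * \<bar>l2 r\<bar> * \<bar>l3 r\<bar> * \<bar>l4 r\<bar> * \<bar>w r\<bar>)"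
    and "\<bar>\<Phi> (((!) [A, B, C, D, W])(3 := mm W D))\<bar> \<le> K * (\<Sum>r<d. \<bar>l1 r\<bar> * \<bar>l2 r\<bar> * \<bar>l3 r\<bar> * \<bar>l4 r\<bar> * \<bar>w r\<bar>)"
proof -
  have h: "spec ([A, B, C, D, W] ! s) ([e1, e2, e3, e4, f] ! s) ([l1, l2, l3, l4, w] ! s)" if "s < Suc 4" for s
    using that assms(2-) by (auto simp: eval_nat_numeral less_Suc_eq)
  show "\<bar>\<Phi> (((!) [A, B, C, D, W])(2 := mm C W))\<bar> \<le> K * (\<Sum>r<d. \<bar>l1 r\<bar> * \<bar>l2 r\<bar> * \<bar>l3 r\<bar> * \<bar>l4 r\<bar> * \<bar>w r\<bar>)"
    using mlf_layer_cake[OF mlf_comp(1)[OF assms(1), of 2], where B = "(!) [A, B, C, D, W]" and e = "(!) [e1, e2, e3, e4, f]" and l = "(!) [l1, l2, l3, l4, w]", OF _ _ h] by (simp add: eval_nat_numeral lessThan_Suc mult_ac)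
  show "\<bar>\<Phi> (((!) [A, B, C, D, W])(3 := mm W D))\<bar> \<le> K * (\<Sum>r<d. \<bar>l1 r\<bar> * \<bar>l2 r\<bar> * \<bar>l3 r\<bar> * \<bar>l4 r\<bar> * \<bar>w r\<bar>)"
    using mlf_layer_cake[OF mlf_comp(2)[OF assms(1), of 3], where B = "(!) [A, B, C, D, W]" and e = "(!) [e1, e2, e3, e4, f]" and l = "(!) [l1, l2, l3, l4, w]", OF _ _ h] by (simp add: eval_nat_numeral lessThan_Suc mult_ac)
qed

end

locale gmodel_bound = gmodel +
  fixes s v R \<mu> :: real and p :: nat
  assumes s: "conds s" and v: "condv v" and R: "condR R" and R_pos: "0 < R" and p_pos: "0 < p" and d_le: "real d \<le> 2 ^ (2 * p)"
    and d_pos: "0 < d" and \<mu>_pos: "0 < \<mu>" and moment: "(\<integral>g. tr (XP g (2 * p)) \<partial>\<gamma>) = real d * \<mu> ^ (2 * p)"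
begin

abbreviation K :: nat where "K \<equiv> 2 * p"

lemma s_nonneg: "0 \<le> s" and v_pos: "0 < v" using s v by (auto simp: conds_def condv_def)

definition \<kappa>1 :: real where "\<kappa>1 = 16 * s + 128 * real p * R\<^sup>2"
definition \<kappa>2 :: real where "\<kappa>2 = 2 * R * s + 16 * real p * R ^ 3"
definition \<kappa>3 :: real where "\<kappa>3 = 2 * v + 16 * real p * R\<^sup>2"

lemma \<kappa>_pos: "0 < \<kappa>1" "0 < \<kappa>2" "0 < \<kappa>3"
  unfolding \<kappa>1_def \<kappa>2_def \<kappa>3_def using s_nonneg v_pos R_pos p_pos by (auto intro!: add_nonneg_pos)

text \<open>The random constants of \<open>cond1\<close>, \<open>cond2\<close>,
  \<open>cond3\<close>, in this order, divided by \<open>\<kappa>1\<close>,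
  \<open>\<kappa>2\<close>, \<open>\<kappa>3\<close>, so that their \<open>K\<close>-th moments are
  at most 1.\<close>

definition U :: "nat \<Rightarrow> (nat \<times> nat \<Rightarrow> real) \<Rightarrow> real" where
  "U t g = (if t = 0 then schatten p (Q1 g) / \<kappa>1 else if t = 1 then schatten p (Q2 g) / \<kappa>2 else schatten p (Q3 g) / \<kappa>3)"

lemma U_nonneg: "0 \<le> U t g"
  unfolding U_def using schatten_nonneg symm_Q p_pos \<kappa>_pos by (simp add: less_imp_le)

lemma U_pow: "U t g ^ K = inverse ((if t = 0 then \<kappa>1 else if t = 1 then \<kappa>2 else \<kappa>3) ^ K) * tr (mpow ((if t = 0 then Q1 else if t = 1 then Q2 else Q3) g) K)"
  using schatten_pow[OF symm_Q(1)[of g] p_pos] schatten_pow[OF symm_Q(2)[of g] p_pos] schatten_pow[OF symm_Q(3)[of g] p_pos]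
  by (cases "t = 0"; cases "t = 1") (simp_all add: U_def power_mult_distrib power_inverse divide_inverse mult.commute)

lemma U_poly: "polyfun (I \<times> {..<d}) (\<lambda>g. U t g ^ K)"
  unfolding U_pow by (intro polyfun_mult polyfun_const polyfun_tr polyfun_mpow) (auto intro: poly_Q1 poly_Q)

lemma U_moment: "(\<integral>g. U t g ^ K \<partial>\<gamma>) \<le> 1"
proof -
  have "inverse (\<kappa> ^ K) * x \<le> 1" if "0 < \<kappa>" "x \<le> \<kappa> ^ K" for \<kappa> x :: real
    using that by (simp add: field_simps)
  then show ?thesis
    unfolding U_pow integral_mult_right_zero using moments_Q[OF s v R R_pos p_pos d_le] \<kappa>_pos unfolding \<kappa>1_def[symmetric] \<kappa>2_def[symmetric] \<kappa>3_def[symmetric]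
    by auto
qed

lemma cond_U: "cond1 (Yv g) (\<kappa>1 * U 0 g)" "cond2 (Yv g) (\<kappa>2 * U 1 g)" "cond3 (Yv g) (\<kappa>3 * U 2 g)"
  unfolding U_def using cond_Q[OF p_pos] \<kappa>_pos by simp_all

text \<open>The free weight is now fixed as \<open>c = sqrt (\<kappa>3 / \<kappa>1)\<close>, for
  which \<open>c * \<kappa>1\<close> and \<open>\<kappa>3 / c\<close> agree; \<open>cB\<close> is
  their common value.\<close>

definition cB :: real where "cB = sqrt (\<kappa>1 * \<kappa>3)"

lemma cB_nonneg: "0 \<le> cB" using \<kappa>_pos by (simp add: cB_def)

lemma ratio: "0 < sqrt (\<kappa>3 / \<kappa>1)" "sqrt (\<kappa>3 / \<kappa>1) * \<kappa>1 = cB" "\<kappa>3 / sqrt (\<kappa>3 / \<kappa>1) = cB"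
proof -
  have "sqrt \<kappa>1 * sqrt \<kappa>1 = \<kappa>1" "sqrt \<kappa>3 * sqrt \<kappa>3 = \<kappa>3" "0 < sqrt \<kappa>1" "0 < sqrt \<kappa>3" using \<kappa>_pos by simp_all
  then obtain a b where ab: "sqrt \<kappa>1 = a" "sqrt \<kappa>3 = b" "\<kappa>1 = a * a" "\<kappa>3 = b * b" "0 < a" "0 < b" by metis
  then show "0 < sqrt (\<kappa>3 / \<kappa>1)" "sqrt (\<kappa>3 / \<kappa>1) * \<kappa>1 = cB" "\<kappa>3 / sqrt (\<kappa>3 / \<kappa>1) = cB"
    by (simp_all add: cB_def real_sqrt_divide real_sqrt_mult)
qed

lemma mlf_B: "mlf 2 (formB (Yv g)) (cB / 2 * U 0 g + cB / 2 * U 2 g)"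
proof -
  have eq: "(sqrt (\<kappa>3 / \<kappa>1) * (\<kappa>1 * U 0 g) + \<kappa>3 * U 2 g / sqrt (\<kappa>3 / \<kappa>1)) / 2 = cB / 2 * U 0 g + cB / 2 * U 2 g"
    using ratio(2,3) by (simp add: field_simps flip: mult.assoc times_divide_eq_left)
  show ?thesis using mlf_formB[OF cond_U(1,3) ratio(1), of g] unfolding eq .
qed

lemma mlf_C: "mlf 3 (formC1 (Yv g)) (R * \<kappa>1 * U 0 g + \<kappa>2 * U 1 g)" "mlf 3 (formC2 (Yv g)) (R * \<kappa>1 * U 0 g + \<kappa>2 * U 1 g)"
  "mlf 3 (formC3 (Yv g)) (R * \<kappa>1 * U 0 g + \<kappa>2 * U 1 g)"
  using mlf_formC1[OF cond_U(1,2) R, of g] mlf_formC2[OF cond_U(1,2) R, of g] mlf_formC3[OF cond_U(1,2) R, of g] R_pos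
  by (simp_all add: add.commute mult.assoc)

lemma mlf_D: "mlf 4 (formD (Yv g) (Yv h)) (v * cB / 2 * U 0 g + v * cB / 2 * U 0 h + v * cB / 2 * U 2 g + v * cB / 2 * U 2 h)"
proof -
  have "v * (sqrt (\<kappa>3 / \<kappa>1) * (\<kappa>1 * U 0 g + \<kappa>1 * U 0 h) + (\<kappa>3 * U 2 g + \<kappa>3 * U 2 h) / sqrt (\<kappa>3 / \<kappa>1)) / 2
    = v * ((sqrt (\<kappa>3 / \<kappa>1) * \<kappa>1) * (U 0 g + U 0 h) + \<kappa>3 / sqrt (\<kappa>3 / \<kappa>1) * (U 2 g + U 2 h)) / 2"
    by (simp add: field_simps)
  also have "\<dots> = v * cB / 2 * U 0 g + v * cB / 2 * U 0 h + v * cB / 2 * U 2 g + v * cB / 2 * U 2 h"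
    unfolding ratio(2,3) by (simp add: field_simps)
  finally have eq: "v * (sqrt (\<kappa>3 / \<kappa>1) * (\<kappa>1 * U 0 g + \<kappa>1 * U 0 h) + (\<kappa>3 * U 2 g + \<kappa>3 * U 2 h) / sqrt (\<kappa>3 / \<kappa>1)) / 2 = v * cB / 2 * U 0 g + v * cB / 2 * U 0 h + v * cB / 2 * U 2 g + v * cB / 2 * U 2 h" .
  show ?thesis using mlf_formD[OF cond_U(1) cond_U(1) cond_U(3) cond_U(3) v ratio(1), of g h] unfolding eq .
qed

section \<open>Normalised Schatten norms of the mean powers\<close>

definition Lm :: "nat \<Rightarrow> nat \<Rightarrow> real" where "Lm n = (SOME l. \<exists>e. spec (Mm n) e l)"

lemma spec_Mm: "\<exists>e. spec (Mm n) e (Lm n)"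
  unfolding Lm_def by (rule someI_ex[where P = "\<lambda>l. \<exists>e. spec (Mm n) e l"]) (use spectral[OF symm_Mm] in blast)

text \<open>\<open>root 0\<close> is constantly \<open>0\<close>, hence the separate value at \<open>n = 0\<close>, where \<open>Mm 0\<close> is the identity.\<close>

definition om :: "nat \<Rightarrow> nat \<Rightarrow> real" where "om n r = (if n = 0 then 1 else root n \<bar>Lm n r\<bar>)"
text \<open>The power \<open>omb n ^ n\<close> is the normalised Schatten norm of
  \<open>Mm n\<close> with exponent \<open>K / n\<close>. Working with the root keeps all exponents
  integral: every factor is measured by its \<open>K\<close>-th power sum.\<close>

definition omb :: "nat \<Rightarrow> real" where "omb n = root K ((\<Sum>r<d. om n r ^ K) / real d)"

lemma om_nonneg: "0 \<le> om n r" by (simp add: om_def)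

lemma bil_one: assumes "\<And>a c. a < d \<Longrightarrow> c < d \<Longrightarrow> M a c = (if a = c then 1 else 0)" shows "bil x M y = ip x y"
proof -
  have "bil x M y = (\<Sum>a<d. \<Sum>c<d. x a * M a c * y c)" by (rule bil_sum2)
  also have "\<dots> = (\<Sum>a<d. \<Sum>c<d. if c = a then x a * y c else 0)" by (intro sum.cong refl) (auto simp: assms)
  also have "\<dots> = ip x y" by (simp add: ip_def)
  finally show ?thesis .
qed

lemma Lm_0: "r < d \<Longrightarrow> Lm 0 r = 1"
proof -
  assume r: "r < d"
  obtain e where e: "spec (Mm 0) e (Lm 0)" using spec_Mm by blast
  have "Lm 0 r = bil (e r) (Mm 0) (e r)" using spec_eig[OF e r r] by simp
  also have "\<dots> = ip (e r) (e r)" by (rule bil_one) (simp add: Mm_def G.prob_space)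
  also have "\<dots> = 1" using e r by (simp add: spec_def orthon_def)
  finally show ?thesis .
qed

lemma om_pow: "r < d \<Longrightarrow> om n r ^ n = \<bar>Lm n r\<bar>"
  by (simp add: om_def Lm_0)

lemma om_sum: "(\<Sum>r<d. om n r ^ K) = real d * omb n ^ K"
proof -
  have "0 \<le> (\<Sum>r<d. om n r ^ K) / real d" by (intro divide_nonneg_nonneg sum_nonneg) (auto simp: om_nonneg)
  then show ?thesis unfolding omb_def using p_pos d_pos by simp
qed

lemma omb_nonneg: "0 \<le> omb n"
  unfolding omb_def by (intro real_root_ge_zero divide_nonneg_nonneg sum_nonneg) (auto simp: om_nonneg)

lemma omb_0: "omb 0 = 1" using p_pos d_pos by (simp add: omb_def om_def)

text \<open>The dual element for the norm \<open>omb n ^ n\<close>: in the eigenbasis of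
  \<open>Mm n\<close> its eigenvalues are \<open>sgn (Lm n r) * om n r ^ (K - n)\<close>, so the
  pairing raises \<open>om n r\<close> to the exponent \<open>K\<close>.\<close>

lemma test_matrix:
  assumes n: "0 < n" "n \<le> K"
  obtains W f w where "spec W f w" "symm W" "\<And>r. r < d \<Longrightarrow> \<bar>w r\<bar> \<le> om n r ^ (K - n)" "tr (mm (Mm n) W) = real d * omb n ^ K"
proof -
  obtain e where e: "spec (Mm n) e (Lm n)" using spec_Mm by blast
  have o: "orthon d e" using e by (simp add: spec_def)
  define w where "w r = sgn (Lm n r) * om n r ^ (K - n)" for r
  define W where "W a c = (\<Sum>r<d. w r * e r a * e r c)" for a c
  have W: "spec W e w"
    unfolding spec_def
  proof (intro conjI allI impI)
    fix r q assume rq: "r \<le> q" "q < d"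
    then have L: "\<bar>Lm n q\<bar> \<le> \<bar>Lm n r\<bar>" using e by (auto simp: spec_def)
    then have "om n q ^ (K - n) \<le> om n r ^ (K - n)" using n by (intro power_mono om_nonneg) (simp add: om_def)
    \<comment> \<open>Needed for the ordering when \<open>n = K\<close>: then
      \<open>om n r ^ 0 = 1\<close> even for a zero eigenvalue, and only the sign tells the
      eigenvalues apart.\<close>
    moreover have "\<bar>sgn (Lm n q)\<bar> \<le> \<bar>sgn (Lm n r)\<bar>" using L by (auto simp: sgn_if)
    ultimately show "\<bar>w q\<bar> \<le> \<bar>w r\<bar>" unfolding w_def abs_mult using om_nonneg by (intro mult_mono) auto
  qed (use o in \<open>auto simp: W_def\<close>)
  have "tr (mm (Mm n) W) = (\<Sum>t<d. Lm n t * bil (e t) W (e t))" by (rule tr_mm_spec[OF e])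
  also have "\<dots> = (\<Sum>t<d. om n t ^ K)"
  proof (intro sum.cong refl)
    fix t assume "t \<in> {..<d}" then have t: "t < d" by simp
    have "Lm n t * bil (e t) W (e t) = \<bar>Lm n t\<bar> * om n t ^ (K - n)"
      unfolding spec_eig[OF W t t] w_def by (simp add: abs_sgn mult.assoc[symmetric])
    also have "\<dots> = om n t ^ K" unfolding om_pow[OF t, symmetric] using n by (simp flip: power_add)
    finally show "Lm n t * bil (e t) W (e t) = om n t ^ K" .
  qed
  finally have "tr (mm (Mm n) W) = real d * omb n ^ K" unfolding om_sum .
  moreover have "\<bar>w r\<bar> \<le> om n r ^ (K - n)" for r
    unfolding w_def abs_mult using om_nonneg[of n r] by (auto simp: sgn_if)
  ultimately show ?thesis using that W spec_symm[OF W] by blast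
qed

lemma X_spec: "\<exists>e l. (\<forall>a. spec (XP g a) e (\<lambda>r. l r ^ a)) \<and> (\<Sum>r<d. \<bar>l r\<bar> ^ K) = tr (XP g K)"
proof -
  obtain e l where el: "spec (X g) e l" using spectral[OF symm_X] by blast
  have "(\<Sum>r<d. \<bar>l r\<bar> ^ K) = tr (XP g K)" unfolding spec_tr_mpow[OF el] by (simp add: power_mult)
  with spec_mpow[OF el] show ?thesis by blast
qed

section \<open>Expectations of the error forms\<close>

lemma trX_poly: "polyfun (I \<times> {..<d}) (\<lambda>g. tr (XP g k))"
  by (intro polyfun_tr poly_XP)

lemma single_bound:
  assumes om: "0 < omb n" and N: "N + (K - n) + 1 \<le> K" and T: "finite T" "\<And>t. t \<in> T \<Longrightarrow> 0 \<le> c t"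
    and F: "\<And>g e l. (\<And>a. spec (XP g a) e (\<lambda>r. l r ^ a)) \<Longrightarrow> \<bar>F g\<bar> \<le> (\<Sum>t\<in>T. c t * U t g) * (\<Sum>r<d. \<bar>l r\<bar> ^ N * om n r ^ (K - n))"
  shows "\<bar>\<integral>g. F g \<partial>\<gamma>\<bar> \<le> (\<Sum>t\<in>T. c t) * (\<mu> ^ N * (real d * omb n ^ (K - n)))"
proof -
  have "\<bar>\<integral>g. F g \<partial>\<gamma>\<bar> \<le> (\<Sum>t\<in>T. c t) * (\<mu> ^ (N + 0) * (real d * omb n ^ (K - n)))"
  proof (rule holder_integral[where SX = "\<lambda>g. tr (XP g K)" and SY = "\<lambda>g. tr (XP g K)" and U = U and w = "om n" and K = K])
    fix g
    obtain e l where el: "\<And>a. spec (XP g a) e (\<lambda>r. l r ^ a)" and l: "(\<Sum>r<d. \<bar>l r\<bar> ^ K) = tr (XP g K)" using X_spec[of g] by blast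
    show "\<exists>x y. (\<forall>r<d. 0 \<le> x r \<and> 0 \<le> y r) \<and> (\<Sum>r<d. x r ^ K) = tr (XP g K) \<and> (\<Sum>r<d. y r ^ K) = tr (XP g K) \<and>
       \<bar>F g\<bar> \<le> (\<Sum>t\<in>T. c t * U t g) * (\<Sum>r<d. x r ^ N * y r ^ 0 * om n r ^ (K - n))"
      using F[OF el] l by (intro exI[of _ "\<lambda>r. \<bar>l r\<bar>"]) simp
  qed (use om N T in \<open>auto simp: U_nonneg om_nonneg om_sum \<mu>_pos moment G.prob_space_axioms intro: polyfun_integrable U_poly U_moment trX_poly\<close>)
  then show ?thesis by simp
qed

text \<open>The two matrices at the two ends of the rotation are dependent and have different
  eigenbases, but both have the same moments, which is all that \<open>holder_integral\<close> asks
  for.\<close>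

lemma pair_bound:
  assumes om: "0 < omb n" and N: "N1 + N2 + (K - n) + 1 \<le> K" and c: "0 \<le> c"
    and F: "\<And>z e l e' l'. (\<And>a. spec (XP (fst z) a) e (\<lambda>r. l r ^ a)) \<Longrightarrow> (\<And>a. spec (XP (rot \<theta> z) a) e' (\<lambda>r. l' r ^ a)) \<Longrightarrow>
       \<bar>F z\<bar> \<le> (c * U 0 (fst z) + c * U 0 (rot \<theta> z) + c * U 2 (fst z) + c * U 2 (rot \<theta> z)) * (\<Sum>r<d. \<bar>l r\<bar> ^ N1 * \<bar>l' r\<bar> ^ N2 * om n r ^ (K - n))"
  shows "\<bar>\<integral>z. F z \<partial>PP\<bar> \<le> 4 * c * (\<mu> ^ (N1 + N2) * (real d * omb n ^ (K - n)))"
proof -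
  \<comment> \<open>The four coefficients in the order: \<open>U 0\<close> and \<open>U 2\<close> of
    the first copy, then \<open>U 0\<close> and \<open>U 2\<close> of the rotated one.\<close>
  define V where "V t z = (if t < 2 then U (2 * t) (fst z) else U (2 * (t - 2)) (rot \<theta> z))" for t z
  have i: "integrable PP (\<lambda>z. f (fst z))" "integrable PP (\<lambda>z. f (rot \<theta> z))" if "polyfun (I \<times> {..<d}) f" for f
    using good_integrable[OF good_fst[OF that]] good_integrable[OF good_rot[OF that], of \<theta>] by auto
  have "\<bar>\<integral>z. F z \<partial>PP\<bar> \<le> (\<Sum>t\<in>{..<4}. (\<lambda>t::nat. c) t) * (\<mu> ^ (N1 + N2) * (real d * omb n ^ (K - n)))"
  proof (rule holder_integral[where SX = "\<lambda>z. tr (XP (fst z) K)" and SY = "\<lambda>z. tr (XP (rot \<theta> z) K)" and U = V and w = "om n" and K = K])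
    fix z :: "(nat \<times> nat \<Rightarrow> real) \<times> (nat \<times> nat \<Rightarrow> real)"
    obtain e l where el: "\<And>a. spec (XP (fst z) a) e (\<lambda>r. l r ^ a)" and l: "(\<Sum>r<d. \<bar>l r\<bar> ^ K) = tr (XP (fst z) K)" using X_spec[of "fst z"] by blast
    obtain e' l' where el': "\<And>a. spec (XP (rot \<theta> z) a) e' (\<lambda>r. l' r ^ a)" and l': "(\<Sum>r<d. \<bar>l' r\<bar> ^ K) = tr (XP (rot \<theta> z) K)" using X_spec[of "rot \<theta> z"] by blast
    have "(\<Sum>t<4. c * V t z) = c * U 0 (fst z) + c * U 0 (rot \<theta> z) + c * U 2 (fst z) + c * U 2 (rot \<theta> z)"
    proof -
      have "{..<4} = {0, 1, 2, 3 :: nat}" by auto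
      then show ?thesis by (simp add: V_def)
    qed
    then show "\<exists>x y. (\<forall>r<d. 0 \<le> x r \<and> 0 \<le> y r) \<and> (\<Sum>r<d. x r ^ K) = tr (XP (fst z) K) \<and> (\<Sum>r<d. y r ^ K) = tr (XP (rot \<theta> z) K) \<and>
       \<bar>F z\<bar> \<le> (\<Sum>t<4. c * V t z) * (\<Sum>r<d. x r ^ N1 * y r ^ N2 * om n r ^ (K - n))"
      using F[OF el el'] l l' by (intro exI[of _ "\<lambda>r. \<bar>l r\<bar>"] exI[of _ "\<lambda>r. \<bar>l' r\<bar>"]) simp
    show "integrable PP (\<lambda>z. V t z ^ K)" for t unfolding V_def using i[OF U_poly] by (cases "t < 2") auto
    show "(\<integral>z. V t z ^ K \<partial>PP) \<le> 1" for t
      unfolding V_def using PP_fst[OF U_poly] rot_invariant[OF U_poly] U_moment by (cases "t < 2") auto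
    show "(\<integral>z. tr (XP (fst z) K) \<partial>PP) \<le> real d * \<mu> ^ K" "(\<integral>z. tr (XP (rot \<theta> z) K) \<partial>PP) \<le> real d * \<mu> ^ K"
      using PP_fst[OF trX_poly] rot_invariant[OF trX_poly] moment by auto
  qed (use om N c in \<open>auto simp: V_def U_nonneg om_nonneg om_sum \<mu>_pos prob_PP intro: i trX_poly\<close>)
  then show ?thesis by simp
qed

lemma expectation_form_B:
  assumes om: "0 < omb n" and n: "n \<le> K" "a + b + 2 = n"
    and W: "spec W f w" "\<And>r. r < d \<Longrightarrow> \<bar>w r\<bar> \<le> om n r ^ (K - n)"
  shows "\<bar>\<integral>g. formB (Yv g) ((!) [XP g a, mm (XP g b) W]) \<partial>\<gamma>\<bar> \<le> cB * (\<mu> ^ (n - 2) * (real d * omb n ^ (K - n)))"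
proof -
  have "\<bar>\<integral>g. formB (Yv g) ((!) [XP g a, mm (XP g b) W]) \<partial>\<gamma>\<bar> \<le> (\<Sum>t\<in>{0, 2}. (\<lambda>t::nat. cB / 2) t) * (\<mu> ^ (a + b) * (real d * omb n ^ (K - n)))"
  proof (rule single_bound[OF om])
    fix g e l assume el: "\<And>a. spec (XP g a) e (\<lambda>r. l r ^ a)"
    have "formB (Yv g) ((!) [XP g a, mm (XP g b) W]) = formB (Yv g) (((!) [XP g a, XP g b, W])(1 := mm (XP g b) W))"
      by (simp add: formB_def)
    then have "\<bar>formB (Yv g) ((!) [XP g a, mm (XP g b) W])\<bar> \<le> (cB / 2 * U 0 g + cB / 2 * U 2 g) * (\<Sum>r<d. \<bar>l r ^ a\<bar> * \<bar>l r ^ b\<bar> * \<bar>w r\<bar>)"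
      using mlf_prod2[OF mlf_B el el W(1), of g a b] by simp
    also have "\<dots> \<le> (cB / 2 * U 0 g + cB / 2 * U 2 g) * (\<Sum>r<d. \<bar>l r\<bar> ^ (a + b) * om n r ^ (K - n))"
      unfolding power_abs power_add using W(2) cB_nonneg U_nonneg by (intro mult_left_mono sum_mono) auto
    finally show "\<bar>formB (Yv g) ((!) [XP g a, mm (XP g b) W])\<bar> \<le> (\<Sum>t\<in>{0, 2}. cB / 2 * U t g) * (\<Sum>r<d. \<bar>l r\<bar> ^ (a + b) * om n r ^ (K - n))"
      by simp
  qed (use n cB_nonneg in auto)
  also have "a + b = n - 2" using n by simp
  finally show ?thesis by simp
qed

text \<open>The alternative in the last hypothesis serves all three forms: the test matrix is
  attached to slot 1 in \<open>formC1\<close> and \<open>formC2\<close>, and to slot 2 in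
  \<open>formC3\<close>.\<close>

lemma expectation_form_C:
  assumes om: "0 < omb n" and n: "n \<le> K" "a + b + c + 3 = n"
    and W: "spec W f w" "\<And>r. r < d \<Longrightarrow> \<bar>w r\<bar> \<le> om n r ^ (K - n)"
    and \<Phi>: "\<And>g. mlf 3 (\<Phi> g) (R * \<kappa>1 * U 0 g + \<kappa>2 * U 1 g)"
    and F: "(\<forall>g. F g = \<Phi> g (((!) [XP g a, XP g b, XP g c, W])(1 := mm (XP g b) W))) \<or> (\<forall>g. F g = \<Phi> g (((!) [XP g a, XP g b, XP g c, W])(2 := mm (XP g c) W)))"
  shows "\<bar>\<integral>g. F g \<partial>\<gamma>\<bar> \<le> (R * \<kappa>1 + \<kappa>2) * (\<mu> ^ (n - 3) * (real d * omb n ^ (K - n)))"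
proof -
  have pos: "0 \<le> R * \<kappa>1" "0 \<le> \<kappa>2" using \<kappa>_pos R_pos by auto
  have "\<bar>\<integral>g. F g \<partial>\<gamma>\<bar> \<le> (\<Sum>t\<in>{0, 1}. (\<lambda>t::nat. if t = 0 then R * \<kappa>1 else \<kappa>2) t) * (\<mu> ^ (a + b + c) * (real d * omb n ^ (K - n)))"
  proof (rule single_bound[OF om])
    fix g e l assume el: "\<And>a. spec (XP g a) e (\<lambda>r. l r ^ a)"
    have "\<bar>F g\<bar> \<le> (R * \<kappa>1 * U 0 g + \<kappa>2 * U 1 g) * (\<Sum>r<d. \<bar>l r ^ a\<bar> * \<bar>l r ^ b\<bar> * \<bar>l r ^ c\<bar> * \<bar>w r\<bar>)"
      using F mlf_prod3[OF \<Phi> el el el W(1), of g a b c] by auto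
    also have "\<dots> \<le> (R * \<kappa>1 * U 0 g + \<kappa>2 * U 1 g) * (\<Sum>r<d. \<bar>l r\<bar> ^ (a + b + c) * om n r ^ (K - n))"
      unfolding power_abs power_add using W(2) pos U_nonneg by (intro mult_left_mono sum_mono) auto
    finally show "\<bar>F g\<bar> \<le> (\<Sum>t\<in>{0, 1}. (if t = 0 then R * \<kappa>1 else \<kappa>2) * U t g) * (\<Sum>r<d. \<bar>l r\<bar> ^ (a + b + c) * om n r ^ (K - n))"
      by simp
  qed (use n pos in auto)
  also have "a + b + c = n - 3" using n by simp
  finally show ?thesis by simp
qed

lemma expectation_form_D:
  assumes om: "0 < omb n" and n: "n \<le> K" "a + b + e + h + 4 = n"
    and W: "spec W f w" "\<And>r. r < d \<Longrightarrow> \<bar>w r\<bar> \<le> om n r ^ (K - n)"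
    and F: "(\<forall>z. F z = formD (Yv (fst z)) (Yv (rot \<theta> z)) (((!) [XP (fst z) a, XP (fst z) b, XP (rot \<theta> z) e, XP (rot \<theta> z) h, W])(2 := mm (XP (rot \<theta> z) e) W))) \<or>
      (\<forall>z. F z = formD (Yv (fst z)) (Yv (rot \<theta> z)) (((!) [XP (fst z) a, XP (fst z) b, XP (rot \<theta> z) e, XP (rot \<theta> z) h, W])(3 := mm W (XP (rot \<theta> z) h))))"
  shows "\<bar>\<integral>z. F z \<partial>PP\<bar> \<le> 2 * v * cB * (\<mu> ^ (n - 4) * (real d * omb n ^ (K - n)))"
proof -
  have pos: "0 \<le> v * cB / 2" using cB_nonneg v_pos by simp
  have "\<bar>\<integral>z. F z \<partial>PP\<bar> \<le> 4 * (v * cB / 2) * (\<mu> ^ ((a + b) + (e + h)) * (real d * omb n ^ (K - n)))"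
  proof (rule pair_bound[OF om _ pos])
    fix z E l E' l' assume el: "\<And>a. spec (XP (fst z) a) E (\<lambda>r. l r ^ a)" and el': "\<And>a. spec (XP (rot \<theta> z) a) E' (\<lambda>r. l' r ^ a)"
    let ?c = "v * cB / 2 * U 0 (fst z) + v * cB / 2 * U 0 (rot \<theta> z) + v * cB / 2 * U 2 (fst z) + v * cB / 2 * U 2 (rot \<theta> z)"
    have "\<bar>F z\<bar> \<le> ?c * (\<Sum>r<d. \<bar>l r ^ a\<bar> * \<bar>l r ^ b\<bar> * \<bar>l' r ^ e\<bar> * \<bar>l' r ^ h\<bar> * \<bar>w r\<bar>)"
    proof -
      note h = mlf_prod4[OF mlf_D el el el' el' W(1), of "fst z" "rot \<theta> z" a b e h]
      from F show ?thesis
      proof (elim disjE)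
        assume "\<forall>z. F z = formD (Yv (fst z)) (Yv (rot \<theta> z)) (((!) [XP (fst z) a, XP (fst z) b, XP (rot \<theta> z) e, XP (rot \<theta> z) h, W])(2 := mm (XP (rot \<theta> z) e) W))"
        then show ?thesis using h(1) by (simp only:)
      next
        assume "\<forall>z. F z = formD (Yv (fst z)) (Yv (rot \<theta> z)) (((!) [XP (fst z) a, XP (fst z) b, XP (rot \<theta> z) e, XP (rot \<theta> z) h, W])(3 := mm W (XP (rot \<theta> z) h)))"
        then show ?thesis using h(2) by (simp only:)
      qed
    qed
    also have "\<dots> \<le> ?c * (\<Sum>r<d. \<bar>l r\<bar> ^ (a + b) * \<bar>l' r\<bar> ^ (e + h) * om n r ^ (K - n))"
      unfolding power_abs power_add mult.assoc[symmetric] using W(2) pos U_nonneg cB_nonneg v_pos by (intro mult_left_mono sum_mono) auto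
    finally show "\<bar>F z\<bar> \<le> ?c * (\<Sum>r<d. \<bar>l r\<bar> ^ (a + b) * \<bar>l' r\<bar> ^ (e + h) * om n r ^ (K - n))" .
  qed (use n in auto)
  also have "(a + b) + (e + h) = n - 4" using n by simp
  finally show ?thesis by simp
qed

lemma form_M_bound:
  assumes n: "n \<le> K" "j + m + 2 = n" and W: "spec W f w" "\<And>r. r < d \<Longrightarrow> \<bar>w r\<bar> \<le> om n r ^ (K - n)"
  shows "\<bar>formM ((!) [Mm j, mm (Mm m) W])\<bar> \<le> s * (real d * (omb j ^ j * omb m ^ m * omb n ^ (K - n)))"
proof -
  obtain e e' where e: "spec (Mm j) e (Lm j)" "spec (Mm m) e' (Lm m)" using spec_Mm by blast
  have "formM ((!) [Mm j, mm (Mm m) W]) = formM (((!) [Mm j, Mm m, W])(1 := mm (Mm m) W))" by (simp add: formM_def)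
  then have "\<bar>formM ((!) [Mm j, mm (Mm m) W])\<bar> \<le> s * (\<Sum>r<d. \<bar>Lm j r\<bar> * \<bar>Lm m r\<bar> * \<bar>w r\<bar>)"
    using mlf_prod2[OF mlf_formM[OF s] e W(1)] by simp
  also have "\<dots> \<le> s * (\<Sum>r<d. om j r ^ j * om m r ^ m * om n r ^ (K - n))"
    using s_nonneg W(2) om_pow by (intro mult_left_mono sum_mono) (auto intro!: mult_left_mono simp: om_nonneg)
  also have "\<dots> \<le> s * (real d * (omb j ^ j * omb m ^ m * omb n ^ (K - n)))"
    by (intro mult_left_mono s_nonneg sum_holder[where K = K]) (use n in \<open>auto simp: om_nonneg omb_nonneg om_sum\<close>)
  finally show ?thesis .
qed

text \<open>The total error of \<open>approximate_dyson_equation\<close> after division by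
  \<open>\<mu> ^ Suc k\<close> and by the size of the test matrix, in terms of dimensionless
  coefficients.\<close>

definition err :: "nat \<Rightarrow> real" where
  "err k = real k * (cB / \<mu>\<^sup>2) + 4 * (real k)\<^sup>2 * ((R * \<kappa>1 + \<kappa>2) / \<mu> ^ 3) + 8 * real k ^ 3 * (2 * v * cB / \<mu> ^ 4)"

text \<open>The approximate Dyson equation is paired with the test matrix. Every term, the left side
  included, then carries the same factor \<open>real d * omb n ^ (K - n)\<close>, which is divided
  out.\<close>

lemma om_recursion:
  assumes k: "Suc k \<le> K"
  shows "omb (Suc k) ^ Suc k \<le> s * (\<Sum>j<k. omb j ^ j * omb (k - 1 - j) ^ (k - 1 - j)) + err k * \<mu> ^ Suc k"
proof (cases "omb (Suc k) = 0")
  case True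
  have "0 \<le> err k" unfolding err_def using cB_nonneg \<mu>_pos v_pos R_pos \<kappa>_pos by (intro add_nonneg_nonneg mult_nonneg_nonneg divide_nonneg_nonneg) auto
  then have "0 \<le> s * (\<Sum>j<k. omb j ^ j * omb (k - 1 - j) ^ (k - 1 - j)) + err k * \<mu> ^ Suc k"
    using s_nonneg \<mu>_pos omb_nonneg by (intro add_nonneg_nonneg mult_nonneg_nonneg sum_nonneg zero_le_power) auto
  with True show ?thesis by simp
next
  case False
  define n where "n = Suc k"
  have n: "0 < n" "n \<le> K" using k by (auto simp: n_def)
  have om: "0 < omb n" using False omb_nonneg[of n] by (simp add: n_def)
  obtain W f w where W: "spec W f w" "symm W" "\<And>r. r < d \<Longrightarrow> \<bar>w r\<bar> \<le> om n r ^ (K - n)" and trW: "tr (mm (Mm n) W) = real d * omb n ^ K"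
    using test_matrix[OF n] by metis
  \<comment> \<open>The common factor is positive because the case \<open>omb n = 0\<close>, in
    which the claim is trivial, has been split off.\<close>
  define q where "q = real d * omb n ^ (K - n)"
  have q: "0 < q" using om d_pos by (simp add: q_def)
  have pw: "\<mu> ^ (n - m) = \<mu> ^ n / \<mu> ^ m" if "m \<le> n" for m using that \<mu>_pos by (simp add: power_diff)
  have D: "\<bar>tr (mm (Mm (Suc k)) W) - (\<Sum>j<k. formM ((!) [Mm j, mm (Mm (k - 1 - j)) W]))\<bar>
     \<le> real k * (cB * (\<mu> ^ n / \<mu>\<^sup>2 * q)) + 4 * (real k)\<^sup>2 * ((R * \<kappa>1 + \<kappa>2) * (\<mu> ^ n / \<mu> ^ 3 * q)) + 8 * real k ^ 3 * (2 * v * cB * (\<mu> ^ n / \<mu> ^ 4 * q))"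
  proof (rule approximate_dyson_equation[OF W(2)])
    fix a b assume "a + b + 1 = k"
    then show "\<bar>\<integral>g. formB (Yv g) ((!) [XP g a, mm (XP g b) W]) \<partial>\<gamma>\<bar> \<le> cB * (\<mu> ^ n / \<mu>\<^sup>2 * q)"
      using expectation_form_B[OF om n(2) _ W(1,3), of a b] pw[of 2] by (simp add: n_def q_def)
  next
    fix a b c assume abc: "a + b + c + 2 = k"
    then have p3: "\<mu> ^ (n - 3) = \<mu> ^ n / \<mu> ^ 3" and abc': "a + b + c + 3 = n" using pw[of 3] by (auto simp: n_def)
    show "\<bar>\<integral>g. formC1 (Yv g) ((!) [XP g a, mm (XP g b) W, XP g c]) \<partial>\<gamma>\<bar> \<le> (R * \<kappa>1 + \<kappa>2) * (\<mu> ^ n / \<mu> ^ 3 * q)"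
      unfolding p3[symmetric] q_def by (rule expectation_form_C[OF om n(2) abc' W(1,3) mlf_C(1)]) (simp_all add: formC1_def)
    show "\<bar>\<integral>g. formC2 (Yv g) ((!) [XP g a, mm (XP g b) W, XP g c]) \<partial>\<gamma>\<bar> \<le> (R * \<kappa>1 + \<kappa>2) * (\<mu> ^ n / \<mu> ^ 3 * q)"
      unfolding p3[symmetric] q_def by (rule expectation_form_C[OF om n(2) abc' W(1,3) mlf_C(2)]) (simp_all add: formC2_def)
    show "\<bar>\<integral>g. formC3 (Yv g) ((!) [XP g a, XP g b, mm (XP g c) W]) \<partial>\<gamma>\<bar> \<le> (R * \<kappa>1 + \<kappa>2) * (\<mu> ^ n / \<mu> ^ 3 * q)"
      unfolding p3[symmetric] q_def by (rule expectation_form_C[OF om n(2) abc' W(1,3) mlf_C(3)]) (simp_all add: formC3_def)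
  next
    fix \<theta> a b e h assume abeh: "a + b + e + h + 3 = k"
    then have p4: "\<mu> ^ (n - 4) = \<mu> ^ n / \<mu> ^ 4" and abeh': "a + b + e + h + 4 = n" using pw[of 4] by (auto simp: n_def)
    show "\<bar>\<integral>z. formD (Yv (fst z)) (Yv (rot \<theta> z)) ((!) [XP (fst z) a, XP (fst z) b, XP (rot \<theta> z) e, mm W (XP (rot \<theta> z) h)]) \<partial>PP\<bar> \<le> 2 * v * cB * (\<mu> ^ n / \<mu> ^ 4 * q)"
      unfolding p4[symmetric] q_def by (rule expectation_form_D[OF om n(2) abeh' W(1,3), where \<theta> = \<theta>]) (simp_all add: formD_def)
    show "\<bar>\<integral>z. formD (Yv (fst z)) (Yv (rot \<theta> z)) ((!) [XP (fst z) a, XP (fst z) b, mm (XP (rot \<theta> z) e) W, XP (rot \<theta> z) h]) \<partial>PP\<bar> \<le> 2 * v * cB * (\<mu> ^ n / \<mu> ^ 4 * q)"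
      unfolding p4[symmetric] q_def by (rule expectation_form_D[OF om n(2) abeh' W(1,3), where \<theta> = \<theta>]) (simp_all add: formD_def)
  next
    show "0 \<le> (R * \<kappa>1 + \<kappa>2) * (\<mu> ^ n / \<mu> ^ 3 * q)" "0 \<le> 2 * v * cB * (\<mu> ^ n / \<mu> ^ 4 * q)"
      using R_pos \<kappa>_pos \<mu>_pos q v_pos cB_nonneg by (auto intro!: mult_nonneg_nonneg add_nonneg_nonneg)
  qed
  have "(\<Sum>j<k. formM ((!) [Mm j, mm (Mm (k - 1 - j)) W])) \<le> (\<Sum>j<k. s * (omb j ^ j * omb (k - 1 - j) ^ (k - 1 - j)) * q)"
  proof (rule sum_mono)
    fix j assume "j \<in> {..<k}"
    then have "j + (k - 1 - j) + 2 = n" by (auto simp: n_def)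
    from form_M_bound[OF n(2) this W(1,3)]
    show "formM ((!) [Mm j, mm (Mm (k - 1 - j)) W]) \<le> s * (omb j ^ j * omb (k - 1 - j) ^ (k - 1 - j)) * q"
      by (simp add: q_def mult_ac)
  qed
  then have M: "(\<Sum>j<k. formM ((!) [Mm j, mm (Mm (k - 1 - j)) W])) \<le> s * (\<Sum>j<k. omb j ^ j * omb (k - 1 - j) ^ (k - 1 - j)) * q"
    by (simp add: sum_distrib_left sum_distrib_right)
  have "omb n ^ n * q = tr (mm (Mm (Suc k)) W)"
    using n trW by (simp add: q_def n_def[symmetric] flip: power_add)
  also have "\<dots> \<le> s * (\<Sum>j<k. omb j ^ j * omb (k - 1 - j) ^ (k - 1 - j)) * q
     + (real k * (cB * (\<mu> ^ n / \<mu>\<^sup>2 * q)) + 4 * (real k)\<^sup>2 * ((R * \<kappa>1 + \<kappa>2) * (\<mu> ^ n / \<mu> ^ 3 * q)) + 8 * real k ^ 3 * (2 * v * cB * (\<mu> ^ n / \<mu> ^ 4 * q)))"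
    using D M by linarith
  also have "\<dots> = (s * (\<Sum>j<k. omb j ^ j * omb (k - 1 - j) ^ (k - 1 - j)) + err k * \<mu> ^ n) * q"
    unfolding err_def by (simp add: divide_inverse algebra_simps)
  finally show ?thesis using q unfolding n_def by (rule mult_right_le_imp_le)
qed

text \<open>At \<open>n = K\<close> the norm is the normalised trace norm, which dominates the
  normalised trace of the mean of \<open>X ^ K\<close>.\<close>

lemma omb_top: "\<mu> ^ K \<le> omb K ^ K"
proof -
  obtain e where e: "spec (Mm K) e (Lm K)" using spec_Mm by blast
  have "real d * \<mu> ^ K = (\<Sum>a<d. \<integral>g. XP g K a a \<partial>\<gamma>)"
    unfolding moment[symmetric] tr_def by (intro integral_sum_poly poly_XP) auto
  also have "\<dots> = tr (Mm K)" by (simp add: tr_def Mm_def)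
  also have "\<dots> \<le> (\<Sum>r<d. \<bar>Lm K r\<bar>)" unfolding spec_tr[OF e] by (intro sum_mono) auto
  also have "\<dots> = real d * omb K ^ K" unfolding om_sum[symmetric] by (intro sum.cong refl) (simp add: om_pow)
  finally show ?thesis using d_pos by simp
qed

lemma dichotomy: "1 \<le> 4 * (s / \<mu>\<^sup>2) + real K * err K"
proof (rule ccontr)
  assume neg: "\<not> ?thesis"
  define \<beta> where "\<beta> n = omb n ^ n / \<mu> ^ n" for n
  have c0: "0 \<le> cB / \<mu>\<^sup>2" "0 \<le> (R * \<kappa>1 + \<kappa>2) / \<mu> ^ 3" "0 \<le> 2 * v * cB / \<mu> ^ 4"
    using cB_nonneg \<mu>_pos v_pos R_pos \<kappa>_pos by simp_all
  have err0: "0 \<le> err K" unfolding err_def by (intro add_nonneg_nonneg mult_nonneg_nonneg c0 zero_le_power) auto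
  have err_mono: "err k \<le> err K" if "k \<le> K" for k
    unfolding err_def using that by (intro add_mono mult_right_mono mult_left_mono power_mono c0) auto
  have \<beta>0: "\<beta> 0 = 1" by (simp add: \<beta>_def omb_0)
  have nn: "0 \<le> \<beta> n" for n using omb_nonneg \<mu>_pos by (simp add: \<beta>_def)
  \<comment> \<open>The recursion at \<open>k = 0\<close> has an empty sum and no error:
    \<open>X\<close> is centered.\<close>
  have "omb (Suc 0) ^ Suc 0 \<le> 0" using om_recursion[of 0] p_pos by (simp add: err_def)
  then have \<beta>1: "\<beta> 1 = 0" using omb_nonneg[of 1] by (simp add: \<beta>_def)
  have "(\<Sum>j\<le>K. \<beta> j) < 2"
  proof (rule catalan_partial_sum[OF nn \<beta>0 \<beta>1 _ err0])
    show "0 \<le> s / \<mu>\<^sup>2" using s_nonneg by simp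
    show "4 * (s / \<mu>\<^sup>2) + real K * err K < 1" using neg by simp
    fix k assume k: "0 < k" "k < K"
    have "\<beta> (Suc k) \<le> (s * (\<Sum>j<k. omb j ^ j * omb (k - 1 - j) ^ (k - 1 - j)) + err k * \<mu> ^ Suc k) / \<mu> ^ Suc k"
      unfolding \<beta>_def using om_recursion[of k] k \<mu>_pos by (intro divide_right_mono) auto
    also have "\<dots> = s / \<mu>\<^sup>2 * (\<Sum>j<k. \<beta> j * \<beta> (k - 1 - j)) + err k"
    proof -
      have "(\<Sum>j<k. \<beta> j * \<beta> (k - 1 - j)) = (\<Sum>j<k. omb j ^ j * omb (k - 1 - j) ^ (k - 1 - j)) / \<mu> ^ (k - 1)"
        unfolding sum_divide_distrib
      proof (intro sum.cong refl)
        fix j assume "j \<in> {..<k}"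
        then have "\<mu> ^ (k - 1) = \<mu> ^ j * \<mu> ^ (k - 1 - j)" by (simp flip: power_add)
        then show "\<beta> j * \<beta> (k - 1 - j) = omb j ^ j * omb (k - 1 - j) ^ (k - 1 - j) / \<mu> ^ (k - 1)"
          by (simp add: \<beta>_def)
      qed
      moreover have "\<mu> ^ Suc k = \<mu>\<^sup>2 * \<mu> ^ (k - 1)" using k by (simp flip: power_add)
      ultimately show ?thesis using \<mu>_pos by (simp add: add_divide_distrib)
    qed
    also have "\<dots> \<le> s / \<mu>\<^sup>2 * (\<Sum>j<k. \<beta> j * \<beta> (k - 1 - j)) + err K" using err_mono[of k] k by simp
    finally show "\<beta> (Suc k) \<le> s / \<mu>\<^sup>2 * (\<Sum>j<k. \<beta> j * \<beta> (k - 1 - j)) + err K" .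
  qed simp
  moreover have "\<beta> 0 + \<beta> K \<le> (\<Sum>j\<le>K. \<beta> j)"
  proof -
    have "(\<Sum>j\<in>{0, K}. \<beta> j) \<le> (\<Sum>j\<le>K. \<beta> j)" by (intro sum_mono2) (auto simp: nn)
    then show ?thesis using p_pos by simp
  qed
  moreover have "1 \<le> \<beta> K" unfolding \<beta>_def using omb_top \<mu>_pos by simp
  ultimately show False using \<beta>0 by linarith
qed

text \<open>If the bound failed, dividing all quantities by \<open>\<mu>\<close> would make the
  error small enough to contradict \<open>dichotomy\<close>. The main term there is
  \<open>4 * \<sigma>\<^sup>2\<close>, which is at most \<open>2 * \<sigma>\<close> as soon as
  \<open>\<sigma> \<le> 1 / 2\<close>; so the constant 2 in front of \<open>sqrt s\<close> comes out
  exactly.\<close>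

theorem moment_bound: "\<mu> \<le> 2 * sqrt s + 1000 * real p ^ 3 * (sqrt v + R)"
proof (rule ccontr)
  assume neg: "\<not> ?thesis"
  define \<sigma> \<nu> \<rho> P where "\<sigma> = sqrt s / \<mu>" and "\<nu> = sqrt v / \<mu>" and "\<rho> = R / \<mu>" and "P = real p"
  define x where "x = \<nu> + \<rho>"
  have s': "s = (\<sigma> * \<mu>)\<^sup>2" and v': "v = (\<nu> * \<mu>)\<^sup>2" and R': "R = \<rho> * \<mu>"
    using s_nonneg v_pos \<mu>_pos by (simp_all add: \<sigma>_def \<nu>_def \<rho>_def)
  have pos: "0 \<le> \<sigma>" "0 < \<nu>" "0 < \<rho>" "1 \<le> P"
    using s_nonneg v_pos \<mu>_pos R_pos p_pos by (simp_all add: \<sigma>_def \<nu>_def \<rho>_def P_def)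
  then have x: "0 < x" "\<rho> \<le> x" "\<nu> \<le> x" by (auto simp: x_def)
  have "2 * sqrt s + 1000 * real p ^ 3 * (sqrt v + R) < \<mu>" using neg by simp
  then have "(2 * sqrt s + 1000 * real p ^ 3 * (sqrt v + R)) / \<mu> < 1" using \<mu>_pos by simp
  then have hx: "2 * \<sigma> + 1000 * (P ^ 3 * x) < 1"
    unfolding x_def \<sigma>_def \<nu>_def \<rho>_def P_def by (simp add: add_divide_distrib distrib_left)
  \<comment> \<open>The assumption to be refuted makes \<open>y\<close> less than 1 / 1000, so that
    all quadratic expressions in \<open>x\<close> and \<open>P * x\<close> become
    negligible.\<close>
  define y where "y = P ^ 3 * x"
  have y: "0 < y" using pos x by (simp add: y_def)
  have P: "P \<le> P ^ 3" "1 \<le> P ^ 3" using pos power_increasing[of 1 3 P] by auto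
  have xy: "x \<le> y" "P * x \<le> y" unfolding y_def using mult_right_mono[OF P(2), of x] mult_right_mono[OF P(1), of x] x by auto
  have small: "y < 1 / 1000" "\<sigma> \<le> 1 / 2" using hx pos x y unfolding y_def[symmetric] by linarith+
  have \<sigma>2: "\<sigma>\<^sup>2 \<le> 1 / 4" using power_mono[OF small(2) pos(1), of 2] by (simp add: power2_eq_square)
  have x2: "x\<^sup>2 \<le> y * y" using xy x by (simp add: power2_eq_square mult_mono)
  have yy: "y * y \<le> 1 / 1000 * (1 / 1000)" using small y by (intro mult_mono) auto
  have \<rho>x: "\<rho>\<^sup>2 \<le> x\<^sup>2" and \<nu>x: "\<nu>\<^sup>2 \<le> x\<^sup>2" using x pos by (auto intro: power_mono)
  have \<nu>\<rho>: "\<nu>\<^sup>2 + \<rho>\<^sup>2 \<le> x\<^sup>2" unfolding x_def using pos by (simp add: power2_sum)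
  have cB: "cB / \<mu>\<^sup>2 \<le> 46 * (P * x)"
  proof -
    have "cB = sqrt ((16 * \<sigma>\<^sup>2 + 128 * P * \<rho>\<^sup>2) * (2 * \<nu>\<^sup>2 + 16 * P * \<rho>\<^sup>2) * (\<mu>\<^sup>2)\<^sup>2)"
      unfolding cB_def \<kappa>1_def \<kappa>3_def unfolding s' v' R' P_def by (simp add: power_mult_distrib power2_eq_square algebra_simps)
    also have "\<dots> = sqrt ((16 * \<sigma>\<^sup>2 + 128 * P * \<rho>\<^sup>2) * (2 * \<nu>\<^sup>2 + 16 * P * \<rho>\<^sup>2)) * \<mu>\<^sup>2"
      by (simp only: real_sqrt_mult real_sqrt_abs abs_power2)
    finally have "cB / \<mu>\<^sup>2 = sqrt ((16 * \<sigma>\<^sup>2 + 128 * P * \<rho>\<^sup>2) * (2 * \<nu>\<^sup>2 + 16 * P * \<rho>\<^sup>2))" using \<mu>_pos by simp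
    \<comment> \<open>The two factors are at most \<open>128 * P\<close> and
      \<open>16 * (P * x\<^sup>2)\<close>, and 128 times 16 is less than the square of 46.\<close>
    also have "\<dots> \<le> sqrt ((46 * (P * x))\<^sup>2)"
    proof (rule real_sqrt_le_mono)
      have "\<sigma>\<^sup>2 + \<rho>\<^sup>2 \<le> 1" using \<sigma>2 \<rho>x x2 yy by linarith
      then have "P * (\<sigma>\<^sup>2 + \<rho>\<^sup>2) \<le> P * 1" using pos by (intro mult_left_mono) auto
      moreover have "1 * \<sigma>\<^sup>2 \<le> P * \<sigma>\<^sup>2" "1 * \<nu>\<^sup>2 \<le> P * \<nu>\<^sup>2" using pos by (intro mult_right_mono; simp)+
      moreover have "P * (\<nu>\<^sup>2 + \<rho>\<^sup>2) \<le> P * x\<^sup>2" using pos \<nu>\<rho> by (intro mult_left_mono) auto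
      moreover have "0 \<le> \<sigma>\<^sup>2" "0 \<le> \<nu>\<^sup>2" by simp_all
      ultimately have "16 * \<sigma>\<^sup>2 + 128 * P * \<rho>\<^sup>2 \<le> 128 * P" "2 * \<nu>\<^sup>2 + 16 * P * \<rho>\<^sup>2 \<le> 16 * (P * x\<^sup>2)"
        unfolding distrib_left mult.assoc by linarith+
      then have "(16 * \<sigma>\<^sup>2 + 128 * P * \<rho>\<^sup>2) * (2 * \<nu>\<^sup>2 + 16 * P * \<rho>\<^sup>2) \<le> (128 * P) * (16 * (P * x\<^sup>2))"
        using pos by (intro mult_mono) auto
      also have "\<dots> \<le> (46 * (P * x))\<^sup>2" using pos x by (simp add: power_mult_distrib power2_eq_square)
      finally show "(16 * \<sigma>\<^sup>2 + 128 * P * \<rho>\<^sup>2) * (2 * \<nu>\<^sup>2 + 16 * P * \<rho>\<^sup>2) \<le> (46 * (P * x))\<^sup>2" .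
    qed
    also have "\<dots> = 46 * (P * x)" unfolding real_sqrt_abs using pos x by simp
    finally show ?thesis .
  qed
  have cC: "(R * \<kappa>1 + \<kappa>2) / \<mu> ^ 3 \<le> 6 * x"
  proof -
    have "R * \<kappa>1 + \<kappa>2 = \<rho> * (18 * \<sigma>\<^sup>2 + 144 * (P * \<rho>\<^sup>2)) * \<mu> ^ 3"
      unfolding \<kappa>1_def \<kappa>2_def unfolding s' R' P_def by (simp add: power2_eq_square power3_eq_cube algebra_simps)
    then have "(R * \<kappa>1 + \<kappa>2) / \<mu> ^ 3 = \<rho> * (18 * \<sigma>\<^sup>2 + 144 * (P * \<rho>\<^sup>2))" using \<mu>_pos by simp
    also have "\<dots> \<le> x * 6"
    proof (intro mult_mono)
      have "P * \<rho>\<^sup>2 \<le> P * x\<^sup>2" using \<rho>x pos by (intro mult_left_mono) auto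
      also have "\<dots> = (P * x) * x" by (simp add: power2_eq_square)
      also have "\<dots> \<le> y * y" using xy x y by (intro mult_mono) auto
      finally show "18 * \<sigma>\<^sup>2 + 144 * (P * \<rho>\<^sup>2) \<le> 6" using \<sigma>2 yy by linarith
    qed (use x pos in auto)
    finally show ?thesis by simp
  qed
  have cD: "2 * v * cB / \<mu> ^ 4 \<le> 92 * (P * x * x\<^sup>2)"
  proof -
    have "2 * v * cB / \<mu> ^ 4 = 2 * \<nu>\<^sup>2 * (cB / \<mu>\<^sup>2)"
      unfolding v' using \<mu>_pos by (simp add: power_mult_distrib eval_nat_numeral)
    also have "\<dots> \<le> 2 * x\<^sup>2 * (46 * (P * x))" using \<nu>x cB cB_nonneg by (intro mult_mono) auto
    finally show ?thesis by (simp add: mult_ac)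
  qed
  have "real K * err K \<le> real K * (real K * (46 * (P * x)) + 4 * (real K)\<^sup>2 * (6 * x) + 8 * real K ^ 3 * (92 * (P * x * x\<^sup>2)))"
    unfolding err_def using cB cC cD by (intro mult_left_mono add_mono) auto
  \<comment> \<open>With \<open>K = 2 * P\<close> the terms B and C give
    \<open>4 * 46 + 32 * 6 = 376\<close>, the terms D give \<open>128 * 92 = 11776\<close>. The
    latter come with a factor below 1 / 1000000, so 400 covers everything.\<close>
  also have "\<dots> = 376 * y + 11776 * (P ^ 5 * x ^ 3)"
    unfolding y_def P_def by (simp add: eval_nat_numeral algebra_simps)
  also have "P ^ 5 * x ^ 3 = y * ((P * x) * (P * x))" unfolding y_def by (simp add: eval_nat_numeral)
  also have "y * ((P * x) * (P * x)) \<le> y * (y * y)" using xy x y pos by (intro mult_left_mono mult_mono) auto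
  also have "y * (y * y) \<le> y * (1 / 1000 * (1 / 1000))" using y yy by (intro mult_left_mono) auto
  finally have E: "real K * err K \<le> 400 * y" using y by linarith
  have "s / \<mu>\<^sup>2 = \<sigma>\<^sup>2" unfolding s' using \<mu>_pos by (simp add: power_mult_distrib)
  moreover have "\<sigma>\<^sup>2 \<le> \<sigma> / 2" using small pos mult_left_mono[of \<sigma> "1/2" \<sigma>] by (simp add: power2_eq_square)
  ultimately have "1 \<le> 2 * \<sigma> + 400 * y" using dichotomy E by linarith
  with hx y show False unfolding y_def by linarith
qed

end

section \<open>From moments to laws\<close>

text \<open>The induction is over integrability of all absolute powers, since a product needs higher
  powers of its factors.\<close>

lemma polyfun_process_integrable:
  assumes N: "prob_space N" and Z: "\<And>j k. j \<in> J \<Longrightarrow> integrable N (\<lambda>x. Z x j ^ k)" and F: "polyfun J F"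
  shows "integrable N (\<lambda>x. F (Z x))"
proof -
  interpret prob_space N by (rule N)
  have *: "(\<lambda>x. F (Z x)) \<in> borel_measurable N \<and> (\<forall>k. integrable N (\<lambda>x. \<bar>F (Z x)\<bar> ^ k))"
    using F
  proof induction
    case (polyfun_var j)
    have "(\<lambda>x. Z x j ^ 1) \<in> borel_measurable N" using Z[OF polyfun_var] by (rule borel_measurable_integrable)
    moreover have "integrable N (\<lambda>x. \<bar>Z x j\<bar> ^ k)" for k
      using integrable_abs[OF Z[OF polyfun_var, of k]] by (simp add: power_abs)
    ultimately show ?case by simp
  next
    case (polyfun_add F G)
    have [measurable]: "(\<lambda>x. F (Z x)) \<in> borel_measurable N" "(\<lambda>x. G (Z x)) \<in> borel_measurable N" using polyfun_add by auto
    have "integrable N (\<lambda>x. \<bar>F (Z x) + G (Z x)\<bar> ^ k)" for k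
    proof (rule Bochner_Integration.integrable_bound)
      show "integrable N (\<lambda>x. 2 ^ k * (\<bar>F (Z x)\<bar> ^ k + \<bar>G (Z x)\<bar> ^ k))" using polyfun_add by simp
      have "\<bar>a + b\<bar> ^ k \<le> 2 ^ k * (\<bar>a\<bar> ^ k + \<bar>b\<bar> ^ k)" for a b :: real
      proof -
        have "\<bar>a + b\<bar> ^ k \<le> (2 * max \<bar>a\<bar> \<bar>b\<bar>) ^ k" by (intro power_mono) auto
        also have "\<dots> \<le> 2 ^ k * (\<bar>a\<bar> ^ k + \<bar>b\<bar> ^ k)" by (auto simp: power_mult_distrib max_def)
        finally show ?thesis .
      qed
      then show "AE x in N. norm (\<bar>F (Z x) + G (Z x)\<bar> ^ k) \<le> norm (2 ^ k * (\<bar>F (Z x)\<bar> ^ k + \<bar>G (Z x)\<bar> ^ k))" by simp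
    qed measurable
    then show ?case by simp
  next
    case (polyfun_mult F G)
    have [measurable]: "(\<lambda>x. F (Z x)) \<in> borel_measurable N" "(\<lambda>x. G (Z x)) \<in> borel_measurable N" using polyfun_mult by auto
    have "integrable N (\<lambda>x. \<bar>F (Z x) * G (Z x)\<bar> ^ k)" for k
    proof (rule Bochner_Integration.integrable_bound)
      show "integrable N (\<lambda>x. \<bar>F (Z x)\<bar> ^ (k + k) + \<bar>G (Z x)\<bar> ^ (k + k))" using polyfun_mult by simp
      show "AE x in N. norm (\<bar>F (Z x) * G (Z x)\<bar> ^ k) \<le> norm (\<bar>F (Z x)\<bar> ^ (k + k) + \<bar>G (Z x)\<bar> ^ (k + k))"
        using pow_mult_le_add[of "\<bar>F (Z x)\<bar>" "\<bar>G (Z x)\<bar>" k k for x] by (simp add: abs_mult power_mult_distrib)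
    qed measurable
    then show ?case by simp
  qed auto
  then have "integrable N (\<lambda>x. \<bar>F (Z x)\<bar> ^ 1)" "(\<lambda>x. F (Z x)) \<in> borel_measurable N" by blast+
  then show ?thesis by (simp add: integrable_abs_iff)
qed

text \<open>Equality of the moments of all linear forms forces equality of all mixed moments, by comparing
  coefficients of \<open>t\<close> in \<open>E (\<ell> + t x\<^sub>j)\<^sup>m\<^sup>+\<^sup>1\<close>.\<close>

locale moment_matching =
  fixes J :: "'k set" and N :: "'z measure" and Z :: "'z \<Rightarrow> 'k \<Rightarrow> real" and N' :: "'y measure" and Z' :: "'y \<Rightarrow> 'k \<Rightarrow> real"
  assumes fin: "finite J" and N: "prob_space N" and N': "prob_space N'"
    and int: "\<And>j k. j \<in> J \<Longrightarrow> integrable N (\<lambda>x. Z x j ^ k)" and int': "\<And>j k. j \<in> J \<Longrightarrow> integrable N' (\<lambda>x. Z' x j ^ k)"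
    and forms: "\<And>c m. (\<integral>x. (\<Sum>j\<in>J. c j * Z x j) ^ m \<partial>N) = (\<integral>x. (\<Sum>j\<in>J. c j * Z' x j) ^ m \<partial>N')"
begin

lemma integrable: "polyfun J F \<Longrightarrow> integrable N (\<lambda>x. F (Z x))" "polyfun J F \<Longrightarrow> integrable N' (\<lambda>x. F (Z' x))"
  by (rule polyfun_process_integrable[OF N int], assumption+) (rule polyfun_process_integrable[OF N' int'], assumption+)

definition lf :: "('k \<Rightarrow> real) \<Rightarrow> ('k \<Rightarrow> real) \<Rightarrow> real" where "lf c = (\<lambda>z. \<Sum>j\<in>J. c j * z j)"
definition mono :: "'k list \<Rightarrow> ('k \<Rightarrow> real) \<Rightarrow> real" where "mono js = (\<lambda>z. prod_list (map z js))"

lemma poly_lf: "polyfun J (lf c)"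
  unfolding lf_def by (rule polyfun_sum) (rule polyfun_mult[OF polyfun_const polyfun_var])

lemma poly_mono: "set js \<subseteq> J \<Longrightarrow> polyfun J (mono js)"
proof (induction js)
  case (Cons j js)
  then show ?case unfolding mono_def by (simp add: polyfun_mult polyfun_var)
qed (simp add: mono_def polyfun_const)

text \<open>Variables already extracted are carried along in \<open>mono js\<close>. The linear form
  \<open>c\<close> and the power \<open>m\<close> vary in the induction, since each extraction
  perturbs \<open>c\<close> in one coordinate and uses the power \<open>Suc m\<close>.\<close>

lemma mixed: "set js \<subseteq> J \<Longrightarrow> (\<integral>x. mono js (Z x) * lf c (Z x) ^ m \<partial>N) = (\<integral>x. mono js (Z' x) * lf c (Z' x) ^ m \<partial>N')"
proof (induction js arbitrary: c m)
  case Nil then show ?case using forms by (simp add: mono_def lf_def)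
next
  case (Cons j js)
  then have j: "j \<in> J" and js: "set js \<subseteq> J" by auto
  have lf_upd: "lf (c(j := c j + t)) z = t * z j + lf c z" for t z
  proof -
    have "lf (c(j := c j + t)) z = (\<Sum>i\<in>J. (if i = j then t * z j else 0) + c i * z i)"
      unfolding lf_def by (intro sum.cong) (auto simp: algebra_simps)
    then show ?thesis using fin j by (simp add: sum.distrib lf_def)
  qed
  define e where "e k = (\<integral>x. mono js (Z x) * Z x j ^ k * lf c (Z x) ^ (Suc m - k) \<partial>N)" for k
  define e' where "e' k = (\<integral>x. mono js (Z' x) * Z' x j ^ k * lf c (Z' x) ^ (Suc m - k) \<partial>N')" for k
  have pk: "polyfun J (\<lambda>z. real (Suc m choose k) * t ^ k * (mono js z * z j ^ k * lf c z ^ (Suc m - k)))" for k t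
    by (intro polyfun_intros poly_mono poly_lf js j)
  have ex: "mono js z * lf (c(j := c j + t)) z ^ Suc m = (\<Sum>k\<le>Suc m. real (Suc m choose k) * t ^ k * (mono js z * z j ^ k * lf c z ^ (Suc m - k)))" for t z
    unfolding lf_upd binomial_ring sum_distrib_left by (intro sum.cong refl) (simp add: power_mult_distrib mult_ac)
  have "(\<Sum>k\<le>Suc m. real (Suc m choose k) * t ^ k * e k) = (\<Sum>k\<le>Suc m. real (Suc m choose k) * t ^ k * e' k)" for t
  proof -
    have "(\<Sum>k\<le>Suc m. real (Suc m choose k) * t ^ k * e k) = (\<integral>x. mono js (Z x) * lf (c(j := c j + t)) (Z x) ^ Suc m \<partial>N)"
      unfolding ex e_def by (subst Bochner_Integration.integral_sum[OF integrable(1)[OF pk]]) simp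
    also have "\<dots> = (\<integral>x. mono js (Z' x) * lf (c(j := c j + t)) (Z' x) ^ Suc m \<partial>N')" by (rule Cons.IH[OF js])
    also have "\<dots> = (\<Sum>k\<le>Suc m. real (Suc m choose k) * t ^ k * e' k)"
      unfolding ex e'_def by (subst Bochner_Integration.integral_sum[OF integrable(2)[OF pk]]) simp
    finally show ?thesis .
  qed
  then have "poly (\<Sum>k\<le>Suc m. monom (real (Suc m choose k) * e k) k) = poly (\<Sum>k\<le>Suc m. monom (real (Suc m choose k) * e' k) k)"
    by (intro ext) (simp add: poly_sum poly_monom mult_ac del: sum.atMost_Suc)
  then have "(\<Sum>k\<le>Suc m. monom (real (Suc m choose k) * e k) k) = (\<Sum>k\<le>Suc m. monom (real (Suc m choose k) * e' k) k)"
    by (simp only: poly_eq_poly_eq_iff)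
  then have "coeff (\<Sum>k\<le>Suc m. monom (real (Suc m choose k) * e k) k) 1 = coeff (\<Sum>k\<le>Suc m. monom (real (Suc m choose k) * e' k) k) 1" by simp
  then have "real (Suc m choose 1) * e 1 = real (Suc m choose 1) * e' 1"
    by (simp add: coeff_sum if_distrib cong: if_cong del: sum.atMost_Suc)
  then have "e 1 = e' 1" by simp
  then show ?case by (simp add: e_def e'_def mono_def mult_ac)
qed

text \<open>Monomials are covered by \<open>mixed\<close>. To avoid an expansion of \<open>F\<close>
  into monomials, the induction shows that multiplication by \<open>F\<close> preserves the class of
  polynomials whose expectations against all monomials agree.\<close>

lemma matching: assumes "polyfun J F" shows "(\<integral>x. F (Z x) \<partial>N) = (\<integral>x. F (Z' x) \<partial>N')"
proof -
  define Q where "Q H \<longleftrightarrow> polyfun J H \<and> (\<forall>js. set js \<subseteq> J \<longrightarrow> (\<integral>x. H (Z x) * mono js (Z x) \<partial>N) = (\<integral>x. H (Z' x) * mono js (Z' x) \<partial>N'))" for H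
  have "\<forall>H. Q H \<longrightarrow> Q (\<lambda>z. F z * H z)" using assms
  proof induction
    case (polyfun_const c)
    show ?case unfolding Q_def by (auto intro: polyfun.intros simp: mult.assoc)
  next
    case (polyfun_var k)
    show ?case
    proof (intro allI impI)
      fix H assume H: "Q H"
      have "(\<integral>x. Z x k * H (Z x) * mono js (Z x) \<partial>N) = (\<integral>x. Z' x k * H (Z' x) * mono js (Z' x) \<partial>N')" if "set js \<subseteq> J" for js
      proof -
        have "set (k # js) \<subseteq> J" using that polyfun_var by simp
        then have "(\<integral>x. H (Z x) * mono (k # js) (Z x) \<partial>N) = (\<integral>x. H (Z' x) * mono (k # js) (Z' x) \<partial>N')" using H unfolding Q_def by blast
        then show ?thesis by (simp add: mono_def mult_ac)
      qed
      then show "Q (\<lambda>z. z k * H z)" using H polyfun_var by (auto simp: Q_def intro: polyfun.intros)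
    qed
  next
    case (polyfun_add F G)
    show ?case
    proof (intro allI impI)
      fix H assume "Q H"
      then have F: "Q (\<lambda>z. F z * H z)" and G: "Q (\<lambda>z. G z * H z)" using polyfun_add by auto
      have i: "integrable N (\<lambda>x. P (Z x) * mono js (Z x))" "integrable N' (\<lambda>x. P (Z' x) * mono js (Z' x))" if "Q P" "set js \<subseteq> J" for P js
        using integrable[of "\<lambda>z. P z * mono js z"] that poly_mono by (auto simp: Q_def intro: polyfun.intros)
      show "Q (\<lambda>z. (F z + G z) * H z)"
        using F G i[OF F] i[OF G] unfolding Q_def by (auto simp: distrib_right intro: polyfun.intros)
    qed
  next
    case (polyfun_mult F G)
    then show ?case by (simp add: mult.assoc)
  qed
  moreover have "Q (\<lambda>z. 1)" unfolding Q_def using mixed[where m = 0] by (simp add: polyfun_const)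
  ultimately have "Q (\<lambda>z. F z * 1)" by blast
  then have "(\<integral>x. F (Z x) * 1 * mono [] (Z x) \<partial>N) = (\<integral>x. F (Z' x) * 1 * mono [] (Z' x) \<partial>N')" unfolding Q_def by (metis empty_set empty_subsetI)
  then show ?thesis by (simp add: mono_def)
qed

end

section \<open>Normal laws, possibly degenerate, and their moments\<close>

lemma normal_law_distr: assumes "0 \<le> v" shows "normal_law v = distr stdn borel (\<lambda>x. sqrt v * x)"
proof (cases "v = 0")
  case True
  then show ?thesis using prob_space.distr_const[OF prob_stdn, of "0::real" borel] by (simp add: normal_law_def)
next
  case False
  interpret S: prob_space stdn by (rule prob_stdn)
  have "distributed stdn lborel (\<lambda>x. x) (\<lambda>x. ennreal (std_normal_density x))"
    unfolding distributed_def by (auto simp: distr_id2)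
  from S.normal_density_affine[OF this, of "sqrt v" 0] False assms
  have "distributed stdn lborel (\<lambda>x. sqrt v * x) (\<lambda>x. ennreal (normal_density 0 (sqrt v) x))" by simp
  then have "distr stdn lborel (\<lambda>x. sqrt v * x) = density lborel (normal_density 0 (sqrt v))"
    by (rule distributed_distr_eq_density)
  moreover have "distr stdn borel (\<lambda>x. sqrt v * x) = distr stdn lborel (\<lambda>x. sqrt v * x)" by (rule distr_cong) auto
  ultimately show ?thesis using False by (simp add: normal_law_def)
qed

lemma normal_law_real_distribution: assumes "0 \<le> v" shows "real_distribution (normal_law v)"
  unfolding normal_law_distr[OF assms] by (rule prob_space.real_distribution_distr[OF prob_stdn]) simp

lemma normal_law_char: assumes "0 \<le> v" shows "char (normal_law v) t = complex_of_real (exp (- (v * t\<^sup>2 / 2)))"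
proof -
  have "char (normal_law v) t = char stdn (t * sqrt v)"
    unfolding normal_law_distr[OF assms] char_def by (subst integral_distr) (auto simp: mult.assoc)
  also have "\<dots> = complex_of_real (exp (- (v * t\<^sup>2 / 2)))"
    unfolding char_std_normal_distribution using assms by (simp add: power_mult_distrib mult.commute)
  finally show ?thesis .
qed

lemma normal_law_moment:
  assumes "0 \<le> v" shows "integrable (normal_law v) (\<lambda>x. x ^ k)" "(\<integral>x. x ^ k \<partial>normal_law v) = sqrt v ^ k * (\<integral>x. x ^ k \<partial>stdn)"
  unfolding normal_law_distr[OF assms] using stdn_power
  by (simp_all add: integrable_distr_eq integral_distr power_mult_distrib)

lemma haspd_power: "haspd k F F' \<Longrightarrow> haspd k (\<lambda>w. F w ^ m) (\<lambda>w. real m * (F' w * F w ^ (m - 1)))"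
proof (induction m)
  case (Suc m)
  have "haspd k (\<lambda>w. F w * F w ^ m) (\<lambda>w. F' w * F w ^ m + F w * (real m * (F' w * F w ^ (m - 1))))"
    by (rule haspd_mult[OF Suc.prems Suc.IH[OF Suc.prems]])
  then have "haspd k (\<lambda>w. F w * F w ^ m) (\<lambda>w. real (Suc m) * (F' w * F w ^ (Suc m - 1)))"
    by (rule haspd_cong) (cases m, auto simp: algebra_simps)
  then show ?case by simp
qed (simp add: haspd_const)

context gauss_space
begin

text \<open>Integration by parts lowers the power by two and produces the variance, which is the
  recursion of the standard moments. So all moments of a linear form are known without identifying
  its law.\<close>

lemma linear_moment: "(\<integral>w. (\<Sum>k\<in>J. \<alpha> k * w k) ^ m \<partial>\<gamma>) = sqrt (\<Sum>k\<in>J. (\<alpha> k)\<^sup>2) ^ m * (\<integral>x. x ^ m \<partial>stdn)"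
proof (induction m rule: less_induct)
  case (less m)
  define q where "q = (\<Sum>k\<in>J. (\<alpha> k)\<^sup>2)"
  have q: "0 \<le> q" unfolding q_def by (intro sum_nonneg) auto
  let ?l = "\<lambda>w. \<Sum>k\<in>J. \<alpha> k * w k"
  have pl: "polyfun J ?l" by (rule polyfun_sum) (rule polyfun_mult[OF polyfun_const polyfun_var])
  show ?case
  proof (cases m)
    case 0
    then show ?thesis using G.prob_space prob_space.prob_space[OF prob_stdn] by simp
  next
    case (Suc n)
    have hl: "haspd k ?l (\<lambda>w. \<alpha> k)" if k: "k \<in> J" for k
    proof -
      have "haspd k ?l (\<lambda>w. \<Sum>j\<in>J. \<alpha> j * (if j = k then 1 else 0))"
        by (intro haspd_sum haspd_cmult haspd_var)
      then show ?thesis by (rule haspd_cong) (use k finite_J in \<open>simp add: if_distrib cong: if_cong\<close>)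
    qed
    have i: "integrable \<gamma> (\<lambda>w. \<alpha> k * (w k * ?l w ^ n))" if "k \<in> J" for k
      by (rule polyfun_integrable, rule polyfun_mult[OF polyfun_const polyfun_mult[OF polyfun_var[OF that] polyfun_power[OF pl]]])
    have "(\<integral>w. ?l w ^ m \<partial>\<gamma>) = (\<integral>w. (\<Sum>k\<in>J. \<alpha> k * (w k * ?l w ^ n)) \<partial>\<gamma>)"
      unfolding Suc power_Suc sum_distrib_right by (simp add: mult.assoc)
    also have "\<dots> = (\<Sum>k\<in>J. \<alpha> k * (\<integral>w. w k * ?l w ^ n \<partial>\<gamma>))"
      by (subst Bochner_Integration.integral_sum[OF i]) simp_all
    also have "\<dots> = (\<Sum>k\<in>J. \<alpha> k * (\<integral>w. real n * (\<alpha> k * ?l w ^ (n - 1)) \<partial>\<gamma>))"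
      by (intro sum.cong refl arg_cong2[where f = times] gauss_ibp[OF polyfun_power[OF pl] _ haspd_power[OF hl]])
    also have "\<dots> = q * (real n * (\<integral>w. ?l w ^ (n - 1) \<partial>\<gamma>))"
      unfolding q_def sum_distrib_right by (simp add: power2_eq_square mult_ac)
    also have "\<dots> = q * (real n * (sqrt q ^ (n - 1) * (\<integral>x. x ^ (n - 1) \<partial>stdn)))"
      unfolding q_def using less.IH[of "n - 1"] Suc by simp
    also have "\<dots> = sqrt q ^ m * (\<integral>x. x ^ m \<partial>stdn)"
    proof (cases n)
      case 0
      then show ?thesis using stdn_moment_rec[of 0] by (simp add: Suc)
    next
      case (Suc j)
      have "sqrt q ^ m = q * sqrt q ^ j" using q by (simp add: \<open>m = Suc n\<close> Suc)
      then show ?thesis using stdn_moment_rec[of n] q by (simp add: \<open>m = Suc n\<close> Suc)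
    qed
    finally show ?thesis by (simp add: q_def)
  qed
qed

end

section \<open>Operator norms of concrete matrices\<close>

context dimn
begin

lemma euclid_norm_nrm: "x \<in> carrier_vec d \<Longrightarrow> (\<And>a. a < d \<Longrightarrow> x $ a = f a) \<Longrightarrow> euclid_norm x = nrm f"
  by (auto simp: euclid_norm_def nrm_def ip_def scalar_prod_def atLeast0LessThan intro!: arg_cong[where f = sqrt] sum.cong)

lemma mult_mat_vec_mv:
  assumes B: "B \<in> carrier_mat d d" "\<And>a c. a < d \<Longrightarrow> c < d \<Longrightarrow> B $$ (a, c) = G a c" and x: "x \<in> carrier_vec d" "\<And>a. a < d \<Longrightarrow> x $ a = f a" and a: "a < d"
  shows "(B *\<^sub>v x) $ a = mv G f a"
  using assms by (auto simp: mv_def scalar_prod_def atLeast0LessThan intro!: sum.cong)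

lemma euclid_norm_mult_mat_vec:
  assumes B: "B \<in> carrier_mat d d" "\<And>a c. a < d \<Longrightarrow> c < d \<Longrightarrow> B $$ (a, c) = G a c" and x: "x \<in> carrier_vec d" "\<And>a. a < d \<Longrightarrow> x $ a = f a"
  shows "euclid_norm (B *\<^sub>v x) = nrm (mv G f)"
proof (rule euclid_norm_nrm)
  show "B *\<^sub>v x \<in> carrier_vec d" using B(1) x(1) by auto
  show "(B *\<^sub>v x) $ a = mv G f a" if "a < d" for a by (rule mult_mat_vec_mv[OF B x that])
qed

lemma op_norm_le:
  assumes B: "B \<in> carrier_mat d d" "\<And>a c. a < d \<Longrightarrow> c < d \<Longrightarrow> B $$ (a, c) = G a c" and K: "\<And>x. nrm (mv G x) \<le> K * nrm x" "0 \<le> K"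
  shows "op_norm B \<le> K"
  unfolding op_norm_def
proof (rule cSUP_least)
  have "0\<^sub>v d \<in> {x \<in> carrier_vec (dim_col B). euclid_norm x \<le> 1}" using B by (auto simp: euclid_norm_def scalar_prod_def)
  then show "{x \<in> carrier_vec (dim_col B). euclid_norm x \<le> 1} \<noteq> {}" by blast
  fix x assume x: "x \<in> {x \<in> carrier_vec (dim_col B). euclid_norm x \<le> 1}"
  then have xd: "x \<in> carrier_vec d" using B by auto
  have "euclid_norm (B *\<^sub>v x) = nrm (mv G (($) x))" by (rule euclid_norm_mult_mat_vec[OF B xd refl])
  also have "\<dots> \<le> K * nrm (($) x)" by (rule K)
  also have "\<dots> \<le> K * 1" using x euclid_norm_nrm[OF xd refl] K(2) by (intro mult_left_mono) auto
  finally show "euclid_norm (B *\<^sub>v x) \<le> K" by simp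
qed

lemma schatten_mv: assumes "symm G" "0 < p" shows "nrm (mv G x) \<le> schatten p G * nrm x"
proof (rule nrm_le_of_ip)
  fix z
  show "\<bar>ip z (mv G x)\<bar> \<le> nrm z * (schatten p G * nrm x)"
    using schatten_bound[OF assms, of z x] by (simp add: bil_def mult_ac)
qed (use schatten_nonneg assms in simp)

lemma op_norm_bound:
  assumes B: "B \<in> carrier_mat d d" "\<And>a c. a < d \<Longrightarrow> c < d \<Longrightarrow> B $$ (a, c) = G a c" and G: "symm G"
  shows "nrm (mv G f) \<le> op_norm B * nrm f" "0 \<le> op_norm B"
proof -
  let ?U = "{x \<in> carrier_vec (dim_col B). euclid_norm x \<le> 1}"
  \<comment> \<open>The supremum defining \<open>op_norm\<close> is meaningful only for a bounded
    set; any Schatten norm supplies a bound.\<close>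
  have bdd: "bdd_above ((\<lambda>x. euclid_norm (B *\<^sub>v x)) ` ?U)"
  proof (rule bdd_aboveI2)
    fix x assume x: "x \<in> ?U"
    then have xd: "x \<in> carrier_vec d" using B by auto
    have "euclid_norm (B *\<^sub>v x) = nrm (mv G (($) x))" by (rule euclid_norm_mult_mat_vec[OF B xd refl])
    also have "\<dots> \<le> schatten 1 G * nrm (($) x)" by (rule schatten_mv[OF G]) simp
    also have "\<dots> \<le> schatten 1 G * 1" using x euclid_norm_nrm[OF xd refl] schatten_nonneg[OF G, of 1] by (intro mult_left_mono) auto
    finally show "euclid_norm (B *\<^sub>v x) \<le> schatten 1 G" by simp
  qed
  have unit: "nrm (mv G h) \<le> op_norm B" if h: "nrm h \<le> 1" for h
  proof -
    have v: "vec d h \<in> carrier_vec d" "\<And>a. a < d \<Longrightarrow> vec d h $ a = h a" by auto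
    have "vec d h \<in> ?U" using B h euclid_norm_nrm[OF v] by auto
    then have "euclid_norm (B *\<^sub>v vec d h) \<le> op_norm B" unfolding op_norm_def by (rule cSUP_upper[OF _ bdd])
    then show ?thesis using euclid_norm_mult_mat_vec[OF B v] by simp
  qed
  show nn: "0 \<le> op_norm B" by (rule order_trans[OF nrm_nonneg unit[of "\<lambda>a. 0"]]) (simp add: nrm_def ip_def)
  show "nrm (mv G f) \<le> op_norm B * nrm f"
  proof (cases "nrm f = 0")
    case True
    then have "nrm (mv G f) \<le> schatten 1 G * 0" using schatten_mv[OF G, of 1 f] by simp
    then show ?thesis using True by simp
  next
    case False
    then have pos: "0 < nrm f" using nrm_nonneg[of f] by linarith
    have sc: "nrm (\<lambda>a. c * h a) = c * nrm h" if "0 \<le> c" for c h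
      using that by (simp add: nrm_def real_sqrt_mult)
    have "nrm (\<lambda>a. inverse (nrm f) * f a) \<le> 1" using pos by (simp add: sc)
    from unit[OF this] have "inverse (nrm f) * nrm (mv G f) \<le> op_norm B" using pos by (simp add: sc)
    then show ?thesis using pos by (simp add: field_simps)
  qed
qed

lemma op_norm_bil:
  assumes B: "B \<in> carrier_mat d d" "\<And>a c. a < d \<Longrightarrow> c < d \<Longrightarrow> B $$ (a, c) = G a c" and G: "symm G"
  shows "bil x G x \<le> op_norm B * ip x x"
proof -
  have "bil x G x \<le> nrm x * nrm (mv G x)" unfolding bil_def using abs_ip_le[of x "mv G x"] by linarith
  also have "\<dots> \<le> nrm x * (op_norm B * nrm x)" by (intro mult_left_mono op_norm_bound[OF assms] nrm_nonneg)
  finally show ?thesis by (simp add: nrm_sq[symmetric] power2_eq_square mult_ac)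
qed

lemma op_norm_le_schatten:
  assumes B: "B \<in> carrier_mat d d" "\<And>a c. a < d \<Longrightarrow> c < d \<Longrightarrow> B $$ (a, c) = G a c" and G: "symm G" and p: "0 < p"
  shows "op_norm B \<le> schatten p G"
  by (rule op_norm_le[OF B schatten_mv[OF G p] schatten_nonneg[OF G p]])

text \<open>Each of the \<open>d\<close> eigenvalues is at most the operator norm in absolute value.
  The factor, the \<open>2 * p\<close>-th root of \<open>d\<close>, tends to 1 as \<open>p\<close>
  grows.\<close>

lemma schatten_le_op_norm:
  assumes B: "B \<in> carrier_mat d d" "\<And>a c. a < d \<Longrightarrow> c < d \<Longrightarrow> B $$ (a, c) = G a c" and G: "symm G" and p: "0 < p"
  shows "schatten p G \<le> root (2 * p) (real d) * op_norm B"
proof -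
  obtain e l where el: "spec G e l" using spectral[OF G] by blast
  have "\<bar>l r\<bar> \<le> op_norm B" if r: "r < d" for r
  proof -
    have o: "nrm (e r) = 1" using el r by (simp add: spec_def orthon_def nrm_def)
    have "\<bar>l r\<bar> = \<bar>ip (e r) (mv G (e r))\<bar>" using spec_eig[OF el r r] by (simp add: bil_def)
    also have "\<dots> \<le> nrm (e r) * nrm (mv G (e r))" by (rule abs_ip_le)
    also have "\<dots> \<le> op_norm B" using op_norm_bound(1)[OF B G, of "e r"] o by simp
    finally show ?thesis .
  qed
  then have "(\<Sum>r<d. \<bar>l r\<bar> ^ (2 * p)) \<le> (\<Sum>r<d. op_norm B ^ (2 * p))" by (intro sum_mono power_mono) auto
  then have "tr (mpow G (2 * p)) \<le> real d * op_norm B ^ (2 * p)" by (simp add: spec_tr_mpow[OF el] power_mult)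
  then have "schatten p G \<le> root (2 * p) (real d * op_norm B ^ (2 * p))"
    unfolding schatten_def using p by simp
  also have "\<dots> = root (2 * p) (real d) * op_norm B"
    using p op_norm_bound(2)[OF B G] by (simp add: real_root_mult real_root_power_cancel)
  finally show ?thesis .
qed

end

lemma borel_vec_space: "space (borel_vec d) = carrier_vec d"
  by (simp add: borel_vec_def)

lemma measurable_vec_index: assumes "j < d" shows "(\<lambda>v. v $ j) \<in> borel_measurable (borel_vec d)"
proof -
  have "(\<lambda>v. \<lambda>j\<in>{..<d}. v $ j) \<in> borel_vec d \<rightarrow>\<^sub>M (\<Pi>\<^sub>M j\<in>{..<d}. borel)"
    unfolding borel_vec_def by (rule measurable_vimage_algebra1) (auto simp: space_PiM)
  from measurable_compose[OF this measurable_component_singleton[of j "{..<d}"]] assms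
  show ?thesis by simp
qed

lemma measurable_vec_scalar: "(\<lambda>y. u \<bullet> y) \<in> borel_measurable (borel_vec d)"
proof -
  have "(\<lambda>y. \<Sum>a<d. u $ a * y $ a) \<in> borel_measurable (borel_vec d)"
    by (intro borel_measurable_sum borel_measurable_times borel_measurable_const measurable_vec_index) auto
  then show ?thesis
    by (rule measurable_cong[THEN iffD1, rotated]) (auto simp: borel_vec_space scalar_prod_def atLeast0LessThan)
qed

section \<open>The given sample and its explicit Gaussian model\<close>

locale gaussian_sample = prob_space M for M :: "'w measure" +
  fixes d n :: nat and \<Sigma> :: "nat \<Rightarrow> real mat" and Y :: "nat \<Rightarrow> 'w \<Rightarrow> real vec"
  assumes d: "1 \<le> d" and n: "1 \<le> n" and cov: "\<And>i. i \<in> {1..n} \<Longrightarrow> covariance_matrix d (\<Sigma> i)"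
    and indep: "indep_vars (\<lambda>_. borel_vec d) Y {1..n}" and gauss: "\<And>i. i \<in> {1..n} \<Longrightarrow> gaussian_vector M d (\<Sigma> i) (Y i)"
begin

definition Ix :: "nat set" where "Ix = {1..n}"

lemma finite_Ix: "finite Ix" by (simp add: Ix_def)

lemma sum_Ix: "(\<Sum>j\<in>Ix \<times> {..<d}. f j) = (\<Sum>i\<in>Ix. \<Sum>a<d. f (i, a))"
  by (simp add: sum.cartesian_product)

lemmas indep_Ix = indep[folded Ix_def] and cov_Ix = cov[folded Ix_def] and gauss_Ix = gauss[folded Ix_def]

text \<open>The \<open>sq i b\<close> are the scaled eigenvectors of \<open>\<Sigma> i\<close>, so that \<open>\<Sigma> i = \<Sum>\<^sub>b sq i b (sq i b)\<^sup>T\<close>.\<close>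

definition sq :: "nat \<Rightarrow> nat \<Rightarrow> nat \<Rightarrow> real" where
  "sq i = (SOME w. \<forall>a<d. \<forall>c<d. (\<Sum>b<d. w b a * w b c) = \<Sigma> i $$ (a, c))"

lemma sq: assumes i: "i \<in> Ix" shows "\<forall>a<d. \<forall>c<d. (\<Sum>b<d. sq i b a * sq i b c) = \<Sigma> i $$ (a, c)"
proof -
  have car: "\<Sigma> i \<in> carrier_mat d d" and tp: "transpose_mat (\<Sigma> i) = \<Sigma> i" and psd: "\<And>x. x \<in> carrier_vec d \<Longrightarrow> 0 \<le> x \<bullet> (\<Sigma> i *\<^sub>v x)"
    using cov_Ix[OF i] by (auto simp: covariance_matrix_def)
  have sy: "dimn.symm d (\<lambda>a c. \<Sigma> i $$ (a, c))"
    unfolding dimn.symm_def using arg_cong[OF tp, of "\<lambda>A. A $$ (_, _)"] car by (metis carrier_matD index_transpose_mat(1))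
  then obtain e l where el: "dimn.spec d (\<lambda>a c. \<Sigma> i $$ (a, c)) e l" using dimn.spectral by blast
  have "0 \<le> dimn.bil d z (\<lambda>a c. \<Sigma> i $$ (a, c)) z" for z
    using psd[of "vec d z"] car
    by (simp add: dimn.bil_def dimn.ip_def dimn.mv_def scalar_prod_def atLeast0LessThan)
  then have l: "0 \<le> l r" if "r < d" for r using dimn.spec_eig_nonneg[OF el _ that] by blast
  have "\<forall>a<d. \<forall>c<d. (\<Sum>b<d. (sqrt (l b) * e b a) * (sqrt (l b) * e b c)) = \<Sigma> i $$ (a, c)"
  proof (intro allI impI)
    fix a c assume ac: "a < d" "c < d"
    have "(\<Sum>b<d. (sqrt (l b) * e b a) * (sqrt (l b) * e b c)) = (\<Sum>b<d. l b * e b a * e b c)"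
    proof (intro sum.cong refl)
      fix b assume "b \<in> {..<d}"
      then have "sqrt (l b) * sqrt (l b) = l b" using l by simp
      then show "(sqrt (l b) * e b a) * (sqrt (l b) * e b c) = l b * e b a * e b c" by (metis mult.assoc mult.left_commute)
    qed
    then show "(\<Sum>b<d. (sqrt (l b) * e b a) * (sqrt (l b) * e b c)) = \<Sigma> i $$ (a, c)" using el ac by (simp add: dimn.spec_def)
  qed
  then show ?thesis unfolding sq_def by (rule someI[where P = "\<lambda>w. \<forall>a<d. \<forall>c<d. (\<Sum>b<d. w b a * w b c) = \<Sigma> i $$ (a, c)"])
qed

sublocale m: gmodel d "Ix" sq by unfold_locales (simp add: Ix_def)

lemma \<Sigma>_entry: "i \<in> Ix \<Longrightarrow> a < d \<Longrightarrow> c < d \<Longrightarrow> \<Sigma> i $$ (a, c) = m.Sg i a c"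
  using sq by (simp add: m.Sg_def)

lemma \<Sigma>_carrier: "i \<in> Ix \<Longrightarrow> \<Sigma> i \<in> carrier_mat d d" using cov_Ix by (auto simp: covariance_matrix_def)

abbreviation "J \<equiv> Ix \<times> {..<d}"
text \<open>\<open>Z\<close> collects the coordinates of the sample and \<open>Z'\<close> those of
  the model, over the same index set, so that their mixed moments can be matched.\<close>

definition Z :: "'w \<Rightarrow> nat \<times> nat \<Rightarrow> real" where "Z w = (\<lambda>(i, a). Y i w $ a)"
definition Z' :: "(nat \<times> nat \<Rightarrow> real) \<Rightarrow> nat \<times> nat \<Rightarrow> real" where "Z' g = (\<lambda>(i, a). m.Yv g i a)"

lemma Y_carrier: "i \<in> Ix \<Longrightarrow> w \<in> space M \<Longrightarrow> Y i w \<in> carrier_vec d"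
  using gauss_Ix[of i] measurable_space[of "Y i" M "borel_vec d" w] by (auto simp: gaussian_vector_def borel_vec_space)

lemma Y_meas: "i \<in> Ix \<Longrightarrow> Y i \<in> M \<rightarrow>\<^sub>M borel_vec d" using gauss_Ix by (auto simp: gaussian_vector_def)

definition var :: "(nat \<times> nat \<Rightarrow> real) \<Rightarrow> nat \<Rightarrow> real" where "var c i = vec d (\<lambda>a. c (i, a)) \<bullet> (\<Sigma> i *\<^sub>v vec d (\<lambda>a. c (i, a)))"

lemma var_nonneg: "i \<in> Ix \<Longrightarrow> 0 \<le> var c i" using cov_Ix[of i] by (auto simp: covariance_matrix_def var_def)

text \<open>By independence the characteristic function of the sum is a product of Gaussian ones,
  whose variances add; a characteristic function determines its law. This also covers degenerate
  variances.\<close>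

lemma linear_form_law:
  "distr M borel (\<lambda>w. \<Sum>i\<in>Ix. vec d (\<lambda>a. c (i, a)) \<bullet> Y i w) = normal_law (\<Sum>i\<in>Ix. var c i)"
proof (rule Levy_uniqueness)
  have v: "0 \<le> (\<Sum>i\<in>Ix. var c i)" by (intro sum_nonneg var_nonneg)
  have meas: "(\<lambda>w. vec d (\<lambda>a. c (i, a)) \<bullet> Y i w) \<in> borel_measurable M" if "i \<in> Ix" for i
    by (rule measurable_compose[OF Y_meas[OF that] measurable_vec_scalar])
  show "real_distribution (distr M borel (\<lambda>w. \<Sum>i\<in>Ix. vec d (\<lambda>a. c (i, a)) \<bullet> Y i w))"
    by (rule real_distribution_distr) (intro borel_measurable_sum meas)
  show "real_distribution (normal_law (\<Sum>i\<in>Ix. var c i))" by (rule normal_law_real_distribution[OF v])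
  have iv: "indep_vars (\<lambda>_. borel) (\<lambda>i w. vec d (\<lambda>a. c (i, a)) \<bullet> Y i w) Ix"
    by (rule indep_vars_compose2[OF indep_Ix]) (rule measurable_vec_scalar)
  show "char (distr M borel (\<lambda>w. \<Sum>i\<in>Ix. vec d (\<lambda>a. c (i, a)) \<bullet> Y i w)) = char (normal_law (\<Sum>i\<in>Ix. var c i))"
  proof
    fix t
    have "char (distr M borel (\<lambda>w. \<Sum>i\<in>Ix. vec d (\<lambda>a. c (i, a)) \<bullet> Y i w)) t = (\<Prod>i\<in>Ix. char (distr M borel (\<lambda>w. vec d (\<lambda>a. c (i, a)) \<bullet> Y i w)) t)"
      by (rule char_distr_sum[OF iv])
    also have "\<dots> = (\<Prod>i\<in>Ix. complex_of_real (exp (- (var c i * t\<^sup>2 / 2))))"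
    proof (intro prod.cong refl)
      fix i assume i: "i \<in> Ix"
      have "distr M borel (\<lambda>w. vec d (\<lambda>a. c (i, a)) \<bullet> Y i w) = normal_law (var c i)"
        using gauss_Ix[OF i] by (auto simp: gaussian_vector_def var_def)
      then show "char (distr M borel (\<lambda>w. vec d (\<lambda>a. c (i, a)) \<bullet> Y i w)) t = complex_of_real (exp (- (var c i * t\<^sup>2 / 2)))"
        using normal_law_char[OF var_nonneg[OF i]] by simp
    qed
    also have "\<dots> = complex_of_real (exp (\<Sum>i\<in>Ix. - (var c i * t\<^sup>2 / 2)))" by (simp add: exp_sum finite_Ix)
    also have "\<dots> = char (normal_law (\<Sum>i\<in>Ix. var c i)) t"
      unfolding normal_law_char[OF v] by (simp add: sum_negf sum_distrib_right sum_divide_distrib)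
    finally show "char (distr M borel (\<lambda>w. \<Sum>i\<in>Ix. vec d (\<lambda>a. c (i, a)) \<bullet> Y i w)) t = char (normal_law (\<Sum>i\<in>Ix. var c i)) t" .
  qed
qed

lemma form_Z: assumes w: "w \<in> space M" shows "(\<Sum>j\<in>J. c j * Z w j) = (\<Sum>i\<in>Ix. vec d (\<lambda>a. c (i, a)) \<bullet> Y i w)"
  unfolding sum_Ix
proof (rule sum.cong[OF refl])
  fix i assume i: "i \<in> Ix"
  have "dim_vec (Y i w) = d" using Y_carrier[OF i w] by auto
  then show "(\<Sum>a<d. c (i, a) * Z w (i, a)) = vec d (\<lambda>a. c (i, a)) \<bullet> Y i w"
    by (auto simp: Z_def scalar_prod_def atLeast0LessThan intro!: sum.cong)
qed

lemma form_moments: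
  "integrable M (\<lambda>w. (\<Sum>j\<in>J. c j * Z w j) ^ m)"
  "(\<integral>w. (\<Sum>j\<in>J. c j * Z w j) ^ m \<partial>M) = sqrt (\<Sum>i\<in>Ix. var c i) ^ m * (\<integral>x. x ^ m \<partial>stdn)"
proof -
  have v: "0 \<le> (\<Sum>i\<in>Ix. var c i)" by (intro sum_nonneg var_nonneg)
  have meas: "(\<lambda>w. \<Sum>i\<in>Ix. vec d (\<lambda>a. c (i, a)) \<bullet> Y i w) \<in> borel_measurable M"
    by (intro borel_measurable_sum measurable_compose[OF Y_meas measurable_vec_scalar])
  have "integrable M (\<lambda>w. (\<Sum>i\<in>Ix. vec d (\<lambda>a. c (i, a)) \<bullet> Y i w) ^ m)"
    using normal_law_moment(1)[OF v, of m] unfolding linear_form_law[symmetric] by (subst (asm) integrable_distr_eq[OF meas]) auto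
  then show "integrable M (\<lambda>w. (\<Sum>j\<in>J. c j * Z w j) ^ m)"
    by (rule Bochner_Integration.integrable_cong[THEN iffD1, OF refl, rotated]) (simp add: form_Z)
  have "(\<integral>w. (\<Sum>j\<in>J. c j * Z w j) ^ m \<partial>M) = (\<integral>w. (\<Sum>i\<in>Ix. vec d (\<lambda>a. c (i, a)) \<bullet> Y i w) ^ m \<partial>M)"
    by (rule Bochner_Integration.integral_cong[OF refl]) (simp only: form_Z)
  also have "\<dots> = (\<integral>x. x ^ m \<partial>normal_law (\<Sum>i\<in>Ix. var c i))"
    unfolding linear_form_law[symmetric] by (subst integral_distr[OF meas]) auto
  finally show "(\<integral>w. (\<Sum>j\<in>J. c j * Z w j) ^ m \<partial>M) = sqrt (\<Sum>i\<in>Ix. var c i) ^ m * (\<integral>x. x ^ m \<partial>stdn)"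
    unfolding normal_law_moment(2)[OF v] .
qed

lemma form_Z': "(\<Sum>j\<in>J. c j * Z' g j) = (\<Sum>j\<in>J. m.ip (sq (fst j) (snd j)) (\<lambda>a. c (fst j, a)) * g j)"
proof -
  have "(\<Sum>j\<in>J. c j * Z' g j) = (\<Sum>i\<in>Ix. \<Sum>a<d. \<Sum>b<d. c (i, a) * (g (i, b) * sq i b a))"
    unfolding sum_Ix by (simp add: Z'_def m.Yv_def sum_distrib_left)
  also have "\<dots> = (\<Sum>i\<in>Ix. \<Sum>b<d. \<Sum>a<d. c (i, a) * (g (i, b) * sq i b a))" by (intro sum.cong refl sum.swap)
  also have "\<dots> = (\<Sum>i\<in>Ix. \<Sum>b<d. m.ip (sq i b) (\<lambda>a. c (i, a)) * g (i, b))"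
    by (simp add: m.ip_def sum_distrib_left sum_distrib_right mult_ac)
  finally show ?thesis unfolding sum_Ix by simp
qed

lemma var_model: "(\<Sum>j\<in>J. (m.ip (sq (fst j) (snd j)) (\<lambda>a. c (fst j, a)))\<^sup>2) = (\<Sum>i\<in>Ix. var c i)"
proof -
  have "(\<Sum>b<d. (m.ip (sq i b) (\<lambda>a. c (i, a)))\<^sup>2) = var c i" if i: "i \<in> Ix" for i
  proof -
    have "(\<Sum>b<d. (m.ip (sq i b) (\<lambda>a. c (i, a)))\<^sup>2) = m.bil (\<lambda>a. c (i, a)) (m.Sg i) (\<lambda>a. c (i, a))"
      unfolding m.bil_Sg m.ip_S by (simp add: power2_eq_square m.ip_commute[of "sq _ _"])
    also have "\<dots> = var c i"
      unfolding var_def m.bil_def m.ip_def m.mv_def using \<Sigma>_carrier[OF i] \<Sigma>_entry[OF i]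
      by (auto simp: scalar_prod_def atLeast0LessThan intro!: sum.cong)
    finally show ?thesis .
  qed
  then show ?thesis unfolding sum_Ix by simp
qed

text \<open>On both sides the m-th moment of a linear form is the m-th power of its standard
  deviation times the standard moment, and the variances agree because the \<open>sq i b\<close>
  factor the covariances.\<close>

sublocale mm: moment_matching J M Z m.\<gamma> Z'
proof (rule moment_matching.intro)
  show "finite J" by (simp add: Ix_def)
  show "prob_space M" by (rule prob_space_axioms)
  show "prob_space m.\<gamma>" by (rule m.prob_gauss)
  have fJ: "finite J" by (simp add: Ix_def)
  fix j k assume j: "j \<in> J"
  have "(\<Sum>i\<in>J. (if i = j then 1 else 0) * Z w i) = Z w j" for w
    using j fJ by (simp add: if_distrib[of "\<lambda>x. x * _"] cong: if_cong)
  then show "integrable M (\<lambda>x. Z x j ^ k)" using form_moments(1)[of "\<lambda>i. if i = j then 1 else 0" k] by simp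
  have "polyfun J (\<lambda>g. Z' g j)" using j by (auto simp: Z'_def case_prod_unfold intro!: m.poly_Y)
  then show "integrable m.\<gamma> (\<lambda>x. Z' x j ^ k)" by (intro m.polyfun_integrable polyfun_power)
next
  fix c m
  show "(\<integral>x. (\<Sum>j\<in>J. c j * Z x j) ^ m \<partial>M) = (\<integral>x. (\<Sum>j\<in>J. c j * Z' x j) ^ m \<partial>m.\<gamma>)"
    unfolding form_moments(2) form_Z' m.linear_moment var_model ..
qed

text \<open>The centered matrix as a polynomial in abstract coordinates: at \<open>Z w\<close> it is
  the actual deviation, at \<open>Z' g\<close> the matrix \<open>X g\<close> of the model. So moment
  matching applies to the traces of its powers.\<close>

definition XY :: "(nat \<times> nat \<Rightarrow> real) \<Rightarrow> nat \<Rightarrow> nat \<Rightarrow> real" where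
  "XY y = (\<lambda>a c. \<Sum>i\<in>Ix. y (i, a) * y (i, c) - m.Sg i a c)"

lemma XY_Z': "XY (Z' g) = m.X g" by (simp add: XY_def Z'_def m.X_def)

lemma symm_XY: "m.symm (XY y)" by (simp add: m.symm_def XY_def m.Sg_def mult.commute)

lemma poly_XY: "a < d \<Longrightarrow> c < d \<Longrightarrow> polyfun J (\<lambda>y. XY y a c)"
  unfolding XY_def by (intro polyfun_sum polyfun_diff polyfun_mult polyfun_var polyfun_const) auto

lemma poly_tr_XY: "polyfun J (\<lambda>y. m.tr (m.mpow (XY y) k))"
  by (rule m.polyfun_tr, rule m.polyfun_mpow, rule poly_XY)

text \<open>The hypothesis speaks about linear forms only. Moment matching moves the mixed second
  moment to the model, where one integration by parts evaluates it.\<close>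

lemma covariance_entry:
  assumes "i \<in> Ix" "a < d" "c < d" shows "(\<integral>w. Z w (i, a) * Z w (i, c) \<partial>M) = m.Sg i a c"
proof -
  have "(\<integral>w. Z w (i, a) * Z w (i, c) \<partial>M) = (\<integral>g. Z' g (i, a) * Z' g (i, c) \<partial>m.\<gamma>)"
    by (rule mm.matching[where F = "\<lambda>y. y (i, a) * y (i, c)"]) (use assms in \<open>auto intro!: polyfun_mult polyfun_var\<close>)
  also have "\<dots> = (\<integral>g. (\<Sum>b<d. sq i b a * (g (i, b) * m.Yv g i c)) \<partial>m.\<gamma>)"
  proof (rule Bochner_Integration.integral_cong[OF refl])
    fix g
    have "m.Yv g i a * t = (\<Sum>b<d. sq i b a * (g (i, b) * t))" for t by (simp add: m.Yv_def sum_distrib_left sum_distrib_right mult_ac)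
    then show "Z' g (i, a) * Z' g (i, c) = (\<Sum>b<d. sq i b a * (g (i, b) * m.Yv g i c))" by (simp add: Z'_def)
  qed
  also have "\<dots> = (\<Sum>b<d. \<integral>g. sq i b a * (g (i, b) * m.Yv g i c) \<partial>m.\<gamma>)"
    by (rule m.integral_sum_poly) (use assms in \<open>auto intro!: polyfun_mult polyfun_var polyfun_const m.poly_Y\<close>)
  also have "\<dots> = (\<Sum>b<d. sq i b a * (\<integral>g. sq i b c \<partial>m.\<gamma>))"
  proof (intro sum.cong refl)
    fix b assume b: "b \<in> {..<d}"
    have "haspd (i, b) (\<lambda>g. m.Yv g i c) (\<lambda>g. sq i b c)" using m.pd_Y[of b i i c] b by simp
    then have "(\<integral>g. g (i, b) * m.Yv g i c \<partial>m.\<gamma>) = (\<integral>g. sq i b c \<partial>m.\<gamma>)"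
      using assms b by (intro m.gauss_ibp m.poly_Y) auto
    then show "(\<integral>g. sq i b a * (g (i, b) * m.Yv g i c) \<partial>m.\<gamma>) = sq i b a * (\<integral>g. sq i b c \<partial>m.\<gamma>)" by simp
  qed
  also have "\<dots> = m.Sg i a c" by (simp add: m.Sg_def m.G.prob_space)
  finally show ?thesis .
qed

definition dev :: "'w \<Rightarrow> real mat" where "dev w = sample_cov d n Y w - expect_mat M d (sample_cov d n Y)"

lemma dev_carrier: "dev w \<in> carrier_mat d d"
  unfolding dev_def sample_cov_def sum_mats_def expect_mat_def by (intro minus_carrier_mat mat_carrier)

lemma dev_entry: assumes "a < d" "c < d" shows "dev w $$ (a, c) = XY (Z w) a c"
proof -
  have e: "sample_cov d n Y w $$ (a, c) = (\<Sum>i\<in>Ix. Z w (i, a) * Z w (i, c))" for w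
    using assms by (simp add: sample_cov_def sum_mats_def outer_prod_def Z_def Ix_def)
  have "(\<integral>w. (\<Sum>i\<in>Ix. Z w (i, a) * Z w (i, c)) \<partial>M) = (\<Sum>i\<in>Ix. \<integral>w. Z w (i, a) * Z w (i, c) \<partial>M)"
  proof (rule Bochner_Integration.integral_sum)
    fix i assume "i \<in> Ix"
    then show "integrable M (\<lambda>w. Z w (i, a) * Z w (i, c))"
      using assms by (intro mm.integrable(1)[where F = "\<lambda>y. y (i, a) * y (i, c)"] polyfun_mult polyfun_var) auto
  qed
  also have "\<dots> = (\<Sum>i\<in>Ix. m.Sg i a c)" using assms by (intro sum.cong refl covariance_entry)
  finally show ?thesis
    using assms e by (simp add: dev_def XY_def sum_subtractf expect_mat_def sample_cov_def sum_mats_def)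
qed

text \<open>The operator norm is a supremum over uncountably many vectors. It is instead the limit
  of the Schatten norms, roots of polynomials in the coordinates, sandwiched by the dimension root
  that tends to 1.\<close>

lemma op_norm_dev_measurable: "(\<lambda>w. op_norm (dev w)) \<in> borel_measurable M"
proof (rule borel_measurable_LIMSEQ_real)
  fix w
  have up: "op_norm (dev w) \<le> m.schatten (Suc p) (XY (Z w))" for p
    by (rule m.op_norm_le_schatten[OF dev_carrier _ symm_XY]) (auto simp: dev_entry)
  have lo: "m.schatten (Suc p) (XY (Z w)) \<le> root (2 * Suc p) (real d) * op_norm (dev w)" for p
    by (rule m.schatten_le_op_norm[OF dev_carrier _ symm_XY]) (auto simp: dev_entry)
  have "(\<lambda>k. root k (real d)) \<longlonglongrightarrow> 1" using d by (intro LIMSEQ_root_const) simp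
  moreover have "filterlim (\<lambda>p. 2 * Suc p) sequentially sequentially"
    by (rule filterlim_subseq) (auto simp: strict_mono_def)
  ultimately have "(\<lambda>p. root (2 * Suc p) (real d)) \<longlonglongrightarrow> 1" by (rule filterlim_compose)
  then have "(\<lambda>p. root (2 * Suc p) (real d) * op_norm (dev w)) \<longlonglongrightarrow> 1 * op_norm (dev w)" by (intro tendsto_mult tendsto_const)
  then show "(\<lambda>p. m.schatten (Suc p) (XY (Z w))) \<longlonglongrightarrow> op_norm (dev w)"
    using tendsto_sandwich[OF always_eventually[OF allI[OF up]] always_eventually[OF allI[OF lo]] tendsto_const] by simp
next
  fix p
  have "(\<lambda>w. m.tr (m.mpow (XY (Z w)) (2 * Suc p))) \<in> borel_measurable M"
    by (rule borel_measurable_integrable[OF mm.integrable(1)[OF poly_tr_XY]])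
  then show "(\<lambda>w. m.schatten (Suc p) (XY (Z w))) \<in> borel_measurable M"
    unfolding m.schatten_def by (rule measurable_compose[OF _ borel_measurable_root])
qed

end

section \<open>The deviation bound\<close>

context gaussian_sample
begin

lemma trace_\<tau>: assumes i: "i \<in> Ix" shows "trace_mat (\<Sigma> i) = m.\<tau> i"
proof -
  have "trace_mat (\<Sigma> i) = (\<Sum>a<d. \<Sum>b<d. sq i b a * sq i b a)"
    using \<Sigma>_carrier[OF i] \<Sigma>_entry[OF i] by (auto simp: trace_mat_def m.Sg_def)
  also have "\<dots> = m.\<tau> i" unfolding m.\<tau>_def m.ip_def by (rule sum.swap)
  finally show ?thesis .
qed

definition \<sigma>sq :: real where "\<sigma>sq = op_norm (sum_mats d (\<lambda>i. trace_mat (\<Sigma> i) \<cdot>\<^sub>m \<Sigma> i) {1..n})"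
definition \<nu>sq :: real where "\<nu>sq = op_norm (sum_mats d (\<lambda>i. \<Sigma> i * \<Sigma> i) {1..n})"
definition R :: real where "R = (MAX i\<in>{1..n}. trace_mat (\<Sigma> i))"

lemma conds: "m.conds \<sigma>sq"
proof -
  let ?B = "sum_mats d (\<lambda>i. trace_mat (\<Sigma> i) \<cdot>\<^sub>m \<Sigma> i) Ix" and ?G = "\<lambda>a c. \<Sum>i\<in>Ix. m.\<tau> i * m.Sg i a c"
  have B: "?B \<in> carrier_mat d d" by (simp add: sum_mats_def)
  have e: "?B $$ (a, c) = ?G a c" if ac: "a < d" "c < d" for a c
  proof -
    have "(trace_mat (\<Sigma> i) \<cdot>\<^sub>m \<Sigma> i) $$ (a, c) = m.\<tau> i * m.Sg i a c" if "i \<in> Ix" for i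
      using that ac \<Sigma>_carrier[OF that] \<Sigma>_entry[OF that ac] trace_\<tau>[OF that] by auto
    then show ?thesis using ac by (simp add: sum_mats_def)
  qed
  have G: "m.symm ?G" using m.symm_Sg by (simp add: m.symm_def)
  have "m.bil x ?G x = (\<Sum>i\<in>Ix. m.\<tau> i * m.ip x (m.S i x))" for x
    unfolding m.lin_sum[OF m.lin_bil] m.lin_scale[OF m.lin_bil] m.bil_Sg ..
  then show ?thesis
    using m.op_norm_bil[OF B e G] m.op_norm_bound(2)[OF B e G] unfolding m.conds_def \<sigma>sq_def Ix_def[symmetric] by simp
qed

text \<open>The shift by \<open>\<eta>\<close> makes the parameter positive even if all covariances
  vanish; it is removed by a limit in \<open>deviation\<close>.\<close>

lemma condv: assumes "0 < \<eta>" shows "m.condv (\<nu>sq + \<eta>)" and \<nu>sq_nonneg: "0 \<le> \<nu>sq"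
proof -
  let ?B = "sum_mats d (\<lambda>i. \<Sigma> i * \<Sigma> i) Ix" and ?G = "\<lambda>a c. \<Sum>i\<in>Ix. m.mm (m.Sg i) (m.Sg i) a c"
  have B: "?B \<in> carrier_mat d d" by (simp add: sum_mats_def)
  have e: "?B $$ (a, c) = ?G a c" if ac: "a < d" "c < d" for a c
  proof -
    have "(\<Sigma> i * \<Sigma> i) $$ (a, c) = m.mm (m.Sg i) (m.Sg i) a c" if "i \<in> Ix" for i
      using that ac \<Sigma>_carrier[OF that] \<Sigma>_entry[OF that] by (auto simp: m.mm_def scalar_prod_def atLeast0LessThan intro!: sum.cong)
    then show ?thesis using ac by (simp add: sum_mats_def)
  qed
  have G: "m.symm ?G" by (simp add: m.symm_def m.mm_def m.Sg_def mult.commute)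
  have b: "m.bil x ?G x = (\<Sum>i\<in>Ix. m.ip (m.S i x) (m.S i x))" for x
    unfolding m.lin_sum[OF m.lin_bil] m.bil_mm m.mv_Sg m.bil_Sg m.ip_S_sym ..
  show n0: "0 \<le> \<nu>sq" using m.op_norm_bound(2)[OF B e G] by (simp add: \<nu>sq_def Ix_def)
  have "(\<Sum>i\<in>Ix. m.ip (m.S i x) (m.S i x)) \<le> (\<nu>sq + \<eta>) * m.ip x x" for x
  proof -
    have "(\<Sum>i\<in>Ix. m.ip (m.S i x) (m.S i x)) \<le> \<nu>sq * m.ip x x"
      using m.op_norm_bil[OF B e G, of x] unfolding b \<nu>sq_def Ix_def[symmetric] .
    also have "\<dots> \<le> (\<nu>sq + \<eta>) * m.ip x x" using assms by (intro mult_right_mono) auto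
    finally show ?thesis .
  qed
  then show "m.condv (\<nu>sq + \<eta>)" using assms n0 by (simp add: m.condv_def)
qed

lemma condR: assumes "0 < \<eta>" shows "m.condR (R + \<eta>)" and R_nonneg: "0 \<le> R"
proof -
  have le: "m.\<tau> i \<le> R" if i: "i \<in> Ix" for i
  proof -
    have "trace_mat (\<Sigma> i) \<le> R" unfolding R_def using i by (intro Max_ge) (auto simp: Ix_def)
    then show ?thesis using trace_\<tau>[OF i] by simp
  qed
  then show "m.condR (R + \<eta>)" using assms unfolding m.condR_def by (meson add_increasing2 less_imp_le order_trans order_refl)
  show "0 \<le> R" using le[of 1] n m.\<tau>_nonneg[of 1] by (simp add: Ix_def)
qed

text \<open>The operator norm is at most the Schatten norm, whose \<open>K\<close>-th moment equals
  that of the model. The passage from the \<open>K\<close>-th moment to the mean is done by the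
  tangent inequality \<open>t \<le> (t ^ K + (K - 1)) / K\<close> at scale
  \<open>\<kappa>\<close>.\<close>

lemma expected_norm_le:
  assumes \<eta>: "0 < \<eta>" and p: "0 < p" and dp: "real d \<le> 2 ^ (2 * p)"
  shows "(\<integral>w. op_norm (dev w) \<partial>M) \<le> root (2 * p) (real d) * (2 * sqrt \<sigma>sq + 1000 * real p ^ 3 * (sqrt (\<nu>sq + \<eta>) + (R + \<eta>)))"
proof -
  define K where "K = 2 * p"
  define B where "B = 2 * sqrt \<sigma>sq + 1000 * real p ^ 3 * (sqrt (\<nu>sq + \<eta>) + (R + \<eta>))"
  define T where "T = (\<integral>w. m.tr (m.mpow (XY (Z w)) K) \<partial>M)"
  define \<mu> where "\<mu> = root K (T / real d)"
  have s0: "0 \<le> \<sigma>sq" using conds by (simp add: m.conds_def)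
  have "0 < sqrt (\<nu>sq + \<eta>) + (R + \<eta>)" using \<eta> R_nonneg[OF \<eta>] \<nu>sq_nonneg[OF \<eta>] by (intro add_nonneg_pos) auto
  then have "0 < 1000 * real p ^ 3 * (sqrt (\<nu>sq + \<eta>) + (R + \<eta>))" using p by (intro mult_pos_pos[of "1000 * real p ^ 3"]) auto
  then have B: "0 < B" unfolding B_def using s0 by (intro add_nonneg_pos) auto
  have K: "0 < K" using p by (simp add: K_def)
  have d0: "0 < real d" using d by simp
  have TG: "T = (\<integral>g. m.tr (m.XP g K) \<partial>m.\<gamma>)"
    unfolding T_def using mm.matching[OF poly_tr_XY] by (simp add: XY_Z')
  have T0: "0 \<le> T" unfolding T_def K_def by (intro Bochner_Integration.integral_nonneg m.tr_mpow_even_nonneg symm_XY)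
  have \<mu>K: "real d * \<mu> ^ K = T" unfolding \<mu>_def using T0 K d0 by simp
  have \<mu>0: "0 \<le> \<mu>" unfolding \<mu>_def using T0 by (intro real_root_ge_zero divide_nonneg_nonneg) auto
  have \<mu>B: "\<mu> \<le> B"
  \<comment> \<open>The recursion divides by \<open>\<mu>\<close>, so a vanishing moment is treated
    apart.\<close>
  proof (cases "\<mu> = 0")
    case False
    then have "gmodel_bound d Ix sq \<sigma>sq (\<nu>sq + \<eta>) (R + \<eta>) \<mu> p"
      using conds condv[OF \<eta>] condR[OF \<eta>] R_nonneg[OF \<eta>] \<eta> p dp d \<mu>0 \<mu>K TG
      by (intro gmodel_bound.intro gmodel_bound_axioms.intro m.gmodel_axioms) (auto simp: K_def)
    then show ?thesis unfolding B_def by (rule gmodel_bound.moment_bound)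
  qed (use B in simp)
  define \<kappa> where "\<kappa> = root K (real d) * B"
  have \<kappa>: "0 < \<kappa>" unfolding \<kappa>_def using B d0 K by simp
  have "T \<le> real d * B ^ K" unfolding \<mu>K[symmetric] using \<mu>0 \<mu>B d0 by (intro mult_left_mono power_mono) auto
  also have "\<dots> = \<kappa> ^ K" unfolding \<kappa>_def using K d0 by (simp add: power_mult_distrib)
  finally have T\<kappa>: "T / \<kappa> ^ K \<le> 1" using \<kappa> by simp
  have it: "integrable M (\<lambda>w. m.tr (m.mpow (XY (Z w)) K))" by (rule mm.integrable(1)[OF poly_tr_XY])
  have "(\<integral>w. op_norm (dev w) \<partial>M) \<le> (\<integral>w. \<kappa> * ((m.tr (m.mpow (XY (Z w)) K) / \<kappa> ^ K + real (K - 1)) / real K) \<partial>M)"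
  \<comment> \<open>Only the majorant has to be integrable here.\<close>
  proof (rule integral_mono')
    show "integrable M (\<lambda>w. \<kappa> * ((m.tr (m.mpow (XY (Z w)) K) / \<kappa> ^ K + real (K - 1)) / real K))" using it by simp
    fix w
    show "0 \<le> \<kappa> * ((m.tr (m.mpow (XY (Z w)) K) / \<kappa> ^ K + real (K - 1)) / real K)"
      using \<kappa> m.tr_mpow_even_nonneg[OF symm_XY, of "Z w" p] by (intro mult_nonneg_nonneg divide_nonneg_nonneg add_nonneg_nonneg) (auto simp: K_def)
    let ?s = "m.schatten p (XY (Z w))"
    have s: "0 \<le> ?s" by (rule m.schatten_nonneg[OF symm_XY p])
    have "op_norm (dev w) \<le> \<kappa> * (?s / \<kappa>)" using m.op_norm_le_schatten[OF dev_carrier dev_entry symm_XY p, of w] \<kappa> by simp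
    also have "\<dots> \<le> \<kappa> * (((?s / \<kappa>) ^ K + real (K - 1)) / real K)"
      using am_gm4[of "?s / \<kappa>" 0 0 0 0 0 0 K] s \<kappa> K by (intro mult_left_mono) auto
    also have "(?s / \<kappa>) ^ K = m.tr (m.mpow (XY (Z w)) K) / \<kappa> ^ K"
      unfolding K_def power_divide m.schatten_pow[OF symm_XY p] ..
    finally show "op_norm (dev w) \<le> \<kappa> * ((m.tr (m.mpow (XY (Z w)) K) / \<kappa> ^ K + real (K - 1)) / real K)" .
  qed
  also have "\<dots> = \<kappa> * ((T / \<kappa> ^ K + real (K - 1)) / real K)" unfolding T_def using it by (simp add: prob_space)
  also have "\<dots> \<le> \<kappa> * ((1 + real (K - 1)) / real K)" using \<kappa> T\<kappa> by (intro mult_left_mono divide_right_mono add_right_mono) auto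
  also have "\<dots> = \<kappa>" using K by simp
  finally show ?thesis unfolding \<kappa>_def B_def K_def .
qed

text \<open>The choice of \<open>p\<close> makes the \<open>2 * p\<close>-th root of
  \<open>d\<close> at most \<open>1 + \<epsilon>\<close>, which accounts for the factor of the
  leading term. The price is \<open>p ^ 3\<close>, at most
  \<open>27 * (L / \<epsilon>) ^ 3\<close>.\<close>

theorem deviation:
  assumes \<epsilon>: "0 < \<epsilon>" "\<epsilon> \<le> 1"
  shows "(\<integral>w. op_norm (dev w) \<partial>M) \<le> (1 + \<epsilon>) * 2 * sqrt \<sigma>sq + 54000 / \<epsilon> ^ 3 * (sqrt \<nu>sq + R) * ln (real d + real n) ^ 3"
proof -
  define L where "L = ln (real d + real n)"
  define p where "p = nat \<lceil>L / \<epsilon>\<rceil>"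
  have "ln 2 \<le> L" unfolding L_def using d n by (subst ln_le_cancel_iff) auto
  then have L: "1 / 2 \<le> L" using ln2_ge_two_thirds by linarith
  have Le: "1 / 2 \<le> L / \<epsilon>"
  proof -
    have "L * 1 \<le> L / \<epsilon>" using L \<epsilon> by (simp add: field_simps mult_left_le)
    then show ?thesis using L by linarith
  qed
  have p1: "L / \<epsilon> \<le> real p" unfolding p_def by (rule real_nat_ceiling_ge)
  \<comment> \<open>Rounding up adds at most 1, which is at most twice
    \<open>L / \<epsilon>\<close>; a positive lower bound for \<open>L\<close> holds because
    \<open>d + n\<close> is at least 2.\<close>
  have p2: "real p \<le> 3 * (L / \<epsilon>)"
  proof -
    have "real p \<le> L / \<epsilon> + 1" unfolding p_def using Le by linarith
    then show ?thesis using Le by linarith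
  qed
  have p0: "0 < p" using p1 Le by (cases p) auto
  have Lp: "L \<le> real p * \<epsilon>" using p1 \<epsilon> by (simp add: field_simps)
  \<comment> \<open>As \<open>2 * p\<close> is at least \<open>2 * L / \<epsilon>\<close>, the root
    of \<open>d\<close> is at most \<open>exp (\<epsilon> / 2)\<close>.\<close>
  have "exp (\<epsilon> / 2) \<le> 1 + \<epsilon> / 2 + (\<epsilon> / 2)\<^sup>2" using \<epsilon> by (intro exp_bound) auto
  also have "\<dots> \<le> 1 + \<epsilon>"
  proof -
    have "\<epsilon> * \<epsilon> \<le> \<epsilon> * 1" using \<epsilon> by (intro mult_left_mono) auto
    moreover have "(\<epsilon> / 2)\<^sup>2 = \<epsilon> * \<epsilon> / 4" by (simp add: power2_eq_square)
    ultimately show ?thesis using \<epsilon> by linarith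
  qed
  finally have ex: "exp (\<epsilon> / 2) \<le> 1 + \<epsilon>" .
  have "real d \<le> exp L" unfolding L_def using d n by simp
  also have "\<dots> \<le> exp (real (2 * p) * (\<epsilon> / 2))" using Lp by simp
  also have "\<dots> = exp (\<epsilon> / 2) ^ (2 * p)" by (rule exp_of_nat_mult)
  also have "\<dots> \<le> (1 + \<epsilon>) ^ (2 * p)" by (intro power_mono ex) auto
  finally have dle: "real d \<le> (1 + \<epsilon>) ^ (2 * p)" .
  also have "(1 + \<epsilon>) ^ (2 * p) \<le> 2 ^ (2 * p)" using \<epsilon> by (intro power_mono) auto
  finally have dp: "real d \<le> 2 ^ (2 * p)" .
  have "root (2 * p) (real d) \<le> root (2 * p) ((1 + \<epsilon>) ^ (2 * p))" using dle p0 by simp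
  then have rt: "root (2 * p) (real d) \<le> 1 + \<epsilon>" using p0 \<epsilon> by (simp add: real_root_power_cancel)
  have s0: "0 \<le> \<sigma>sq" using conds by (simp add: m.conds_def)
  have n0: "0 \<le> \<nu>sq" "0 \<le> R" using \<nu>sq_nonneg[of 1] R_nonneg[of 1] by auto
  have bound: "(\<integral>w. op_norm (dev w) \<partial>M) \<le> (1 + \<epsilon>) * (2 * sqrt \<sigma>sq + 1000 * real p ^ 3 * (sqrt (\<nu>sq + \<eta>) + (R + \<eta>)))" if \<eta>: "0 < \<eta>" for \<eta>
  proof -
    have "(\<integral>w. op_norm (dev w) \<partial>M) \<le> root (2 * p) (real d) * (2 * sqrt \<sigma>sq + 1000 * real p ^ 3 * (sqrt (\<nu>sq + \<eta>) + (R + \<eta>)))"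
      by (rule expected_norm_le[OF \<eta> p0 dp])
    also have "\<dots> \<le> (1 + \<epsilon>) * (2 * sqrt \<sigma>sq + 1000 * real p ^ 3 * (sqrt (\<nu>sq + \<eta>) + (R + \<eta>)))"
      using rt s0 n0 \<eta> by (intro mult_right_mono) auto
    finally show ?thesis .
  qed
  have lim: "((\<lambda>\<eta>. (1 + \<epsilon>) * (2 * sqrt \<sigma>sq + 1000 * real p ^ 3 * (sqrt (\<nu>sq + \<eta>) + (R + \<eta>)))) \<longlongrightarrow>
      (1 + \<epsilon>) * (2 * sqrt \<sigma>sq + 1000 * real p ^ 3 * (sqrt (\<nu>sq + 0) + (R + 0)))) (at_right 0)"
    by (intro tendsto_intros)
  have "\<forall>\<^sub>F \<eta> in at_right 0. (\<integral>w. op_norm (dev w) \<partial>M) \<le> (1 + \<epsilon>) * (2 * sqrt \<sigma>sq + 1000 * real p ^ 3 * (sqrt (\<nu>sq + \<eta>) + (R + \<eta>)))"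
    unfolding eventually_at_right_field by (intro exI[of _ 1]) (auto intro: bound)
  from tendsto_lowerbound[OF lim this]
  have "(\<integral>w. op_norm (dev w) \<partial>M) \<le> (1 + \<epsilon>) * 2 * sqrt \<sigma>sq + (1 + \<epsilon>) * (1000 * real p ^ 3 * (sqrt \<nu>sq + R))"
    by (simp add: algebra_simps)
  \<comment> \<open>The final constant arises here: 2 from \<open>1 + \<epsilon>\<close>, 1000 from
    \<open>moment_bound\<close>, 27 from the cube of 3.\<close>
  also have "(1 + \<epsilon>) * (1000 * real p ^ 3 * (sqrt \<nu>sq + R)) \<le> 2 * (1000 * (3 * (L / \<epsilon>)) ^ 3 * (sqrt \<nu>sq + R))"
    using \<epsilon> n0 p2 by (intro mult_mono mult_right_mono mult_left_mono power_mono) (auto intro!: mult_nonneg_nonneg)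
  also have "\<dots> = 54000 / \<epsilon> ^ 3 * (sqrt \<nu>sq + R) * L ^ 3" by (simp add: power_mult_distrib power_divide)
  finally show ?thesis unfolding L_def by simp
qed

section \<open>Transfer to the joint law of the sample\<close>

definition law :: "(nat \<Rightarrow> real vec) measure" where
  "law = distr M (\<Pi>\<^sub>M i\<in>{1..n}. borel_vec d) (\<lambda>w. \<lambda>i\<in>{1..n}. Y i w)"

lemma joint_measurable: "(\<lambda>w. \<lambda>i\<in>{1..n}. Y i w) \<in> M \<rightarrow>\<^sub>M (\<Pi>\<^sub>M i\<in>{1..n}. borel_vec d)"
  by (rule measurable_restrict) (rule Y_meas[unfolded Ix_def])

lemma coordinate_distr: assumes i: "i \<in> {1..n}" and f: "f \<in> borel_vec d \<rightarrow>\<^sub>M N"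
  shows "distr law N (\<lambda>x. f (x i)) = distr M N (\<lambda>w. f (Y i w))"
  unfolding law_def
proof (subst distr_distr)
  show "(\<lambda>x. f (x i)) \<in> (\<Pi>\<^sub>M i\<in>{1..n}. borel_vec d) \<rightarrow>\<^sub>M N"
    by (rule measurable_compose[OF measurable_component_singleton[OF i] f])
  show "distr M N ((\<lambda>x. f (x i)) \<circ> (\<lambda>w. \<lambda>i\<in>{1..n}. Y i w)) = distr M N (\<lambda>w. f (Y i w))"
    using i by (simp add: comp_def)
qed (rule joint_measurable)

text \<open>By independence the joint law is the product of the laws of the \<open>Y i\<close>.
  Hence under it the coordinate maps are independent with the same marginals as the
  \<open>Y i\<close>.\<close>

lemma gaussian_sample_law: "gaussian_sample law d n \<Sigma> (\<lambda>i x. x i)"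
proof -
  interpret L: prob_space law unfolding law_def by (rule prob_space_distr[OF joint_measurable])
  have ne: "{1..n} \<noteq> {}" using n by simp
  have sl: "sets law = sets (\<Pi>\<^sub>M i\<in>{1..n}. borel_vec d)" by (simp add: law_def)
  have c: "(\<lambda>x. x i) \<in> law \<rightarrow>\<^sub>M borel_vec d" if "i \<in> {1..n}" for i
    using measurable_component_singleton[OF that, of "\<lambda>_. borel_vec d"] measurable_cong_sets[OF sl refl] by blast
  have spl: "space law = space (\<Pi>\<^sub>M i\<in>{1..n}. borel_vec d)" by (simp add: law_def)
  show ?thesis
  proof (intro gaussian_sample.intro gaussian_sample_axioms.intro)
    show "prob_space law" by unfold_locales
    show "L.indep_vars (\<lambda>_. borel_vec d) (\<lambda>i x. x i) {1..n}"
    proof (subst L.indep_vars_iff_distr_eq_PiM'[OF ne c], assumption)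
      have "distr law (\<Pi>\<^sub>M i\<in>{1..n}. borel_vec d) (\<lambda>x. \<lambda>i\<in>{1..n}. x i) = distr law (\<Pi>\<^sub>M i\<in>{1..n}. borel_vec d) (\<lambda>x. x)"
        by (rule distr_cong) (auto simp: spl space_PiM PiE_def extensional_def restrict_def)
      also have "\<dots> = law" by (rule distr_id2) (simp add: sl)
      also have "\<dots> = (\<Pi>\<^sub>M i\<in>{1..n}. distr M (borel_vec d) (Y i))"
        unfolding law_def using indep_vars_iff_distr_eq_PiM'[OF ne, of Y "\<lambda>_. borel_vec d"] Y_meas[unfolded Ix_def] indep by blast
      also have "\<dots> = (\<Pi>\<^sub>M i\<in>{1..n}. distr law (borel_vec d) (\<lambda>x. x i))"
        using coordinate_distr[of _ "\<lambda>y. y" "borel_vec d"] by (intro PiM_cong) auto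
      finally show "distr law (\<Pi>\<^sub>M i\<in>{1..n}. borel_vec d) (\<lambda>x. \<lambda>i\<in>{1..n}. x i) = (\<Pi>\<^sub>M i\<in>{1..n}. distr law (borel_vec d) (\<lambda>x. x i))" .
    qed
    fix i assume i: "i \<in> {1..n}"
    show "gaussian_vector law d (\<Sigma> i) (\<lambda>x. x i)"
      using gauss[OF i] c[OF i] coordinate_distr[OF i measurable_vec_scalar] by (simp add: gaussian_vector_def)
  qed (use d n cov in auto)
qed

text \<open>A change of variables, first entrywise for the expectation inside the norm, then for the
  norm itself, which is where its measurability enters.\<close>

lemma expected_norm_law:
  "(\<integral>x. op_norm (sample_cov d n (\<lambda>i x. x i) x - expect_mat law d (sample_cov d n (\<lambda>i x. x i))) \<partial>law) = (\<integral>w. op_norm (dev w) \<partial>M)"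
proof -
  interpret L: gaussian_sample law d n \<Sigma> "\<lambda>i x. x i" by (rule gaussian_sample_law)
  have sl: "sets law = sets (\<Pi>\<^sub>M i\<in>{1..n}. borel_vec d)" by (simp add: law_def)
  have sc: "sample_cov d n (\<lambda>i x. x i) (\<lambda>i\<in>{1..n}. Y i w) = sample_cov d n Y w" for w
    by (auto simp: sample_cov_def sum_mats_def intro!: cong_mat sum.cong)
  have "expect_mat law d (sample_cov d n (\<lambda>i x. x i)) = expect_mat M d (sample_cov d n Y)"
    unfolding expect_mat_def
  proof (rule cong_mat[OF refl refl], clarsimp)
    fix j k assume jk: "j < d" "k < d"
    have mi: "(\<lambda>x. x i $ a) \<in> borel_measurable (\<Pi>\<^sub>M i\<in>{1..n}. borel_vec d)" if "i \<in> {1..n}" "a < d" for i a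
      by (rule measurable_compose[OF measurable_component_singleton[OF that(1)] measurable_vec_index[OF that(2)]])
    have "(\<lambda>x. sample_cov d n (\<lambda>i x. x i) x $$ (j, k)) = (\<lambda>x. \<Sum>i\<in>{1..n}. x i $ j * x i $ k)"
      using jk by (simp add: sample_cov_def sum_mats_def outer_prod_def)
    then have m: "(\<lambda>x. sample_cov d n (\<lambda>i x. x i) x $$ (j, k)) \<in> borel_measurable (\<Pi>\<^sub>M i\<in>{1..n}. borel_vec d)"
      by (simp only:) (intro borel_measurable_sum borel_measurable_times mi jk)
    show "(\<integral>x. sample_cov d n (\<lambda>i x. x i) x $$ (j, k) \<partial>law) = (\<integral>w. sample_cov d n Y w $$ (j, k) \<partial>M)"
      unfolding law_def by (subst integral_distr[OF joint_measurable m]) (simp only: sc)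
  qed
  then have d: "L.dev (\<lambda>i\<in>{1..n}. Y i w) = dev w" for w by (simp only: L.dev_def dev_def sc)
  have m: "(\<lambda>x. op_norm (L.dev x)) \<in> borel_measurable (\<Pi>\<^sub>M i\<in>{1..n}. borel_vec d)"
    using L.op_norm_dev_measurable measurable_cong_sets[OF sl refl] by blast
  have "(\<integral>x. op_norm (L.dev x) \<partial>law) = (\<integral>w. op_norm (L.dev (\<lambda>i\<in>{1..n}. Y i w)) \<partial>M)"
    unfolding law_def by (rule integral_distr[OF joint_measurable m[unfolded law_def]])
  then show ?thesis unfolding d unfolding L.dev_def .
qed

end

text \<open>A universal constant must serve probability spaces over all types, and a quantifier over
  \<open>C\<close> cannot enclose types. So one constant is established for the type that carries
  joint laws of samples, and the second conjunct moves any constant from there to an arbitrary type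
  without change, by passing from a sample to its joint law.\<close>

theorem theorem3p21:
  shows "(\<exists>C>0. deviation_bound TYPE(nat \<Rightarrow> real vec) C) \<and>
         (\<forall>C. deviation_bound TYPE(nat \<Rightarrow> real vec) C \<longrightarrow> deviation_bound TYPE('w) C)"
proof (intro conjI exI[of _ 54000] allI impI)
  show "deviation_bound TYPE(nat \<Rightarrow> real vec) 54000"
    unfolding deviation_bound_def
  proof (intro allI impI)
    fix d n :: nat and \<Sigma> :: "nat \<Rightarrow> real mat" and Y and \<epsilon> :: real and M :: "(nat \<Rightarrow> real vec) measure"
    assume a: "1 \<le> d" "1 \<le> n" "\<forall>i\<in>{1..n}. covariance_matrix d (\<Sigma> i)" "prob_space M"
      "prob_space.indep_vars M (\<lambda>_. borel_vec d) Y {1..n}" "\<forall>i\<in>{1..n}. gaussian_vector M d (\<Sigma> i) (Y i)" "0 < \<epsilon>" "\<epsilon> \<le> 1"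
    interpret gaussian_sample M d n \<Sigma> Y
      using a by (intro gaussian_sample.intro gaussian_sample_axioms.intro) auto
    show "(\<integral>\<omega>. op_norm (sample_cov d n Y \<omega> - expect_mat M d (sample_cov d n Y)) \<partial>M)
        \<le> (1 + \<epsilon>) * 2 * sqrt (op_norm (sum_mats d (\<lambda>i. trace_mat (\<Sigma> i) \<cdot>\<^sub>m \<Sigma> i) {1..n}))
          + 54000 / \<epsilon> ^ 3 * (sqrt (op_norm (sum_mats d (\<lambda>i. \<Sigma> i * \<Sigma> i) {1..n})) + (MAX i\<in>{1..n}. trace_mat (\<Sigma> i))) * ln (real d + real n) ^ 3"
      using deviation[OF a(7,8)] unfolding dev_def \<sigma>sq_def \<nu>sq_def R_def .
  qed
next
  fix C assume C: "deviation_bound TYPE(nat \<Rightarrow> real vec) C"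
  show "deviation_bound TYPE('w) C"
    unfolding deviation_bound_def
  proof (intro allI impI)
    fix d n :: nat and \<Sigma> :: "nat \<Rightarrow> real mat" and Y and \<epsilon> :: real and M :: "'w measure"
    assume a: "1 \<le> d" "1 \<le> n" "\<forall>i\<in>{1..n}. covariance_matrix d (\<Sigma> i)" "prob_space M"
      "prob_space.indep_vars M (\<lambda>_. borel_vec d) Y {1..n}" "\<forall>i\<in>{1..n}. gaussian_vector M d (\<Sigma> i) (Y i)" "0 < \<epsilon>" "\<epsilon> \<le> 1"
    interpret gaussian_sample M d n \<Sigma> Y
      using a by (intro gaussian_sample.intro gaussian_sample_axioms.intro) auto
    interpret L: gaussian_sample law d n \<Sigma> "\<lambda>i x. x i" by (rule gaussian_sample_law)
    show "(\<integral>\<omega>. op_norm (sample_cov d n Y \<omega> - expect_mat M d (sample_cov d n Y)) \<partial>M)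
        \<le> (1 + \<epsilon>) * 2 * sqrt (op_norm (sum_mats d (\<lambda>i. trace_mat (\<Sigma> i) \<cdot>\<^sub>m \<Sigma> i) {1..n}))
          + C / \<epsilon> ^ 3 * (sqrt (op_norm (sum_mats d (\<lambda>i. \<Sigma> i * \<Sigma> i) {1..n})) + (MAX i\<in>{1..n}. trace_mat (\<Sigma> i))) * ln (real d + real n) ^ 3"
      using C[unfolded deviation_bound_def, rule_format, of d n \<Sigma> law "\<lambda>i x. x i" \<epsilon>] a L.indep L.gauss L.prob_space_axioms expected_norm_law
      unfolding dev_def by simp
  qed
qed simp

end
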